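(* Let $G$ be a locally compact group, and let $p\in(1,\infty)$ with $p\neq 2$. Then the maps $$\Delta\colon \mathbb{T}\times G\to \mathcal{U}(CV_p(G))_{w^*},\quad \Delta(\gamma,s)=\gamma\lambda_p(s),\qquad \Delta'\colon G\to \pi_0(\mathcal{U}(CV_p(G)))_{w^*},\quad \Delta'(s)=[\lambda_p(s)],$$ are isomorphisms of topological groups.
   Context: Fix a left Haar measure on $G$. The left and right regular representations on $L^p(G)$ are $\lambda_p(s)(\xi)(t)=\xi(s^{-1}t)$ and $\rho_p(s)(\xi)(t)=\xi(ts)$, and $CV_p(G)=\{a\in\mathcal{B}(L^p(G)) : a\rho_p(s)=\rho_p(s)a \text{ for all } s\in G\}$ is the algebra of $p$-convolvers. The weak$^*$-topology on $\mathcal{B}(L^p(G))$ comes from identifying it with the dual of the projective tensor product $L^p(G)\widehat{\otimes}L^{p'}(G)$ ($\frac1p+\frac1{p'}=1$) via $\langle a,\xi\otimes\eta\rangle=\langle a\xi,\eta\rangle$; $CV_p(G)$ carries its restriction. $\mathbb{T}$ is the circle group. For a unital Banach algebra $A$, $\mathcal{U}(A)$ is the group of invertible isometries in $A$, i.e. invertible $u\in A$ with $\|u\|=\|u^{-1}\|=1$. $\mathcal{U}(A)_0$ is the connected component of $1$ in $\mathcal{U}(A)$ in the norm topology (a normal subgroup), $\pi_0(\mathcal{U}(A))=\mathcal{U}(A)/\mathcal{U}(A)_0$, and $[u]$ is the class of $u$. $\mathcal{U}(A)_{w^*}$ is $\mathcal{U}(A)$ with the restricted weak$^*$-topology, and $\pi_0(\mathcal{U}(A))_{w^*}$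 carries the quotient topology induced by $\mathcal{U}(A)_{w^*}\to\pi_0(\mathcal{U}(A))$. *)

theory Defs
  imports "HOL-Analysis.Analysis" "HOL-Algebra.Coset" "HOL-Algebra.Module"
begin

section \<open>Topological groups\<close>

definition topological_group :: "('a, 'b) monoid_scheme \<Rightarrow> 'a topology \<Rightarrow> bool" where
  "topological_group G T \<longleftrightarrow>
     group G \<and> topspace T = carrier G \<and>
     continuous_map (prod_topology T T) T (\<lambda>(x, y). x \<otimes>\<^bsub>G\<^esub> y) \<and>
     continuous_map T T (\<lambda>x. inv\<^bsub>G\<^esub> x)"

definition locally_compact_group :: "('a, 'b) monoid_scheme \<Rightarrow> 'a topology \<Rightarrow> bool" where
  "locally_compact_group G T \<longleftrightarrow>
     topological_group G T \<and> Hausdorff_space T \<and> locally_compact_space T"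

definition topological_group_iso ::
  "('a, 'c) monoid_scheme \<Rightarrow> 'a topology \<Rightarrow> ('b, 'd) monoid_scheme \<Rightarrow> 'b topology \<Rightarrow>
   ('a \<Rightarrow> 'b) \<Rightarrow> bool" where
  "topological_group_iso G T H S f \<longleftrightarrow>
     topological_group G T \<and> topological_group H S \<and> f \<in> iso G H \<and> homeomorphic_map T S f"

definition circle_group :: "complex monoid" where
  "circle_group = \<lparr>carrier = sphere 0 1, mult = (*), one = 1\<rparr>"

definition circle_topology :: "complex topology" where
  "circle_topology = top_of_set (sphere 0 1)"

definition quotient_topology :: "'a topology \<Rightarrow> ('a \<Rightarrow> 'b) \<Rightarrow> 'b topology" where
  "quotient_topology X f =
     topology (\<lambda>V. V \<subseteq> f ` topspace X \<and> openin X {x \<in> topspace X. f x \<in> V})"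

lemma openin_quotient_topology:
  "openin (quotient_topology X f) V \<longleftrightarrow>
     V \<subseteq> f ` topspace X \<and> openin X {x \<in> topspace X. f x \<in> V}"
proof -
  have "istopology (\<lambda>V. V \<subseteq> f ` topspace X \<and> openin X {x \<in> topspace X. f x \<in> V})"
    unfolding istopology_def
  proof (intro conjI allI impI)
    fix S T
    assume S: "S \<subseteq> f ` topspace X \<and> openin X {x \<in> topspace X. f x \<in> S}"
      and T: "T \<subseteq> f ` topspace X \<and> openin X {x \<in> topspace X. f x \<in> T}"
    then show "S \<inter> T \<subseteq> f ` topspace X" by blast
    have "{x \<in> topspace X. f x \<in> S \<inter> T} =
        {x \<in> topspace X. f x \<in> S} \<inter> {x \<in> topspace X. f x \<in> T}" by blast
    then show "openin X {x \<in> topspace X. f x \<in> S \<inter> T}"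
      using openin_Int[of X "{x \<in> topspace X. f x \<in> S}" "{x \<in> topspace X. f x \<in> T}"] S T
      by (simp only:)
  next
    fix K
    assume K: "\<forall>S\<in>K. S \<subseteq> f ` topspace X \<and> openin X {x \<in> topspace X. f x \<in> S}"
    then show "\<Union>K \<subseteq> f ` topspace X" by blast
    have "{x \<in> topspace X. f x \<in> \<Union>K} = (\<Union>S\<in>K. {x \<in> topspace X. f x \<in> S})" by blast
    then show "openin X {x \<in> topspace X. f x \<in> \<Union>K}"
      using K openin_Union[of "(\<lambda>S. {x \<in> topspace X. f x \<in> S}) ` K" X]
      by (simp only:) (use K in blast)
  qed
  then show ?thesis
    by (simp add: quotient_topology_def topology_inverse')
qed

lemma quotient_map_quotient_topology: "quotient_map X (quotient_topology X f) f"
proof -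
  have "topspace (quotient_topology X f) = f ` topspace X"
  proof
    have "{x \<in> topspace X. f x \<in> f ` topspace X} = topspace X" by blast
    then have "openin (quotient_topology X f) (f ` topspace X)"
      by (simp add: openin_quotient_topology)
    then show "f ` topspace X \<subseteq> topspace (quotient_topology X f)"
      by (rule openin_subset)
    show "topspace (quotient_topology X f) \<subseteq> f ` topspace X"
      using openin_quotient_topology[of X f "topspace (quotient_topology X f)"] by auto
  qed
  then show ?thesis
    by (auto simp: quotient_map_def openin_quotient_topology)
qed


section \<open>Haar measure\<close>

text \<open>A left Haar measure is a nonzero left-invariant Radon measure on the Borel sets. On groups
  that are not sigma-compact the regularity convention matters: outer regular on Borel sets,
  inner regular on open sets.\<close>

definition left_haar_measure :: "('a, 'b) monoid_scheme \<Rightarrow> 'a topology \<Rightarrow> 'a measure \<Rightarrow> bool" where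
  "left_haar_measure G T M \<longleftrightarrow>
     space M = topspace T \<and>
     sets M = sigma_sets (topspace T) {U. openin T U} \<and>
     (\<forall>K. compactin T K \<longrightarrow> emeasure M K < \<infinity>) \<and>
     (\<forall>A\<in>sets M. emeasure M A = (INF U\<in>{U. openin T U \<and> A \<subseteq> U}. emeasure M U)) \<and>
     (\<forall>U. openin T U \<longrightarrow> emeasure M U = (SUP K\<in>{K. compactin T K \<and> K \<subseteq> U}. emeasure M K)) \<and>
     emeasure M (space M) \<noteq> 0 \<and>
     (\<forall>s\<in>carrier G. \<forall>A\<in>sets M. emeasure M (s <#\<^bsub>G\<^esub> A) = emeasure M A)"


section \<open>Complex normed spaces and normed algebras as records\<close>

text \<open>As for the record \<^typ>\<open>('a, 'b) module\<close>, the fields \<^const>\<open>mult\<close> and \<^const>\<open>one\<close> are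
  irrelevant when the record is used as a normed space only.\<close>

record 'v normed_module = "(complex, 'v) module" +
  mnorm :: "'v \<Rightarrow> real"

text \<open>The value outside the carrier is chosen so that the locale \<^locale>\<open>Metric_space\<close>, which
  requires symmetry and nonnegativity on the whole type, can be interpreted.\<close>

definition mdistance :: "('v, 'm) normed_module_scheme \<Rightarrow> 'v \<Rightarrow> 'v \<Rightarrow> real" where
  "mdistance E x y = (if x \<in> carrier E \<and> y \<in> carrier E then mnorm E (x \<ominus>\<^bsub>E\<^esub> y) else 0)"

definition norm_topology :: "('v, 'm) normed_module_scheme \<Rightarrow> 'v topology" where
  "norm_topology E = Metric_space.mtopology (carrier E) (mdistance E)"

definition completion :: "('v, 'm) normed_module_scheme \<Rightarrow> (nat \<Rightarrow> 'v) set set" where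
  "completion E =
     Collect (Metric_space.MCauchy (carrier E) (mdistance E)) //
     {(s, t). Metric_space.MCauchy (carrier E) (mdistance E) s \<and>
              Metric_space.MCauchy (carrier E) (mdistance E) t \<and>
              (\<lambda>n. mdistance E (s n) (t n)) \<longlonglongrightarrow> 0}"

definition bounded_operators :: "('v, 'm) normed_module_scheme \<Rightarrow> ('v \<Rightarrow> 'v) set" where
  "bounded_operators E =
     {a \<in> carrier E \<rightarrow>\<^sub>E carrier E.
        (\<forall>x\<in>carrier E. \<forall>y\<in>carrier E. a (x \<oplus>\<^bsub>E\<^esub> y) = a x \<oplus>\<^bsub>E\<^esub> a y) \<and>
        (\<forall>c. \<forall>x\<in>carrier E. a (c \<odot>\<^bsub>E\<^esub> x) = c \<odot>\<^bsub>E\<^esub> a x) \<and>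
        (\<exists>C. \<forall>x\<in>carrier E. mnorm E (a x) \<le> C * mnorm E x)}"

definition operator_algebra :: "('v, 'm) normed_module_scheme \<Rightarrow> ('v \<Rightarrow> 'v) normed_module" where
  "operator_algebra E =
     \<lparr>carrier = bounded_operators E,
      mult = compose (carrier E),
      one = (\<lambda>x\<in>carrier E. x),
      zero = (\<lambda>x\<in>carrier E. \<zero>\<^bsub>E\<^esub>),
      add = (\<lambda>a b. \<lambda>x\<in>carrier E. a x \<oplus>\<^bsub>E\<^esub> b x),
      smult = (\<lambda>c a. \<lambda>x\<in>carrier E. c \<odot>\<^bsub>E\<^esub> a x),
      mnorm = (\<lambda>a. SUP x\<in>{x \<in> carrier E. mnorm E x \<le> 1}. mnorm E (a x))\<rparr>"


section \<open>Invertible isometries of a unital normed algebra\<close>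

definition isometry_group :: "('v, 'm) normed_module_scheme \<Rightarrow> 'v monoid" where
  "isometry_group A =
     \<lparr>carrier = {u \<in> Units A. mnorm A u = 1 \<and> mnorm A (inv\<^bsub>A\<^esub> u) = 1},
      mult = mult A, one = one A\<rparr>"

definition isometry_group_0 :: "('v, 'm) normed_module_scheme \<Rightarrow> 'v set" where
  "isometry_group_0 A =
     connected_component_of_set
       (subtopology (norm_topology A) (carrier (isometry_group A))) \<one>\<^bsub>A\<^esub>"

definition pi0_group :: "('v, 'm) normed_module_scheme \<Rightarrow> 'v set monoid" where
  "pi0_group A = isometry_group A Mod isometry_group_0 A"

definition pi0_class :: "('v, 'm) normed_module_scheme \<Rightarrow> 'v \<Rightarrow> 'v set" where
  "pi0_class A u = isometry_group_0 A #>\<^bsub>isometry_group A\<^esub> u"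

text \<open>Here \<open>W\<close> is a topology on the algebra, possibly different from the norm topology.\<close>

definition isometry_topology :: "('v, 'm) normed_module_scheme \<Rightarrow> 'v topology \<Rightarrow> 'v topology" where
  "isometry_topology A W = subtopology W (carrier (isometry_group A))"

definition pi0_topology :: "('v, 'm) normed_module_scheme \<Rightarrow> 'v topology \<Rightarrow> 'v set topology" where
  "pi0_topology A W = quotient_topology (isometry_topology A W) (pi0_class A)"


section \<open>Projective tensor product and weak* topology\<close>

definition bilinear_forms ::
  "('v, 'm) normed_module_scheme \<Rightarrow> ('w, 'n) normed_module_scheme \<Rightarrow> ('v \<Rightarrow> 'w \<Rightarrow> complex) set" where
  "bilinear_forms E F =
     {B. (\<forall>x\<in>carrier E. \<forall>x'\<in>carrier E. \<forall>y\<in>carrier F. B (x \<oplus>\<^bsub>E\<^esub> x') y = B x y + B x' y) \<and>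
         (\<forall>x\<in>carrier E. \<forall>y\<in>carrier F. \<forall>y'\<in>carrier F. B x (y \<oplus>\<^bsub>F\<^esub> y') = B x y + B x y') \<and>
         (\<forall>c. \<forall>x\<in>carrier E. \<forall>y\<in>carrier F.
            B (c \<odot>\<^bsub>E\<^esub> x) y = c * B x y \<and> B x (c \<odot>\<^bsub>F\<^esub> y) = c * B x y)}"

text \<open>The algebraic tensor product is realised as the space of functionals on bilinear forms
  spanned by the elementary tensors, where \<open>x \<otimes> y\<close> is evaluation at \<open>(x, y)\<close>. A list of pairs
  stands for the sum of the corresponding elementary tensors.\<close>

type_synonym ('v, 'w) tensor = "('v \<Rightarrow> 'w \<Rightarrow> complex) \<Rightarrow> complex"

definition tensor_of_list ::
  "('v, 'm) normed_module_scheme \<Rightarrow> ('w, 'n) normed_module_scheme \<Rightarrow> ('v \<times> 'w) list \<Rightarrow>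
   ('v, 'w) tensor" where
  "tensor_of_list E F l = (\<lambda>B\<in>bilinear_forms E F. \<Sum>(x, y)\<leftarrow>l. B x y)"

definition projective_norm ::
  "('v, 'm) normed_module_scheme \<Rightarrow> ('w, 'n) normed_module_scheme \<Rightarrow> ('v, 'w) tensor \<Rightarrow> real" where
  "projective_norm E F t =
     Inf {(\<Sum>(x, y)\<leftarrow>l. mnorm E x * mnorm F y) | l.
            l \<in> lists (carrier E \<times> carrier F) \<and> t = tensor_of_list E F l}"

definition algebraic_tensor_product ::
  "('v, 'm) normed_module_scheme \<Rightarrow> ('w, 'n) normed_module_scheme \<Rightarrow>
   ('v, 'w) tensor normed_module" where
  "algebraic_tensor_product E F =
     \<lparr>carrier = tensor_of_list E F ` lists (carrier E \<times> carrier F),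
      mult = undefined,
      one = undefined,
      zero = (\<lambda>B\<in>bilinear_forms E F. 0),
      add = (\<lambda>t u. \<lambda>B\<in>bilinear_forms E F. t B + u B),
      smult = (\<lambda>c t. \<lambda>B\<in>bilinear_forms E F. c * t B),
      mnorm = projective_norm E F\<rparr>"

definition projective_tensor_product ::
  "('v, 'm) normed_module_scheme \<Rightarrow> ('w, 'n) normed_module_scheme \<Rightarrow>
   (nat \<Rightarrow> ('v, 'w) tensor) set set" where
  "projective_tensor_product E F = completion (algebraic_tensor_product E F)"

text \<open>For a pairing \<open>D\<close> of \<open>E\<close> and \<open>F\<close>, this is the continuous extension of
  \<open>x \<otimes> y \<mapsto> D (a x) y\<close> to the completed tensor product, evaluated at (the class) \<open>\<tau>\<close>.\<close>

definition operator_tensor_pairing ::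
  "('v \<Rightarrow> 'w \<Rightarrow> complex) \<Rightarrow> ('v \<Rightarrow> 'v) \<Rightarrow> (nat \<Rightarrow> ('v, 'w) tensor) set \<Rightarrow> complex" where
  "operator_tensor_pairing D a \<tau> = lim (\<lambda>n. (SOME t. t \<in> \<tau>) n (\<lambda>x y. D (a x) y))"

definition weak_star_topology ::
  "('v, 'm) normed_module_scheme \<Rightarrow> ('w, 'n) normed_module_scheme \<Rightarrow> ('v \<Rightarrow> 'w \<Rightarrow> complex) \<Rightarrow>
   ('v \<Rightarrow> 'v) topology" where
  "weak_star_topology E F D =
     pullback_topology (bounded_operators E)
       (\<lambda>a. \<lambda>\<tau>\<in>projective_tensor_product E F. operator_tensor_pairing D a \<tau>)
       (product_topology (\<lambda>_. euclidean) (projective_tensor_product E F))"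


section \<open>Lebesgue spaces\<close>

definition Lp_functions :: "'a measure \<Rightarrow> real \<Rightarrow> ('a \<Rightarrow> complex) set" where
  "Lp_functions M p = {f \<in> borel_measurable M. integrable M (\<lambda>x. cmod (f x) powr p)}"

definition ae_class :: "'a measure \<Rightarrow> ('a \<Rightarrow> complex) \<Rightarrow> ('a \<Rightarrow> complex) set" where
  "ae_class M f = {g \<in> borel_measurable M. AE x in M. g x = f x}"

definition rep :: "('a \<Rightarrow> complex) set \<Rightarrow> 'a \<Rightarrow> complex" where
  "rep \<xi> = (SOME f. f \<in> \<xi>)"

definition Lp :: "'a measure \<Rightarrow> real \<Rightarrow> ('a \<Rightarrow> complex) set normed_module" where
  "Lp M p =
     \<lparr>carrier = ae_class M ` Lp_functions M p,
      mult = undefined,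
      one = undefined,
      zero = ae_class M (\<lambda>_. 0),
      add = (\<lambda>\<xi> \<eta>. ae_class M (\<lambda>x. rep \<xi> x + rep \<eta> x)),
      smult = (\<lambda>c \<xi>. ae_class M (\<lambda>x. c * rep \<xi> x)),
      mnorm = (\<lambda>\<xi>. (\<integral>x. cmod (rep \<xi> x) powr p \<partial>M) powr (1 / p))\<rparr>"

definition conjugate_exponent :: "real \<Rightarrow> real" where
  "conjugate_exponent p = p / (p - 1)"

definition Lp_pairing :: "'a measure \<Rightarrow> ('a \<Rightarrow> complex) set \<Rightarrow> ('a \<Rightarrow> complex) set \<Rightarrow> complex" where
  "Lp_pairing M \<xi> \<eta> = (\<integral>x. rep \<xi> x * rep \<eta> x \<partial>M)"


section \<open>Convolvers\<close>

definition left_regular ::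
  "('a, 'b) monoid_scheme \<Rightarrow> 'a measure \<Rightarrow> real \<Rightarrow> 'a \<Rightarrow> ('a \<Rightarrow> complex) set \<Rightarrow> ('a \<Rightarrow> complex) set" where
  "left_regular G M p s = (\<lambda>\<xi>\<in>carrier (Lp M p). ae_class M (\<lambda>t. rep \<xi> (inv\<^bsub>G\<^esub> s \<otimes>\<^bsub>G\<^esub> t)))"

definition right_regular ::
  "('a, 'b) monoid_scheme \<Rightarrow> 'a measure \<Rightarrow> real \<Rightarrow> 'a \<Rightarrow> ('a \<Rightarrow> complex) set \<Rightarrow> ('a \<Rightarrow> complex) set" where
  "right_regular G M p s = (\<lambda>\<xi>\<in>carrier (Lp M p). ae_class M (\<lambda>t. rep \<xi> (t \<otimes>\<^bsub>G\<^esub> s)))"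

definition CV ::
  "('a, 'b) monoid_scheme \<Rightarrow> 'a measure \<Rightarrow> real \<Rightarrow>
   (('a \<Rightarrow> complex) set \<Rightarrow> ('a \<Rightarrow> complex) set) normed_module" where
  "CV G M p =
     (operator_algebra (Lp M p))
       \<lparr>carrier := {a \<in> bounded_operators (Lp M p). \<forall>s\<in>carrier G.
          compose (carrier (Lp M p)) a (right_regular G M p s) =
          compose (carrier (Lp M p)) (right_regular G M p s) a}\<rparr>"

definition CV_weak_star ::
  "('a, 'b) monoid_scheme \<Rightarrow> 'a measure \<Rightarrow> real \<Rightarrow>
   (('a \<Rightarrow> complex) set \<Rightarrow> ('a \<Rightarrow> complex) set) topology" where
  "CV_weak_star G M p =
     subtopology
       (weak_star_topology (Lp M p) (Lp M (conjugate_exponent p)) (Lp_pairing M))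
       (carrier (CV G M p))"

end

theory Submission
  imports Defs
begin

text \<open>The heart of the matter is that an isometric convolver \<open>u\<close> is a unimodular multiple of a left
  translation. For \<open>p \<noteq> 2\<close> the equality case of the Clarkson inequality
  \<open>\<bar>f + g\<bar>\<^sup>p + \<bar>f - g\<bar>\<^sup>p = 2 (\<bar>f\<bar>\<^sup>p + \<bar>g\<bar>\<^sup>p)\<close> (in norm) says that \<open>f\<close> and \<open>g\<close> have disjoint supports, so \<open>u\<close>
  preserves disjointness (Lamperti). Instead of representing \<open>u\<close> by a set map, one combines this with
  the commutation with right translations: let \<open>f\<close>, \<open>g\<close> be supported in a small
  neighbourhood \<open>V\<close> of the identity. If \<open>u f\<close> were nonzero near \<open>x\<close> and \<open>u g\<close> near a point \<open>y\<close> far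
  from \<open>x\<close>, then, right translations being ergodic, some right translate of \<open>g\<close> would be disjoint
  from \<open>f\<close> although its image overlaps \<open>u f\<close>. Shrinking \<open>V\<close> singles out a point \<open>t\<close>, and
  \<open>\<lambda>(t)\<^sup>-\<^sup>1 u\<close> is local, hence a multiplication operator; commuting with right
  translations, it is a scalar.

  The coefficients of \<open>\<lambda>\<close> are continuous, so \<open>\<Delta>\<close> is weak* continuous; pairing with
  indicators of small open sets recovers both the point and the scalar, so \<open>\<Delta>\<close> is open onto its
  image. In norm, \<open>z \<lambda>(s)\<close> and \<open>w \<lambda>(t)\<close> are at distance at least 1 for
  \<open>s \<noteq> t\<close>, so the circles \<open>T \<lambda>(s)\<close> are the connected components.\<close>

subsection \<open>Normed modules and bounded operators\<close>

text \<open>\<open>G\<close> need not be sigma-compact nor \<open>M\<close> sigma-finite, and this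
  shapes most arguments. Null sets cannot be glued over arbitrary covers; but the set where an
  \<open>Lp\<close> function exceeds a positive level has finite measure, so if it is not null it
  contains a compact set of positive measure, where finitely many neighbourhoods suffice
  (\<open>Lp_locally_zero\<close>). Interchange of integrals is at hand for continuous functions of
  compact support only. Ergodicity rests on the fact that the measure of the set of \<open>t\<close>
  in \<open>A\<close> with \<open>t \<otimes> s\<close> in \<open>B\<close>, integrated over
  \<open>s\<close>, is the product of the measures of \<open>A\<close> and \<open>B\<close>;
  indicators of compact sets are approximated by continuous functions, and since right translations
  distort the measure, the error is controlled by boundedness of the modular function on compact
  sets. Ergodicity enters twice: in \<open>spread_close\<close> it limits how far \<open>u\<close>
  can scatter a small support, and in \<open>local_constant\<close> it forces the multiplier to be
  constant. The two target groups obtain their topological group structure by transport along the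
  homeomorphism (\<open>topological_group_isoI\<close>).\<close>

text \<open>A common interface for three kinds of records: the spaces \<open>Lp M p\<close>, the
  algebraic tensor product with the projective norm, and \<open>CV G M p\<close>.\<close>

locale cnormed_module = abelian_group E
  for E :: "('v, 'm) normed_module_scheme" (structure) +
  assumes smult_closed [simp, intro]: "x \<in> carrier E \<Longrightarrow> c \<odot> x \<in> carrier E"
    and smult_add_right: "x \<in> carrier E \<Longrightarrow> y \<in> carrier E \<Longrightarrow> c \<odot> (x \<oplus> y) = c \<odot> x \<oplus> c \<odot> y"
    and smult_add_left: "x \<in> carrier E \<Longrightarrow> (c + d) \<odot> x = c \<odot> x \<oplus> d \<odot> x"
    and smult_assoc: "x \<in> carrier E \<Longrightarrow> (c * d) \<odot> x = c \<odot> (d \<odot> x)"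
    and smult_one [simp]: "x \<in> carrier E \<Longrightarrow> 1 \<odot> x = x"
    and norm_nonneg [simp]: "x \<in> carrier E \<Longrightarrow> 0 \<le> mnorm E x"
    and norm_eq_0D: "x \<in> carrier E \<Longrightarrow> mnorm E x = 0 \<Longrightarrow> x = \<zero>"
    and norm_smult: "x \<in> carrier E \<Longrightarrow> mnorm E (c \<odot> x) = cmod c * mnorm E x"
    and norm_triangle: "x \<in> carrier E \<Longrightarrow> y \<in> carrier E \<Longrightarrow> mnorm E (x \<oplus> y) \<le> mnorm E x + mnorm E y"
begin

lemma smult_zero_left [simp]:
  assumes "x \<in> carrier E" shows "0 \<odot> x = \<zero>"
proof -
  have "0 \<odot> x \<oplus> 0 \<odot> x = 0 \<odot> x"
    using smult_add_left[OF assms, of 0 0] by simp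
  then show ?thesis
    using assms add.r_cancel_one' smult_closed by metis
qed

lemma smult_minus_one: "x \<in> carrier E \<Longrightarrow> (-1) \<odot> x = \<ominus> x"
  using smult_add_left[of x "-1" 1] by (intro minus_equality[symmetric]) auto

lemma smult_zero_right [simp]: "c \<odot> \<zero> = \<zero>"
  using smult_assoc[of \<zero> c 0] by simp

lemma norm_zero [simp]: "mnorm E \<zero> = 0"
  using norm_smult[of \<zero> 0] by simp

lemma norm_eq_0_iff: "x \<in> carrier E \<Longrightarrow> mnorm E x = 0 \<longleftrightarrow> x = \<zero>"
  using norm_eq_0D by auto

lemma norm_minus: "x \<in> carrier E \<Longrightarrow> mnorm E (\<ominus> x) = mnorm E x"
  by (simp add: norm_smult flip: smult_minus_one)

lemma smult_minus_left: "x \<in> carrier E \<Longrightarrow> (- c) \<odot> x = \<ominus> (c \<odot> x)"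
  using smult_assoc[of x "-1" c] by (simp add: smult_minus_one)

lemma smult_diff_left:
  "x \<in> carrier E \<Longrightarrow> (c - d) \<odot> x = c \<odot> x \<ominus> d \<odot> x"
  using smult_add_left[of x c "- d"] by (simp add: smult_minus_left a_minus_def)

lemma norm_minus_commute:
  "x \<in> carrier E \<Longrightarrow> y \<in> carrier E \<Longrightarrow> mnorm E (x \<ominus> y) = mnorm E (y \<ominus> x)"
  by (metis minus_closed norm_minus minus_add minus_eq a_comm a_inv_closed minus_minus)

lemma mdistance_eq:
  "x \<in> carrier E \<Longrightarrow> y \<in> carrier E \<Longrightarrow> mdistance E x y = mnorm E (x \<ominus> y)"
  by (simp add: mdistance_def)

lemma diff_eq_zero_iff:
  assumes "x \<in> carrier E" "y \<in> carrier E"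
  shows "x \<ominus> y = \<zero> \<longleftrightarrow> x = y"
  using minus_equality[of x "\<ominus> y"] assms by (auto simp: minus_eq r_neg)

lemma norm_diff_triangle:
  assumes "x \<in> carrier E" "y \<in> carrier E" "z \<in> carrier E"
  shows "mnorm E (x \<ominus> z) \<le> mnorm E (x \<ominus> y) + mnorm E (y \<ominus> z)"
proof -
  have "x \<ominus> z = (x \<ominus> y) \<oplus> (y \<ominus> z)"
    using assms by (simp add: minus_eq a_assoc r_neg1)
  then show ?thesis
    using norm_triangle[of "x \<ominus> y" "y \<ominus> z"] assms by simp
qed

lemma Metric_space: "Metric_space (carrier E) (mdistance E)"
proof
  show "0 \<le> mdistance E x y" for x y
    by (simp add: mdistance_def)
  show "mdistance E x y = mdistance E y x" for x y
    by (simp add: mdistance_def norm_minus_commute)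
  show "mdistance E x y = 0 \<longleftrightarrow> x = y" if "x \<in> carrier E" "y \<in> carrier E" for x y
    using that by (simp add: mdistance_eq norm_eq_0_iff diff_eq_zero_iff)
  show "mdistance E x z \<le> mdistance E x y + mdistance E y z"
    if "x \<in> carrier E" "y \<in> carrier E" "z \<in> carrier E" for x y z
    using that by (simp add: mdistance_eq norm_diff_triangle)
qed

lemma bounded_operatorsD:
  assumes "a \<in> bounded_operators E"
  shows "a \<in> extensional (carrier E)"
    and "x \<in> carrier E \<Longrightarrow> a x \<in> carrier E"
    and "x \<in> carrier E \<Longrightarrow> y \<in> carrier E \<Longrightarrow> a (x \<oplus> y) = a x \<oplus> a y"
    and "x \<in> carrier E \<Longrightarrow> a (c \<odot> x) = c \<odot> a x"
  using assms by (auto simp: bounded_operators_def PiE_iff)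

lemma bounded_operatorsE:
  assumes "a \<in> bounded_operators E"
  obtains C where "0 \<le> C" "\<And>x. x \<in> carrier E \<Longrightarrow> mnorm E (a x) \<le> C * mnorm E x"
proof -
  obtain C where C: "\<And>x. x \<in> carrier E \<Longrightarrow> mnorm E (a x) \<le> C * mnorm E x"
    using assms unfolding bounded_operators_def by blast
  have "mnorm E (a x) \<le> \<bar>C\<bar> * mnorm E x" if "x \<in> carrier E" for x
    by (rule order_trans[OF C[OF that]]) (use that in \<open>auto intro: mult_right_mono\<close>)
  then show ?thesis
    using that[of "\<bar>C\<bar>"] by auto
qed

lemma bounded_operators_zero:
  assumes "a \<in> bounded_operators E" shows "a \<zero> = \<zero>"
  using bounded_operatorsD(2)[OF assms] bounded_operatorsD(4)[OF assms, of \<zero> 0] by simp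

lemma bounded_operators_diff:
  assumes "a \<in> bounded_operators E" "x \<in> carrier E" "y \<in> carrier E"
  shows "a (x \<ominus> y) = a x \<ominus> a y"
  using assms bounded_operatorsD[OF assms(1)]
  by (simp add: minus_eq flip: smult_minus_one)

lemma bounded_operators_eqI:
  assumes "a \<in> bounded_operators E" "b \<in> bounded_operators E" "\<And>x. x \<in> carrier E \<Longrightarrow> a x = b x"
  shows "a = b"
  using assms bounded_operatorsD(1) by (metis extensionalityI)

lemma bounded_operatorsI:
  assumes "\<And>x. x \<in> carrier E \<Longrightarrow> f x \<in> carrier E"
    and "\<And>x y. x \<in> carrier E \<Longrightarrow> y \<in> carrier E \<Longrightarrow> f (x \<oplus> y) = f x \<oplus> f y"
    and "\<And>c x. x \<in> carrier E \<Longrightarrow> f (c \<odot> x) = c \<odot> f x"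
    and "\<And>x. x \<in> carrier E \<Longrightarrow> mnorm E (f x) \<le> C * mnorm E x"
  shows "(\<lambda>x\<in>carrier E. f x) \<in> bounded_operators E"
  using assms unfolding bounded_operators_def by (auto intro!: exI[of _ C])

text \<open>The formula of \<open>mnorm (operator_algebra E)\<close>, detached from the record so
  that it applies to every subspace of operators, in particular to \<open>CV G M p\<close>.\<close>

definition opnorm :: "('v \<Rightarrow> 'v) \<Rightarrow> real" where
  "opnorm a = (SUP x\<in>{x \<in> carrier E. mnorm E x \<le> 1}. mnorm E (a x))"

lemma bdd_above_opnorm:
  assumes "a \<in> bounded_operators E"
  shows "bdd_above ((\<lambda>x. mnorm E (a x)) ` {x \<in> carrier E. mnorm E x \<le> 1})"
proof -
  obtain C where C: "0 \<le> C" "\<And>x. x \<in> carrier E \<Longrightarrow> mnorm E (a x) \<le> C * mnorm E x"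
    using bounded_operatorsE[OF assms] by blast
  have "mnorm E (a x) \<le> C" if "x \<in> carrier E" "mnorm E x \<le> 1" for x
    using C(2)[OF that(1)] mult_left_mono[OF that(2) C(1)] by simp
  then show ?thesis
    by (auto intro!: bdd_aboveI2[of _ _ C])
qed

lemma opnorm_nonneg: "a \<in> bounded_operators E \<Longrightarrow> 0 \<le> opnorm a"
  unfolding opnorm_def
  by (intro cSUP_upper2[of _ _ \<zero>] bdd_above_opnorm) (auto simp: bounded_operatorsD)

lemma opnorm_apply:
  assumes a: "a \<in> bounded_operators E" and x: "x \<in> carrier E"
  shows "mnorm E (a x) \<le> opnorm a * mnorm E x"
proof (cases "x = \<zero>")
  case True
  then show ?thesis by (simp add: bounded_operators_zero[OF a])
next
  case False
  then have pos: "mnorm E x > 0"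
    using norm_eq_0_iff[OF x] norm_nonneg[OF x] by linarith
  let ?c = "complex_of_real (1 / mnorm E x)"
  have "mnorm E (a (?c \<odot> x)) \<le> opnorm a"
    unfolding opnorm_def using pos x
    by (intro cSUP_upper bdd_above_opnorm[OF a]) (auto simp: norm_smult norm_divide)
  then have "mnorm E (a x) / mnorm E x \<le> opnorm a"
    using pos x bounded_operatorsD[OF a] by (simp add: norm_smult norm_divide)
  then show ?thesis
    using pos by (simp add: field_simps)
qed

lemma opnorm_least:
  assumes "0 \<le> C" "\<And>x. x \<in> carrier E \<Longrightarrow> mnorm E (a x) \<le> C * mnorm E x"
  shows "opnorm a \<le> C"
  unfolding opnorm_def
proof (rule cSUP_least)
  show "{x \<in> carrier E. mnorm E x \<le> 1} \<noteq> {}"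
    by (auto intro!: exI[of _ \<zero>])
  show "mnorm E (a x) \<le> C" if "x \<in> {x \<in> carrier E. mnorm E x \<le> 1}" for x
    using that assms(2)[of x] mult_left_mono[of "mnorm E x" 1 C] assms(1) by simp
qed

lemma opnorm_isometry:
  assumes "\<And>x. x \<in> carrier E \<Longrightarrow> mnorm E (a x) = mnorm E x" "\<exists>x\<in>carrier E. x \<noteq> \<zero>"
    and "a \<in> bounded_operators E"
  shows "opnorm a = 1"
proof (rule antisym)
  show "opnorm a \<le> 1"
    using assms by (intro opnorm_least) auto
  obtain x where x: "x \<in> carrier E" "x \<noteq> \<zero>"
    using assms by auto
  then have "mnorm E x > 0"
    using norm_eq_0_iff norm_nonneg by (metis less_eq_real_def)
  then show "1 \<le> opnorm a"
    using opnorm_apply[OF assms(3) x(1)] assms(1)[OF x(1)] by simp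
qed

text \<open>Stated for an arbitrary linear subspace \<open>S\<close>, since \<open>CV\<close> keeps
  the operations of \<open>operator_algebra\<close> and changes the carrier only.\<close>

lemma cnormed_module_operators:
  assumes S: "S \<subseteq> bounded_operators E" "(\<lambda>x\<in>carrier E. \<zero>) \<in> S"
    and add: "\<And>a b. a \<in> S \<Longrightarrow> b \<in> S \<Longrightarrow> (\<lambda>x\<in>carrier E. a x \<oplus> b x) \<in> S"
    and smult: "\<And>c a. a \<in> S \<Longrightarrow> (\<lambda>x\<in>carrier E. c \<odot> a x) \<in> S"
  shows "cnormed_module (operator_algebra E\<lparr>carrier := S\<rparr>)"
proof -
  let ?A = "operator_algebra E\<lparr>carrier := S\<rparr>"
  have bo: "a \<in> bounded_operators E" if "a \<in> S" for a
    using that S by auto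
  have cl: "a x \<in> carrier E" if "a \<in> S" "x \<in> carrier E" for a x
    using bo[OF that(1)] that(2) bounded_operatorsD(2) by auto
  have ex: "restrict a (carrier E) = a" if "a \<in> S" for a
    using bo[OF that] bounded_operatorsD(1) extensional_restrict by metis
  have norm: "mnorm ?A = opnorm"
    by (rule ext) (simp add: operator_algebra_def opnorm_def)
  interpret A: abelian_group ?A
  proof (rule abelian_groupI)
    fix a b c assume abc: "a \<in> carrier ?A" "b \<in> carrier ?A" "c \<in> carrier ?A"
    then show "a \<oplus>\<^bsub>?A\<^esub> b \<oplus>\<^bsub>?A\<^esub> c = a \<oplus>\<^bsub>?A\<^esub> (b \<oplus>\<^bsub>?A\<^esub> c)"
      by (auto simp: operator_algebra_def a_assoc cl)
  next
    fix a b assume ab: "a \<in> carrier ?A" "b \<in> carrier ?A"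
    then show "a \<oplus>\<^bsub>?A\<^esub> b \<in> carrier ?A"
      by (simp add: operator_algebra_def add)
    show "a \<oplus>\<^bsub>?A\<^esub> b = b \<oplus>\<^bsub>?A\<^esub> a"
      using ab by (auto simp: operator_algebra_def a_comm cl intro!: restrict_ext)
  next
    show "\<zero>\<^bsub>?A\<^esub> \<in> carrier ?A"
      using S by (simp add: operator_algebra_def)
  next
    fix a assume a: "a \<in> carrier ?A"
    then have "(\<lambda>x\<in>carrier E. \<zero> \<oplus> a x) = restrict a (carrier E)"
      by (intro restrict_ext) (simp add: cl)
    then show "\<zero>\<^bsub>?A\<^esub> \<oplus>\<^bsub>?A\<^esub> a = a"
      using a ex by (simp add: operator_algebra_def cong: restrict_cong)
    have "(\<lambda>x\<in>carrier E. (-1) \<odot> a x) \<in> carrier ?A"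
      using a smult by simp
    moreover have "(\<lambda>x\<in>carrier E. (-1) \<odot> a x) \<oplus>\<^bsub>?A\<^esub> a = \<zero>\<^bsub>?A\<^esub>"
      using a by (auto simp: operator_algebra_def cl smult_minus_one l_neg intro!: restrict_ext)
    ultimately show "\<exists>b\<in>carrier ?A. b \<oplus>\<^bsub>?A\<^esub> a = \<zero>\<^bsub>?A\<^esub>"
      by blast
  qed
  show ?thesis
  proof
    fix a c d assume a: "a \<in> carrier ?A"
    then have aS: "a \<in> S" by simp
    show "c \<odot>\<^bsub>?A\<^esub> a \<in> carrier ?A"
      using a smult by (simp add: operator_algebra_def)
    show "(c + d) \<odot>\<^bsub>?A\<^esub> a = c \<odot>\<^bsub>?A\<^esub> a \<oplus>\<^bsub>?A\<^esub> d \<odot>\<^bsub>?A\<^esub> a"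
      using aS by (auto simp: operator_algebra_def smult_add_left cl intro!: restrict_ext)
    show "(c * d) \<odot>\<^bsub>?A\<^esub> a = c \<odot>\<^bsub>?A\<^esub> (d \<odot>\<^bsub>?A\<^esub> a)"
      using aS by (auto simp: operator_algebra_def smult_assoc cl intro!: restrict_ext)
    have "(\<lambda>x\<in>carrier E. 1 \<odot> a x) = restrict a (carrier E)"
      using aS by (intro restrict_ext) (simp add: cl)
    then show "1 \<odot>\<^bsub>?A\<^esub> a = a"
      using aS ex by (simp add: operator_algebra_def)
    show "0 \<le> mnorm ?A a"
      unfolding norm using opnorm_nonneg bo aS by blast
    show "a = \<zero>\<^bsub>?A\<^esub>" if "mnorm ?A a = 0"
    proof -
      have "a x = \<zero>" if "x \<in> carrier E" for x
        using opnorm_apply[OF bo[OF aS] that] \<open>mnorm ?A a = 0\<close>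
          norm_nonneg[OF cl[OF aS that]] norm_eq_0D[OF cl[OF aS that]] by (simp add: norm)
      then have "restrict a (carrier E) = (\<lambda>x\<in>carrier E. \<zero>)"
        by (intro restrict_ext) simp
      then show ?thesis
        using ex[OF aS] by (simp add: operator_algebra_def)
    qed
    have le: "opnorm (\<lambda>x\<in>carrier E. c \<odot> a x) \<le> cmod c * opnorm a" if "a \<in> S" for c a
      using opnorm_apply[OF bo[OF that]] opnorm_nonneg[OF bo[OF that]]
      by (intro opnorm_least)
        (auto simp: norm_smult cl that mult.assoc intro!: mult_left_mono)
    show "mnorm ?A (c \<odot>\<^bsub>?A\<^esub> a) = cmod c * mnorm ?A a"
    proof (cases "c = 0")
      case True
      have "opnorm (\<lambda>x\<in>carrier E. c \<odot> a x) = 0"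
        using le[OF aS, of c] opnorm_nonneg[OF bo[OF smult[OF aS, of c]]] True by simp
      then show ?thesis
        unfolding norm using True by (simp add: operator_algebra_def)
    next
      case False
      let ?ca = "\<lambda>x\<in>carrier E. c \<odot> a x"
      \<comment> \<open>Undoing the scaling with \<open>1/c\<close> turns the inequality
        \<open>le\<close> into its reverse.\<close>
      have "(\<lambda>x\<in>carrier E. (1/c) \<odot> ?ca x) = restrict a (carrier E)"
        using aS False by (intro restrict_ext) (simp add: cl flip: smult_assoc)
      then have "(\<lambda>x\<in>carrier E. (1/c) \<odot> ?ca x) = a"
        using ex[OF aS] by simp
      then have "opnorm a \<le> cmod (1/c) * opnorm ?ca"
        using le[OF smult[OF aS], of "1/c" c] by simp
      then have "cmod c * opnorm a \<le> opnorm ?ca"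
        using False by (simp add: norm_divide field_simps)
      then show ?thesis
        unfolding norm using le[OF aS, of c] by (simp add: operator_algebra_def)
    qed
  next
    fix a b c assume ab: "a \<in> carrier ?A" "b \<in> carrier ?A"
    show "c \<odot>\<^bsub>?A\<^esub> (a \<oplus>\<^bsub>?A\<^esub> b) = c \<odot>\<^bsub>?A\<^esub> a \<oplus>\<^bsub>?A\<^esub> c \<odot>\<^bsub>?A\<^esub> b"
      using ab by (auto simp: operator_algebra_def smult_add_right cl intro!: restrict_ext)
    have "opnorm (\<lambda>x\<in>carrier E. a x \<oplus> b x) \<le> opnorm a + opnorm b"
    proof (rule opnorm_least)
      show "0 \<le> opnorm a + opnorm b"
        using opnorm_nonneg bo ab by simp
      fix x assume x: "x \<in> carrier E"
      show "mnorm E ((\<lambda>x\<in>carrier E. a x \<oplus> b x) x) \<le> (opnorm a + opnorm b) * mnorm E x"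
        using norm_triangle[of "a x" "b x"] opnorm_apply[OF bo x, of a] opnorm_apply[OF bo x, of b] ab x
        by (simp add: cl distrib_right)
    qed
    then show "mnorm ?A (a \<oplus>\<^bsub>?A\<^esub> b) \<le> mnorm ?A a + mnorm ?A b"
      unfolding norm by (simp add: operator_algebra_def)
  qed
qed

end

subsection \<open>The projective tensor product and the weak* topology\<close>

lemma bilinear_formsD:
  assumes "B \<in> bilinear_forms E F"
  shows "x \<in> carrier E \<Longrightarrow> x' \<in> carrier E \<Longrightarrow> y \<in> carrier F \<Longrightarrow> B (x \<oplus>\<^bsub>E\<^esub> x') y = B x y + B x' y"
    and "x \<in> carrier E \<Longrightarrow> y \<in> carrier F \<Longrightarrow> y' \<in> carrier F \<Longrightarrow> B x (y \<oplus>\<^bsub>F\<^esub> y') = B x y + B x y'"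
    and "x \<in> carrier E \<Longrightarrow> y \<in> carrier F \<Longrightarrow> B (c \<odot>\<^bsub>E\<^esub> x) y = c * B x y"
    and "x \<in> carrier E \<Longrightarrow> y \<in> carrier F \<Longrightarrow> B x (c \<odot>\<^bsub>F\<^esub> y) = c * B x y"
  using assms unfolding bilinear_forms_def by auto

locale normed_pairing = E: cnormed_module E + F: cnormed_module F
  for E :: "('v, 'm) normed_module_scheme" and F :: "('w, 'n) normed_module_scheme" +
  fixes D :: "'v \<Rightarrow> 'w \<Rightarrow> complex"
  assumes D_bilinear: "D \<in> bilinear_forms E F"
    and D_bound: "x \<in> carrier E \<Longrightarrow> y \<in> carrier F \<Longrightarrow> cmod (D x y) \<le> mnorm E x * mnorm F y"
    and D_separates_E: "x \<in> carrier E \<Longrightarrow> (\<And>y. y \<in> carrier F \<Longrightarrow> D x y = 0) \<Longrightarrow> x = \<zero>\<^bsub>E\<^esub>"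
    and D_separates_F: "y \<in> carrier F \<Longrightarrow> (\<And>x. x \<in> carrier E \<Longrightarrow> D x y = 0) \<Longrightarrow> y = \<zero>\<^bsub>F\<^esub>"
begin

lemmas D_add_left = bilinear_formsD(1)[OF D_bilinear]
  and D_add_right = bilinear_formsD(2)[OF D_bilinear]
  and D_smult_left = bilinear_formsD(3)[OF D_bilinear]
  and D_smult_right = bilinear_formsD(4)[OF D_bilinear]

definition tensor_sum :: "('v \<times> 'w) list \<Rightarrow> ('v \<Rightarrow> 'w \<Rightarrow> complex) \<Rightarrow> complex" where
  "tensor_sum l B = (\<Sum>(x, y)\<leftarrow>l. B x y)"

definition tensor_cost :: "('v \<times> 'w) list \<Rightarrow> real" where
  "tensor_cost l = (\<Sum>(x, y)\<leftarrow>l. mnorm E x * mnorm F y)"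

abbreviation lsts :: "('v \<times> 'w) list set" where
  "lsts \<equiv> lists (carrier E \<times> carrier F)"

lemma tensor_of_list_apply: "B \<in> bilinear_forms E F \<Longrightarrow> tensor_of_list E F l B = tensor_sum l B"
  by (simp add: tensor_of_list_def tensor_sum_def)

lemma tensor_cost_nonneg: "l \<in> lsts \<Longrightarrow> 0 \<le> tensor_cost l"
  unfolding tensor_cost_def by (rule sum_list_nonneg) auto

text \<open>Tensors live on bilinear forms without any boundedness, so a tensor killed by the bounded forms of
  rank one must first be shown to vanish; this makes the projective norm definite.\<close>

lemma tensor_sum_rank_one_zero:
  assumes "l \<in> lsts"
    and "\<And>\<xi> \<eta>. \<xi> \<in> carrier E \<Longrightarrow> \<eta> \<in> carrier F \<Longrightarrow> tensor_sum l (\<lambda>x y. D x \<eta> * D \<xi> y) = 0"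
    and B: "B \<in> bilinear_forms E F"
  shows "tensor_sum l B = 0"
  using assms(1,2)
proof (induction "length l" arbitrary: l)
  case 0
  then show ?case by (simp add: tensor_sum_def)
next
  case (Suc n)
  obtain x1 y1 l' where l: "l = (x1, y1) # l'" and n: "length l' = n"
    using Suc.hyps(2) by (cases l) auto
  have x1: "x1 \<in> carrier E" and y1: "y1 \<in> carrier F" and l': "l' \<in> lsts"
    using Suc.prems(1) l by auto
  show ?case
  proof (cases "x1 = \<zero>\<^bsub>E\<^esub>")
    case True
    have z: "b \<zero>\<^bsub>E\<^esub> y1 = 0" if "b \<in> bilinear_forms E F" for b
      using bilinear_formsD(3)[OF that E.zero_closed y1, of 0] by simp
    have "tensor_sum l' (\<lambda>x y. D x \<eta> * D \<xi> y) = 0" if "\<xi> \<in> carrier E" "\<eta> \<in> carrier F" for \<xi> \<eta>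
      using Suc.prems(2)[OF that] l True D_smult_left[OF E.zero_closed that(2), of 0]
      by (simp add: tensor_sum_def)
    then have "tensor_sum l' B = 0"
      using Suc.hyps(1) n l' by blast
    then show ?thesis
      using l True z[OF B] by (simp add: tensor_sum_def)
  next
    case False
    then obtain \<eta>0 where \<eta>0: "\<eta>0 \<in> carrier F" "D x1 \<eta>0 \<noteq> 0"
      using D_separates_E[OF x1] by blast
    \<comment> \<open>\<open>\<phi>\<close> is a functional with value 1 at \<open>x1\<close>.
      Splitting every later \<open>x\<close> into \<open>\<phi> x\<close> times \<open>x1\<close>
      and a remainder rewrites the tensor as \<open>x1\<close> tensor \<open>y1 \<oplus> z\<close>
      plus the sum of \<open>tr\<close>, which has one term less. Testing against
      \<open>\<eta>0\<close> and all \<open>\<xi>\<close> shows that \<open>y1 \<oplus> z\<close> is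
      zero.\<close>
    define \<phi> where "\<phi> x = D x \<eta>0 / D x1 \<eta>0" for x
    define z where "z = foldr (\<lambda>(x, y) w. \<phi> x \<odot>\<^bsub>F\<^esub> y \<oplus>\<^bsub>F\<^esub> w) l' \<zero>\<^bsub>F\<^esub>"
    define tr where "tr = map (\<lambda>(x, y). (x \<oplus>\<^bsub>E\<^esub> (- \<phi> x) \<odot>\<^bsub>E\<^esub> x1, y)) l'"
    have z_gen: "foldr (\<lambda>(x, y) w. \<phi> x \<odot>\<^bsub>F\<^esub> y \<oplus>\<^bsub>F\<^esub> w) k \<zero>\<^bsub>F\<^esub> \<in> carrier F \<and>
        (\<forall>b\<in>bilinear_forms E F. \<forall>x\<in>carrier E.
          b x (foldr (\<lambda>(x, y) w. \<phi> x \<odot>\<^bsub>F\<^esub> y \<oplus>\<^bsub>F\<^esub> w) k \<zero>\<^bsub>F\<^esub>) = (\<Sum>(x', y)\<leftarrow>k. \<phi> x' * b x y))"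
      if "k \<in> lsts" for k
      using that
    proof (induction k)
      case Nil
      have "b x \<zero>\<^bsub>F\<^esub> = 0" if "b \<in> bilinear_forms E F" "x \<in> carrier E" for b x
        using bilinear_formsD(4)[OF that(1,2) F.zero_closed, of 0] by simp
      then show ?case by simp
    next
      case (Cons a k)
      obtain x y where a: "a = (x, y)" by force
      show ?case
        using Cons by (simp add: a bilinear_formsD)
    qed
    have zF: "z \<in> carrier F"
      and z: "\<And>b x. b \<in> bilinear_forms E F \<Longrightarrow> x \<in> carrier E \<Longrightarrow> b x z = (\<Sum>(x', y)\<leftarrow>l'. \<phi> x' * b x y)"
      using z_gen[OF l'] by (auto simp: z_def)
    have "y1 \<oplus>\<^bsub>F\<^esub> z = \<zero>\<^bsub>F\<^esub>"
    proof (rule D_separates_F)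
      fix \<xi> assume \<xi>: "\<xi> \<in> carrier E"
      have "D x1 \<eta>0 * D \<xi> y1 + (\<Sum>(x, y)\<leftarrow>l'. D x \<eta>0 * D \<xi> y) = 0"
        using Suc.prems(2)[OF \<xi> \<eta>0(1)] by (simp add: l tensor_sum_def)
      moreover have "(\<Sum>(x, y)\<leftarrow>l'. D x \<eta>0 * D \<xi> y) = D x1 \<eta>0 * (\<Sum>(x, y)\<leftarrow>l'. \<phi> x * D \<xi> y)"
        using \<eta>0(2) by (simp add: \<phi>_def sum_list_const_mult[symmetric] case_prod_unfold)
      ultimately have "D x1 \<eta>0 * (D \<xi> y1 + (\<Sum>(x, y)\<leftarrow>l'. \<phi> x * D \<xi> y)) = 0"
        by (simp add: distrib_left)
      then show "D \<xi> (y1 \<oplus>\<^bsub>F\<^esub> z) = 0"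
        using \<eta>0(2) by (simp add: D_add_right \<xi> y1 zF z[OF D_bilinear \<xi>])
    qed (use y1 zF in simp)
    have tr_sum: "tensor_sum tr b = tensor_sum l b" if b: "b \<in> bilinear_forms E F" for b
    proof -
      have "b x1 \<zero>\<^bsub>F\<^esub> = 0"
        using bilinear_formsD(4)[OF b x1 F.zero_closed, of 0] by simp
      then have "b x1 y1 + b x1 z = 0"
        using \<open>y1 \<oplus>\<^bsub>F\<^esub> z = \<zero>\<^bsub>F\<^esub>\<close> bilinear_formsD(2)[OF b x1 y1 zF] by simp
      moreover have "tensor_sum tr b = tensor_sum l' b - (\<Sum>(x, y)\<leftarrow>l'. \<phi> x * b x1 y)"
        using l' unfolding tr_def tensor_sum_def
        by (induction l') (auto simp: bilinear_formsD[OF b] x1)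
      ultimately show ?thesis
        using z[OF b x1] by (simp add: l tensor_sum_def algebra_simps add_eq_0_iff)
    qed
    have tr: "tr \<in> lsts" "length tr = n"
      using l' x1 n by (fastforce simp: tr_def)+
    have "(\<lambda>x y. D x \<eta> * D \<xi> y) \<in> bilinear_forms E F" if "\<xi> \<in> carrier E" "\<eta> \<in> carrier F" for \<xi> \<eta>
      using that unfolding bilinear_forms_def
      by (auto simp: D_add_left D_add_right D_smult_left D_smult_right algebra_simps)
    then have "tensor_sum tr (\<lambda>x y. D x \<eta> * D \<xi> y) = 0" if "\<xi> \<in> carrier E" "\<eta> \<in> carrier F" for \<xi> \<eta>
      using that Suc.prems(2) tr_sum by simp
    then have "tensor_sum tr B = 0"
      using Suc.hyps(1)[of tr] tr by blast
    then show ?thesis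
      using tr_sum[OF B] by simp
  qed
qed

section \<open>The projective norm on the algebraic tensor product\<close>

abbreviation "tensors \<equiv> algebraic_tensor_product E F"

lemma tensors_carrierE:
  assumes "t \<in> carrier tensors"
  obtains l where "l \<in> lsts" "t = tensor_of_list E F l"
  using assms by (auto simp: algebraic_tensor_product_def)

lemma tensor_of_list_carrier: "l \<in> lsts \<Longrightarrow> tensor_of_list E F l \<in> carrier tensors"
  by (auto simp: algebraic_tensor_product_def)

lemma projective_norm_le: "l \<in> lsts \<Longrightarrow> projective_norm E F (tensor_of_list E F l) \<le> tensor_cost l"
  unfolding projective_norm_def tensor_cost_def
  by (rule cInf_lower)
    (auto intro!: bdd_belowI[of _ 0] tensor_cost_nonneg[unfolded tensor_cost_def])

lemma projective_norm_greatest: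
  assumes "t \<in> carrier tensors"
    and "\<And>l. l \<in> lsts \<Longrightarrow> t = tensor_of_list E F l \<Longrightarrow> c \<le> tensor_cost l"
  shows "c \<le> projective_norm E F t"
  unfolding projective_norm_def
  by (rule cInf_greatest)
    (use assms in \<open>auto simp: tensor_cost_def elim!: tensors_carrierE\<close>)

lemma projective_norm_approx:
  assumes "t \<in> carrier tensors" "0 < e"
  obtains l where "l \<in> lsts" "t = tensor_of_list E F l" "tensor_cost l < projective_norm E F t + e"
  using projective_norm_greatest[OF assms(1), of "projective_norm E F t + e"] assms(2)
  by (metis add_le_same_cancel1 linorder_not_le)

text \<open>Every list that represents \<open>t\<close> computes the same value \<open>t B\<close>,
  so the estimate for a single list passes to the infimum. Dividing by \<open>C\<close> before
  taking the infimum is what sets the case \<open>C = 0\<close> apart.\<close>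

lemma tensor_bound:
  assumes B: "B \<in> bilinear_forms E F" and t: "t \<in> carrier tensors" and C: "0 \<le> C"
    and bd: "\<And>x y. x \<in> carrier E \<Longrightarrow> y \<in> carrier F \<Longrightarrow> cmod (B x y) \<le> C * (mnorm E x * mnorm F y)"
  shows "cmod (t B) \<le> C * projective_norm E F t"
proof (cases "C = 0")
  case True
  obtain l where l: "l \<in> lsts" "t = tensor_of_list E F l"
    using t by (rule tensors_carrierE)
  have "tensor_sum l B = 0"
    using l(1) unfolding tensor_sum_def
    by (induction l) (use bd True in auto)
  then show ?thesis
    using True l B by (simp add: tensor_of_list_apply)
next
  case False
  have "cmod (t B) / C \<le> projective_norm E F t"
  proof (rule projective_norm_greatest[OF t])
    fix l assume l: "l \<in> lsts" "t = tensor_of_list E F l"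
    have "cmod (tensor_sum l B) \<le> C * tensor_cost l"
      using l(1) unfolding tensor_sum_def tensor_cost_def
    proof (induction l)
      case (Cons a l)
      obtain x y where a: "a = (x, y)" by force
      show ?case
        using Cons bd[of x y] norm_triangle_ineq[of "B x y" "\<Sum>(x, y)\<leftarrow>l. B x y"]
        by (simp add: a distrib_left)
    qed simp
    then show "cmod (t B) / C \<le> tensor_cost l"
      using l B C False by (simp add: tensor_of_list_apply field_simps)
  qed
  then show ?thesis
    using C False by (simp add: field_simps)
qed

lemma tensor_ext:
  assumes "t \<in> carrier tensors" "u \<in> carrier tensors"
    and "\<And>B. B \<in> bilinear_forms E F \<Longrightarrow> t B = u B"
  shows "t = u"
  using assms by (auto elim!: tensors_carrierE simp: tensor_of_list_def restrict_def fun_eq_iff)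

lemma tensor_add_of_list:
  "tensor_of_list E F l \<oplus>\<^bsub>tensors\<^esub> tensor_of_list E F l' = tensor_of_list E F (l @ l')"
  by (auto simp: algebraic_tensor_product_def tensor_of_list_def intro!: restrict_ext)

lemma tensor_smult_of_list:
  assumes "l \<in> lsts"
  shows "c \<odot>\<^bsub>tensors\<^esub> tensor_of_list E F l = tensor_of_list E F (map (\<lambda>(x, y). (c \<odot>\<^bsub>E\<^esub> x, y)) l)"
proof -
  have "c * (\<Sum>(x, y)\<leftarrow>l. B x y) = (\<Sum>(x, y)\<leftarrow>map (\<lambda>(x, y). (c \<odot>\<^bsub>E\<^esub> x, y)) l. B x y)"
    if "B \<in> bilinear_forms E F" for B
    using assms by (induction l) (auto simp: bilinear_formsD[OF that] distrib_left)
  then show ?thesis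
    by (auto simp: algebraic_tensor_product_def tensor_of_list_def intro!: restrict_ext)
qed

lemma tensor_zero: "\<zero>\<^bsub>tensors\<^esub> = tensor_of_list E F []"
  by (auto simp: algebraic_tensor_product_def tensor_of_list_def)

lemma tensor_apply:
  assumes "B \<in> bilinear_forms E F"
  shows "(t \<oplus>\<^bsub>tensors\<^esub> u) B = t B + u B" "(c \<odot>\<^bsub>tensors\<^esub> t) B = c * t B" "\<zero>\<^bsub>tensors\<^esub> B = 0"
  using assms by (auto simp: algebraic_tensor_product_def)

lemma tensor_closed:
  assumes "t \<in> carrier tensors"
  shows "u \<in> carrier tensors \<Longrightarrow> t \<oplus>\<^bsub>tensors\<^esub> u \<in> carrier tensors"
    and "c \<odot>\<^bsub>tensors\<^esub> t \<in> carrier tensors"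
proof -
  obtain l where l: "l \<in> lsts" "t = tensor_of_list E F l"
    using assms by (rule tensors_carrierE)
  show "c \<odot>\<^bsub>tensors\<^esub> t \<in> carrier tensors"
    unfolding l(2) tensor_smult_of_list[OF l(1)] using l(1)
    by (intro tensor_of_list_carrier) fastforce
  show "t \<oplus>\<^bsub>tensors\<^esub> u \<in> carrier tensors" if u: "u \<in> carrier tensors"
  proof -
    obtain k where "k \<in> lsts" "u = tensor_of_list E F k"
      using u by (rule tensors_carrierE)
    then show ?thesis
      using l tensor_of_list_carrier[of "l @ k"] by (simp add: tensor_add_of_list del: in_lists_conv_set)
  qed
qed

lemma projective_norm_smult_le:
  assumes "t \<in> carrier tensors"
  shows "projective_norm E F (c \<odot>\<^bsub>tensors\<^esub> t) \<le> cmod c * projective_norm E F t"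
proof (rule field_le_epsilon)
  fix e :: real assume e: "0 < e"
  \<comment> \<open>The summand 1 keeps the denominator positive when \<open>c = 0\<close>.\<close>
  define e' where "e' = e / (cmod c + 1)"
  have e': "0 < e'" "cmod c * e' \<le> e"
    using e by (auto simp: e'_def field_simps pos_divide_le_eq add_pos_nonneg
        intro!: divide_pos_pos)
  obtain l where l: "l \<in> lsts" "t = tensor_of_list E F l" "tensor_cost l < projective_norm E F t + e'"
    using projective_norm_approx[OF assms e'(1)] by blast
  let ?l = "map (\<lambda>(x, y). (c \<odot>\<^bsub>E\<^esub> x, y)) l"
  have cl: "?l \<in> lsts"
    using l(1) by fastforce
  have "tensor_cost ?l = cmod c * tensor_cost l"
    using l(1) unfolding tensor_cost_def
    by (induction l) (auto simp: E.norm_smult distrib_left)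
  then have "projective_norm E F (c \<odot>\<^bsub>tensors\<^esub> t) \<le> cmod c * tensor_cost l"
    using projective_norm_le[OF cl] l by (simp add: tensor_smult_of_list)
  also have "\<dots> \<le> cmod c * (projective_norm E F t + e')"
    using l(3) by (intro mult_left_mono) auto
  finally show "projective_norm E F (c \<odot>\<^bsub>tensors\<^esub> t) \<le> cmod c * projective_norm E F t + e"
    using e'(2) by (simp add: distrib_left)
qed

text \<open>The rank one forms built from \<open>D\<close> are bounded, so
  \<open>tensor_bound\<close> makes a tensor of norm zero vanish on them;
  \<open>tensor_sum_rank_one_zero\<close> extends this to all bilinear forms.\<close>

lemma projective_norm_definite:
  assumes t: "t \<in> carrier tensors" and z: "projective_norm E F t = 0"
  shows "t = \<zero>\<^bsub>tensors\<^esub>"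
proof -
  obtain l where l: "l \<in> lsts" "t = tensor_of_list E F l"
    using t by (rule tensors_carrierE)
  have "tensor_sum l (\<lambda>x y. D x \<eta> * D \<xi> y) = 0" if \<xi>\<eta>: "\<xi> \<in> carrier E" "\<eta> \<in> carrier F" for \<xi> \<eta>
  proof -
    have bl: "(\<lambda>x y. D x \<eta> * D \<xi> y) \<in> bilinear_forms E F"
      using \<xi>\<eta> unfolding bilinear_forms_def
      by (auto simp: D_add_left D_add_right D_smult_left D_smult_right algebra_simps)
    have "cmod (D x \<eta> * D \<xi> y) \<le> (mnorm F \<eta> * mnorm E \<xi>) * (mnorm E x * mnorm F y)"
      if "x \<in> carrier E" "y \<in> carrier F" for x y
      using mult_mono[OF D_bound[OF that(1) \<xi>\<eta>(2)] D_bound[OF \<xi>\<eta>(1) that(2)]] that \<xi>\<eta>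
      by (simp add: norm_mult mult_ac)
    from tensor_bound[OF bl t _ this] have "t (\<lambda>x y. D x \<eta> * D \<xi> y) = 0"
      using z \<xi>\<eta> by simp
    then show ?thesis
      using l bl by (simp add: tensor_of_list_apply)
  qed
  then have "tensor_sum l B = 0" if "B \<in> bilinear_forms E F" for B
    using tensor_sum_rank_one_zero[OF l(1)] that by blast
  then show ?thesis
    by (intro tensor_ext[OF t]) (auto simp: tensor_zero l tensor_of_list_carrier tensor_of_list_apply tensor_sum_def)
qed

sublocale tensors: cnormed_module tensors
proof -
  note tc = tensor_closed
  have z: "\<zero>\<^bsub>tensors\<^esub> \<in> carrier tensors"
    by (simp add: tensor_zero tensor_of_list_carrier)
  have norm: "mnorm tensors = projective_norm E F"
    by (simp add: algebraic_tensor_product_def)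
  have nonneg: "0 \<le> projective_norm E F t" if "t \<in> carrier tensors" for t
    using projective_norm_greatest[OF that] tensor_cost_nonneg by blast
  interpret abelian_group tensors
  proof (rule abelian_groupI)
    fix t assume t: "t \<in> carrier tensors"
    have "(-1) \<odot>\<^bsub>tensors\<^esub> t \<oplus>\<^bsub>tensors\<^esub> t = \<zero>\<^bsub>tensors\<^esub>"
      by (rule tensor_ext) (use t z tc in \<open>auto simp: tensor_apply\<close>)
    then show "\<exists>u\<in>carrier tensors. u \<oplus>\<^bsub>tensors\<^esub> t = \<zero>\<^bsub>tensors\<^esub>"
      using tc(2)[OF t] by blast
  qed (use z tc in \<open>auto simp: tensor_apply intro!: tensor_ext\<close>)
  show "cnormed_module tensors"
  proof
    fix t c d assume t: "t \<in> carrier tensors"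
    show "mnorm tensors (c \<odot>\<^bsub>tensors\<^esub> t) = cmod c * mnorm tensors t"
    proof (cases "c = 0")
      case True
      then show ?thesis
        using projective_norm_smult_le[OF t, of c] nonneg[OF tc(2)[OF t, of c]] norm by simp
    next
      case False
      have "(1/c) \<odot>\<^bsub>tensors\<^esub> (c \<odot>\<^bsub>tensors\<^esub> t) = t"
        by (rule tensor_ext) (use t tc False in \<open>auto simp: tensor_apply\<close>)
      then have "cmod c * projective_norm E F t \<le> projective_norm E F (c \<odot>\<^bsub>tensors\<^esub> t)"
        using projective_norm_smult_le[OF tc(2)[OF t], of "1/c" c] False
        by (simp add: norm_divide field_simps)
      then show ?thesis
        using projective_norm_smult_le[OF t, of c] norm by simp
    qed
    show "0 \<le> mnorm tensors t"
      using nonneg t norm by simp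
    show "mnorm tensors t = 0 \<Longrightarrow> t = \<zero>\<^bsub>tensors\<^esub>"
      using projective_norm_definite t norm by simp
  next
    fix t u assume tu: "t \<in> carrier tensors" "u \<in> carrier tensors"
    have "projective_norm E F (t \<oplus>\<^bsub>tensors\<^esub> u) \<le> projective_norm E F t + projective_norm E F u"
    proof (rule field_le_epsilon)
      fix e :: real assume "0 < e"
      then have e: "0 < e/2" by simp
      obtain l where l: "l \<in> lsts" "t = tensor_of_list E F l" "tensor_cost l < projective_norm E F t + e/2"
        using projective_norm_approx[OF tu(1) e] by blast
      obtain k where k: "k \<in> lsts" "u = tensor_of_list E F k" "tensor_cost k < projective_norm E F u + e/2"
        using projective_norm_approx[OF tu(2) e] by blast
      have "projective_norm E F (t \<oplus>\<^bsub>tensors\<^esub> u) \<le> tensor_cost (l @ k)"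
        unfolding l(2) k(2) tensor_add_of_list using l(1) k(1) by (intro projective_norm_le) auto
      then show "projective_norm E F (t \<oplus>\<^bsub>tensors\<^esub> u) \<le> projective_norm E F t + projective_norm E F u + e"
        using l(3) k(3) by (simp add: tensor_cost_def)
    qed
    then show "mnorm tensors (t \<oplus>\<^bsub>tensors\<^esub> u) \<le> mnorm tensors t + mnorm tensors u"
      using norm by simp
  qed (use tc in \<open>auto simp: tensor_apply algebra_simps intro!: tensor_ext\<close>)
qed

lemma mnorm_tensors [simp]: "mnorm tensors = projective_norm E F"
  by (simp add: algebraic_tensor_product_def)

lemma tensor_diff_apply:
  assumes "t \<in> carrier tensors" "u \<in> carrier tensors" "B \<in> bilinear_forms E F"
  shows "(t \<ominus>\<^bsub>tensors\<^esub> u) B = t B - u B"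
  using assms by (simp add: a_minus_def tensor_apply flip: tensors.smult_minus_one)

section \<open>The completed tensor product and weak* continuity\<close>

abbreviation "TCauchy \<equiv> Metric_space.MCauchy (carrier tensors) (mdistance tensors)"

lemma TCauchy_iff:
  "TCauchy s \<longleftrightarrow> range s \<subseteq> carrier tensors \<and>
     (\<forall>e>0. \<exists>N. \<forall>n m. N \<le> n \<longrightarrow> N \<le> m \<longrightarrow> mdistance tensors (s n) (s m) < e)"
  by (simp add: Metric_space.MCauchy_def[OF tensors.Metric_space])

text \<open>Classes of the completion are nonempty, since a Cauchy sequence is at distance zero from
  itself. Hence the choice in \<open>operator_tensor_pairing\<close> returns a genuine Cauchy
  sequence.\<close>

lemma projective_tensor_productE:
  assumes "\<tau> \<in> projective_tensor_product E F"
  obtains t where "TCauchy t" "(SOME t. t \<in> \<tau>) = t"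
proof -
  obtain s where s: "TCauchy s"
    "\<tau> = {t. TCauchy t \<and> (\<lambda>n. mdistance tensors (s n) (t n)) \<longlonglongrightarrow> 0}"
    using assms by (auto simp: projective_tensor_product_def completion_def quotient_def)
  have "mdistance tensors (s n) (s n) = 0" for n
    using s(1) Metric_space.mdist_zero[OF tensors.Metric_space, of "s n"] by (auto simp: TCauchy_iff)
  then have "s \<in> \<tau>"
    using s by simp
  then have "(SOME t. t \<in> \<tau>) \<in> \<tau>"
    by (rule someI[of "\<lambda>t. t \<in> \<tau>"])
  then show ?thesis
    using that s(2) by blast
qed

lemma operator_form_bilinear:
  assumes "a \<in> bounded_operators E"
  shows "(\<lambda>x y. D (a x) y) \<in> bilinear_forms E F"
  using assms unfolding bilinear_forms_def
  by (auto simp: E.bounded_operatorsD D_add_left D_add_right D_smult_left D_smult_right)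

lemma operator_form_bound:
  assumes a: "a \<in> bounded_operators E" and "x \<in> carrier E" "y \<in> carrier F"
  shows "cmod (D (a x) y) \<le> E.opnorm a * (mnorm E x * mnorm F y)"
  using order_trans[OF D_bound[of "a x" y] mult_right_mono[OF E.opnorm_apply[OF a, of x]]] assms
  by (simp add: E.bounded_operatorsD mult.assoc)

lemma tensor_operator_diff_bound:
  assumes a: "a \<in> bounded_operators E" and "t \<in> carrier tensors" "u \<in> carrier tensors"
  shows "cmod (t (\<lambda>x y. D (a x) y) - u (\<lambda>x y. D (a x) y)) \<le> E.opnorm a * mdistance tensors t u"
  using tensor_bound[OF operator_form_bilinear[OF a] _ E.opnorm_nonneg[OF a] operator_form_bound[OF a],
      of "t \<ominus>\<^bsub>tensors\<^esub> u"] assms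
  by (simp add: tensors.mdistance_eq tensor_diff_apply operator_form_bilinear)

text \<open>A bounded operator induces a Lipschitz functional on tensors, so a Cauchy sequence of
  tensors has a Cauchy sequence of values, and the \<open>lim\<close> in the definition of the
  pairing is an actual limit.\<close>

lemma operator_tensor_pairing_LIMSEQ:
  assumes a: "a \<in> bounded_operators E" and t: "TCauchy t" "(SOME t. t \<in> \<tau>) = t"
  shows "(\<lambda>n. t n (\<lambda>x y. D (a x) y)) \<longlonglongrightarrow> operator_tensor_pairing D a \<tau>"
proof -
  let ?f = "\<lambda>n. t n (\<lambda>x y. D (a x) y)"
  have "Cauchy ?f"
  proof (rule metric_CauchyI)
    fix e :: real assume e: "0 < e"
    define e' where "e' = e / (E.opnorm a + 1)"
    have pos: "0 < E.opnorm a + 1"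
      using E.opnorm_nonneg[OF a] by simp
    then have e': "0 < e'" "(E.opnorm a + 1) * e' = e"
      using e by (auto simp: e'_def)
    obtain N where N: "\<And>n m. N \<le> n \<Longrightarrow> N \<le> m \<Longrightarrow> mdistance tensors (t n) (t m) < e'"
      using t(1) e'(1) unfolding TCauchy_iff by meson
    show "\<exists>N. \<forall>m\<ge>N. \<forall>n\<ge>N. dist (?f m) (?f n) < e"
    proof (intro exI allI impI)
      fix m n assume mn: "N \<le> m" "N \<le> n"
      have "dist (?f m) (?f n) \<le> E.opnorm a * mdistance tensors (t m) (t n)"
        using tensor_operator_diff_bound[OF a, of "t m" "t n"] t(1)
        by (auto simp: dist_norm TCauchy_iff)
      also have "\<dots> \<le> E.opnorm a * e'"
        using N[OF mn] E.opnorm_nonneg[OF a] by (intro mult_left_mono) auto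
      also have "\<dots> < e"
        using e' by (simp add: distrib_right)
      finally show "dist (?f m) (?f n) < e" .
    qed
  qed
  then show ?thesis
    unfolding operator_tensor_pairing_def t(2)
    using Cauchy_convergent convergent_LIMSEQ_iff by blast
qed

lemma topspace_weak_star [simp]: "topspace (weak_star_topology E F D) = bounded_operators E"
  unfolding weak_star_topology_def by (auto simp: topspace_pullback_topology)

lemma continuous_map_weak_star_pairing:
  assumes "\<tau> \<in> projective_tensor_product E F"
  shows "continuous_map (weak_star_topology E F D) euclidean (\<lambda>a. operator_tensor_pairing D a \<tau>)"
proof -
  let ?P = "product_topology (\<lambda>_. euclidean :: complex topology) (projective_tensor_product E F)"
  have "continuous_map (weak_star_topology E F D) euclidean
      ((\<lambda>h. h \<tau>) \<circ> (\<lambda>a. \<lambda>\<tau>\<in>projective_tensor_product E F. operator_tensor_pairing D a \<tau>))"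
    unfolding weak_star_topology_def
    by (rule continuous_map_pullback) (use assms in \<open>auto intro: continuous_map_product_projection\<close>)
  then show ?thesis
    using assms by (simp add: o_def)
qed

text \<open>The elementary tensor enters the completion as the class of a constant sequence. The
  representative picked by the pairing may be another member of that class, but it differs by a null
  sequence, which does not affect the limit.\<close>

lemma continuous_map_weak_star_eval:
  assumes x: "x \<in> carrier E" and y: "y \<in> carrier F"
  shows "continuous_map (weak_star_topology E F D) euclidean (\<lambda>a. D (a x) y)"
proof -
  define s where "s n = tensor_of_list E F [(x, y)]" for n :: nat
  define \<tau> where "\<tau> = {t. TCauchy t \<and> (\<lambda>n. mdistance tensors (s n) (t n)) \<longlonglongrightarrow> 0}"
  have s: "s n \<in> carrier tensors" for n
    using x y by (auto simp: s_def intro!: tensor_of_list_carrier)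
  have "TCauchy s"
    using s Metric_space.mdist_zero[OF tensors.Metric_space] by (auto simp: TCauchy_iff s_def)
  then have \<tau>: "\<tau> \<in> projective_tensor_product E F"
    unfolding projective_tensor_product_def completion_def \<tau>_def
    by (intro quotientI[THEN back_subst[of "\<lambda>z. z \<in> _"]]) auto
  have "operator_tensor_pairing D a \<tau> = D (a x) y" if a: "a \<in> bounded_operators E" for a
  proof -
    have "s \<in> \<tau>"
      using \<open>TCauchy s\<close> s Metric_space.mdist_zero[OF tensors.Metric_space] by (simp add: \<tau>_def)
    then have t\<tau>: "(SOME t. t \<in> \<tau>) \<in> \<tau>"
      by (rule someI[of "\<lambda>t. t \<in> \<tau>"])
    define t where "t = (SOME t. t \<in> \<tau>)"
    have t: "TCauchy t" "(\<lambda>n. mdistance tensors (s n) (t n)) \<longlonglongrightarrow> 0"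
      using t\<tau> by (auto simp: \<tau>_def t_def)
    have tc: "t n \<in> carrier tensors" for n
      using t(1) by (auto simp: TCauchy_iff)
    have sv: "s n (\<lambda>x y. D (a x) y) = D (a x) y" for n
      using operator_form_bilinear[OF a] by (simp add: s_def tensor_of_list_apply tensor_sum_def)
    have "(\<lambda>n. D (a x) y - t n (\<lambda>x y. D (a x) y)) \<longlonglongrightarrow> 0"
    proof (rule Lim_null_comparison)
      show "\<forall>\<^sub>F n in sequentially. norm (D (a x) y - t n (\<lambda>x y. D (a x) y)) \<le>
          E.opnorm a * mdistance tensors (s n) (t n)"
        using tensor_operator_diff_bound[OF a s tc] sv by (intro always_eventually) metis
      show "(\<lambda>n. E.opnorm a * mdistance tensors (s n) (t n)) \<longlonglongrightarrow> 0"
        using tendsto_mult_right_zero[OF t(2)] by simp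
    qed
    from tendsto_diff[OF tendsto_const this, of "D (a x) y"]
    have "(\<lambda>n. t n (\<lambda>x y. D (a x) y)) \<longlonglongrightarrow> D (a x) y"
      by simp
    then show ?thesis
      using operator_tensor_pairing_LIMSEQ[OF a t(1)] LIMSEQ_unique unfolding t_def by blast
  qed
  then show ?thesis
    by (intro continuous_map_eq[OF continuous_map_weak_star_pairing[OF \<tau>]]) auto
qed

text \<open>On a norm bounded family of operators, approximating an element of the completion by
  algebraic tensors is uniform in the parameter. A uniform limit of continuous functions is
  continuous, so continuity of the coefficients on elementary tensors suffices.\<close>

lemma continuous_map_into_weak_star:
  assumes a: "\<And>z. z \<in> topspace X \<Longrightarrow> a z \<in> bounded_operators E"
    and norm: "\<And>z. z \<in> topspace X \<Longrightarrow> E.opnorm (a z) \<le> C"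
    and cont: "\<And>x y. x \<in> carrier E \<Longrightarrow> y \<in> carrier F \<Longrightarrow> continuous_map X euclidean (\<lambda>z. D (a z x) y)"
  shows "continuous_map X (weak_star_topology E F D) a"
proof -
  have "continuous_map X euclidean (\<lambda>z. operator_tensor_pairing D (a z) \<tau>)"
    if "\<tau> \<in> projective_tensor_product E F" for \<tau>
  proof -
    obtain t where t: "TCauchy t" "(SOME t. t \<in> \<tau>) = t"
      using \<open>\<tau> \<in> _\<close> by (rule projective_tensor_productE)
    have tc: "t n \<in> carrier tensors" for n
      using t(1) by (auto simp: TCauchy_iff)
    have "continuous_map X Met_TC.mtopology (\<lambda>z. operator_tensor_pairing D (a z) \<tau>)"
    proof (rule Met_TC.continuous_map_uniform_limit)
      show "\<forall>\<^sub>F n in sequentially. continuous_map X Met_TC.mtopology (\<lambda>z. t n (\<lambda>x y. D (a z x) y))"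
      proof (intro always_eventually allI)
        fix n
        obtain l where l: "l \<in> lsts" "t n = tensor_of_list E F l"
          using tc by (rule tensors_carrierE)
        have "continuous_map X euclidean (\<lambda>z. tensor_sum l (\<lambda>x y. D (a z x) y))"
          using l(1) unfolding tensor_sum_def
        proof (induction l)
          case (Cons p l)
          obtain x y where p: "p = (x, y)" by force
          show ?case
            using Cons cont[of x y] by (auto simp: p intro!: continuous_map_add)
        qed simp
        then show "continuous_map X Met_TC.mtopology (\<lambda>z. t n (\<lambda>x y. D (a z x) y))"
          unfolding mtopology_is_euclidean
          by (rule continuous_map_eq)
            (simp add: l tensor_of_list_apply operator_form_bilinear a)
      qed
      fix e :: real assume e: "0 < e"
      define e' where "e' = e / (\<bar>C\<bar> + 1) / 2"
      have "0 < \<bar>C\<bar> + 1"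
        by simp
      then have "e = 2 * (\<bar>C\<bar> + 1) * e'"
        by (simp add: e'_def field_simps)
      moreover have e'_pos: "0 < e'"
        using e by (simp add: e'_def add_nonneg_pos)
      moreover have "0 \<le> \<bar>C\<bar> * e'"
        using e'_pos by simp
      ultimately have e': "0 < e'" "\<bar>C\<bar> * e' < e"
        by (auto simp only: distrib_left distrib_right)
      obtain N where N: "\<And>n m. N \<le> n \<Longrightarrow> N \<le> m \<Longrightarrow> mdistance tensors (t n) (t m) < e'"
        using t(1) e'(1) unfolding TCauchy_iff by meson
      have "dist (t n (\<lambda>x y. D (a z x) y)) (operator_tensor_pairing D (a z) \<tau>) < e"
        if n: "N \<le> n" and z: "z \<in> topspace X" for n z
      proof -
        have "cmod (t n (\<lambda>x y. D (a z x) y) - t m (\<lambda>x y. D (a z x) y)) \<le> \<bar>C\<bar> * e'"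
          if "N \<le> m" for m
        proof (rule order_trans[OF tensor_operator_diff_bound[OF a[OF z] tc tc]])
          show "E.opnorm (a z) * mdistance tensors (t n) (t m) \<le> \<bar>C\<bar> * e'"
            using norm[OF z] N[OF n that] E.opnorm_nonneg[OF a[OF z]]
              Metric_space.nonneg[OF tensors.Metric_space]
            by (intro mult_mono) auto
        qed
        then have "cmod (t n (\<lambda>x y. D (a z x) y) - operator_tensor_pairing D (a z) \<tau>) \<le> \<bar>C\<bar> * e'"
          by (intro LIMSEQ_le_const2[OF tendsto_norm[OF tendsto_diff[OF tendsto_const
                  operator_tensor_pairing_LIMSEQ[OF a[OF z] t]]]]) auto
        then show ?thesis
          using e'(2) by (simp add: dist_norm)
      qed
      then show "\<forall>\<^sub>F n in sequentially. \<forall>z\<in>topspace X. operator_tensor_pairing D (a z) \<tau> \<in> UNIV \<and>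
          dist (t n (\<lambda>x y. D (a z x) y)) (operator_tensor_pairing D (a z) \<tau>) < e"
        unfolding eventually_sequentially by blast
    qed simp
    then show ?thesis by simp
  qed
  then have "continuous_map X (product_topology (\<lambda>_. euclidean) (projective_tensor_product E F))
      ((\<lambda>a. \<lambda>\<tau>\<in>projective_tensor_product E F. operator_tensor_pairing D a \<tau>) \<circ> a)"
    by (auto simp: continuous_map_componentwise o_def)
  then show ?thesis
    unfolding weak_star_topology_def
    by (rule continuous_map_pullback') (use a in auto)
qed

end

subsection \<open>The Clarkson inequality\<close>

text \<open>Bernoulli's inequality, from the weighted arithmetic-geometric mean inequality for
  \<open>t powr q\<close> and 1 with weights \<open>1/q\<close> and \<open>1 - 1/q\<close>.\<close>

lemma powr_ge_tangent:
  fixes t q :: real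
  assumes "1 \<le> q" "0 \<le> t"
  shows "1 + q * (t - 1) \<le> t powr q"
proof (cases "t = 0")
  case False
  have "(t powr q) powr (1/q) * 1 powr (1 - 1/q) \<le> (1/q) * t powr q + (1 - 1/q) * 1"
    using assms False by (intro Youngs_inequality_0) auto
  then have "t \<le> (1/q) * t powr q + (1 - 1/q)"
    using assms by (simp add: powr_powr)
  then have "q * t \<le> q * ((1/q) * t powr q + (1 - 1/q))"
    using assms by (intro mult_left_mono) auto
  then show ?thesis
    using assms by (simp add: algebra_simps)
qed (use assms in auto)

lemma powr_le_tangent:
  fixes t q :: real
  assumes "0 \<le> q" "q \<le> 1" "0 \<le> t"
  shows "t powr q \<le> 1 + q * (t - 1)"
proof (cases "t = 0")
  case False
  have "t powr q * 1 powr (1 - q) \<le> q * t + (1 - q) * 1"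
    using assms False by (intro Youngs_inequality_0) auto
  then show ?thesis
    by (simp add: algebra_simps)
qed (use assms in auto)

text \<open>Jensen's inequality by way of the tangent at the mean \<open>m\<close>: the linear terms
  average out to zero.\<close>

lemma powr_convex_combination:
  fixes a b l p :: real
  assumes "1 \<le> p" "0 \<le> a" "0 \<le> b" "0 \<le> l" "l \<le> 1"
  shows "(l * a + (1 - l) * b) powr p \<le> l * a powr p + (1 - l) * b powr p"
proof (cases "l * a + (1 - l) * b = 0")
  case False
  define m where "m = l * a + (1 - l) * b"
  have m: "0 < m"
    using False assms by (simp add: m_def add_nonneg_nonneg less_le)
  have t: "m powr p * (1 + p * (c / m - 1)) \<le> c powr p" if "0 \<le> c" for c
    using mult_left_mono[OF powr_ge_tangent[OF assms(1), of "c/m"], of "m powr p"] that m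
    by (simp add: powr_divide)
  have "m powr p = m powr p * (1 + p * ((l * a + (1 - l) * b) / m - 1))"
    using m by (simp add: m_def)
  also have "\<dots> = l * (m powr p * (1 + p * (a / m - 1))) + (1 - l) * (m powr p * (1 + p * (b / m - 1)))"
    using m by (simp add: field_simps)
  also have "\<dots> \<le> l * a powr p + (1 - l) * b powr p"
    using assms t by (intro add_mono mult_left_mono) auto
  finally show ?thesis
    by (simp add: m_def)
qed (use assms in auto)

text \<open>Split off one factor, \<open>z powr q = z * z powr (q - 1)\<close>, and use that the
  remaining power is strictly increasing.\<close>

lemma powr_superadd_strict:
  fixes x y q :: real
  assumes "1 < q" "0 < x" "0 < y"
  shows "x powr q + y powr q < (x + y) powr q"
proof -
  have "z powr q = z * z powr (q - 1)" if "0 < z" for z :: real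
    using that by (simp add: powr_mult_base)
  then have "x powr q = x * x powr (q - 1)" "y powr q = y * y powr (q - 1)"
    "(x + y) powr q = x * (x + y) powr (q - 1) + y * (x + y) powr (q - 1)"
    using assms by (auto simp: distrib_right)
  moreover have "x * x powr (q - 1) < x * (x + y) powr (q - 1)" "y * y powr (q - 1) < y * (x + y) powr (q - 1)"
    using assms by (auto intro!: mult_strict_left_mono powr_less_mono2)
  ultimately show ?thesis
    by linarith
qed

lemma powr_subadd_strict:
  fixes x y q :: real
  assumes "q < 1" "0 < x" "0 < y"
  shows "(x + y) powr q < x powr q + y powr q"
proof -
  have "z powr q = z * z powr (q - 1)" if "0 < z" for z :: real
    using that by (simp add: powr_mult_base)
  then have "x powr q = x * x powr (q - 1)" "y powr q = y * y powr (q - 1)"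
    "(x + y) powr q = x * (x + y) powr (q - 1) + y * (x + y) powr (q - 1)"
    using assms by (auto simp: distrib_right)
  moreover have "x * (x + y) powr (q - 1) < x * x powr (q - 1)" "y * (x + y) powr (q - 1) < y * y powr (q - 1)"
    using assms by (auto intro!: mult_strict_left_mono powr_less_mono2_neg)
  ultimately show ?thesis
    by linarith
qed

text \<open>Taken pointwise because it has constant sign for fixed \<open>p\<close>; this is what
  turns an equality of integrals into an equality almost everywhere.\<close>

definition clarkson_gap :: "real \<Rightarrow> complex \<Rightarrow> complex \<Rightarrow> real" where
  "clarkson_gap p a b =
     cmod (a + b) powr p + cmod (a - b) powr p - 2 * (cmod a powr p + cmod b powr p)"

text \<open>With \<open>q = p / 2\<close> everything is a power of a squared modulus. The
  parallelogram law says that \<open>u\<close> and \<open>v\<close> have mean \<open>s\<close>, so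
  the tangent inequality compares \<open>u powr q + v powr q\<close> with
  \<open>2 * s powr q\<close>. The comparison of \<open>s powr q\<close> with
  \<open>x powr q + y powr q\<close> is strict for nonzero \<open>a\<close> and \<open>b\<close>, in
  the same direction, and this yields the equality case.\<close>

lemma clarkson_gap_sign:
  assumes "0 < p"
  shows "2 < p \<Longrightarrow> 0 \<le> clarkson_gap p a b"
    and "p < 2 \<Longrightarrow> clarkson_gap p a b \<le> 0"
    and "p \<noteq> 2 \<Longrightarrow> clarkson_gap p a b = 0 \<longleftrightarrow> a * b = 0"
proof -
  have *: "(2 < p \<longrightarrow> 0 < clarkson_gap p a b) \<and> (p < 2 \<longrightarrow> clarkson_gap p a b < 0)"
    if ab: "a \<noteq> 0" "b \<noteq> 0"
  proof -
    define q x y s u v where "q = p / 2" and "x = (cmod a)\<^sup>2" and "y = (cmod b)\<^sup>2" and "s = x + y"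
      and "u = (cmod (a + b))\<^sup>2" and "v = (cmod (a - b))\<^sup>2"
    have sq: "cmod z powr p = (cmod z)\<^sup>2 powr q" for z
      by (simp add: q_def powr_powr flip: powr_numeral)
    have pos: "0 < x" "0 < y" "0 < s" "0 \<le> u" "0 \<le> v"
      using ab by (auto simp: x_def y_def s_def u_def v_def add_pos_pos)
    have uv: "u + v = 2 * s"
      unfolding u_def v_def s_def x_def y_def cmod_power2 by (simp add: power2_eq_square algebra_simps)
    have eq: "clarkson_gap p a b = u powr q + v powr q - 2 * (x powr q + y powr q)"
      by (simp add: clarkson_gap_def sq u_def v_def x_def y_def)
    have scale: "u powr q = s powr q * (u / s) powr q" "v powr q = s powr q * (v / s) powr q"
      using pos by (simp_all add: powr_divide)
    have us: "v / s = 2 - u / s"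
      using uv pos by (simp add: field_simps)
    have weights: "1 + q * (u/s - 1) + (1 + q * (v/s - 1)) = 2"
      unfolding us by (simp add: algebra_simps)
    show ?thesis
    proof (intro conjI impI)
      assume "2 < p"
      then have q: "1 < q" by (simp add: q_def)
      have "1 + q * (u/s - 1) + (1 + q * (v/s - 1)) \<le> (u/s) powr q + (v/s) powr q"
        using pos q by (intro add_mono powr_ge_tangent) auto
      moreover have "1 + q * (u/s - 1) + (1 + q * (v/s - 1)) = 2"
        by (rule weights)
      ultimately have "2 \<le> (u/s) powr q + (v/s) powr q"
        by linarith
      then have "s powr q * 2 \<le> u powr q + v powr q"
        unfolding scale distrib_left[symmetric] by (intro mult_left_mono) auto
      then show "0 < clarkson_gap p a b"
        unfolding eq using powr_superadd_strict[OF q pos(1,2)] by (simp add: s_def)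
    next
      assume "p < 2"
      then have q: "q < 1" "0 < q" using assms by (auto simp: q_def)
      have "(u/s) powr q + (v/s) powr q \<le> 1 + q * (u/s - 1) + (1 + q * (v/s - 1))"
        using pos q by (intro add_mono powr_le_tangent) auto
      moreover have "1 + q * (u/s - 1) + (1 + q * (v/s - 1)) = 2"
        by (rule weights)
      ultimately have "(u/s) powr q + (v/s) powr q \<le> 2"
        by linarith
      then have "u powr q + v powr q \<le> s powr q * 2"
        unfolding scale distrib_left[symmetric] by (intro mult_left_mono) auto
      then show "clarkson_gap p a b < 0"
        unfolding eq using powr_subadd_strict[OF q(1) pos(1,2)] by (simp add: s_def)
    qed
  qed
  have 0: "clarkson_gap p a b = 0" if "a * b = 0"
    using that assms by (auto simp: clarkson_gap_def)
  have **: "a * b = 0 \<or> (2 < p \<longrightarrow> 0 < clarkson_gap p a b) \<and> (p < 2 \<longrightarrow> clarkson_gap p a b < 0)"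
    using * by auto
  show "2 < p \<Longrightarrow> 0 \<le> clarkson_gap p a b" "p < 2 \<Longrightarrow> clarkson_gap p a b \<le> 0"
    using ** 0 by linarith+
  show "p \<noteq> 2 \<Longrightarrow> clarkson_gap p a b = 0 \<longleftrightarrow> a * b = 0"
    using ** 0 by linarith
qed

subsection \<open>The spaces of p-integrable functions\<close>

definition Lp_int :: "'a measure \<Rightarrow> real \<Rightarrow> ('a \<Rightarrow> complex) \<Rightarrow> real" where
  "Lp_int M p f = (\<integral>x. cmod (f x) powr p \<partial>M)"

lemma Lp_functionsD:
  assumes "f \<in> Lp_functions M p"
  shows "f \<in> borel_measurable M" "integrable M (\<lambda>x. cmod (f x) powr p)"
  using assms unfolding Lp_functions_def by blast+

lemma Lp_functionsI:
  "f \<in> borel_measurable M \<Longrightarrow> integrable M (\<lambda>x. cmod (f x) powr p) \<Longrightarrow> f \<in> Lp_functions M p"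
  unfolding Lp_functions_def by blast

lemma Lp_int_nonneg [simp]: "0 \<le> Lp_int M p f"
  unfolding Lp_int_def by (rule integral_nonneg_AE) (rule AE_I2, rule powr_ge_zero)

lemma Lp_functions_bound:
  assumes "f \<in> Lp_functions M p" "g \<in> borel_measurable M"
    and "AE x in M. cmod (g x) powr p \<le> C * cmod (f x) powr p"
  shows "g \<in> Lp_functions M p"
proof (rule Lp_functionsI[OF assms(2)], rule Bochner_Integration.integrable_bound)
  show "integrable M (\<lambda>x. C * cmod (f x) powr p)"
    by (rule integrable_mult_right, rule Lp_functionsD(2)[OF assms(1)])
  show "(\<lambda>x. cmod (g x) powr p) \<in> borel_measurable M"
    using assms(2) by measurable
  show "AE x in M. norm (cmod (g x) powr p) \<le> norm (C * cmod (f x) powr p)"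
    using assms(3)
  proof eventually_elim
    case (elim x)
    show ?case
      unfolding real_norm_def abs_of_nonneg[OF powr_ge_zero]
      by (rule order_trans[OF elim abs_ge_self])
  qed
qed

lemma Lp_functions_AE:
  assumes "f \<in> Lp_functions M p" "g \<in> borel_measurable M" "AE x in M. g x = f x"
  shows "g \<in> Lp_functions M p"
proof (rule Lp_functions_bound[OF assms(1,2), of 1])
  show "AE x in M. cmod (g x) powr p \<le> 1 * cmod (f x) powr p"
    using assms(3) by eventually_elim simp
qed

lemma Lp_int_cong_AE:
  assumes "f \<in> borel_measurable M" "g \<in> borel_measurable M" "AE x in M. f x = g x"
  shows "Lp_int M p f = Lp_int M p g"
  unfolding Lp_int_def
proof (rule integral_cong_AE)
  show "AE x in M. cmod (f x) powr p = cmod (g x) powr p"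
    using assms(3) by eventually_elim simp
qed (use assms(1,2) in measurable)

context
  fixes M :: "'a measure" and p :: real
  assumes p: "1 < p"
begin

lemma Lp_functions_zero: "(\<lambda>_. 0) \<in> Lp_functions M p"
  by (simp add: Lp_functions_def)

lemma Lp_functions_smult:
  assumes "f \<in> Lp_functions M p" shows "(\<lambda>x. c * f x) \<in> Lp_functions M p"
  by (rule Lp_functions_bound[OF assms, of _ "cmod c powr p"])
    (use assms in \<open>auto dest: Lp_functionsD simp: norm_mult powr_mult\<close>)

lemma Lp_functions_add:
  assumes "f \<in> Lp_functions M p" "g \<in> Lp_functions M p"
  shows "(\<lambda>x. f x + g x) \<in> Lp_functions M p"
proof -
  have "cmod (f x + g x) powr p \<le> 2 powr p * (cmod (f x) powr p + cmod (g x) powr p)" for x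
  proof -
    have "cmod (f x + g x) powr p \<le> (2 * max (cmod (f x)) (cmod (g x))) powr p"
      using p norm_triangle_ineq[of "f x" "g x"] by (intro powr_mono2) auto
    also have "\<dots> = 2 powr p * max (cmod (f x)) (cmod (g x)) powr p"
      by (simp add: powr_mult)
    also have "\<dots> \<le> 2 powr p * (cmod (f x) powr p + cmod (g x) powr p)"
      by (intro mult_left_mono) (auto simp: max_def)
    finally show ?thesis .
  qed
  then have le: "norm (cmod (f x + g x) powr p) \<le>
      norm (2 powr p * (cmod (f x) powr p + cmod (g x) powr p))" for x
    by simp
  have "integrable M (\<lambda>x. 2 powr p * (cmod (f x) powr p + cmod (g x) powr p))"
    using assms[THEN Lp_functionsD(2)] by simp
  then have "integrable M (\<lambda>x. cmod (f x + g x) powr p)"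
  proof (rule Bochner_Integration.integrable_bound)
    show "(\<lambda>x. cmod (f x + g x) powr p) \<in> borel_measurable M"
      using assms[THEN Lp_functionsD(1)] by measurable
    show "AE x in M. norm (cmod (f x + g x) powr p) \<le>
        norm (2 powr p * (cmod (f x) powr p + cmod (g x) powr p))"
      by (rule AE_I2, rule le)
  qed
  then show ?thesis
    using assms[THEN Lp_functionsD(1)] by (simp add: Lp_functions_def)
qed

lemma Lp_functions_uminus:
  "f \<in> Lp_functions M p \<Longrightarrow> (\<lambda>x. - f x) \<in> Lp_functions M p"
  using Lp_functions_smult[of f "-1"] by simp

lemma Lp_functions_diff:
  "f \<in> Lp_functions M p \<Longrightarrow> g \<in> Lp_functions M p \<Longrightarrow> (\<lambda>x. f x - g x) \<in> Lp_functions M p"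
  using Lp_functions_add[OF _ Lp_functions_uminus, of f g] by simp

lemma Lp_functions_indicator_mult:
  assumes "f \<in> Lp_functions M p" "A \<in> sets M"
  shows "(\<lambda>x. indicator A x * f x) \<in> Lp_functions M p"
  by (rule Lp_functions_bound[OF assms(1), of _ 1])
    (use assms in \<open>auto dest: Lp_functionsD simp: indicator_def\<close>)

lemma Lp_functions_indicator:
  assumes "A \<in> sets M" "emeasure M A < \<infinity>"
  shows "indicator A \<in> Lp_functions M p"
proof -
  have "(\<lambda>x. cmod (indicator A x) powr p) = (indicator A :: _ \<Rightarrow> real)"
    using p by (auto simp: indicator_def fun_eq_iff)
  then show ?thesis
    using assms by (simp add: Lp_functions_def)
qed

lemma Lp_int_indicator:
  "A \<in> sets M \<Longrightarrow> emeasure M A < \<infinity> \<Longrightarrow> Lp_int M p (indicator A) = measure M A"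
proof -
  assume A: "A \<in> sets M" "emeasure M A < \<infinity>"
  have "(\<lambda>x. cmod (indicator A x) powr p) = (indicator A :: _ \<Rightarrow> real)"
    using p by (auto simp: indicator_def fun_eq_iff)
  then show ?thesis
    using A by (simp add: Lp_int_def)
qed

lemma Lp_int_smult: "Lp_int M p (\<lambda>x. c * f x) = cmod c powr p * Lp_int M p f"
  by (simp add: Lp_int_def norm_mult powr_mult)

lemma Lp_int_mono:
  assumes "f \<in> Lp_functions M p" "g \<in> Lp_functions M p" "AE x in M. cmod (f x) \<le> cmod (g x)"
  shows "Lp_int M p f \<le> Lp_int M p g"
  unfolding Lp_int_def
  by (rule integral_mono_AE) (use assms p in \<open>auto dest: Lp_functionsD intro!: powr_mono2\<close>)

lemma Lp_int_zero_iff: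
  assumes "f \<in> Lp_functions M p"
  shows "Lp_int M p f = 0 \<longleftrightarrow> (AE x in M. f x = 0)"
  unfolding Lp_int_def using assms
  by (subst integral_nonneg_eq_0_iff_AE) (auto dest: Lp_functionsD)

text \<open>Normalise \<open>f\<close> and \<open>g\<close> by their norms \<open>\<alpha>\<close>
  and \<open>\<beta>\<close>; with weight \<open>l = \<alpha> / (\<alpha> + \<beta>)\<close> the sum
  of the moduli is \<open>\<alpha> + \<beta>\<close> times a convex combination of the normalised
  functions, and convexity of the power applies pointwise. If one norm vanishes, that function is
  zero almost everywhere.\<close>

lemma minkowski:
  assumes f: "f \<in> Lp_functions M p" and g: "g \<in> Lp_functions M p"
  shows "Lp_int M p (\<lambda>x. f x + g x) powr (1/p) \<le> Lp_int M p f powr (1/p) + Lp_int M p g powr (1/p)"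
proof -
  define \<alpha> \<beta> where "\<alpha> = Lp_int M p f powr (1/p)" and "\<beta> = Lp_int M p g powr (1/p)"
  have pw: "\<alpha> powr p = Lp_int M p f" "\<beta> powr p = Lp_int M p g"
    using p by (auto simp: \<alpha>_def \<beta>_def powr_powr)
  have nn: "0 \<le> \<alpha>" "0 \<le> \<beta>" by (auto simp: \<alpha>_def \<beta>_def)
  note fg = Lp_functions_add[OF f g]
  consider "\<alpha> = 0" | "\<beta> = 0" | "0 < \<alpha>" "0 < \<beta>" using nn by linarith
  then show ?thesis
  proof cases
    case 1
    then have "Lp_int M p f = 0" using pw p by simp
    then have "AE x in M. f x = 0" using Lp_int_zero_iff[OF f] by simp
    then have "Lp_int M p (\<lambda>x. f x + g x) = Lp_int M p g"
      using f g fg by (intro Lp_int_cong_AE) (auto intro: Lp_functionsD(1))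
    then show ?thesis by simp
  next
    case 2
    then have "Lp_int M p g = 0" using pw p by simp
    then have "AE x in M. g x = 0" using Lp_int_zero_iff[OF g] by simp
    then have "Lp_int M p (\<lambda>x. f x + g x) = Lp_int M p f"
      using f g fg by (intro Lp_int_cong_AE) (auto intro: Lp_functionsD(1))
    then show ?thesis by simp
  next
    case 3
    define l where "l = \<alpha> / (\<alpha> + \<beta>)"
    have l: "0 \<le> l" "l \<le> 1" "1 - l = \<beta> / (\<alpha> + \<beta>)"
      using 3 by (auto simp: l_def field_simps)
    let ?c = "(\<alpha> + \<beta>) powr p"
    have le: "cmod (f x + g x) powr p \<le> ?c * (l * (cmod (f x) powr p / \<alpha> powr p) + (1 - l) * (cmod (g x) powr p / \<beta> powr p))" for x
    proof -
      have "cmod (f x + g x) powr p \<le> (cmod (f x) + cmod (g x)) powr p"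
        using p norm_triangle_ineq by (intro powr_mono2) auto
      also have "cmod (f x) + cmod (g x) = (\<alpha> + \<beta>) * (l * (cmod (f x) / \<alpha>) + (1 - l) * (cmod (g x) / \<beta>))"
        unfolding l(3) using 3 by (simp add: l_def distrib_left)
      also have "\<dots> powr p = ?c * (l * (cmod (f x) / \<alpha>) + (1 - l) * (cmod (g x) / \<beta>)) powr p"
        by (simp add: powr_mult)
      also have "\<dots> \<le> ?c * (l * (cmod (f x) / \<alpha>) powr p + (1 - l) * (cmod (g x) / \<beta>) powr p)"
        using p l 3 by (intro mult_left_mono powr_convex_combination) auto
      finally show ?thesis using 3 by (simp add: powr_divide)
    qed
    note int = Lp_functionsD(2)[OF f] Lp_functionsD(2)[OF g] Lp_functionsD(2)[OF fg]
    have "Lp_int M p (\<lambda>x. f x + g x) \<le>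
        (\<integral>x. ?c * (l * (cmod (f x) powr p / \<alpha> powr p) + (1 - l) * (cmod (g x) powr p / \<beta> powr p)) \<partial>M)"
      unfolding Lp_int_def using int le by (intro integral_mono) auto
    also have "\<dots> = ?c * (l * (Lp_int M p f / \<alpha> powr p) + (1 - l) * (Lp_int M p g / \<beta> powr p))"
      using int by (simp add: Lp_int_def)
    also have "\<dots> = ?c"
    proof -
      have "0 < \<alpha> powr p" "0 < \<beta> powr p"
        using 3 by auto
      then show ?thesis
        unfolding pw by simp
    qed
    finally have "Lp_int M p (\<lambda>x. f x + g x) powr (1/p) \<le> ?c powr (1/p)"
      using p by (intro powr_mono2) auto
    then show ?thesis
      using 3 p by (simp add: powr_powr \<alpha>_def \<beta>_def)
  qed
qed

text \<open>Simple functions dominated by a multiple of \<open>f\<close> converge to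
  \<open>f\<close> in p-th mean by dominated convergence, and their nonzero level sets have finite
  measure by Markov's inequality. So linearity and closedness under p-th mean limits reduce
  everything to indicators of sets of finite measure.\<close>

lemma Lp_functions_induct [consumes 1, case_names indicator smult add limit]:
  assumes f: "f \<in> Lp_functions M p"
    and ind: "\<And>A. A \<in> sets M \<Longrightarrow> emeasure M A < \<infinity> \<Longrightarrow> P (indicator A)"
    and smult: "\<And>c g. g \<in> Lp_functions M p \<Longrightarrow> P g \<Longrightarrow> P (\<lambda>x. c * g x)"
    and add: "\<And>g h. g \<in> Lp_functions M p \<Longrightarrow> P g \<Longrightarrow> h \<in> Lp_functions M p \<Longrightarrow> P h \<Longrightarrow> P (\<lambda>x. g x + h x)"
    and lim: "\<And>g s. g \<in> Lp_functions M p \<Longrightarrow> (\<And>i :: nat. s i \<in> Lp_functions M p) \<Longrightarrow> (\<And>i. P (s i)) \<Longrightarrow>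
      (\<lambda>i. Lp_int M p (\<lambda>x. g x - s i x)) \<longlonglongrightarrow> 0 \<Longrightarrow> P g"
  shows "P f"
proof -
  have fm: "f \<in> borel_measurable M" using f by (rule Lp_functionsD)
  from borel_measurable_implies_sequence_metric[OF fm, of 0] obtain s where
    s: "\<And>i. simple_function M (s i)" and
    pt: "\<And>x. x \<in> space M \<Longrightarrow> (\<lambda>i. s i x) \<longlonglongrightarrow> f x" and
    bd: "\<And>i x. x \<in> space M \<Longrightarrow> cmod (s i x) \<le> 2 * cmod (f x)"
    by simp metis
  have sm: "s i \<in> borel_measurable M" for i
    using s by (rule borel_measurable_simple_function)
  define A where "A i y = s i -` {y} \<inter> space M" for i y
  have A: "A i y \<in> sets M" for i y
    using s by (auto simp: A_def simple_functionD)
  have sL: "s i \<in> Lp_functions M p" for i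
  proof (rule Lp_functions_bound[OF f sm, of _ "2 powr p"])
    have "cmod (s i x) powr p \<le> 2 powr p * cmod (f x) powr p" if "x \<in> space M" for x
      using powr_mono2[OF _ _ bd[OF that], of p i] p by (simp add: powr_mult)
    then show "AE x in M. cmod (s i x) powr p \<le> 2 powr p * cmod (f x) powr p"
      by auto
  qed
  have Afin: "emeasure M (A i y) < \<infinity>" if "y \<noteq> 0" for i y
  proof -
    have c: "0 < cmod y powr p" using that by simp
    have "emeasure M {x \<in> space M. cmod (s i x) powr p \<ge> cmod y powr p} \<le>
        ennreal ((1 / cmod y powr p) * (\<integral>x. cmod (s i x) powr p \<partial>M))"
      using Lp_functionsD(2)[OF sL] c by (intro integral_Markov_inequality) auto
    then have "emeasure M {x \<in> space M. cmod (s i x) powr p \<ge> cmod y powr p} < \<infinity>"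
      by (rule le_less_trans) simp
    moreover have "emeasure M (A i y) \<le> emeasure M {x \<in> space M. cmod (s i x) powr p \<ge> cmod y powr p}"
      using Lp_functionsD(2)[OF sL, of i] by (intro emeasure_mono) (auto simp: A_def)
    ultimately show ?thesis
      by (rule le_less_trans[rotated])
  qed
  \<comment> \<open>\<open>r i\<close> is \<open>s i\<close> written as an explicit combination of
    indicators. The value 0 is left out, as its level set may have infinite measure.\<close>
  define r where "r i x = (\<Sum>y\<in>s i ` space M - {0}. y * indicator (A i y) x)" for i x
  have fin: "finite (s i ` space M - {0})" for i
    using simple_functionD(1)[OF s] by blast
  have "(\<lambda>x. \<Sum>y\<in>Y. y * indicator (A i y) x) \<in> Lp_functions M p \<and> P (\<lambda>x. \<Sum>y\<in>Y. y * indicator (A i y) x)"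
    if "finite Y" "0 \<notin> Y" for Y i
    using that
  proof (induction Y)
    case empty
    have "P (indicator {})" by (rule ind) auto
    then show ?case using Lp_functions_zero by (simp add: indicator_def[abs_def])
  next
    case (insert y Y)
    have "indicator (A i y) \<in> Lp_functions M p" "P (indicator (A i y))"
      using insert A Afin[of y i] Lp_functions_indicator ind by auto
    then have "(\<lambda>x. y * indicator (A i y) x) \<in> Lp_functions M p" "P (\<lambda>x. y * indicator (A i y) x)"
      by (auto intro: Lp_functions_smult smult)
    moreover have "(\<lambda>x. \<Sum>y\<in>Y. y * indicator (A i y) x) \<in> Lp_functions M p"
      "P (\<lambda>x. \<Sum>y\<in>Y. y * indicator (A i y) x)"
      using insert by blast+
    ultimately show ?case
      unfolding sum.insert[OF insert.hyps(1,2)] using Lp_functions_add add by blast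
  qed
  then have r: "r i \<in> Lp_functions M p" "P (r i)" for i
    using fin[of i] unfolding r_def[abs_def] by blast+
  have rs: "r i x = s i x" if x: "x \<in> space M" for i x
  proof -
    have "r i x = (\<Sum>y\<in>s i ` space M - {0}. if s i x = y then y else 0)"
      unfolding r_def by (intro sum.cong) (auto simp: A_def x)
    also have "\<dots> = s i x"
      using fin[of i] x by (simp add: sum.delta')
    finally show ?thesis .
  qed
  show ?thesis
  proof (rule lim[OF f, of r])
    \<comment> \<open>The factor 3 in the dominating function is 1 for \<open>f\<close> plus 2 for
      the bound \<open>bd\<close> on the approximants.\<close>
    have "(\<lambda>i. \<integral>x. cmod (f x - r i x) powr p \<partial>M) \<longlonglongrightarrow> (\<integral>x. 0 \<partial>M)"
    proof (rule integral_dominated_convergence[where w = "\<lambda>x. 3 powr p * cmod (f x) powr p"])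
      show "AE x in M. (\<lambda>i. cmod (f x - r i x) powr p) \<longlonglongrightarrow> 0"
      proof (rule AE_I2)
        fix x assume x: "x \<in> space M"
        have "(\<lambda>i. cmod (f x - r i x)) \<longlonglongrightarrow> 0"
          using tendsto_norm[OF tendsto_diff[OF tendsto_const pt[OF x]], of "f x"] rs[OF x] by simp
        then show "(\<lambda>i. cmod (f x - r i x) powr p) \<longlonglongrightarrow> 0"
          using p by (intro tendsto_zero_powrI[of _ _ _ p]) auto
      qed
      fix i
      show "AE x in M. norm (cmod (f x - r i x) powr p) \<le> 3 powr p * cmod (f x) powr p"
      proof (rule AE_I2)
        fix x assume x: "x \<in> space M"
        have "cmod (f x - r i x) \<le> 3 * cmod (f x)"
          using norm_triangle_ineq4[of "f x" "s i x"] bd[OF x, of i] rs[OF x, of i] by simp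
        then show "norm (cmod (f x - r i x) powr p) \<le> 3 powr p * cmod (f x) powr p"
          using p powr_mono2[of p "cmod (f x - r i x)" "3 * cmod (f x)"] by (simp add: powr_mult)
      qed
      show "(\<lambda>x. cmod (f x - r i x) powr p) \<in> borel_measurable M"
        using fm Lp_functionsD(1)[OF r(1)] by measurable
    qed (use Lp_functionsD[OF f] in auto)
    then show "(\<lambda>i. Lp_int M p (\<lambda>x. f x - r i x)) \<longlonglongrightarrow> 0"
      by (simp add: Lp_int_def)
  qed (use r in auto)
qed

text \<open>The gap has constant sign, so its integral vanishes exactly when it vanishes almost
  everywhere. The right-hand side speaks only of p-integrals of \<open>f\<close>, \<open>g\<close>,
  their sum and their difference, which a linear isometry preserves.\<close>

lemma clarkson_disjoint_iff:
  assumes "p \<noteq> 2" and f: "f \<in> Lp_functions M p" and g: "g \<in> Lp_functions M p"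
  shows "(AE x in M. f x * g x = 0) \<longleftrightarrow>
    Lp_int M p (\<lambda>x. f x + g x) + Lp_int M p (\<lambda>x. f x - g x) = 2 * (Lp_int M p f + Lp_int M p g)"
proof -
  note int = Lp_functionsD(2)[OF f] Lp_functionsD(2)[OF g]
    Lp_functionsD(2)[OF Lp_functions_add[OF f g]] Lp_functionsD(2)[OF Lp_functions_diff[OF f g]]
  have gap_int: "integrable M (\<lambda>x. clarkson_gap p (f x) (g x))"
    unfolding clarkson_gap_def using int by auto
  have "(\<integral>x. clarkson_gap p (f x) (g x) \<partial>M) =
      Lp_int M p (\<lambda>x. f x + g x) + Lp_int M p (\<lambda>x. f x - g x) - 2 * (Lp_int M p f + Lp_int M p g)"
    unfolding clarkson_gap_def Lp_int_def using int by simp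
  moreover have "(\<integral>x. clarkson_gap p (f x) (g x) \<partial>M) = 0 \<longleftrightarrow> (AE x in M. clarkson_gap p (f x) (g x) = 0)"
  proof (cases "2 < p")
    case True
    then show ?thesis
      using clarkson_gap_sign(1) p by (intro integral_nonneg_eq_0_iff_AE[OF gap_int]) auto
  next
    case False
    then have "p < 2" using assms(1) by simp
    then have "(\<integral>x. - clarkson_gap p (f x) (g x) \<partial>M) = 0 \<longleftrightarrow> (AE x in M. - clarkson_gap p (f x) (g x) = 0)"
      using clarkson_gap_sign(2)[of p] p gap_int by (intro integral_nonneg_eq_0_iff_AE) auto
    then show ?thesis by simp
  qed
  moreover have "clarkson_gap p (f x) (g x) = 0 \<longleftrightarrow> f x * g x = 0" for x
    using clarkson_gap_sign(3)[of p] p assms(1) by simp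
  ultimately show ?thesis
    by (simp only:) linarith
qed

end

section \<open>Classes modulo null sets as a normed space\<close>

lemma rep_ae_class:
  assumes "f \<in> borel_measurable M"
  shows "rep (ae_class M f) \<in> borel_measurable M" "AE x in M. rep (ae_class M f) x = f x"
proof -
  have "f \<in> ae_class M f"
    using assms by (simp add: ae_class_def)
  then have "rep (ae_class M f) \<in> ae_class M f"
    unfolding rep_def by (rule someI[of "\<lambda>g. g \<in> ae_class M f"])
  then show "rep (ae_class M f) \<in> borel_measurable M" "AE x in M. rep (ae_class M f) x = f x"
    unfolding ae_class_def by blast+
qed

lemma ae_class_eqI:
  assumes "f \<in> borel_measurable M" "g \<in> borel_measurable M" "AE x in M. f x = g x"
  shows "ae_class M f = ae_class M g"
proof -
  have "(AE x in M. h x = f x) \<longleftrightarrow> (AE x in M. h x = g x)" for h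
    using assms(3) by (auto elim: AE_mp)
  then show ?thesis
    unfolding ae_class_def by blast
qed

lemma ae_class_eq_iff:
  assumes "f \<in> borel_measurable M" "g \<in> borel_measurable M"
  shows "ae_class M f = ae_class M g \<longleftrightarrow> (AE x in M. f x = g x)"
proof
  assume eq: "ae_class M f = ae_class M g"
  have "f \<in> ae_class M f"
    using assms by (simp add: ae_class_def)
  then have "f \<in> ae_class M g"
    unfolding eq .
  then show "AE x in M. f x = g x"
    unfolding ae_class_def by blast
qed (rule ae_class_eqI[OF assms])

lemma mnorm_Lp: "mnorm (Lp M p) \<xi> = Lp_int M p (rep \<xi>) powr (1 / p)"
  by (simp add: Lp_def Lp_int_def)

lemma Lp_carrierE:
  assumes "\<xi> \<in> carrier (Lp M p)"
  obtains f where "f \<in> Lp_functions M p" "\<xi> = ae_class M f"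
  using assms by (auto simp: Lp_def)

lemma ae_class_in_Lp: "f \<in> Lp_functions M p \<Longrightarrow> ae_class M f \<in> carrier (Lp M p)"
  by (simp add: Lp_def)

lemma rep_ae_class_Lp:
  assumes "f \<in> Lp_functions M p"
  shows "rep (ae_class M f) \<in> Lp_functions M p"
  using Lp_functions_AE[OF assms] rep_ae_class[OF Lp_functionsD(1)[OF assms]] by blast

lemma rep_Lp:
  assumes "\<xi> \<in> carrier (Lp M p)"
  shows "rep \<xi> \<in> Lp_functions M p" "ae_class M (rep \<xi>) = \<xi>"
proof -
  obtain f where f: "f \<in> Lp_functions M p" "\<xi> = ae_class M f"
    using assms by (rule Lp_carrierE)
  show r: "rep \<xi> \<in> Lp_functions M p"
    using f rep_ae_class_Lp by simp
  show "ae_class M (rep \<xi>) = \<xi>"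
    using ae_class_eqI[OF Lp_functionsD(1)[OF r] Lp_functionsD(1)[OF f(1)]] f(2)
      rep_ae_class(2)[OF Lp_functionsD(1)[OF f(1)]] by simp
qed

lemma mnorm_ae_class:
  assumes "f \<in> Lp_functions M p"
  shows "mnorm (Lp M p) (ae_class M f) = Lp_int M p f powr (1 / p)"
  unfolding mnorm_Lp
  using Lp_int_cong_AE[OF rep_ae_class(1) Lp_functionsD(1)[OF assms] rep_ae_class(2)]
    Lp_functionsD(1)[OF assms] by metis

lemma add_ae_class:
  assumes "f \<in> borel_measurable M" "g \<in> borel_measurable M"
  shows "ae_class M f \<oplus>\<^bsub>Lp M p\<^esub> ae_class M g = ae_class M (\<lambda>x. f x + g x)"
proof -
  note r = rep_ae_class[OF assms(1)] rep_ae_class[OF assms(2)]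
  have "ae_class M (\<lambda>x. rep (ae_class M f) x + rep (ae_class M g) x) = ae_class M (\<lambda>x. f x + g x)"
  proof (rule ae_class_eqI)
    show "AE x in M. rep (ae_class M f) x + rep (ae_class M g) x = f x + g x"
      using r(2,4) by eventually_elim simp
  qed (use r(1,3) assms in measurable)
  then show ?thesis
    by (simp add: Lp_def)
qed

lemma smult_ae_class:
  assumes "f \<in> borel_measurable M"
  shows "c \<odot>\<^bsub>Lp M p\<^esub> ae_class M f = ae_class M (\<lambda>x. c * f x)"
proof -
  note r = rep_ae_class[OF assms(1)]
  have "ae_class M (\<lambda>x. c * rep (ae_class M f) x) = ae_class M (\<lambda>x. c * f x)"
  proof (rule ae_class_eqI)
    show "AE x in M. c * rep (ae_class M f) x = c * f x"
      using r(2) by eventually_elim simp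
  qed (use r(1) assms in measurable)
  then show ?thesis
    by (simp add: Lp_def)
qed

lemma zero_Lp: "\<zero>\<^bsub>Lp M p\<^esub> = ae_class M (\<lambda>_. 0)"
  by (simp add: Lp_def)

lemma cnormed_module_Lp:
  assumes p: "1 < p"
  shows "cnormed_module (Lp M p)"
proof -
  note bm = Lp_functionsD(1)
  interpret abelian_group "Lp M p"
  proof (rule abelian_groupI)
    show "\<zero>\<^bsub>Lp M p\<^esub> \<in> carrier (Lp M p)"
      unfolding zero_Lp by (intro ae_class_in_Lp Lp_functions_zero[OF p])
  next
    fix \<xi> \<eta> assume "\<xi> \<in> carrier (Lp M p)" "\<eta> \<in> carrier (Lp M p)"
    then obtain f g where f: "f \<in> Lp_functions M p" "\<xi> = ae_class M f"
      and g: "g \<in> Lp_functions M p" "\<eta> = ae_class M g"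
      by (metis Lp_carrierE)
    show "\<xi> \<oplus>\<^bsub>Lp M p\<^esub> \<eta> \<in> carrier (Lp M p)"
      using f g by (simp add: add_ae_class bm ae_class_in_Lp Lp_functions_add[OF p])
    show "\<xi> \<oplus>\<^bsub>Lp M p\<^esub> \<eta> = \<eta> \<oplus>\<^bsub>Lp M p\<^esub> \<xi>"
      using f g by (simp add: add_ae_class bm add.commute)
    fix \<zeta> assume "\<zeta> \<in> carrier (Lp M p)"
    then obtain h where h: "h \<in> Lp_functions M p" "\<zeta> = ae_class M h"
      by (metis Lp_carrierE)
    show "\<xi> \<oplus>\<^bsub>Lp M p\<^esub> \<eta> \<oplus>\<^bsub>Lp M p\<^esub> \<zeta> = \<xi> \<oplus>\<^bsub>Lp M p\<^esub> (\<eta> \<oplus>\<^bsub>Lp M p\<^esub> \<zeta>)"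
      unfolding f(2) g(2) h(2)
      by (simp add: add_ae_class bm[OF f(1)] bm[OF g(1)] bm[OF h(1)] add.assoc
          bm[OF Lp_functions_add[OF p f(1) g(1)]] bm[OF Lp_functions_add[OF p g(1) h(1)]])
  next
    fix \<xi> assume "\<xi> \<in> carrier (Lp M p)"
    then obtain f where f: "f \<in> Lp_functions M p" "\<xi> = ae_class M f"
      by (metis Lp_carrierE)
    show "\<zero>\<^bsub>Lp M p\<^esub> \<oplus>\<^bsub>Lp M p\<^esub> \<xi> = \<xi>"
      unfolding f(2) zero_Lp by (simp add: add_ae_class bm[OF f(1)])
    have "ae_class M (\<lambda>x. - f x) \<oplus>\<^bsub>Lp M p\<^esub> \<xi> = \<zero>\<^bsub>Lp M p\<^esub>"
      unfolding f(2) zero_Lp by (simp add: add_ae_class bm[OF f(1)] bm[OF Lp_functions_uminus[OF p f(1)]])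
    then show "\<exists>\<eta>\<in>carrier (Lp M p). \<eta> \<oplus>\<^bsub>Lp M p\<^esub> \<xi> = \<zero>\<^bsub>Lp M p\<^esub>"
      using ae_class_in_Lp[OF Lp_functions_uminus[OF p f(1)]] by blast
  qed
  show ?thesis
  proof
    fix \<xi> c d assume "\<xi> \<in> carrier (Lp M p)"
    then obtain f where f: "f \<in> Lp_functions M p" "\<xi> = ae_class M f"
      by (metis Lp_carrierE)
    note cf = Lp_functions_smult[OF p f(1)]
    show "c \<odot>\<^bsub>Lp M p\<^esub> \<xi> \<in> carrier (Lp M p)"
      unfolding f(2) by (simp add: smult_ae_class bm[OF f(1)] ae_class_in_Lp cf)
    show "(c + d) \<odot>\<^bsub>Lp M p\<^esub> \<xi> = c \<odot>\<^bsub>Lp M p\<^esub> \<xi> \<oplus>\<^bsub>Lp M p\<^esub> d \<odot>\<^bsub>Lp M p\<^esub> \<xi>"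
      unfolding f(2) by (simp add: smult_ae_class add_ae_class bm[OF f(1)] bm[OF cf] distrib_right)
    show "(c * d) \<odot>\<^bsub>Lp M p\<^esub> \<xi> = c \<odot>\<^bsub>Lp M p\<^esub> (d \<odot>\<^bsub>Lp M p\<^esub> \<xi>)"
      unfolding f(2) by (simp add: smult_ae_class bm[OF f(1)] bm[OF cf] mult.assoc)
    show "1 \<odot>\<^bsub>Lp M p\<^esub> \<xi> = \<xi>"
      unfolding f(2) by (simp add: smult_ae_class bm[OF f(1)])
    show "0 \<le> mnorm (Lp M p) \<xi>"
      by (simp add: mnorm_Lp)
    show "mnorm (Lp M p) (c \<odot>\<^bsub>Lp M p\<^esub> \<xi>) = cmod c * mnorm (Lp M p) \<xi>"
      unfolding f(2) smult_ae_class[OF bm[OF f(1)]] mnorm_ae_class[OF f(1)] mnorm_ae_class[OF cf]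
      using p by (simp add: Lp_int_smult[OF p] powr_mult powr_powr)
    assume "mnorm (Lp M p) \<xi> = 0"
    then have "Lp_int M p f = 0"
      unfolding f(2) mnorm_ae_class[OF f(1)] by simp
    then have "AE x in M. f x = 0"
      using Lp_int_zero_iff[OF p f(1)] by simp
    then show "\<xi> = \<zero>\<^bsub>Lp M p\<^esub>"
      unfolding f(2) zero_Lp by (intro ae_class_eqI bm[OF f(1)]) simp_all
  next
    fix \<xi> \<eta> c assume "\<xi> \<in> carrier (Lp M p)" "\<eta> \<in> carrier (Lp M p)"
    then obtain f g where f: "f \<in> Lp_functions M p" "\<xi> = ae_class M f"
      and g: "g \<in> Lp_functions M p" "\<eta> = ae_class M g"
      by (metis Lp_carrierE)
    note fg = Lp_functions_add[OF p f(1) g(1)]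
    show "c \<odot>\<^bsub>Lp M p\<^esub> (\<xi> \<oplus>\<^bsub>Lp M p\<^esub> \<eta>) = c \<odot>\<^bsub>Lp M p\<^esub> \<xi> \<oplus>\<^bsub>Lp M p\<^esub> c \<odot>\<^bsub>Lp M p\<^esub> \<eta>"
      unfolding f(2) g(2) 
      by (simp add: smult_ae_class add_ae_class bm[OF f(1)] bm[OF g(1)] bm[OF fg]
          bm[OF Lp_functions_smult[OF p f(1)]] bm[OF Lp_functions_smult[OF p g(1)]] distrib_left)
    show "mnorm (Lp M p) (\<xi> \<oplus>\<^bsub>Lp M p\<^esub> \<eta>) \<le> mnorm (Lp M p) \<xi> + mnorm (Lp M p) \<eta>"
      unfolding f(2) g(2) add_ae_class[OF bm[OF f(1)] bm[OF g(1)]]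
        mnorm_ae_class[OF f(1)] mnorm_ae_class[OF g(1)] mnorm_ae_class[OF fg]
      using minkowski[OF p f(1) g(1)] .
  qed
qed

section \<open>Conjugate exponents and the duality pairing\<close>

lemma conjugate_exponent:
  assumes "1 < p"
  shows "1 < conjugate_exponent p" "1 / p + 1 / conjugate_exponent p = 1"
    "conjugate_exponent (conjugate_exponent p) = p" "(p - 1) * conjugate_exponent p = p"
  using assms by (auto simp: conjugate_exponent_def field_simps)

text \<open>Young's inequality yields integrability directly; applied to the functions divided by
  their norms \<open>\<alpha>\<close> and \<open>\<beta>\<close> it yields the product bound,
  because the reciprocal exponents add up to 1.\<close>

lemma holder:
  assumes p: "1 < p" and f: "f \<in> Lp_functions M p" and g: "g \<in> Lp_functions M (conjugate_exponent p)"
  shows "integrable M (\<lambda>x. f x * g x)"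
    and "cmod (\<integral>x. f x * g x \<partial>M) \<le>
      Lp_int M p f powr (1 / p) * Lp_int M (conjugate_exponent p) g powr (1 / conjugate_exponent p)"
proof -
  define q where "q = conjugate_exponent p"
  have q: "1 < q" "1 / p + 1 / q = 1"
    using conjugate_exponent[OF p] by (auto simp: q_def)
  note bm = Lp_functionsD(1)[OF f] Lp_functionsD(1)[OF g]
  note int = Lp_functionsD(2)[OF f] Lp_functionsD(2)[OF g[folded q_def]]
  have young: "cmod (a * b) \<le> cmod a powr p / p + cmod b powr q / q" for a b
    unfolding norm_mult using p q by (intro Youngs_inequality) auto
  have intb: "integrable M (\<lambda>x. cmod (f x) powr p / p + cmod (g x) powr q / q)"
    using int by simp
  have "integrable M (\<lambda>x. f x * g x)"
  proof (rule Bochner_Integration.integrable_bound[OF intb])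
    show "(\<lambda>x. f x * g x) \<in> borel_measurable M"
      using bm by measurable
    show "AE x in M. norm (f x * g x) \<le> norm (cmod (f x) powr p / p + cmod (g x) powr q / q)"
      using young p q by (intro AE_I2) (metis abs_ge_self order_trans real_norm_def)
  qed
  then show fg: "integrable M (\<lambda>x. f x * g x)" .
  define \<alpha> \<beta> where "\<alpha> = Lp_int M p f powr (1 / p)" and "\<beta> = Lp_int M q g powr (1 / q)"
  have pw: "\<alpha> powr p = Lp_int M p f" "\<beta> powr q = Lp_int M q g"
    using p q by (auto simp: \<alpha>_def \<beta>_def powr_powr)
  have "cmod (\<integral>x. f x * g x \<partial>M) \<le> \<alpha> * \<beta>"
  proof (cases "\<alpha> = 0 \<or> \<beta> = 0")
    case True
    have "AE x in M. f x * g x = 0"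
    proof (cases "\<alpha> = 0")
      case True
      then have "AE x in M. f x = 0"
        using pw p Lp_int_zero_iff[OF p f] by simp
      then show ?thesis by eventually_elim simp
    next
      case False
      then have "AE x in M. g x = 0"
        using True pw q Lp_int_zero_iff[OF q(1) g[folded q_def]] by simp
      then show ?thesis by eventually_elim simp
    qed
    then have "(\<integral>x. f x * g x \<partial>M) = 0"
      by (rule integral_eq_zero_AE)
    then show ?thesis
      by (simp add: \<alpha>_def \<beta>_def)
  next
    case False
    then have pos: "0 < \<alpha>" "0 < \<beta>"
      by (auto simp: \<alpha>_def \<beta>_def)
    have "cmod (f x * g x) \<le> \<alpha> * \<beta> * (cmod (f x) powr p / \<alpha> powr p / p + cmod (g x) powr q / \<beta> powr q / q)" for x
    proof -
      have "cmod (f x * g x) = \<alpha> * \<beta> * ((cmod (f x) / \<alpha>) * (cmod (g x) / \<beta>))"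
        using pos by (simp add: norm_mult)
      also have "\<dots> \<le> \<alpha> * \<beta> * ((cmod (f x) / \<alpha>) powr p / p + (cmod (g x) / \<beta>) powr q / q)"
        using pos p q by (intro mult_left_mono Youngs_inequality) auto
      finally show ?thesis
        using pos by (simp add: powr_divide)
    qed
    then have "cmod (\<integral>x. f x * g x \<partial>M) \<le>
        (\<integral>x. \<alpha> * \<beta> * (cmod (f x) powr p / \<alpha> powr p / p + cmod (g x) powr q / \<beta> powr q / q) \<partial>M)"
      using int fg by (intro order_trans[OF integral_norm_bound integral_mono]) simp_all
    also have "\<dots> = \<alpha> * \<beta> * (Lp_int M p f / \<alpha> powr p / p + Lp_int M q g / \<beta> powr q / q)"
      using int by (simp add: Lp_int_def)
    also have "\<dots> = \<alpha> * \<beta>"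
    proof -
      have "0 < \<alpha> powr p" "0 < \<beta> powr q"
        using pos by auto
      then show ?thesis
        unfolding pw using q(2) by simp
    qed
    finally show ?thesis .
  qed
  then show "cmod (\<integral>x. f x * g x \<partial>M) \<le>
      Lp_int M p f powr (1 / p) * Lp_int M (conjugate_exponent p) g powr (1 / conjugate_exponent p)"
    by (simp add: \<alpha>_def \<beta>_def q_def)
qed

lemma Lp_pairing_ae_class:
  assumes "f \<in> borel_measurable M" "g \<in> borel_measurable M"
  shows "Lp_pairing M (ae_class M f) (ae_class M g) = (\<integral>x. f x * g x \<partial>M)"
proof -
  note r = rep_ae_class[OF assms(1)] rep_ae_class[OF assms(2)]
  show ?thesis
    unfolding Lp_pairing_def
  proof (rule integral_cong_AE)
    show "AE x in M. rep (ae_class M f) x * rep (ae_class M g) x = f x * g x"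
      using r(2,4) by eventually_elim simp
  qed (use r(1,3) assms in measurable)
qed

text \<open>The test function \<open>g\<close> is the norming functional of \<open>f\<close> up to a
  factor: \<open>f x * g x\<close> is the p-th power of the modulus of \<open>f x\<close>, and since
  \<open>(p - 1) * conjugate_exponent p = p\<close>, \<open>g\<close> lies in the dual
  space.\<close>

lemma Lp_separated:
  assumes p: "1 < p" and f: "f \<in> Lp_functions M p"
    and z: "\<And>g. g \<in> Lp_functions M (conjugate_exponent p) \<Longrightarrow> (\<integral>x. f x * g x \<partial>M) = 0"
  shows "AE x in M. f x = 0"
proof -
  define q where "q = conjugate_exponent p"
  note bm = Lp_functionsD(1)[OF f]
  define g where "g x = cnj (f x) * of_real (cmod (f x) powr (p - 2))" for x
  have gm: "g \<in> borel_measurable M"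
  proof -
    have [measurable]: "cnj \<in> borel_measurable borel" "complex_of_real \<in> borel_measurable borel"
      by (auto intro!: borel_measurable_continuous_onI continuous_intros)
    show ?thesis
      unfolding g_def[abs_def] using bm by measurable
  qed
  have norm: "cmod (g x) = cmod (f x) powr (p - 1)" for x
  proof (cases "f x = 0")
    case False
    then show ?thesis
      using powr_mult_base[of "cmod (f x)" "p - 2"] by (simp add: g_def norm_mult)
  qed (use p in \<open>simp add: g_def\<close>)
  have "cmod (g x) powr q = cmod (f x) powr p" for x
    using conjugate_exponent(4)[OF p] by (simp add: norm powr_powr q_def)
  then have "g \<in> Lp_functions M q"
    using Lp_functionsD(2)[OF f] gm by (intro Lp_functionsI) simp_all
  then have z0: "(\<integral>x. f x * g x \<partial>M) = 0"
    using z by (simp add: q_def)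
  have "f x * g x = complex_of_real (cmod (f x) powr p)" for x
  proof -
    have "f x * g x = complex_of_real ((cmod (f x))\<^sup>2 * cmod (f x) powr (p - 2))"
      unfolding g_def of_real_mult complex_norm_square by (simp add: mult.assoc)
    also have "(cmod (f x))\<^sup>2 * cmod (f x) powr (p - 2) = cmod (f x) powr p"
      by (cases "f x = 0") (use p in \<open>simp_all flip: powr_numeral powr_add\<close>)
    finally show ?thesis .
  qed
  then have "(\<integral>x. complex_of_real (cmod (f x) powr p) \<partial>M) = 0"
    using z0 by simp
  then have "Lp_int M p f = 0"
    unfolding Lp_int_def by (simp only: integral_complex_of_real of_real_eq_0_iff)
  then show ?thesis
    using Lp_int_zero_iff[OF p f] by simp
qed

lemma normed_pairing_Lp:
  assumes p: "1 < p"
  shows "normed_pairing (Lp M p) (Lp M (conjugate_exponent p)) (Lp_pairing M)"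
proof -
  define q where "q = conjugate_exponent p"
  have q: "1 < q" "conjugate_exponent q = p"
    using conjugate_exponent[OF p] by (auto simp: q_def)
  note bm = Lp_functionsD(1)
  interpret E: cnormed_module "Lp M p" by (rule cnormed_module_Lp[OF p])
  interpret F: cnormed_module "Lp M q" by (rule cnormed_module_Lp[OF q(1)])
  have bil: "Lp_pairing M \<in> bilinear_forms (Lp M p) (Lp M q)"
    unfolding bilinear_forms_def
  proof (intro CollectI conjI ballI allI)
    fix \<xi> \<xi>' \<eta> assume "\<xi> \<in> carrier (Lp M p)" "\<xi>' \<in> carrier (Lp M p)" "\<eta> \<in> carrier (Lp M q)"
    then obtain f f' g where f: "f \<in> Lp_functions M p" "\<xi> = ae_class M f"
      and f': "f' \<in> Lp_functions M p" "\<xi>' = ae_class M f'"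
      and g: "g \<in> Lp_functions M q" "\<eta> = ae_class M g"
      by (metis Lp_carrierE)
    show "Lp_pairing M (\<xi> \<oplus>\<^bsub>Lp M p\<^esub> \<xi>') \<eta> = Lp_pairing M \<xi> \<eta> + Lp_pairing M \<xi>' \<eta>"
      unfolding f(2) f'(2) g(2) add_ae_class[OF bm[OF f(1)] bm[OF f'(1)]]
      using holder(1)[OF p f(1) g(1)[unfolded q_def]] holder(1)[OF p f'(1) g(1)[unfolded q_def]]
      by (simp add: Lp_pairing_ae_class bm[OF f(1)] bm[OF f'(1)] bm[OF g(1)]
          bm[OF Lp_functions_add[OF p f(1) f'(1)]] distrib_right)
  next
    fix \<xi> \<eta> \<eta>' assume "\<xi> \<in> carrier (Lp M p)" "\<eta> \<in> carrier (Lp M q)" "\<eta>' \<in> carrier (Lp M q)"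
    then obtain f g g' where f: "f \<in> Lp_functions M p" "\<xi> = ae_class M f"
      and g': "g' \<in> Lp_functions M q" "\<eta>' = ae_class M g'"
      and g: "g \<in> Lp_functions M q" "\<eta> = ae_class M g"
      by (metis Lp_carrierE)
    show "Lp_pairing M \<xi> (\<eta> \<oplus>\<^bsub>Lp M q\<^esub> \<eta>') = Lp_pairing M \<xi> \<eta> + Lp_pairing M \<xi> \<eta>'"
      unfolding f(2) g'(2) g(2) add_ae_class[OF bm[OF g(1)] bm[OF g'(1)]]
      using holder(1)[OF p f(1) g(1)[unfolded q_def]] holder(1)[OF p f(1) g'(1)[unfolded q_def]]
      by (simp add: Lp_pairing_ae_class bm[OF f(1)] bm[OF g'(1)] bm[OF g(1)]
          bm[OF Lp_functions_add[OF q(1) g(1) g'(1)]] distrib_left)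
  next
    fix c \<xi> \<eta> assume "\<xi> \<in> carrier (Lp M p)" "\<eta> \<in> carrier (Lp M q)"
    then obtain f g where f: "f \<in> Lp_functions M p" "\<xi> = ae_class M f"
      and g: "g \<in> Lp_functions M q" "\<eta> = ae_class M g"
      by (metis Lp_carrierE)
    show "Lp_pairing M (c \<odot>\<^bsub>Lp M p\<^esub> \<xi>) \<eta> = c * Lp_pairing M \<xi> \<eta>"
      unfolding f(2) g(2) smult_ae_class[OF bm[OF f(1)]]
      by (simp add: Lp_pairing_ae_class bm[OF f(1)] bm[OF g(1)] 
          bm[OF Lp_functions_smult[OF p f(1)]] mult.assoc)
    show "Lp_pairing M \<xi> (c \<odot>\<^bsub>Lp M q\<^esub> \<eta>) = c * Lp_pairing M \<xi> \<eta>"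
      unfolding f(2) g(2) smult_ae_class[OF bm[OF g(1)]]
      by (simp add: Lp_pairing_ae_class bm[OF f(1)] bm[OF g(1)] 
          bm[OF Lp_functions_smult[OF q(1) g(1)]] mult.left_commute)
  qed
  have "normed_pairing (Lp M p) (Lp M q) (Lp_pairing M)"
  proof (unfold_locales, rule bil)
    fix \<xi> \<eta> assume "\<xi> \<in> carrier (Lp M p)" "\<eta> \<in> carrier (Lp M q)"
    then obtain f g where f: "f \<in> Lp_functions M p" "\<xi> = ae_class M f"
      and g: "g \<in> Lp_functions M q" "\<eta> = ae_class M g"
      by (metis Lp_carrierE)
    show "cmod (Lp_pairing M \<xi> \<eta>) \<le> mnorm (Lp M p) \<xi> * mnorm (Lp M q) \<eta>"
      unfolding f(2) g(2) mnorm_ae_class[OF f(1)] mnorm_ae_class[OF g(1)]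
        Lp_pairing_ae_class[OF bm[OF f(1)] bm[OF g(1)]]
      using holder(2)[OF p f(1) g(1)[unfolded q_def]] by (simp add: q_def)
  next
    fix \<xi> assume \<xi>: "\<xi> \<in> carrier (Lp M p)" and z: "\<And>\<eta>. \<eta> \<in> carrier (Lp M q) \<Longrightarrow> Lp_pairing M \<xi> \<eta> = 0"
    then obtain f where f: "f \<in> Lp_functions M p" "\<xi> = ae_class M f"
      by (metis Lp_carrierE)
    have "(\<integral>x. f x * g x \<partial>M) = 0" if "g \<in> Lp_functions M q" for g
      using z[OF ae_class_in_Lp[OF that]] unfolding f(2) Lp_pairing_ae_class[OF bm[OF f(1)] bm[OF that]] .
    then have "AE x in M. f x = 0"
      by (intro Lp_separated[OF p f(1)]) (simp add: q_def)
    then show "\<xi> = \<zero>\<^bsub>Lp M p\<^esub>"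
      unfolding f(2) zero_Lp by (intro ae_class_eqI bm[OF f(1)]) simp_all
  next
    fix \<eta> assume \<eta>: "\<eta> \<in> carrier (Lp M q)" and z: "\<And>\<xi>. \<xi> \<in> carrier (Lp M p) \<Longrightarrow> Lp_pairing M \<xi> \<eta> = 0"
    then obtain g where g: "g \<in> Lp_functions M q" "\<eta> = ae_class M g"
      by (metis Lp_carrierE)
    have "(\<integral>x. g x * f x \<partial>M) = 0" if "f \<in> Lp_functions M p" for f
      using z[OF ae_class_in_Lp[OF that]]
      unfolding g(2) Lp_pairing_ae_class[OF bm[OF that] bm[OF g(1)]] by (simp add: mult.commute)
    then have "AE x in M. g x = 0"
      by (intro Lp_separated[OF q(1) g(1)]) (simp add: q(2))
    then show "\<eta> = \<zero>\<^bsub>Lp M q\<^esub>"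
      unfolding g(2) zero_Lp by (intro ae_class_eqI bm[OF g(1)]) simp_all
  qed
  then show ?thesis
    by (simp add: q_def)
qed

subsection \<open>Haar measure\<close>

locale haar_group = group G
  for G :: "('a, 'b) monoid_scheme" (structure) +
  fixes T :: "'a topology" and M :: "'a measure"
  assumes lcg: "locally_compact_group G T"
    and haar: "left_haar_measure G T M"
begin

lemma topspace_T [simp]: "topspace T = carrier G"
  using lcg by (simp add: locally_compact_group_def topological_group_def)

lemma Hausdorff_T: "Hausdorff_space T"
  using lcg by (simp add: locally_compact_group_def)

lemma locally_compact_T: "locally_compact_space T"
  using lcg by (simp add: locally_compact_group_def)

lemma space_M [simp]: "space M = carrier G"
  using haar by (simp add: left_haar_measure_def)

lemma sets_M: "sets M = sigma_sets (carrier G) {U. openin T U}"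
  using haar by (simp add: left_haar_measure_def)

lemma sets_Int_carrier [simp]: "A \<in> sets M \<Longrightarrow> A \<inter> carrier G = A"
  using sets.sets_into_space[of A M] by auto

lemma open_sets: "openin T U \<Longrightarrow> U \<in> sets M"
  unfolding sets_M by (rule sigma_sets.Basic) simp

lemma closed_sets: "closedin T C \<Longrightarrow> C \<in> sets M"
  using sets.compl_sets[OF open_sets, of "carrier G - C"] closedin_subset[of T C]
  by (auto simp: closedin_def double_diff)

lemma compact_closed: "compactin T K \<Longrightarrow> closedin T K"
  using compactin_imp_closedin[OF Hausdorff_T] .

lemma compact_sets: "compactin T K \<Longrightarrow> K \<in> sets M"
  using closed_sets compact_closed by blast

lemma compact_carrier: "compactin T K \<Longrightarrow> K \<subseteq> carrier G"
  using compactin_subset_topspace[of T K] by simp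

lemma open_carrier: "openin T U \<Longrightarrow> U \<subseteq> carrier G"
  using openin_subset[of T U] by simp

lemma compact_finite: "compactin T K \<Longrightarrow> emeasure M K < \<infinity>"
  using haar by (simp add: left_haar_measure_def)

lemma outer_regular:
  "A \<in> sets M \<Longrightarrow> emeasure M A = (INF U\<in>{U. openin T U \<and> A \<subseteq> U}. emeasure M U)"
  using haar unfolding left_haar_measure_def by blast

lemma inner_regular_open:
  "openin T U \<Longrightarrow> emeasure M U = (SUP K\<in>{K. compactin T K \<and> K \<subseteq> U}. emeasure M K)"
  using haar unfolding left_haar_measure_def by blast

lemma continuous_mult:
  assumes "continuous_map X T f" "continuous_map X T g"
  shows "continuous_map X T (\<lambda>x. f x \<otimes> g x)"
proof -
  have "continuous_map (prod_topology T T) T (\<lambda>(x, y). x \<otimes> y)"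
    using lcg by (simp add: locally_compact_group_def topological_group_def)
  from continuous_map_compose[OF _ this, of X "\<lambda>x. (f x, g x)"] show ?thesis
    using assms by (simp add: o_def continuous_map_paired)
qed

lemma continuous_inv:
  assumes "continuous_map X T f"
  shows "continuous_map X T (\<lambda>x. inv (f x))"
proof -
  have "continuous_map T T (\<lambda>x. inv x)"
    using lcg by (simp add: locally_compact_group_def topological_group_def)
  from continuous_map_compose[OF assms this] show ?thesis
    by (simp add: o_def)
qed

lemma continuous_const: "s \<in> carrier G \<Longrightarrow> continuous_map X T (\<lambda>x. s)"
  by simp

lemma continuous_comp:
  "continuous_map T Y h \<Longrightarrow> continuous_map X T f \<Longrightarrow> continuous_map X Y (\<lambda>x. h (f x))"
  using continuous_map_compose[of X T f Y h] by (simp add: o_def)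

lemma continuous_left: "s \<in> carrier G \<Longrightarrow> continuous_map T T (\<lambda>t. s \<otimes> t)"
  by (intro continuous_mult) auto

lemma continuous_right: "s \<in> carrier G \<Longrightarrow> continuous_map T T (\<lambda>t. t \<otimes> s)"
  by (intro continuous_mult) auto

lemma open_preimage:
  assumes "continuous_map T T f" "openin T U" shows "openin T {x \<in> carrier G. f x \<in> U}"
  using openin_continuous_map_preimage[OF assms] by simp

lemma compact_set_mult:
  assumes "compactin T K" "compactin T L" shows "compactin T (K <#> L)"
proof -
  have "compactin (prod_topology T T) (K \<times> L)"
    using assms by (simp add: compactin_Times)
  moreover have "continuous_map (prod_topology T T) T (\<lambda>z. fst z \<otimes> snd z)"
    by (intro continuous_mult continuous_map_fst continuous_map_snd)
  ultimately have "compactin T ((\<lambda>z. fst z \<otimes> snd z) ` (K \<times> L))"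
    by (rule image_compactin)
  moreover have "(\<lambda>z. fst z \<otimes> snd z) ` (K \<times> L) = K <#> L"
    by (force simp: set_mult_def)
  ultimately show ?thesis by simp
qed

lemma compact_inv_image: "compactin T K \<Longrightarrow> compactin T ((\<lambda>x. inv x) ` K)"
  by (erule image_compactin, rule continuous_inv) simp

lemma compact_left_image: "compactin T K \<Longrightarrow> s \<in> carrier G \<Longrightarrow> compactin T ((\<lambda>t. s \<otimes> t) ` K)"
  by (erule image_compactin, rule continuous_left)

lemma compact_right_image: "compactin T K \<Longrightarrow> s \<in> carrier G \<Longrightarrow> compactin T ((\<lambda>t. t \<otimes> s) ` K)"
  by (erule image_compactin, rule continuous_right)

lemma measurable_continuous:
  assumes "continuous_map T T f" shows "f \<in> measurable M M"
proof (rule measurable_sigma_sets[OF sets_M])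
  show "{U. openin T U} \<subseteq> Pow (carrier G)"
    using open_carrier by auto
  show "f \<in> space M \<rightarrow> carrier G"
    using assms by (auto simp: continuous_map_def)
  show "f -` U \<inter> space M \<in> sets M" if "U \<in> {U. openin T U}" for U
    using open_sets[OF open_preimage[OF assms, of U]] that
    by (auto simp: vimage_def Int_def conj_commute)
qed

lemmas measurable_left = measurable_continuous[OF continuous_left]
  and measurable_right = measurable_continuous[OF continuous_right]

lemma borel_measurable_continuous:
  fixes f :: "'a \<Rightarrow> 'c::topological_space"
  assumes "continuous_map T euclidean f" shows "f \<in> borel_measurable M"
proof (rule borel_measurableI)
  fix S :: "'c set" assume "open S"
  then have "openin T {x \<in> topspace T. f x \<in> S}"
    using assms by (intro openin_continuous_map_preimage) auto
  then show "f -` S \<inter> space M \<in> sets M"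
    using open_sets by (auto simp: vimage_def Int_def conj_commute)
qed

lemma left_preimage: "s \<in> carrier G \<Longrightarrow> A \<subseteq> carrier G \<Longrightarrow> (\<lambda>t. s \<otimes> t) -` A \<inter> carrier G = inv s <# A"
  unfolding l_coset_def by (force simp: inv_solve_left subset_iff m_assoc[symmetric])

lemma distr_left:
  assumes s: "s \<in> carrier G" shows "distr M M (\<lambda>t. s \<otimes> t) = M"
proof (rule measure_eqI)
  fix A assume "A \<in> sets (distr M M (\<lambda>t. s \<otimes> t))"
  then have A: "A \<in> sets M" by simp
  then have "A \<subseteq> carrier G"
    using sets.sets_into_space by fastforce
  then show "emeasure (distr M M (\<lambda>t. s \<otimes> t)) A = emeasure M A"
    using haar s A by (simp add: emeasure_distr measurable_left left_preimage left_haar_measure_def)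
qed simp

lemma integral_left:
  fixes f :: "'a \<Rightarrow> 'c::{banach, second_countable_topology}"
  assumes "s \<in> carrier G" "f \<in> borel_measurable M"
  shows "(\<integral>t. f (s \<otimes> t) \<partial>M) = (\<integral>t. f t \<partial>M)"
  using integral_distr[OF measurable_left[OF assms(1)] assms(2)] by (simp add: distr_left assms)

lemma AE_left:
  assumes "s \<in> carrier G" "AE t in M. P t" shows "AE t in M. P (s \<otimes> t)"
proof -
  have "AE t in distr M M (\<lambda>t. s \<otimes> t). P t"
    unfolding distr_left[OF assms(1)] by (rule assms(2))
  then show ?thesis
    by (rule AE_distrD[OF measurable_left[OF assms(1)]])
qed

lemma emeasure_left:
  assumes "s \<in> carrier G" "A \<in> sets M"
  shows "{t \<in> carrier G. s \<otimes> t \<in> A} \<in> sets M" "emeasure M {t \<in> carrier G. s \<otimes> t \<in> A} = emeasure M A"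
proof -
  have eq: "{t \<in> carrier G. s \<otimes> t \<in> A} = (\<lambda>t. s \<otimes> t) -` A \<inter> space M"
    by auto
  show "{t \<in> carrier G. s \<otimes> t \<in> A} \<in> sets M"
    unfolding eq by (rule measurable_sets[OF measurable_left[OF assms(1)] assms(2)])
  show "emeasure M {t \<in> carrier G. s \<otimes> t \<in> A} = emeasure M A"
    unfolding eq using emeasure_distr[OF measurable_left[OF assms(1)] assms(2)] by (simp add: distr_left assms)
qed

text \<open>If \<open>U\<close> were null, its left translates would be null open sets, finitely
  many of which cover any given compact set. All compact sets would be null, and by inner regularity
  so would the whole group.\<close>

lemma open_pos:
  assumes "openin T U" "U \<noteq> {}" shows "0 < emeasure M U"
proof (rule ccontr)
  assume "\<not> 0 < emeasure M U"
  then have z: "emeasure M U = 0" by simp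
  obtain u where u: "u \<in> U" "u \<in> carrier G"
    using assms open_carrier by blast
  have K0: "emeasure M K = 0" if K: "compactin T K" for K
  proof -
    define W where "W k = {t \<in> carrier G. (u \<otimes> inv k) \<otimes> t \<in> U}" for k
    have W: "openin T (W k)" "emeasure M (W k) = 0" "k \<in> W k" if "k \<in> carrier G" for k
      using that u z assms(1) open_sets[OF assms(1)]
      by (auto simp: W_def m_assoc emeasure_left intro!: open_preimage continuous_left)
    have "\<exists>\<F>. finite \<F> \<and> \<F> \<subseteq> W ` K \<and> K \<subseteq> \<Union>\<F>"
      using K W compact_carrier[OF K] by (intro compactinD[OF K]) blast+
    then obtain \<F> where F: "finite \<F>" "\<F> \<subseteq> W ` K" "K \<subseteq> \<Union>\<F>" by blast
    have "W k \<in> null_sets M" if "k \<in> K" for k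
      using W compact_carrier[OF K] open_sets that by (intro null_setsI) blast+
    then have "\<Union>\<F> \<in> null_sets M"
      using F by (intro null_sets.finite_Union) auto
    then show ?thesis
      using F(3) compact_sets[OF K] by (meson null_setsD1 null_sets_subset)
  qed
  have "emeasure M (carrier G) = (SUP K\<in>{K. compactin T K \<and> K \<subseteq> carrier G}. emeasure M K)"
    using inner_regular_open[of "carrier G"] openin_topspace[of T] by simp
  also have "\<dots> = 0"
    using K0 by (intro antisym SUP_least) auto
  finally show False
    using haar by (simp add: left_haar_measure_def)
qed

lemma completely_regular_T: "completely_regular_space T"
  using locally_compact_regular_imp_completely_regular_space[OF locally_compact_T] Hausdorff_T by blast

lemma compact_nbhd:
  assumes "compactin T K" "openin T U" "K \<subseteq> U"
  obtains V L where "openin T V" "compactin T L" "K \<subseteq> V" "V \<subseteq> L" "L \<subseteq> U"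
proof -
  have base: "neighbourhood_base_of (compactin T) T"
    using locally_compact_space_neighbourhood_base Hausdorff_T locally_compact_T by blast
  then have "\<forall>x\<in>K. \<exists>V L. openin T V \<and> compactin T L \<and> x \<in> V \<and> V \<subseteq> L \<and> L \<subseteq> U"
    using assms unfolding neighbourhood_base_of by blast
  then obtain V L where VL: "\<And>x. x \<in> K \<Longrightarrow> openin T (V x) \<and> compactin T (L x) \<and> x \<in> V x \<and> V x \<subseteq> L x \<and> L x \<subseteq> U"
    by metis
  have "\<exists>\<F>. finite \<F> \<and> \<F> \<subseteq> V ` K \<and> K \<subseteq> \<Union>\<F>"
    using VL by (intro compactinD[OF assms(1)]) blast+
  then obtain F where F: "finite F" "F \<subseteq> K" "K \<subseteq> (\<Union>x\<in>F. V x)"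
    by (metis finite_subset_image)
  show ?thesis
  proof (rule that[of "\<Union>x\<in>F. V x" "\<Union>x\<in>F. L x"])
    show "compactin T (\<Union>x\<in>F. L x)"
      using F VL by (intro compactin_Union) auto
    show "openin T (\<Union>x\<in>F. V x)"
      using F VL by (intro openin_Union) auto
    show "(\<Union>x\<in>F. V x) \<subseteq> (\<Union>x\<in>F. L x)" "(\<Union>x\<in>F. L x) \<subseteq> U"
      using F VL by blast+
  qed (use F in simp)
qed

section \<open>Continuous functions of compact support\<close>

definition Cc :: "('a \<Rightarrow> real) set" where
  "Cc = {f. continuous_map T euclidean f \<and> (\<exists>K. compactin T K \<and> (\<forall>x\<in>carrier G - K. f x = 0))}"

lemma CcI:
  "continuous_map T euclidean f \<Longrightarrow> compactin T K \<Longrightarrow> (\<And>x. x \<in> carrier G \<Longrightarrow> x \<notin> K \<Longrightarrow> f x = 0) \<Longrightarrow> f \<in> Cc"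
  unfolding Cc_def by blast

lemma Cc_continuous: "f \<in> Cc \<Longrightarrow> continuous_map T euclidean f"
  unfolding Cc_def by blast

lemma Cc_supportE:
  assumes "f \<in> Cc"
  obtains K where "compactin T K" "\<And>x. x \<in> carrier G \<Longrightarrow> x \<notin> K \<Longrightarrow> f x = 0"
  using assms unfolding Cc_def by auto

lemma Cc_bounded:
  assumes "f \<in> Cc"
  obtains K C where "compactin T K" "0 \<le> C" "\<And>x. x \<in> carrier G \<Longrightarrow> \<bar>f x\<bar> \<le> C * indicator K x"
    "\<And>x. x \<in> carrier G \<Longrightarrow> x \<notin> K \<Longrightarrow> f x = 0"
proof -
  obtain K where K: "compactin T K" "\<And>x. x \<in> carrier G \<Longrightarrow> x \<notin> K \<Longrightarrow> f x = 0"
    using Cc_supportE[OF assms] by metis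
  have "compactin euclidean (f ` K)"
    using image_compactin[OF K(1) Cc_continuous[OF assms]] .
  then have "bounded (f ` K)"
    by (simp add: compact_imp_bounded)
  then obtain C where C: "\<And>x. x \<in> K \<Longrightarrow> \<bar>f x\<bar> \<le> C"
    unfolding bounded_iff by auto
  show ?thesis
  proof (rule that[OF K(1), of "\<bar>C\<bar>"])
    show "\<bar>f x\<bar> \<le> \<bar>C\<bar> * indicator K x" if "x \<in> carrier G" for x
      using K(2)[OF that] C[of x] by (cases "x \<in> K") auto
  qed (use K in auto)
qed

lemma integrable_compact_bound:
  assumes "f \<in> borel_measurable M" "compactin T K" "\<And>x. x \<in> carrier G \<Longrightarrow> \<bar>f x :: real\<bar> \<le> C * indicator K x"
  shows "integrable M f"
proof (rule Bochner_Integration.integrable_bound)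
  show "integrable M (\<lambda>x. C * indicator K x)"
    using compact_sets[OF assms(2)] compact_finite[OF assms(2)]
    by (intro integrable_mult_right integrable_real_indicator)
  show "AE x in M. norm (f x) \<le> norm (C * indicator K x)"
    using order_trans[OF assms(3) abs_ge_self] by (intro AE_I2) simp
qed fact

lemma Cc_integrable: "f \<in> Cc \<Longrightarrow> integrable M f"
  using integrable_compact_bound borel_measurable_continuous Cc_continuous Cc_bounded by metis

lemma Cc_measurable: "f \<in> Cc \<Longrightarrow> f \<in> borel_measurable M"
  using Cc_continuous borel_measurable_continuous by blast

lemma Cc_mult:
  assumes "f \<in> Cc" "continuous_map T euclidean g" shows "(\<lambda>x. g x * f x) \<in> Cc"
proof -
  obtain K where "compactin T K" "\<And>x. x \<in> carrier G \<Longrightarrow> x \<notin> K \<Longrightarrow> f x = 0"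
    using Cc_supportE[OF assms(1)] by metis
  then show ?thesis
    using assms Cc_continuous by (intro CcI[of _ K] continuous_map_real_mult) auto
qed

lemma urysohn_Cc:
  assumes "compactin T K" "openin T U" "K \<subseteq> U"
  obtains f L where "f \<in> Cc" "\<And>x. 0 \<le> f x" "\<And>x. f x \<le> 1" "\<And>x. x \<in> K \<Longrightarrow> f x = 1"
    "compactin T L" "L \<subseteq> U" "\<And>x. x \<in> carrier G \<Longrightarrow> x \<notin> L \<Longrightarrow> f x = 0"
proof -
  obtain V L where VL: "openin T V" "compactin T L" "K \<subseteq> V" "V \<subseteq> L" "L \<subseteq> U"
    using compact_nbhd[OF assms] by blast
  have cl: "closedin T (carrier G - V)"
    using VL(1) openin_closedin_eq[of T V] by simp
  have "disjnt K (carrier G - V)"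
    using VL(3) by (auto simp: disjnt_def)
  then obtain f where f: "continuous_map T euclideanreal f" "f ` K \<subseteq> {1}" "f ` (carrier G - V) \<subseteq> {0}"
    using Urysohn_completely_regular_compact_closed_alt[OF completely_regular_T assms(1) cl] by metis
  \<comment> \<open>The truncation makes the bounds 0 and 1 hold on the whole type, outside the
    carrier as well.\<close>
  define g where "g x = max 0 (min 1 (f x))" for x
  have g: "continuous_map T euclidean g"
    unfolding g_def using f(1) by (intro continuous_map_real_max continuous_map_real_min) auto
  show ?thesis
  proof (rule that[of g L])
    show g0: "g x = 0" if "x \<in> carrier G" "x \<notin> L" for x
    proof -
      have "f x = 0"
        using f(3) VL(4) that by blast
      then show ?thesis by (simp add: g_def)
    qed
    show "g \<in> Cc"
      by (rule CcI[OF g VL(2) g0])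
    show "g x = 1" if "x \<in> K" for x
      using f(2) that by (auto simp: g_def image_subset_iff)
  qed (use VL in \<open>auto simp: g_def\<close>)
qed

text \<open>The Borel sets of \<open>G \<times> G\<close> may be strictly larger than the product sigma algebra, and \<open>M\<close>
  need not be sigma finite, so the Fubini theorem of the library does not apply. For continuous
  functions of compact support one approximates uniformly by finite sums of products.\<close>

lemma fubini_Cc:
  fixes F :: "'a \<Rightarrow> 'a \<Rightarrow> real"
  assumes F: "continuous_map (prod_topology T T) euclidean (\<lambda>z. F (fst z) (snd z))"
    and K: "compactin T K" and L: "compactin T L"
    and zero: "\<And>x y. x \<in> carrier G \<Longrightarrow> y \<in> carrier G \<Longrightarrow> x \<notin> K \<or> y \<notin> L \<Longrightarrow> F x y = 0"
  shows "(\<lambda>x. \<integral>y. F x y \<partial>M) \<in> Cc"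
    and "(\<lambda>y. \<integral>x. F x y \<partial>M) \<in> Cc"
    and "(\<integral>x. (\<integral>y. F x y \<partial>M) \<partial>M) = (\<integral>y. (\<integral>x. F x y \<partial>M) \<partial>M)"
proof -
  \<comment> \<open>Stated for a fresh function and fresh compact sets, so that it can be applied
    both to \<open>F\<close> and to \<open>F\<close> with its arguments exchanged.\<close>
  have key: "(\<lambda>x. \<integral>y. F x y \<partial>M) \<in> Cc"
    and slice: "\<And>x. x \<in> carrier G \<Longrightarrow> F x \<in> Cc"
    and near: "\<And>x0 e. x0 \<in> carrier G \<Longrightarrow> 0 < e \<Longrightarrow>
      \<exists>U. openin T U \<and> x0 \<in> U \<and> (\<forall>x\<in>U. \<forall>y\<in>carrier G. \<bar>F x y - F x0 y\<bar> \<le> e * indicator L y)"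
    if F: "continuous_map (prod_topology T T) euclidean (\<lambda>z. F (fst z) (snd z))"
    and K: "compactin T K" and L: "compactin T L"
    and zero: "\<And>x y. x \<in> carrier G \<Longrightarrow> y \<in> carrier G \<Longrightarrow> x \<notin> K \<or> y \<notin> L \<Longrightarrow> F x y = 0"
    for F :: "'a \<Rightarrow> 'a \<Rightarrow> real" and K L
  proof -
    have sl: "continuous_map X euclidean (\<lambda>z. F (f z) (g z))"
      if "continuous_map X T f" "continuous_map X T g" for X :: "'c topology" and f g
      using continuous_map_compose[OF _ F, of X "\<lambda>z. (f z, g z)"] that
      by (simp add: o_def continuous_map_paired)
    show slice: "F x \<in> Cc" if "x \<in> carrier G" for x
      using that zero by (intro CcI[of _ L] sl L) auto
    show near: "\<exists>U. openin T U \<and> x0 \<in> U \<and> (\<forall>x\<in>U. \<forall>y\<in>carrier G. \<bar>F x y - F x0 y\<bar> \<le> e * indicator L y)"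
      if x0: "x0 \<in> carrier G" and e: "0 < e" for x0 e
    proof -
      \<comment> \<open>\<open>W\<close> is an open set containing \<open>{x0} \<times> L\<close>;
        the tube lemma extracts a neighbourhood of \<open>x0\<close> on which the variation of
        \<open>F\<close> is below \<open>e\<close> for all \<open>y\<close> in \<open>L\<close> at
        once.\<close>
      define W where "W = {z \<in> topspace (prod_topology T T). F (fst z) (snd z) - F x0 (snd z) \<in> {-e<..<e}}"
      have "continuous_map (prod_topology T T) euclidean (\<lambda>z. F (fst z) (snd z) - F x0 (snd z))"
        using x0 by (intro continuous_map_diff sl continuous_map_fst continuous_map_snd continuous_const)
      then have "openin (prod_topology T T) W"
        unfolding W_def by (rule openin_continuous_map_preimage) auto
      moreover have "{x0} \<times> L \<subseteq> W"
        using x0 e compact_carrier[OF L] by (auto simp: W_def)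
      ultimately obtain U V where UV: "openin T U" "openin T V" "x0 \<in> U" "L \<subseteq> V" "U \<times> V \<subseteq> W"
        using tube_lemma_right[OF _ L, of T W x0] x0 by auto
      have "\<bar>F x y - F x0 y\<bar> \<le> e * indicator L y" if "x \<in> U" "y \<in> carrier G" for x y
      proof (cases "y \<in> L")
        case True
        then have "(x, y) \<in> W"
          using UV that by auto
        then show ?thesis
          using True by (auto simp: W_def)
      next
        case False
        then show ?thesis
          using zero[of x y] zero[of x0 y] x0 that open_carrier[OF UV(1)] by auto
      qed
      then show ?thesis
        using UV by blast
    qed
    have "continuous_map T Met_TC.mtopology (\<lambda>x. \<integral>y. F x y \<partial>M)"
      unfolding Met_TC.continuous_map_to_metric
    proof (intro ballI allI impI)
      fix x0 and e :: real assume "x0 \<in> topspace T" and e: "0 < e"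
      then have x0: "x0 \<in> carrier G" by simp
      define e' where "e' = e / (2 * (measure M L + 1))"
      have "0 < measure M L + 1"
        using measure_nonneg[of M L] by linarith
      then have e'_pos: "0 < e'" and "e' * (2 * (measure M L + 1)) = e"
        using e unfolding e'_def by (simp, intro nonzero_eq_divide_eq[THEN iffD1]) auto
      then have "e = 2 * (e' * measure M L) + 2 * e'"
        by (simp add: algebra_simps)
      moreover have "0 \<le> e' * measure M L"
        using e'_pos by simp
      ultimately have e'_less: "e' * measure M L < e"
        using e'_pos by linarith
      note e' = e'_pos e'_less
      obtain U where U: "openin T U" "x0 \<in> U"
        "\<And>x y. x \<in> U \<Longrightarrow> y \<in> carrier G \<Longrightarrow> \<bar>F x y - F x0 y\<bar> \<le> e' * indicator L y"
        using near[OF x0 e'(1)] by blast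
      have "dist (\<integral>y. F x0 y \<partial>M) (\<integral>y. F x y \<partial>M) < e" if x: "x \<in> U" for x
      proof -
        have "x \<in> carrier G"
          using open_carrier[OF U(1)] x by blast
        then have int: "integrable M (F x)" "integrable M (F x0)"
          using slice Cc_integrable x0 by blast+
        have "\<bar>(\<integral>y. F x y \<partial>M) - (\<integral>y. F x0 y \<partial>M)\<bar> = norm (\<integral>y. F x y - F x0 y \<partial>M)"
          using int by simp
        also have "\<dots> \<le> (\<integral>y. e' * indicator L y \<partial>M)"
          using int U(3)[OF x] compact_sets[OF L] compact_finite[OF L]
          by (intro order_trans[OF integral_norm_bound integral_mono]) simp_all
        also have "\<dots> = e' * measure M L"
          using compact_sets[OF L] compact_finite[OF L] by simp
        finally show ?thesis
          using e'(2) by (simp add: dist_real_def)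
      qed
      then show "\<exists>U. openin T U \<and> x0 \<in> U \<and> (\<forall>y\<in>U. (\<integral>y'. F y y' \<partial>M) \<in> Met_TC.mball (\<integral>y. F x0 y \<partial>M) e)"
        using U(1,2) by auto
    qed
    then have "continuous_map T euclidean (\<lambda>x. \<integral>y. F x y \<partial>M)"
      by simp
    moreover have "(\<integral>y. F x y \<partial>M) = 0" if "x \<in> carrier G" "x \<notin> K" for x
    proof -
      have "(\<integral>y. F x y \<partial>M) = (\<integral>y. 0 \<partial>M)"
        using zero that by (intro Bochner_Integration.integral_cong) auto
      then show ?thesis by simp
    qed
    ultimately show "(\<lambda>x. \<integral>y. F x y \<partial>M) \<in> Cc"
      using K by (intro CcI)
  qed
  have F': "continuous_map (prod_topology T T) euclidean (\<lambda>z. F (snd z) (fst z))"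
    using continuous_map_compose[OF _ F, of "prod_topology T T" "\<lambda>z. (snd z, fst z)"]
    by (simp add: o_def continuous_map_paired continuous_map_fst continuous_map_snd)
  show c1: "(\<lambda>x. \<integral>y. F x y \<partial>M) \<in> Cc"
    by (rule key[OF F K L]) (use zero in auto)
  show c2: "(\<lambda>y. \<integral>x. F x y \<partial>M) \<in> Cc"
    by (rule key[OF F' L K]) (use zero in auto)
  have sl1: "F x \<in> Cc" if "x \<in> carrier G" for x
    by (rule slice[OF F K L]) (use zero that in auto)
  have sl2: "(\<lambda>x. F x y) \<in> Cc" if "y \<in> carrier G" for y
    by (rule slice[OF F' L K]) (use zero that in auto)
  let ?m = "measure M K * measure M L"
  have indK: "integrable M (\<lambda>x. indicator K x :: real)" "(\<integral>x. indicator K x \<partial>M) = measure M K"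
    using compact_sets[OF K] compact_finite[OF K] by simp_all
  have indL: "integrable M (\<lambda>x. indicator L x :: real)" "(\<integral>x. indicator L x \<partial>M) = measure M L"
    using compact_sets[OF L] compact_finite[OF L] by simp_all
  have approx: "\<bar>(\<integral>x. (\<integral>y. F x y \<partial>M) \<partial>M) - (\<integral>y. (\<integral>x. F x y \<partial>M) \<partial>M)\<bar> \<le> 2 * (e * ?m)"
    if e: "0 < e" for e
  proof -
    have "\<exists>U. openin T U \<and> x0 \<in> U \<and> (\<forall>x\<in>U. \<forall>y\<in>carrier G. \<bar>F x y - F x0 y\<bar> \<le> e * indicator L y)"
      if "x0 \<in> carrier G" for x0
      by (rule near[OF F K L]) (use zero that e in auto)
    then obtain U where U: "\<And>x0. x0 \<in> carrier G \<Longrightarrow> openin T (U x0) \<and> x0 \<in> U x0"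
      "\<And>x0 x y. x0 \<in> carrier G \<Longrightarrow> x \<in> U x0 \<Longrightarrow> y \<in> carrier G \<Longrightarrow> \<bar>F x y - F x0 y\<bar> \<le> e * indicator L y"
      by metis
    have "\<exists>\<F>. finite \<F> \<and> \<F> \<subseteq> U ` K \<and> K \<subseteq> \<Union>\<F>"
      using U compact_carrier[OF K] by (intro compactinD[OF K]) blast+
    then obtain X where X: "finite X" "X \<subseteq> K" "K \<subseteq> (\<Union>x\<in>X. U x)"
      by (metis finite_subset_image)
    then obtain c n where c: "X = c ` {i. i < (n::nat)}"
      by (metis finite_imp_nat_seg_image_inj_on)
    have cG: "c i \<in> carrier G" if "i < n" for i
      using c X(2) compact_carrier[OF K] that by blast
    define V where "V i = (if i < n then U (c i) else {})" for i
    have Vs: "V i \<in> sets M" for i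
      using U(1) cG open_sets by (auto simp: V_def)
    define D where "D i = disjointed V i \<inter> K" for i
    have Ds: "D i \<in> sets M" for i
  proof -
    have "range (disjointed V) \<subseteq> sets M"
      using Vs by (intro sets.range_disjointed_sets) auto
    then show ?thesis
      unfolding D_def using compact_sets[OF K] by auto
  qed
    have DV: "D i \<subseteq> V i" for i
      using disjointed_subset[of V i] by (auto simp: D_def)
    have Dfin: "emeasure M (D i) < \<infinity>" for i
      using emeasure_mono[of "D i" K M] compact_sets[OF K] compact_finite[OF K]
      by (auto simp: D_def intro: le_less_trans)
    have "(\<Union>i. D i) = (\<Union>i. V i) \<inter> K"
      unfolding D_def using UN_disjointed_eq[of V] by auto
    also have "\<dots> = K"
      using X(3) unfolding c V_def by auto
    finally have DU: "(\<Union>i. D i) = K" .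
    have Dunique: "i = j" if "x \<in> D i" "x \<in> D j" for x i j
      using disjoint_family_disjointed[of V] that unfolding D_def disjoint_family_on_def by blast
    \<comment> \<open>The sets \<open>D i\<close> partition \<open>K\<close>, and on
      \<open>D i\<close> the row \<open>F x\<close> is replaced by the row at the sample point
      \<open>c i\<close>. The result is a finite sum of products, for which both iterated integrals
      equal \<open>S\<close> by linearity; each of them is within \<open>e * ?m\<close> of the
      corresponding integral of \<open>F\<close>.\<close>
    define H where "H x y = (\<Sum>i<n. indicator (D i) x * F (c i) y)" for x y
    have H: "H x y = (if x \<in> D i then F (c i) y else H x y)" for x y i
    proof (cases "x \<in> D i")
      case True
      then have "i < n"
        using DV by (fastforce simp: V_def split: if_splits)
      moreover have "H x y = (\<Sum>j<n. if j = i then F (c i) y else 0)"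
        unfolding H_def using True Dunique by (intro sum.cong) (auto simp: indicator_def)
      ultimately show ?thesis
        using True by simp
    qed simp
    have FH: "\<bar>F x y - H x y\<bar> \<le> e * indicator K x * indicator L y" if xy: "x \<in> carrier G" "y \<in> carrier G" for x y
    proof (cases "x \<in> K")
      case True
      then obtain i where i: "x \<in> D i"
        using DU by blast
      then have "i < n" "x \<in> U (c i)"
        using DV by (fastforce simp: V_def split: if_splits)+
      then show ?thesis
        using H[of x y i] i U(2)[OF cG _ xy(2)] True by simp
    next
      case False
      then have "H x y = 0"
        using DU unfolding H_def by (intro sum.neutral) auto
      then show ?thesis
        using zero[OF xy] False by simp
    qed
    have Fc: "integrable M (F (c i))" if "i < n" for i
      using sl1[OF cG[OF that]] Cc_integrable by blast
    have Di: "integrable M (\<lambda>x. indicator (D i) x :: real)" "(\<integral>x. indicator (D i) x \<partial>M) = measure M (D i)" for i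
      using Ds[of i] Dfin[of i] by simp_all
    note sum_int = Bochner_Integration.integrable_sum integrable_mult_right integrable_mult_left
      Bochner_Integration.integral_sum[THEN trans] sum.cong
    have H1: "integrable M (H x)" "(\<integral>y. H x y \<partial>M) = (\<Sum>i<n. indicator (D i) x * (\<integral>y. F (c i) y \<partial>M))" for x
      unfolding H_def using Fc by (intro sum_int; simp)+
    have H2: "integrable M (\<lambda>x. H x y)" "(\<integral>x. H x y \<partial>M) = (\<Sum>i<n. measure M (D i) * F (c i) y)" for y
      unfolding H_def using Di by (intro sum_int; simp)+
    define S where "S = (\<Sum>i<n. measure M (D i) * (\<integral>y. F (c i) y \<partial>M))"
    have S1: "integrable M (\<lambda>x. \<integral>y. H x y \<partial>M)" "(\<integral>x. (\<integral>y. H x y \<partial>M) \<partial>M) = S"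
      unfolding H1(2) S_def using Di by (intro sum_int; simp)+
    have S2: "integrable M (\<lambda>y. \<integral>x. H x y \<partial>M)" "(\<integral>y. (\<integral>x. H x y \<partial>M) \<partial>M) = S"
      unfolding H2(2) S_def using Fc by (intro sum_int; simp)+
    have "\<bar>(\<integral>y. F x y \<partial>M) - (\<integral>y. H x y \<partial>M)\<bar> \<le> e * measure M L * indicator K x" if x: "x \<in> carrier G" for x
    proof -
      have int: "integrable M (F x)"
        using sl1[OF x] Cc_integrable by blast
      have "\<bar>(\<integral>y. F x y \<partial>M) - (\<integral>y. H x y \<partial>M)\<bar> = norm (\<integral>y. F x y - H x y \<partial>M)"
        using int H1(1) by simp
      also have "\<dots> \<le> (\<integral>y. e * indicator K x * indicator L y \<partial>M)"
        using FH[OF x] int H1(1) indL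
        by (intro order_trans[OF integral_norm_bound integral_mono]) simp_all
      finally show ?thesis
        using indL by (simp add: mult_ac)
    qed
    then have "norm (\<integral>x. (\<integral>y. F x y \<partial>M) - (\<integral>y. H x y \<partial>M) \<partial>M) \<le> (\<integral>x. e * measure M L * indicator K x \<partial>M)"
      using Cc_integrable[OF c1] S1(1) indK
      by (intro order_trans[OF integral_norm_bound integral_mono]) simp_all
    then have 1: "\<bar>(\<integral>x. (\<integral>y. F x y \<partial>M) \<partial>M) - S\<bar> \<le> e * ?m"
      using Cc_integrable[OF c1] S1 indK by (simp add: mult_ac)
    have "\<bar>(\<integral>x. F x y \<partial>M) - (\<integral>x. H x y \<partial>M)\<bar> \<le> e * measure M K * indicator L y" if y: "y \<in> carrier G" for y
    proof -
      have int: "integrable M (\<lambda>x. F x y)"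
        using sl2 Cc_integrable y by blast
      have "\<bar>(\<integral>x. F x y \<partial>M) - (\<integral>x. H x y \<partial>M)\<bar> = norm (\<integral>x. F x y - H x y \<partial>M)"
        using int H2(1) by simp
      also have "\<dots> \<le> (\<integral>x. e * indicator K x * indicator L y \<partial>M)"
        using FH[OF _ y] int H2(1) indK
        by (intro order_trans[OF integral_norm_bound integral_mono]) simp_all
      finally show ?thesis
        using indK by (simp add: mult_ac)
    qed
    then have "norm (\<integral>y. (\<integral>x. F x y \<partial>M) - (\<integral>x. H x y \<partial>M) \<partial>M) \<le> (\<integral>y. e * measure M K * indicator L y \<partial>M)"
      using Cc_integrable[OF c2] S2(1) indL
      by (intro order_trans[OF integral_norm_bound integral_mono]) simp_all
    then have 2: "\<bar>(\<integral>y. (\<integral>x. F x y \<partial>M) \<partial>M) - S\<bar> \<le> e * ?m"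
      using Cc_integrable[OF c2] S2 indL by (simp add: mult_ac)
    show ?thesis
      using 1 2 by linarith
  qed
  show "(\<integral>x. (\<integral>y. F x y \<partial>M) \<partial>M) = (\<integral>y. (\<integral>x. F x y \<partial>M) \<partial>M)"
  proof (rule ccontr)
    define d where "d = \<bar>(\<integral>x. (\<integral>y. F x y \<partial>M) \<partial>M) - (\<integral>y. (\<integral>x. F x y \<partial>M) \<partial>M)\<bar>"
    assume "\<not> ?thesis"
    then have d: "0 < d" by (simp add: d_def)
    have m: "0 \<le> ?m" by simp
    have "d \<le> 2 * (d / (4 * (?m + 1)) * ?m)"
      using approx[of "d / (4 * (?m + 1))"] d m unfolding d_def by simp
    also have "\<dots> < d"
      using d m by (simp add: field_simps add_pos_nonneg)
    finally show False by simp
  qed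
qed

subsection \<open>The modular function and ergodicity of right translations\<close>

lemma Cc_lincomb:
  assumes "f \<in> Cc" "g \<in> Cc" shows "(\<lambda>x. a * f x + b * g x) \<in> Cc"
proof -
  obtain K where K: "compactin T K" "\<And>x. x \<in> carrier G \<Longrightarrow> x \<notin> K \<Longrightarrow> f x = 0"
    using Cc_supportE[OF assms(1)] by metis
  obtain L where L: "compactin T L" "\<And>x. x \<in> carrier G \<Longrightarrow> x \<notin> L \<Longrightarrow> g x = 0"
    using Cc_supportE[OF assms(2)] by metis
  have "continuous_map T euclidean (\<lambda>x. a * f x + b * g x)"
    by (intro continuous_map_add continuous_map_real_mult Cc_continuous[OF assms(1)]
        Cc_continuous[OF assms(2)]) simp_all
  moreover have "compactin T (K \<union> L)"
    using K L by (simp add: compactin_Un)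
  moreover have "a * f x + b * g x = 0" if "x \<in> carrier G" "x \<notin> K \<union> L" for x
    using K(2)[of x] L(2)[of x] that by simp
  ultimately show ?thesis
    by (rule CcI)
qed

text \<open>The set where \<open>f\<close> is nonzero is open and nonempty, hence not null by
  \<open>open_pos\<close>.\<close>

lemma Cc_integral_pos:
  assumes f: "f \<in> Cc" and nn: "\<And>x. x \<in> carrier G \<Longrightarrow> 0 \<le> f x" and x0: "x0 \<in> carrier G" "f x0 \<noteq> 0"
  shows "0 < (\<integral>x. f x \<partial>M)"
proof (rule ccontr)
  assume "\<not> ?thesis"
  moreover have "0 \<le> (\<integral>x. f x \<partial>M)"
    by (rule Bochner_Integration.integral_nonneg) (simp add: nn)
  ultimately have "(\<integral>x. f x \<partial>M) = 0" by simp
  then have "AE x in M. f x = 0"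
    by (rule integral_nonneg_eq_0_iff_AE[OF Cc_integrable[OF f] AE_I2, THEN iffD1, rotated]) (simp add: nn)
  then have "AE x in M. x \<notin> {x \<in> carrier G. f x \<in> - {0}}"
    by eventually_elim simp
  moreover have op: "openin T {x \<in> carrier G. f x \<in> - {0}}"
    using openin_continuous_map_preimage[OF Cc_continuous[OF f], of "- {0}"] by (simp add: open_Compl)
  ultimately have "{x \<in> carrier G. f x \<in> - {0}} \<in> null_sets M"
    using AE_iff_null_sets open_sets by blast
  then have "emeasure M {x \<in> carrier G. f x \<in> - {0}} = 0"
    by (rule null_setsD1)
  moreover have "{x \<in> carrier G. f x \<in> - {0}} \<noteq> {}"
    using x0 by auto
  ultimately show False
    using open_pos[OF op] by (metis less_irrefl)
qed

lemma Cc_right_translate: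
  assumes f: "f \<in> Cc" and s: "s \<in> carrier G"
  shows "(\<lambda>t. f (t \<otimes> s)) \<in> Cc"
proof -
  obtain K where K: "compactin T K" "\<And>x. x \<in> carrier G \<Longrightarrow> x \<notin> K \<Longrightarrow> f x = 0"
    using Cc_supportE[OF f] by metis
  show ?thesis
  proof (rule CcI)
    show "continuous_map T euclidean (\<lambda>t. f (t \<otimes> s))"
      by (intro continuous_comp[OF Cc_continuous[OF f]] continuous_right s)
    show "compactin T ((\<lambda>t. t \<otimes> inv s) ` K)"
      using K(1) s by (intro compact_right_image) auto
    fix x assume x: "x \<in> carrier G" "x \<notin> (\<lambda>t. t \<otimes> inv s) ` K"
    then have "x \<otimes> s \<notin> K"
      using s by (metis image_eqI inv_solve_right m_closed)
    then show "f (x \<otimes> s) = 0"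
      using K(2) x s by simp
  qed
qed

text \<open>Interchange the integrals, replace \<open>x\<close> by \<open>inv y \<otimes> x\<close>,
  interchange again, and replace \<open>y\<close> by \<open>x \<otimes> y\<close>. The weight
  \<open>g\<close> provides the compact support in \<open>x\<close> that
  \<open>f (y \<otimes> x)\<close> alone does not have.\<close>

lemma weighted_right_Cc:
  assumes f: "f \<in> Cc" and g: "g \<in> Cc"
  shows "(\<lambda>x. g x * (\<integral>y. f (y \<otimes> x) \<partial>M)) \<in> Cc"
    and "(\<integral>x. g x * (\<integral>y. f (y \<otimes> x) \<partial>M) \<partial>M) = (\<integral>x. f x \<partial>M) * (\<integral>y. g (inv y) \<partial>M)"
proof -
  obtain K where K: "compactin T K" "\<And>x. x \<in> carrier G \<Longrightarrow> x \<notin> K \<Longrightarrow> f x = 0"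
    using Cc_supportE[OF f] by metis
  obtain L where L: "compactin T L" "\<And>x. x \<in> carrier G \<Longrightarrow> x \<notin> L \<Longrightarrow> g x = 0"
    using Cc_supportE[OF g] by metis
  \<comment> \<open>If \<open>y \<otimes> x\<close> lies in \<open>K\<close> and \<open>x\<close> in
    \<open>L\<close>, then \<open>y\<close> lies in the product of \<open>K\<close> with the
    inverses of \<open>L\<close>.\<close>
  define Q where "Q = K <#> (\<lambda>x. inv x) ` L"
  have Q: "compactin T Q"
    unfolding Q_def by (intro compact_set_mult compact_inv_image K L)
  have Qmem: "y \<in> Q" if "y \<in> carrier G" "x \<in> carrier G" "y \<otimes> x \<in> K" "x \<in> L" for x y
  proof -
    have "y = (y \<otimes> x) \<otimes> inv x"
      using that by (simp add: m_assoc)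
    then show ?thesis
      unfolding Q_def set_mult_def using that by blast
  qed
  note cont = continuous_map_fst continuous_map_snd continuous_mult continuous_inv
    continuous_comp[OF Cc_continuous[OF f]] continuous_comp[OF Cc_continuous[OF g]] continuous_map_real_mult
  have F1: "continuous_map (prod_topology T T) euclidean (\<lambda>z. g (fst z) * f (snd z \<otimes> fst z))"
    by (intro cont)
  have Z1: "g x * f (y \<otimes> x) = 0" if "x \<in> carrier G" "y \<in> carrier G" "x \<notin> L \<or> y \<notin> Q" for x y
  proof (cases "x \<in> L")
    case True
    then have "y \<otimes> x \<notin> K"
      using that Qmem by blast
    then show ?thesis using K(2) that by simp
  qed (use L that in auto)
  note fub1 = fubini_Cc[OF F1 L(1) Q Z1]
  have pull: "(\<integral>y. g x * f (y \<otimes> x) \<partial>M) = g x * (\<integral>y. f (y \<otimes> x) \<partial>M)" for x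
    by simp
  show "(\<lambda>x. g x * (\<integral>y. f (y \<otimes> x) \<partial>M)) \<in> Cc"
    using fub1(1) unfolding pull .
  have F2: "continuous_map (prod_topology T T) euclidean (\<lambda>z. f (snd z) * g (inv (fst z) \<otimes> snd z))"
    by (intro cont)
  have Z2: "f x * g (inv y \<otimes> x) = 0" if "y \<in> carrier G" "x \<in> carrier G" "y \<notin> Q \<or> x \<notin> K" for x y
  proof (cases "x \<in> K")
    case True
    then have "y \<otimes> (inv y \<otimes> x) \<in> K"
      using that by (simp add: m_assoc[symmetric])
    then have "inv y \<otimes> x \<notin> L"
      using Qmem[of y "inv y \<otimes> x"] that True by blast
    then show ?thesis using L(2) that by simp
  qed (use K that in auto)
  note fub2 = fubini_Cc[OF F2 Q K(1) Z2]
  have "(\<integral>x. g x * (\<integral>y. f (y \<otimes> x) \<partial>M) \<partial>M) = (\<integral>y. (\<integral>x. g x * f (y \<otimes> x) \<partial>M) \<partial>M)"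
    using fub1(3) unfolding pull .
  also have "\<dots> = (\<integral>y. (\<integral>x. f x * g (inv y \<otimes> x) \<partial>M) \<partial>M)"
  proof (rule Bochner_Integration.integral_cong[OF refl])
    fix y assume "y \<in> space M"
    then have y: "y \<in> carrier G" by simp
    let ?h = "\<lambda>x. g x * f (y \<otimes> x)"
    have "continuous_map T euclidean ?h"
      by (intro continuous_map_real_mult Cc_continuous[OF g] continuous_comp[OF Cc_continuous[OF f]] continuous_left y)
    from integral_left[OF inv_closed[OF y] borel_measurable_continuous[OF this]]
    have "(\<integral>x. ?h x \<partial>M) = (\<integral>x. ?h (inv y \<otimes> x) \<partial>M)"
      by (rule sym)
    also have "\<dots> = (\<integral>x. f x * g (inv y \<otimes> x) \<partial>M)"
      using y by (intro Bochner_Integration.integral_cong[OF refl]) (simp add: m_assoc[symmetric] mult.commute)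
    finally show "(\<integral>x. ?h x \<partial>M) = (\<integral>x. f x * g (inv y \<otimes> x) \<partial>M)" .
  qed
  also have "\<dots> = (\<integral>x. (\<integral>y. f x * g (inv y \<otimes> x) \<partial>M) \<partial>M)"
    by (rule fub2(3))
  also have "\<dots> = (\<integral>x. f x * (\<integral>y. g (inv y) \<partial>M) \<partial>M)"
  proof (rule Bochner_Integration.integral_cong[OF refl])
    fix x assume "x \<in> space M"
    then have x: "x \<in> carrier G" by simp
    let ?h = "\<lambda>y. g (inv y \<otimes> x)"
    have "continuous_map T euclidean ?h"
      using x by (intro continuous_comp[OF Cc_continuous[OF g]] continuous_mult continuous_inv) auto
    from integral_left[OF x borel_measurable_continuous[OF this]]
    have "(\<integral>y. ?h y \<partial>M) = (\<integral>y. ?h (x \<otimes> y) \<partial>M)"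
      by (rule sym)
    also have "\<dots> = (\<integral>y. g (inv y) \<partial>M)"
      using x by (intro Bochner_Integration.integral_cong[OF refl]) (simp add: inv_mult_group m_assoc)
    finally show "(\<integral>y. f x * ?h y \<partial>M) = f x * (\<integral>y. g (inv y) \<partial>M)"
      by simp
  qed
  finally show "(\<integral>x. g x * (\<integral>y. f (y \<otimes> x) \<partial>M) \<partial>M) = (\<integral>x. f x \<partial>M) * (\<integral>y. g (inv y) \<partial>M)"
    by simp
qed

lemma Cc_nontrivial:
  assumes "x \<in> carrier G"
  obtains f where "f \<in> Cc" "\<And>x. 0 \<le> f x" "\<And>x. f x \<le> 1" "f x = 1" "0 < (\<integral>x. f x \<partial>M)"
proof -
  obtain f where f: "f \<in> Cc" "\<And>x. 0 \<le> f x" "\<And>x. f x \<le> 1" "f x = 1"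
  proof -
    have "compactin T {x}" "openin T (carrier G)" "{x} \<subseteq> carrier G"
      using assms openin_topspace[of T] by auto
    from urysohn_Cc[OF this] show ?thesis
      using that by (metis insertI1)
  qed
  then show ?thesis
    using that Cc_integral_pos[of f x] assms by auto
qed

text \<open>By \<open>weighted_right_Cc\<close>, \<open>R f\<close> paired with any weight is proportional to \<open>I f\<close>. Testing the
  continuous function \<open>I f0 * R f - I f * R f0\<close> against \<open>k\<^sup>2\<close> times itself shows that it vanishes,
  which replaces the uniqueness of Haar measure.\<close>

lemma ex_modular:
  assumes x0: "x0 \<in> carrier G"
  shows "\<exists>c. \<forall>f\<in>Cc. (\<integral>y. f (y \<otimes> x0) \<partial>M) = c * (\<integral>y. f y \<partial>M)"
proof -
  obtain f0 where f0: "f0 \<in> Cc" "0 < (\<integral>x. f0 x \<partial>M)"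
    using Cc_nontrivial[OF x0] by metis
  obtain k where k: "k \<in> Cc" "k x0 = 1"
    using Cc_nontrivial[OF x0] by metis
  define R where "R f x = (\<integral>y. f (y \<otimes> x) \<partial>M)" for f :: "'a \<Rightarrow> real" and x
  define I where "I f = (\<integral>y. f y \<partial>M)" for f :: "'a \<Rightarrow> real"
  have "R f x0 * I f0 = R f0 x0 * I f" if f: "f \<in> Cc" for f
  proof -
    define h where "h x = I f0 * R f x + (- I f) * R f0 x" for x
    define \<phi> where "\<phi> x = I f0 * (k x * R f x) + (- I f) * (k x * R f0 x)" for x
    have kR: "(\<lambda>x. k x * R f x) \<in> Cc" "(\<lambda>x. k x * R f0 x) \<in> Cc"
      unfolding R_def by (rule weighted_right_Cc(1)[OF f k(1)] weighted_right_Cc(1)[OF f0(1) k(1)])+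
    have \<phi>: "\<phi> \<in> Cc"
      unfolding \<phi>_def[abs_def] by (rule Cc_lincomb[OF kR])
    have \<phi>h: "\<phi> x = k x * h x" for x
      by (simp add: \<phi>_def h_def algebra_simps)
    have \<psi>: "(\<lambda>x. \<phi> x * k x) \<in> Cc"
      using Cc_mult[OF k(1) Cc_continuous[OF \<phi>]] .
    have "(\<integral>x. \<phi> x * \<phi> x \<partial>M) = (\<integral>x. I f0 * (\<phi> x * k x * R f x) + (- I f) * (\<phi> x * k x * R f0 x) \<partial>M)"
      by (simp add: \<phi>h h_def algebra_simps)
    also have "\<dots> = I f0 * (\<integral>x. \<phi> x * k x * R f x \<partial>M) + (- I f) * (\<integral>x. \<phi> x * k x * R f0 x \<partial>M)"
      using Cc_integrable[OF weighted_right_Cc(1)[OF f \<psi>]] Cc_integrable[OF weighted_right_Cc(1)[OF f0(1) \<psi>]]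
      by (simp add: R_def)
    also have "\<dots> = 0"
      using weighted_right_Cc(2)[OF f \<psi>] weighted_right_Cc(2)[OF f0(1) \<psi>] by (simp add: R_def I_def)
    finally have z: "(\<integral>x. \<phi> x * \<phi> x \<partial>M) = 0" .
    have "\<phi> x0 = 0"
    proof (rule ccontr)
      assume "\<phi> x0 \<noteq> 0"
      then have "0 < (\<integral>x. \<phi> x * \<phi> x \<partial>M)"
        using Cc_mult[OF \<phi> Cc_continuous[OF \<phi>]] x0 by (intro Cc_integral_pos[of _ x0]) auto
      then show False using z by simp
    qed
    then show ?thesis
      using k(2) by (simp add: \<phi>_def algebra_simps)
  qed
  then have "\<forall>f\<in>Cc. R f x0 = (R f0 x0 / I f0) * I f"
    using f0(2) by (simp add: I_def field_simps)
  then show ?thesis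
    unfolding R_def I_def by blast
qed

text \<open>In the convention in which the modular function at \<open>s\<close> is the factor by
  which translation from \<open>A\<close> to \<open>A #> s\<close> changes the measure, this is its
  value at \<open>inv s\<close>.\<close>

definition modular :: "'a \<Rightarrow> real" where
  "modular s = (SOME c. \<forall>f\<in>Cc. (\<integral>y. f (y \<otimes> s) \<partial>M) = c * (\<integral>y. f y \<partial>M))"

lemma modular_integral:
  assumes "s \<in> carrier G" "f \<in> Cc"
  shows "(\<integral>y. f (y \<otimes> s) \<partial>M) = modular s * (\<integral>y. f y \<partial>M)"
  using someI_ex[OF ex_modular[OF assms(1)]] assms(2) unfolding modular_def by blast

lemma modular_pos:
  assumes s: "s \<in> carrier G" shows "0 < modular s"
proof -
  obtain f where f: "f \<in> Cc" "\<And>x. 0 \<le> f x" "f s = 1" "0 < (\<integral>x. f x \<partial>M)"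
    using Cc_nontrivial[OF s] by metis
  have "0 < (\<integral>y. f (y \<otimes> s) \<partial>M)"
    using f s Cc_right_translate[OF f(1) s] by (intro Cc_integral_pos[of _ \<one>]) auto
  then show ?thesis
    using modular_integral[OF s f(1)] f(4) by (simp add: zero_less_mult_iff)
qed

text \<open>For a fixed bump \<open>f\<close>, the right translates by elements of \<open>Q\<close>
  have a common bound \<open>B\<close> and live on one compact set \<open>L\<close>, so their
  integrals are bounded.\<close>

lemma modular_bounded:
  assumes Q: "compactin T Q"
  obtains C where "0 < C" "\<And>s. s \<in> Q \<Longrightarrow> modular s \<le> C"
proof -
  obtain f where f: "f \<in> Cc" "\<And>x. 0 \<le> f x" "0 < (\<integral>x. f x \<partial>M)"
    using Cc_nontrivial[OF one_closed] by metis
  obtain K B where K: "compactin T K" "0 \<le> B" "\<And>x. x \<in> carrier G \<Longrightarrow> \<bar>f x\<bar> \<le> B * indicator K x"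
    using Cc_bounded[OF f(1)] by metis
  define L where "L = K <#> (\<lambda>x. inv x) ` Q"
  have L: "compactin T L"
    unfolding L_def by (intro compact_set_mult compact_inv_image K Q)
  define C where "C = B * measure M L / (\<integral>x. f x \<partial>M)"
  have "modular s \<le> C" if s: "s \<in> Q" for s
  proof -
    have sG: "s \<in> carrier G"
      using s compact_carrier[OF Q] by blast
    have le: "f (y \<otimes> s) \<le> B * indicator L y" if y: "y \<in> carrier G" for y
    proof (cases "y \<otimes> s \<in> K")
      case True
      have "y = (y \<otimes> s) \<otimes> inv s"
        using y sG by (simp add: m_assoc)
      then have "y \<in> L"
        unfolding L_def set_mult_def using True s by blast
      then show ?thesis
        using K(3)[of "y \<otimes> s"] y sG True by simp
    next
      case False
      then show ?thesis
        using K(3)[of "y \<otimes> s"] K(2) y sG by simp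
    qed
    have "modular s * (\<integral>x. f x \<partial>M) = (\<integral>y. f (y \<otimes> s) \<partial>M)"
      using modular_integral[OF sG f(1)] by simp
    also have "\<dots> \<le> (\<integral>y. B * indicator L y \<partial>M)"
      using le Cc_integrable[OF Cc_right_translate[OF f(1) sG]] compact_sets[OF L] compact_finite[OF L]
      by (intro integral_mono) simp_all
    also have "\<dots> = B * measure M L"
      using compact_sets[OF L] compact_finite[OF L] by simp
    finally show ?thesis
      using f(3) by (simp add: C_def field_simps)
  qed
  then show ?thesis
    using that[of "\<bar>C\<bar> + 1"] by fastforce
qed

text \<open>\<open>modular_integral\<close> knows continuous functions only. A Urysohn function
  between a compact subset and the translated open set carries it over to measures, and inner
  regularity of open sets removes the compact set.\<close>

lemma emeasure_right_open:
  assumes s: "s \<in> carrier G" and U: "openin T U"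
  shows "emeasure M {t \<in> carrier G. t \<otimes> s \<in> U} \<le> ennreal (modular s) * emeasure M U"
proof -
  let ?U = "{t \<in> carrier G. t \<otimes> s \<in> U}"
  have op: "openin T ?U"
    using open_preimage[OF continuous_right[OF s] U] .
  have "emeasure M K \<le> ennreal (modular s) * emeasure M U" if K: "compactin T K" "K \<subseteq> ?U" for K
  proof -
    obtain f L where f: "f \<in> Cc" "\<And>x. 0 \<le> f x" "\<And>x. f x \<le> 1" "\<And>x. x \<in> K \<Longrightarrow> f x = 1"
      and "compactin T L"
      and L: "L \<subseteq> ?U" "\<And>x. x \<in> carrier G \<Longrightarrow> x \<notin> L \<Longrightarrow> f x = 0"
      by (rule urysohn_Cc[OF K(1) op K(2)]) (rule that)
    let ?f = "\<lambda>y. f (y \<otimes> inv s)"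
    have f': "?f \<in> Cc"
      using Cc_right_translate[OF f(1), of "inv s"] s by simp
    have "emeasure M K = (\<integral>\<^sup>+x. indicator K x \<partial>M)"
      using compact_sets[OF K(1)] by simp
    also have "\<dots> \<le> (\<integral>\<^sup>+x. ennreal (f x) \<partial>M)"
      using f(4) by (intro nn_integral_mono) (auto simp: indicator_def)
    also have "\<dots> = ennreal (\<integral>x. f x \<partial>M)"
      using f(2) by (intro nn_integral_eq_integral Cc_integrable f(1)) simp
    also have "(\<integral>x. f x \<partial>M) = (\<integral>y. ?f (y \<otimes> s) \<partial>M)"
      using s by (intro Bochner_Integration.integral_cong[OF refl]) (simp add: m_assoc)
    also have "\<dots> = modular s * (\<integral>y. ?f y \<partial>M)"
      by (rule modular_integral[OF s f'])
    also have "ennreal \<dots> = ennreal (modular s) * ennreal (\<integral>y. ?f y \<partial>M)"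
      using modular_pos[OF s] by (simp add: ennreal_mult')
    also have "ennreal (\<integral>y. ?f y \<partial>M) = (\<integral>\<^sup>+y. ennreal (?f y) \<partial>M)"
      using f(2) by (intro nn_integral_eq_integral[symmetric] Cc_integrable f') simp
    also have "\<dots> \<le> (\<integral>\<^sup>+y. indicator U y \<partial>M)"
    proof (rule nn_integral_mono)
      fix y assume "y \<in> space M"
      then have y: "y \<in> carrier G" by simp
      show "ennreal (?f y) \<le> indicator U y"
      proof (cases "y \<in> U")
        case True
        then show ?thesis
          using f(3)[of "y \<otimes> inv s"] by (simp add: ennreal_le_1)
      next
        case False
        then have "y \<otimes> inv s \<notin> L"
          using L(1) y s by (auto simp: m_assoc)
        then show ?thesis
          using L(2) y s by simp
      qed
    qed
    also have "\<dots> = emeasure M U"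
      using open_sets[OF U] by simp
    finally show ?thesis
      by (simp add: mult_left_mono)
  qed
  then show ?thesis
    unfolding inner_regular_open[OF op] by (intro SUP_least) blast
qed

lemma sets_right:
  assumes s: "s \<in> carrier G" and A: "A \<in> sets M"
  shows "{t \<in> carrier G. t \<otimes> s \<in> A} \<in> sets M"
proof -
  have "{t \<in> carrier G. t \<otimes> s \<in> A} = (\<lambda>t. t \<otimes> s) -` A \<inter> space M"
    by auto
  then show ?thesis
    using measurable_sets[OF measurable_right[OF s] A] by simp
qed

text \<open>Outer regularity passes from open sets to Borel sets. The modular factor is first
  brought to the left, so that what remains to be shown is a lower bound for the infimum that
  defines \<open>emeasure M A\<close>.\<close>

lemma emeasure_right:
  assumes s: "s \<in> carrier G" and A: "A \<in> sets M"
  shows "emeasure M {t \<in> carrier G. t \<otimes> s \<in> A} \<le> ennreal (modular s) * emeasure M A"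
proof -
  let ?m = "ennreal (modular s)"
  let ?A = "{t \<in> carrier G. t \<otimes> s \<in> A}"
  have m: "?m * ennreal (1 / modular s) = 1"
  proof -
    have "?m * ennreal (1 / modular s) = ennreal (modular s * (1 / modular s))"
      using modular_pos[OF s] by (intro ennreal_mult[symmetric]) auto
    then show ?thesis
      using modular_pos[OF s] by simp
  qed
  then have m': "ennreal (1 / modular s) * ?m = 1"
    by (simp only: mult.commute)
  have "ennreal (1 / modular s) * emeasure M ?A \<le> emeasure M U" if U: "openin T U" "A \<subseteq> U" for U
  proof -
    have "emeasure M ?A \<le> emeasure M {t \<in> carrier G. t \<otimes> s \<in> U}"
      using U sets_right[OF s open_sets[OF U(1)]] by (intro emeasure_mono) auto
    also have "\<dots> \<le> ?m * emeasure M U"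
      by (rule emeasure_right_open[OF s U(1)])
    finally have "ennreal (1 / modular s) * emeasure M ?A \<le> ennreal (1 / modular s) * (?m * emeasure M U)"
      by (rule mult_left_mono) simp
    also have "\<dots> = emeasure M U"
      unfolding mult.assoc[symmetric] m' by simp
    finally show ?thesis .
  qed
  then have "ennreal (1 / modular s) * emeasure M ?A \<le> emeasure M A"
    unfolding outer_regular[OF A] by (intro INF_greatest) blast
  then have "?m * (ennreal (1 / modular s) * emeasure M ?A) \<le> ?m * emeasure M A"
    by (rule mult_left_mono) simp
  then show ?thesis
    unfolding mult.assoc[symmetric] m by simp
qed

text \<open>The image of \<open>M\<close> under right translation is dominated, as a measure, by a
  multiple of \<open>M\<close>.\<close>

lemma nn_integral_right:
  assumes s: "s \<in> carrier G" and h: "h \<in> borel_measurable M"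
  shows "(\<integral>\<^sup>+t. h (t \<otimes> s) \<partial>M) \<le> ennreal (modular s) * (\<integral>\<^sup>+t. h t \<partial>M)"
proof -
  let ?N = "distr M M (\<lambda>t. t \<otimes> s)"
  have "emeasure ?N A \<le> emeasure (scale_measure (ennreal (modular s)) M) A" for A
  proof (cases "A \<in> sets M")
    case True
    have "(\<lambda>t. t \<otimes> s) -` A \<inter> carrier G = {t \<in> carrier G. t \<otimes> s \<in> A}"
      by auto
    then show ?thesis
      using emeasure_right[OF s True] by (simp add: emeasure_distr[OF measurable_right[OF s] True])
  qed (simp add: emeasure_notin_sets)
  then have "?N \<le> scale_measure (ennreal (modular s)) M"
    by (simp add: le_measure_iff le_fun_def space_scale_measure)
  then have "(\<integral>\<^sup>+t. h t \<partial>?N) \<le> (\<integral>\<^sup>+t. h t \<partial>scale_measure (ennreal (modular s)) M)"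
    by (intro nn_integral_mono_measure) simp_all
  then show ?thesis
    using h by (simp add: nn_integral_distr[OF measurable_right[OF s]] nn_integral_scale_measure)
qed

text \<open>Right translations map null sets to null sets. This makes \<open>right_regular\<close>
  independent of the representatives chosen by \<open>rep\<close>.\<close>

lemma AE_right:
  assumes s: "s \<in> carrier G" and P: "AE t in M. P t"
  shows "AE t in M. P (t \<otimes> s)"
proof -
  obtain N where N: "N \<in> null_sets M" "{t \<in> space M. \<not> P t} \<subseteq> N"
    using P by (auto simp: eventually_ae_filter)
  have "emeasure M {t \<in> carrier G. t \<otimes> s \<in> N} \<le> 0"
    using emeasure_right[OF s, of N] N(1) by (simp add: null_sets_def)
  then have "{t \<in> carrier G. t \<otimes> s \<in> N} \<in> null_sets M"
    using sets_right[OF s] N(1) by (auto simp: null_sets_def)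
  then show ?thesis
    by (rule AE_I') (use N s in auto)
qed

lemma integrable_right:
  fixes h :: "'a \<Rightarrow> real"
  assumes s: "s \<in> carrier G" and h: "integrable M h" and nn: "\<And>t. 0 \<le> h t"
  shows "integrable M (\<lambda>t. h (t \<otimes> s))"
    and "(\<integral>t. h (t \<otimes> s) \<partial>M) \<le> modular s * (\<integral>t. h t \<partial>M)"
proof -
  have meas: "(\<lambda>t. h (t \<otimes> s)) \<in> borel_measurable M"
    using measurable_compose[OF measurable_right[OF s]] h by blast
  have le: "(\<integral>\<^sup>+t. ennreal (h (t \<otimes> s)) \<partial>M) \<le> ennreal (modular s * (\<integral>t. h t \<partial>M))"
    using nn_integral_right[OF s, of "\<lambda>t. ennreal (h t)"] h nn modular_pos[OF s]
    by (simp add: nn_integral_eq_integral ennreal_mult')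
  show int: "integrable M (\<lambda>t. h (t \<otimes> s))"
    by (rule integrableI_nonneg[OF meas]) (simp_all add: nn le_less_trans[OF le ennreal_less_top])
  show "(\<integral>t. h (t \<otimes> s) \<partial>M) \<le> modular s * (\<integral>t. h t \<partial>M)"
    using le nn modular_pos[OF s] h
    by (simp add: nn_integral_eq_integral[OF int] ennreal_le_iff)
qed

section \<open>Regularity on sets of finite measure\<close>

lemma emeasure_finite_subset:
  "A \<subseteq> B \<Longrightarrow> B \<in> sets M \<Longrightarrow> emeasure M B < \<infinity> \<Longrightarrow> emeasure M A < \<infinity>"
  by (rule le_less_trans[OF emeasure_mono])

lemma fmeasurable_subset:
  "A \<in> sets M \<Longrightarrow> A \<subseteq> B \<Longrightarrow> B \<in> sets M \<Longrightarrow> emeasure M B < \<infinity> \<Longrightarrow> A \<in> fmeasurable M"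
  unfolding fmeasurable_def using emeasure_finite_subset[of A B] by blast

lemma finite_outer:
  assumes A: "A \<in> sets M" "emeasure M A < \<infinity>" and e: "0 < e"
  obtains U where "openin T U" "A \<subseteq> U" "emeasure M U < \<infinity>" "measure M (U - A) < e"
proof -
  have "emeasure M A < emeasure M A + ennreal e"
    using A(2) e by (simp add: ennreal_add_left_cancel_less)
  then have "(INF U\<in>{U. openin T U \<and> A \<subseteq> U}. emeasure M U) < emeasure M A + ennreal e"
    using outer_regular[OF A(1)] by simp
  then obtain U where U: "openin T U" "A \<subseteq> U" "emeasure M U < emeasure M A + ennreal e"
    unfolding INF_less_iff by blast
  have fin: "emeasure M U < \<infinity>"
    using U(3) A(2) by (metis ennreal_less_top ennreal_add_less_top infinity_ennreal_def order_less_trans)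
  have "measure M U < measure M A + e"
  proof -
    have "emeasure M A + ennreal e = ennreal (measure M A + e)"
      using A(2) e by (simp add: emeasure_eq_ennreal_measure ennreal_plus less_top)
    then show ?thesis
      using U(3) fin by (simp add: emeasure_eq_ennreal_measure less_top ennreal_less_iff)
  qed
  then have "measure M (U - A) < e"
    using measure_Diff[OF _ open_sets[OF U(1)] A(1) U(2)] fin by simp
  then show ?thesis
    using that U fin by blast
qed

text \<open>Inner regularity is given on open sets only. Take a compact \<open>L\<close> filling
  most of an open \<open>U\<close> around \<open>A\<close>, and remove an open set \<open>W\<close>
  of small measure that covers \<open>U - A\<close>; then \<open>L - W\<close> is compact and
  contained in \<open>A\<close>.\<close>

lemma finite_inner:
  assumes A: "A \<in> sets M" "emeasure M A < \<infinity>" and e: "0 < e"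
  obtains K where "compactin T K" "K \<subseteq> A" "measure M (A - K) < e"
proof -
  \<comment> \<open>One third is lost in \<open>U - L\<close>, and two thirds in \<open>W\<close>,
    which is \<open>U - A\<close> together with the excess of \<open>W\<close> over it.\<close>
  define d where "d = e / 3"
  have d: "0 < d" using e by (simp add: d_def)
  obtain U where U: "openin T U" "A \<subseteq> U" "emeasure M U < \<infinity>" "measure M (U - A) < d"
    using finite_outer[OF A d] .
  \<comment> \<open>When the measure of \<open>U\<close> is below \<open>d\<close> the target is
    negative, \<open>ennreal\<close> would truncate it to 0, and the empty set already
    serves.\<close>
  have "\<exists>L. compactin T L \<and> L \<subseteq> U \<and> measure M U - d < measure M L"
  proof (cases "measure M U < d")
    case True
    then show ?thesis
      by (intro exI[of _ "{}"]) auto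
  next
    case False
    have "ennreal (measure M U - d) < emeasure M U"
      using U(3) False d by (simp add: emeasure_eq_ennreal_measure less_top ennreal_less_iff)
    then have "ennreal (measure M U - d) < (SUP K\<in>{K. compactin T K \<and> K \<subseteq> U}. emeasure M K)"
      using inner_regular_open[OF U(1)] by simp
    then obtain L where L: "compactin T L" "L \<subseteq> U" "ennreal (measure M U - d) < emeasure M L"
      unfolding less_SUP_iff by blast
    then have "measure M U - d < measure M L"
      using compact_finite[OF L(1)] False
      by (simp add: emeasure_eq_ennreal_measure less_top ennreal_less_iff)
    then show ?thesis using L by blast
  qed
  then obtain L where L: "compactin T L" "L \<subseteq> U" "measure M U - d < measure M L"
    by blast
  have Us: "U \<in> sets M" and Ls: "L \<in> sets M"
    using open_sets U(1) compact_sets L(1) by auto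
  have UA: "U - A \<in> sets M" "emeasure M (U - A) < \<infinity>"
    using Us A(1) by blast (rule emeasure_finite_subset[OF Diff_subset Us U(3)])
  obtain W where W: "openin T W" "U - A \<subseteq> W" "emeasure M W < \<infinity>" "measure M (W - (U - A)) < d"
    using finite_outer[OF UA d] .
  have Ws: "W \<in> sets M" using open_sets W(1) .
  show ?thesis
  proof (rule that[of "L - W"])
    show "compactin T (L - W)"
    proof (rule closed_compactin[OF L(1)])
      show "closedin T (L - W)"
        using compact_closed[OF L(1)] W(1) by (rule closedin_diff)
    qed simp
    show "L - W \<subseteq> A"
      using L(2) W(2) by auto
    have "measure M (A - (L - W)) \<le> measure M ((U - L) \<union> W)"
    proof (rule measure_mono_fmeasurable)
      have "U - L \<in> fmeasurable M" "W \<in> fmeasurable M"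
        using Us Ls Ws W(3) U(3) by (auto intro: fmeasurable_subset[of "U - L" U] fmeasurable_subset[of W W])
      then show "(U - L) \<union> W \<in> fmeasurable M"
        by (rule fmeasurable.Un)
      show "A - (L - W) \<in> sets M"
        using A(1) Ls Ws by blast
    qed (use U(2) in blast)
    also have "\<dots> \<le> measure M (U - L) + measure M W"
      using Us Ls Ws by (intro measure_Un_le) auto
    also have "measure M (U - L) < d"
      using measure_Diff[OF _ Us Ls L(2)] U(3) L(3) by simp
    also have "measure M W < 2 * d"
      using measure_Diff[OF _ Ws UA(1) W(2)] W(3,4) U(4) by simp
    finally show "measure M (A - (L - W)) < e"
      by (simp add: d_def)
  qed
qed

lemma positive_compact_subset:
  assumes A: "A \<in> sets M" "0 < emeasure M A" "emeasure M A < \<infinity>"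
  obtains K where "compactin T K" "K \<subseteq> A" "0 < emeasure M K"
proof -
  have m: "0 < measure M A"
    using A by (simp add: measure_def enn2real_positive_iff)
  obtain K where K: "compactin T K" "K \<subseteq> A" "measure M (A - K) < measure M A"
    using finite_inner[OF A(1,3) m] .
  have "0 < measure M K"
    using measure_Diff[OF _ A(1) compact_sets[OF K(1)] K(2)] A(3) K(3) by simp
  then show ?thesis
    using that[OF K(1,2)] by (auto simp: measure_def enn2real_positive_iff)
qed

text \<open>The compact set \<open>L\<close> carries the approximants for all \<open>e\<close> at
  once. \<open>ergodic_compact\<close> depends on this to keep its set \<open>Q\<close> fixed while
  \<open>e\<close> tends to zero.\<close>

lemma compact_approx_Cc:
  assumes A: "compactin T A"
  obtains L where "compactin T L"
    "\<And>e. 0 < e \<Longrightarrow> \<exists>f\<in>Cc. (\<forall>x. 0 \<le> f x \<and> f x \<le> 1) \<and> (\<forall>x\<in>A. f x = 1) \<and>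
       (\<forall>x\<in>carrier G - L. f x = 0) \<and> (\<integral>x. f x - indicator A x \<partial>M) < e"
proof -
  obtain V L where VL: "openin T V" "compactin T L" "A \<subseteq> V" "V \<subseteq> L"
  proof -
    have "openin T (carrier G)"
      using openin_topspace[of T] by simp
    from compact_nbhd[OF A this compact_carrier[OF A]] show ?thesis
      using that by metis
  qed
  have "\<exists>f\<in>Cc. (\<forall>x. 0 \<le> f x \<and> f x \<le> 1) \<and> (\<forall>x\<in>A. f x = 1) \<and>
       (\<forall>x\<in>carrier G - L. f x = 0) \<and> (\<integral>x. f x - indicator A x \<partial>M) < e" if e: "0 < e" for e
  proof -
    obtain U where U: "openin T U" "A \<subseteq> U" "emeasure M U < \<infinity>" "measure M (U - A) < e"
      using finite_outer[OF compact_sets[OF A] compact_finite[OF A] e] .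
    obtain f Q where f: "f \<in> Cc" "\<And>x. 0 \<le> f x" "\<And>x. f x \<le> 1" "\<And>x. x \<in> A \<Longrightarrow> f x = 1"
      and "compactin T Q"
      and Q: "Q \<subseteq> U \<inter> V" "\<And>x. x \<in> carrier G \<Longrightarrow> x \<notin> Q \<Longrightarrow> f x = 0"
      by (rule urysohn_Cc[OF A openin_Int[OF U(1) VL(1)] Int_greatest[OF U(2) VL(3)]]) (rule that)
    have UAs: "U - A \<in> sets M" "emeasure M (U - A) < \<infinity>"
      using open_sets[OF U(1)] compact_sets[OF A]
      by blast (rule emeasure_finite_subset[OF Diff_subset open_sets[OF U(1)] U(3)])
    have "(\<integral>x. f x - indicator A x \<partial>M) \<le> (\<integral>x. indicator (U - A) x \<partial>M)"
    proof (rule integral_mono)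
      show "integrable M (\<lambda>x. f x - indicator A x)"
        using Cc_integrable[OF f(1)] compact_sets[OF A] compact_finite[OF A] by simp
      show "integrable M (\<lambda>x. indicator (U - A) x :: real)"
        using UAs by simp
      fix x assume "x \<in> space M"
      then show "f x - indicator A x \<le> indicator (U - A) x"
        using f(3)[of x] f(4)[of x] Q(1) Q(2)[of x] by (cases "x \<in> Q") (auto simp: indicator_def)
    qed
    also have "\<dots> = measure M (U - A)"
      using UAs by simp
    finally have "(\<integral>x. f x - indicator A x \<partial>M) < e"
      using U(4) by simp
    moreover have "\<forall>x\<in>carrier G - L. f x = 0"
      using Q VL(4) by blast
    ultimately show ?thesis
      using f by (intro bexI[of _ f]) auto
  qed
  then show ?thesis
    using that VL(2) by blast
qed

text \<open>Integrating \<open>\<phi> t * \<psi> (t \<otimes> s)\<close> over both variables gives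
  the product of the integrals of \<open>\<phi>\<close> and \<open>\<psi>\<close>, which is at least
  \<open>measure M A * measure M B\<close>. If all overlaps of \<open>A\<close> with translates of
  \<open>B\<close> were null, the inner integral would be at most \<open>e * (1 + C)\<close> on
  \<open>Q\<close> and zero elsewhere, which is absurd for small \<open>e\<close>.\<close>

lemma ergodic_compact:
  assumes A: "compactin T A" "0 < emeasure M A" and B: "compactin T B" "0 < emeasure M B"
  shows "\<exists>s\<in>carrier G. 0 < emeasure M {t \<in> A. t \<otimes> s \<in> B}"
proof (rule ccontr)
  assume "\<not> ?thesis"
  then have null: "emeasure M {t \<in> A. t \<otimes> s \<in> B} = 0" if "s \<in> carrier G" for s
    using that by auto
  obtain KA where KA: "compactin T KA" "\<And>e. 0 < e \<Longrightarrow> \<exists>f\<in>Cc. (\<forall>x. 0 \<le> f x \<and> f x \<le> 1) \<and> (\<forall>x\<in>A. f x = 1) \<and>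
       (\<forall>x\<in>carrier G - KA. f x = 0) \<and> (\<integral>x. f x - indicator A x \<partial>M) < e"
    by (rule compact_approx_Cc[OF A(1)]) (rule that)
  obtain KB where KB: "compactin T KB" "\<And>e. 0 < e \<Longrightarrow> \<exists>f\<in>Cc. (\<forall>x. 0 \<le> f x \<and> f x \<le> 1) \<and> (\<forall>x\<in>B. f x = 1) \<and>
       (\<forall>x\<in>carrier G - KB. f x = 0) \<and> (\<integral>x. f x - indicator B x \<partial>M) < e"
    by (rule compact_approx_Cc[OF B(1)]) (rule that)
  \<comment> \<open>Only translations in \<open>Q\<close> can bring a point of \<open>KA\<close>
    into \<open>KB\<close>.\<close>
  define Q where "Q = (\<lambda>x. inv x) ` KA <#> KB"
  have Q: "compactin T Q"
    unfolding Q_def by (intro compact_set_mult compact_inv_image KA KB)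
  have Qmem: "s \<in> Q" if "s \<in> carrier G" "t \<in> carrier G" "t \<in> KA" "t \<otimes> s \<in> KB" for s t
  proof -
    have "s = inv t \<otimes> (t \<otimes> s)"
      using that by (simp add: m_assoc[symmetric])
    then show ?thesis
      unfolding Q_def set_mult_def using that by blast
  qed
  obtain C where C: "0 < C" "\<And>s. s \<in> Q \<Longrightarrow> modular s \<le> C"
    using modular_bounded[OF Q] by metis
  have indA: "integrable M (\<lambda>x. indicator A x :: real)" "(\<integral>x. indicator A x \<partial>M) = measure M A"
    using compact_sets[OF A(1)] compact_finite[OF A(1)] by simp_all
  have indB: "integrable M (\<lambda>x. indicator B x :: real)" "(\<integral>x. indicator B x \<partial>M) = measure M B"
    using compact_sets[OF B(1)] compact_finite[OF B(1)] by simp_all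
  have indQ: "integrable M (\<lambda>x. indicator Q x :: real)" "(\<integral>x. indicator Q x \<partial>M) = measure M Q"
    using compact_sets[OF Q] compact_finite[OF Q] by simp_all
  have main: "measure M A * measure M B \<le> e * ((1 + C) * measure M Q)" if e: "0 < e" for e
  proof -
    from KA(2)[OF e] obtain \<phi> where "\<phi> \<in> Cc" and le: "\<forall>x. 0 \<le> \<phi> x \<and> \<phi> x \<le> 1" and
      "\<forall>x\<in>A. \<phi> x = 1" "\<forall>x\<in>carrier G - KA. \<phi> x = 0" "(\<integral>x. \<phi> x - indicator A x \<partial>M) < e"
      by blast
    then have \<phi>: "\<phi> \<in> Cc" "\<And>x. 0 \<le> \<phi> x" "\<And>x. \<phi> x \<le> 1" "\<And>x. x \<in> A \<Longrightarrow> \<phi> x = 1"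
      "\<And>x. x \<in> carrier G \<Longrightarrow> x \<notin> KA \<Longrightarrow> \<phi> x = 0" "(\<integral>x. \<phi> x - indicator A x \<partial>M) < e"
      by auto
    from KB(2)[OF e] obtain \<psi> where "\<psi> \<in> Cc" and le: "\<forall>x. 0 \<le> \<psi> x \<and> \<psi> x \<le> 1" and
      "\<forall>x\<in>B. \<psi> x = 1" "\<forall>x\<in>carrier G - KB. \<psi> x = 0" "(\<integral>x. \<psi> x - indicator B x \<partial>M) < e"
      by blast
    then have \<psi>: "\<psi> \<in> Cc" "\<And>x. 0 \<le> \<psi> x" "\<And>x. \<psi> x \<le> 1" "\<And>x. x \<in> B \<Longrightarrow> \<psi> x = 1"
      "\<And>x. x \<in> carrier G \<Longrightarrow> x \<notin> KB \<Longrightarrow> \<psi> x = 0" "(\<integral>x. \<psi> x - indicator B x \<partial>M) < e"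
      by auto
    note cont = continuous_map_fst continuous_map_snd continuous_mult
      continuous_comp[OF Cc_continuous[OF \<phi>(1)]] continuous_comp[OF Cc_continuous[OF \<psi>(1)]] continuous_map_real_mult
    have F: "continuous_map (prod_topology T T) euclidean (\<lambda>z. \<phi> (fst z) * \<psi> (fst z \<otimes> snd z))"
      by (intro cont)
    have Z: "\<phi> t * \<psi> (t \<otimes> s) = 0" if "t \<in> carrier G" "s \<in> carrier G" "t \<notin> KA \<or> s \<notin> Q" for t s
      using that \<phi>(5)[of t] \<psi>(5)[of "t \<otimes> s"] Qmem[of s t] by auto
    note fub = fubini_Cc[OF F KA(1) Q Z]
    have "measure M A \<le> (\<integral>x. \<phi> x \<partial>M)"
    proof -
      have "indicator A x \<le> \<phi> x" for x
        using \<phi>(2,4)[of x] by (auto simp: indicator_def)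
      then show ?thesis
        unfolding indA(2)[symmetric] by (intro integral_mono indA(1) Cc_integrable \<phi>(1))
    qed
    moreover have "measure M B \<le> (\<integral>x. \<psi> x \<partial>M)"
    proof -
      have "indicator B x \<le> \<psi> x" for x
        using \<psi>(2,4)[of x] by (auto simp: indicator_def)
      then show ?thesis
        unfolding indB(2)[symmetric] by (intro integral_mono indB(1) Cc_integrable \<psi>(1))
    qed
    ultimately have "measure M A * measure M B \<le> (\<integral>x. \<phi> x \<partial>M) * (\<integral>x. \<psi> x \<partial>M)"
      using \<phi>(2) by (intro mult_mono) (auto intro!: Bochner_Integration.integral_nonneg)
    also have "\<dots> = (\<integral>t. \<phi> t * (\<integral>s. \<psi> s \<partial>M) \<partial>M)"
      by simp
    also have "\<dots> = (\<integral>t. (\<integral>s. \<phi> t * \<psi> (t \<otimes> s) \<partial>M) \<partial>M)"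
      using integral_left[OF _ Cc_measurable[OF \<psi>(1)]]
      by (intro Bochner_Integration.integral_cong[OF refl]) simp
    also have "\<dots> = (\<integral>s. (\<integral>t. \<phi> t * \<psi> (t \<otimes> s) \<partial>M) \<partial>M)"
      by (rule fub(3))
    also have "\<dots> \<le> (\<integral>s. e * (1 + C) * indicator Q s \<partial>M)"
    proof (rule integral_mono)
      show "integrable M (\<lambda>s. \<integral>t. \<phi> t * \<psi> (t \<otimes> s) \<partial>M)"
        using Cc_integrable[OF fub(2)] .
      show "integrable M (\<lambda>s. e * (1 + C) * indicator Q s)"
        using indQ by simp
      fix s assume "s \<in> space M"
      then have s: "s \<in> carrier G" by simp
      show "(\<integral>t. \<phi> t * \<psi> (t \<otimes> s) \<partial>M) \<le> e * (1 + C) * indicator Q s"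
      proof (cases "s \<in> Q")
        case False
        have "(\<integral>t. \<phi> t * \<psi> (t \<otimes> s) \<partial>M) = (\<integral>t. 0 \<partial>M)"
          using Z s False by (intro Bochner_Integration.integral_cong[OF refl]) auto
        then show ?thesis using False by simp
      next
        case True
        let ?N = "{t \<in> A. t \<otimes> s \<in> B}"
        have Ns: "?N \<in> sets M"
        proof -
          have "?N = A \<inter> {t \<in> carrier G. t \<otimes> s \<in> B}"
            using compact_carrier[OF A(1)] by auto
          then show ?thesis
            using compact_sets[OF A(1)] sets_right[OF s compact_sets[OF B(1)]] by auto
        qed
        have nn: "0 \<le> \<psi> t - indicator B t" for t
          using \<psi>(2,4)[of t] by (auto simp: indicator_def)
        have int\<psi>: "integrable M (\<lambda>t. \<psi> t - indicator B t)"
          using Cc_integrable[OF \<psi>(1)] indB by simp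
        note ir = integrable_right[OF s int\<psi> nn]
        have int1: "integrable M (\<lambda>t. (\<phi> t - indicator A t) + (\<psi> (t \<otimes> s) - indicator B (t \<otimes> s)))"
          by (rule Bochner_Integration.integrable_add[OF
                Bochner_Integration.integrable_diff[OF Cc_integrable[OF \<phi>(1)] indA(1)] ir(1)])
        have "AE t in M. t \<notin> ?N"
          using Ns null[OF s] AE_not_in[OF null_setsI[of M ?N]] by simp
        \<comment> \<open>Off the null set \<open>?N\<close> either \<open>t\<close> misses
          \<open>A\<close> or \<open>t \<otimes> s\<close> misses \<open>B\<close>; the product is
          at most either factor, and the factor belonging to the missed set equals its excess over
          the indicator.\<close>
        then have ae: "AE t in M. \<phi> t * \<psi> (t \<otimes> s) \<le> (\<phi> t - indicator A t) + (\<psi> (t \<otimes> s) - indicator B (t \<otimes> s))"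
        proof eventually_elim
          case (elim t)
          have b: "\<phi> t * \<psi> (t \<otimes> s) \<le> \<phi> t" "\<phi> t * \<psi> (t \<otimes> s) \<le> \<psi> (t \<otimes> s)"
            using \<phi>(2,3)[of t] \<psi>(2,3)[of "t \<otimes> s"] mult_left_le[of "\<psi> (t \<otimes> s)" "\<phi> t"]
              mult_left_le_one_le[of "\<psi> (t \<otimes> s)" "\<phi> t"] by auto
          show ?case
            using elim b \<phi>(2)[of t] \<phi>(4)[of t] \<psi>(2)[of "t \<otimes> s"] \<psi>(4)[of "t \<otimes> s"]
            by (auto simp: indicator_def)
        qed
        have "(\<integral>t. \<phi> t * \<psi> (t \<otimes> s) \<partial>M) \<le>
            (\<integral>t. (\<phi> t - indicator A t) + (\<psi> (t \<otimes> s) - indicator B (t \<otimes> s)) \<partial>M)"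
        proof (rule integral_mono_AE[OF _ int1 ae])
          show "integrable M (\<lambda>t. \<phi> t * \<psi> (t \<otimes> s))"
            using Cc_integrable[OF Cc_mult[OF Cc_right_translate[OF \<psi>(1) s] Cc_continuous[OF \<phi>(1)]]] .
        qed
        also have "\<dots> = (\<integral>t. \<phi> t - indicator A t \<partial>M) + (\<integral>t. \<psi> (t \<otimes> s) - indicator B (t \<otimes> s) \<partial>M)"
          by (rule Bochner_Integration.integral_add[OF
                Bochner_Integration.integrable_diff[OF Cc_integrable[OF \<phi>(1)] indA(1)] ir(1)])
        also have "\<dots> \<le> e + C * e"
        proof (rule add_mono)
          have "(\<integral>t. \<psi> (t \<otimes> s) - indicator B (t \<otimes> s) \<partial>M) \<le> modular s * (\<integral>t. \<psi> t - indicator B t \<partial>M)"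
            by (rule ir(2))
          also have "\<dots> \<le> C * e"
            using C(2)[OF True] \<psi>(6) C(1) nn
            by (intro mult_mono) (auto intro!: Bochner_Integration.integral_nonneg)
          finally show "(\<integral>t. \<psi> (t \<otimes> s) - indicator B (t \<otimes> s) \<partial>M) \<le> C * e" .
        qed (use \<phi>(6) in simp)
        finally show ?thesis
          using True by (simp add: algebra_simps)
      qed
    qed
    also have "\<dots> = e * ((1 + C) * measure M Q)"
      using indQ by simp
    finally show ?thesis .
  qed
  have pos: "0 < measure M A * measure M B"
    using A B compact_finite by (simp add: measure_def enn2real_positive_iff)
  define c where "c = (1 + C) * measure M Q"
  have c: "0 \<le> c" using C(1) by (simp add: c_def)
  have "measure M A * measure M B \<le> measure M A * measure M B / (2 * (c + 1)) * c"
    using main[of "measure M A * measure M B / (2 * (c + 1))"] pos c by (simp add: c_def)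
  also have "\<dots> < measure M A * measure M B"
  proof -
    have "c / (2 * (c + 1)) < 1"
      using c by (simp add: field_simps)
    then have "(measure M A * measure M B) * (c / (2 * (c + 1))) < (measure M A * measure M B) * 1"
      by (rule mult_strict_left_mono) (rule pos)
    then show ?thesis by simp
  qed
  finally show False by simp
qed

lemma ergodic:
  assumes A: "A \<in> sets M" "0 < emeasure M A" "emeasure M A < \<infinity>"
    and B: "B \<in> sets M" "0 < emeasure M B" "emeasure M B < \<infinity>"
  obtains s where "s \<in> carrier G" "{t \<in> A. t \<otimes> s \<in> B} \<in> sets M" "0 < emeasure M {t \<in> A. t \<otimes> s \<in> B}"
proof -
  obtain K where K: "compactin T K" "K \<subseteq> A" "0 < emeasure M K"
    using positive_compact_subset[OF A] .
  obtain L where L: "compactin T L" "L \<subseteq> B" "0 < emeasure M L"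
    using positive_compact_subset[OF B] .
  obtain s where s: "s \<in> carrier G" "0 < emeasure M {t \<in> K. t \<otimes> s \<in> L}"
    using ergodic_compact[OF K(1,3) L(1,3)] by blast
  have "{t \<in> A. t \<otimes> s \<in> B} = A \<inter> {t \<in> carrier G. t \<otimes> s \<in> B}"
    using sets.sets_into_space[OF A(1)] by auto
  then have Ns: "{t \<in> A. t \<otimes> s \<in> B} \<in> sets M"
    using A(1) sets_right[OF s(1) B(1)] by auto
  have "emeasure M {t \<in> K. t \<otimes> s \<in> L} \<le> emeasure M {t \<in> A. t \<otimes> s \<in> B}"
    using K(2) L(2) by (intro emeasure_mono Ns) auto
  from that[OF s(1) Ns less_le_trans[OF s(2) this]] show ?thesis .
qed

text \<open>The tube lemma provides a neighbourhood \<open>U\<close> of the identity that moves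
  \<open>K\<close> only inside an open \<open>W\<close> of slightly larger measure. The second
  estimate follows from the first because \<open>K\<close> and its left translate have equal finite
  measure.\<close>

lemma translate_compact_small:
  assumes K: "compactin T K" and e: "0 < e"
  obtains U where "openin T U" "\<one> \<in> U"
    "\<And>s. s \<in> U \<Longrightarrow> measure M ({t \<in> carrier G. inv s \<otimes> t \<in> K} - K) < e"
    "\<And>s. s \<in> U \<Longrightarrow> measure M (K - {t \<in> carrier G. inv s \<otimes> t \<in> K}) < e"
proof -
  note Ks = compact_sets[OF K] and Kf = compact_finite[OF K] and Kc = compact_carrier[OF K]
  obtain W where W: "openin T W" "K \<subseteq> W" "emeasure M W < \<infinity>" "measure M (W - K) < e"
    using finite_outer[OF Ks Kf e] .
  define Z where "Z = {z \<in> topspace (prod_topology T T). fst z \<otimes> snd z \<in> W}"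
  have "continuous_map (prod_topology T T) T (\<lambda>z. fst z \<otimes> snd z)"
    by (intro continuous_mult continuous_map_fst continuous_map_snd)
  then have "openin (prod_topology T T) Z"
    unfolding Z_def by (rule openin_continuous_map_preimage) (rule W(1))
  moreover have "{\<one>} \<times> K \<subseteq> Z"
    using W(2) Kc by (auto simp: Z_def subset_iff)
  ultimately obtain U V where UV: "openin T U" "\<one> \<in> U" "K \<subseteq> V" "U \<times> V \<subseteq> Z"
    using tube_lemma_right[OF _ K, of T Z \<one>] by auto
  have 1: "measure M ({t \<in> carrier G. inv s \<otimes> t \<in> K} - K) < e"
    and 2: "measure M (K - {t \<in> carrier G. inv s \<otimes> t \<in> K}) < e" if s: "s \<in> U" for s
  proof -
    have sG: "s \<in> carrier G"
      using s open_carrier[OF UV(1)] by blast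
    let ?K = "{t \<in> carrier G. inv s \<otimes> t \<in> K}"
    have K's: "?K \<in> sets M" "emeasure M ?K = emeasure M K"
      using emeasure_left[OF _ Ks, of "inv s"] sG by auto
    have "?K \<subseteq> W"
    proof
      fix t assume t: "t \<in> ?K"
      then have "(s, inv s \<otimes> t) \<in> Z"
        using UV s by blast
      then show "t \<in> W"
        using t sG by (simp add: Z_def m_assoc[symmetric])
    qed
    then have "measure M (?K - K) \<le> measure M (W - K)"
    proof (intro measure_mono_fmeasurable)
      show "W - K \<in> fmeasurable M"
        using open_sets[OF W(1)] Ks W(3) by (intro fmeasurable_subset[of "W - K" W]) auto
    qed (use Ks K's(1) in auto)
    then show 1: "measure M (?K - K) < e"
      using W(4) by simp
    have "measure M (B - C) = measure M B - measure M (B \<inter> C)"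
      if "B \<in> sets M" "C \<in> sets M" "emeasure M B < \<infinity>" for B C
    proof -
      have "B - B \<inter> C = B - C" by blast
      then show ?thesis
        using measure_Diff[of M B "B \<inter> C"] that by (simp add: less_top)
    qed
    from this[of ?K K] this[of K ?K]
    have "measure M (?K - K) = measure M ?K - measure M (?K \<inter> K)"
      "measure M (K - ?K) = measure M K - measure M (?K \<inter> K)"
      using K's Ks Kf by (auto simp: Int_commute)
    moreover have "measure M ?K = measure M K"
      unfolding measure_def K's(2) ..
    ultimately show "measure M (K - ?K) < e"
      using 1 by linarith
  qed
  show ?thesis
    using that[OF UV(1,2) 1 2] .
qed

end

subsection \<open>Regular representations and convolvers\<close>

locale haar_Lp = haar_group +
  fixes p :: real
  assumes p: "1 < p"
begin

abbreviation "q \<equiv> conjugate_exponent p"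
abbreviation "E \<equiv> Lp M p"
abbreviation "LF \<equiv> Lp_functions M p"
abbreviation "cls \<equiv> ae_class M"

sublocale P: normed_pairing "Lp M p" "Lp M (conjugate_exponent p)" "Lp_pairing M"
  by (rule normed_pairing_Lp[OF p])

lemmas bm = Lp_functionsD(1)

lemma measurable_left_comp: "s \<in> carrier G \<Longrightarrow> f \<in> borel_measurable M \<Longrightarrow> (\<lambda>t. f (s \<otimes> t)) \<in> borel_measurable M"
  by (rule measurable_compose[OF measurable_left])

lemma measurable_right_comp: "s \<in> carrier G \<Longrightarrow> f \<in> borel_measurable M \<Longrightarrow> (\<lambda>t. f (t \<otimes> s)) \<in> borel_measurable M"
  by (rule measurable_compose[OF measurable_right])

lemma integrable_left:
  fixes f :: "'a \<Rightarrow> real"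
  assumes "s \<in> carrier G" "integrable M f" shows "integrable M (\<lambda>t. f (s \<otimes> t))"
  by (rule integrable_distr[OF measurable_left[OF assms(1)]]) (simp add: distr_left assms)

lemma left_Lp:
  assumes s: "s \<in> carrier G" and f: "f \<in> Lp_functions M r"
  shows "(\<lambda>t. f (s \<otimes> t)) \<in> Lp_functions M r" "Lp_int M r (\<lambda>t. f (s \<otimes> t)) = Lp_int M r f"
proof -
  show "(\<lambda>t. f (s \<otimes> t)) \<in> Lp_functions M r"
    by (rule Lp_functionsI[OF measurable_left_comp[OF s bm[OF f]]])
      (rule integrable_left[OF s Lp_functionsD(2)[OF f]])
  show "Lp_int M r (\<lambda>t. f (s \<otimes> t)) = Lp_int M r f"
    unfolding Lp_int_def
    by (rule integral_left[OF s borel_measurable_integrable[OF Lp_functionsD(2)[OF f]]])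
qed

lemma right_Lp:
  assumes s: "s \<in> carrier G" and f: "f \<in> LF"
  shows "(\<lambda>t. f (t \<otimes> s)) \<in> LF"
  by (rule Lp_functionsI[OF measurable_right_comp[OF s bm[OF f]]])
    (rule integrable_right(1)[OF s Lp_functionsD(2)[OF f] powr_ge_zero])

abbreviation "lreg \<equiv> left_regular G M p"
abbreviation "rreg \<equiv> right_regular G M p"

lemma left_regular_class:
  assumes s: "s \<in> carrier G" and f: "f \<in> LF"
  shows "lreg s (cls f) = cls (\<lambda>t. f (inv s \<otimes> t))"
proof -
  note r = rep_ae_class[OF bm[OF f]]
  have "cls (\<lambda>t. rep (cls f) (inv s \<otimes> t)) = cls (\<lambda>t. f (inv s \<otimes> t))"
    by (intro ae_class_eqI measurable_left_comp AE_left r bm[OF f] inv_closed s)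
  then show ?thesis
    using ae_class_in_Lp[OF f] by (simp add: left_regular_def)
qed

lemma right_regular_class:
  assumes s: "s \<in> carrier G" and f: "f \<in> LF"
  shows "rreg s (cls f) = cls (\<lambda>t. f (t \<otimes> s))"
proof -
  note r = rep_ae_class[OF bm[OF f]]
  have "cls (\<lambda>t. rep (cls f) (t \<otimes> s)) = cls (\<lambda>t. f (t \<otimes> s))"
    by (intro ae_class_eqI measurable_right_comp AE_right r bm[OF f] s)
  then show ?thesis
    using ae_class_in_Lp[OF f] by (simp add: right_regular_def)
qed

lemma left_regular_closed: "s \<in> carrier G \<Longrightarrow> \<xi> \<in> carrier E \<Longrightarrow> lreg s \<xi> \<in> carrier E"
  by (erule Lp_carrierE) (simp add: left_regular_class ae_class_in_Lp left_Lp)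

lemma right_regular_closed: "s \<in> carrier G \<Longrightarrow> \<xi> \<in> carrier E \<Longrightarrow> rreg s \<xi> \<in> carrier E"
  by (erule Lp_carrierE) (simp add: right_regular_class ae_class_in_Lp right_Lp)

lemma regular_linear:
  assumes s: "s \<in> carrier G" and \<xi>: "\<xi> \<in> carrier E"
  shows "\<eta> \<in> carrier E \<Longrightarrow> lreg s (\<xi> \<oplus>\<^bsub>E\<^esub> \<eta>) = lreg s \<xi> \<oplus>\<^bsub>E\<^esub> lreg s \<eta>"
    and "\<eta> \<in> carrier E \<Longrightarrow> rreg s (\<xi> \<oplus>\<^bsub>E\<^esub> \<eta>) = rreg s \<xi> \<oplus>\<^bsub>E\<^esub> rreg s \<eta>"
    and "lreg s (c \<odot>\<^bsub>E\<^esub> \<xi>) = c \<odot>\<^bsub>E\<^esub> lreg s \<xi>"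
    and "rreg s (c \<odot>\<^bsub>E\<^esub> \<xi>) = c \<odot>\<^bsub>E\<^esub> rreg s \<xi>"
proof -
  obtain f where f: "f \<in> LF" "\<xi> = cls f"
    using \<xi> by (rule Lp_carrierE)
  note f' = bm[OF left_Lp(1)[OF inv_closed[OF s] f(1)]] bm[OF right_Lp[OF s f(1)]]
  show "lreg s (c \<odot>\<^bsub>E\<^esub> \<xi>) = c \<odot>\<^bsub>E\<^esub> lreg s \<xi>" "rreg s (c \<odot>\<^bsub>E\<^esub> \<xi>) = c \<odot>\<^bsub>E\<^esub> rreg s \<xi>"
    unfolding f(2) smult_ae_class[OF bm[OF f(1)]] left_regular_class[OF s f(1)] right_regular_class[OF s f(1)]
      smult_ae_class[OF f'(1)] smult_ae_class[OF f'(2)]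
    by (simp_all add: left_regular_class right_regular_class s Lp_functions_smult[OF p f(1)])
  assume "\<eta> \<in> carrier E"
  then obtain g where g: "g \<in> LF" "\<eta> = cls g"
    by (rule Lp_carrierE)
  note g' = bm[OF left_Lp(1)[OF inv_closed[OF s] g(1)]] bm[OF right_Lp[OF s g(1)]]
  show "lreg s (\<xi> \<oplus>\<^bsub>E\<^esub> \<eta>) = lreg s \<xi> \<oplus>\<^bsub>E\<^esub> lreg s \<eta>" "rreg s (\<xi> \<oplus>\<^bsub>E\<^esub> \<eta>) = rreg s \<xi> \<oplus>\<^bsub>E\<^esub> rreg s \<eta>"
    unfolding f(2) g(2) add_ae_class[OF bm[OF f(1)] bm[OF g(1)]] left_regular_class[OF s f(1)]
      right_regular_class[OF s f(1)] left_regular_class[OF s g(1)] right_regular_class[OF s g(1)]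
      add_ae_class[OF f'(1) g'(1)] add_ae_class[OF f'(2) g'(2)]
    by (simp_all add: left_regular_class right_regular_class s Lp_functions_add[OF p f(1) g(1)])
qed

lemma left_regular_norm:
  assumes s: "s \<in> carrier G" and \<xi>: "\<xi> \<in> carrier E"
  shows "mnorm E (lreg s \<xi>) = mnorm E \<xi>"
proof -
  obtain f where f: "f \<in> LF" "\<xi> = cls f"
    using \<xi> by (rule Lp_carrierE)
  show ?thesis
    unfolding f(2) left_regular_class[OF s f(1)] mnorm_ae_class[OF f(1)]
      mnorm_ae_class[OF left_Lp(1)[OF inv_closed[OF s] f(1)]] left_Lp(2)[OF inv_closed[OF s] f(1)] ..
qed

lemma left_regular_extensional: "lreg s \<in> extensional (carrier E)"
  by (simp add: left_regular_def)

lemma left_regular_bounded: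
  assumes s: "s \<in> carrier G" shows "lreg s \<in> bounded_operators E"
proof -
  have "(\<lambda>\<xi>\<in>carrier E. lreg s \<xi>) \<in> bounded_operators E"
    by (rule P.E.bounded_operatorsI[where C = 1])
      (simp_all add: left_regular_closed regular_linear left_regular_norm s)
  then show ?thesis
    using extensional_restrict[OF left_regular_extensional] by simp
qed

lemma left_regular_mult:
  assumes s: "s \<in> carrier G" and t: "t \<in> carrier G" and \<xi>: "\<xi> \<in> carrier E"
  shows "lreg s (lreg t \<xi>) = lreg (s \<otimes> t) \<xi>"
proof -
  obtain f where f: "f \<in> LF" "\<xi> = cls f"
    using \<xi> by (rule Lp_carrierE)
  have ft: "(\<lambda>r. f (inv t \<otimes> r)) \<in> LF"
    using left_Lp(1)[OF inv_closed[OF t] f(1)] .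
  have "lreg s (lreg t \<xi>) = cls (\<lambda>r. f (inv t \<otimes> (inv s \<otimes> r)))"
    unfolding f(2) left_regular_class[OF t f(1)] left_regular_class[OF s ft] ..
  also have "\<dots> = cls (\<lambda>r. f (inv (s \<otimes> t) \<otimes> r))"
  proof (rule ae_class_eqI)
    show "AE r in M. f (inv t \<otimes> (inv s \<otimes> r)) = f (inv (s \<otimes> t) \<otimes> r)"
      using s t by (intro AE_I2) (simp add: inv_mult_group m_assoc)
  qed (use bm[OF left_Lp(1)[OF inv_closed[OF s] ft]] bm[OF left_Lp(1)[OF inv_closed f(1)]] s t in simp_all)
  also have "\<dots> = lreg (s \<otimes> t) \<xi>"
    unfolding f(2) using left_regular_class[OF m_closed[OF s t] f(1)] by simp
  finally show ?thesis .
qed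

lemma left_regular_one:
  assumes \<xi>: "\<xi> \<in> carrier E"
  shows "lreg \<one> \<xi> = \<xi>"
proof -
  obtain f where f: "f \<in> LF" "\<xi> = cls f"
    using \<xi> by (rule Lp_carrierE)
  have "cls (\<lambda>r. f (inv \<one> \<otimes> r)) = cls f"
    by (rule ae_class_eqI[OF bm[OF left_Lp(1)[OF inv_closed[OF one_closed] f(1)]] bm[OF f(1)]])
      (rule AE_I2, simp)
  then show ?thesis
    unfolding f(2) left_regular_class[OF one_closed f(1)] .
qed

lemma left_right_commute:
  assumes s: "s \<in> carrier G" and t: "t \<in> carrier G" and \<xi>: "\<xi> \<in> carrier E"
  shows "lreg s (rreg t \<xi>) = rreg t (lreg s \<xi>)"
proof -
  obtain f where f: "f \<in> LF" "\<xi> = cls f"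
    using \<xi> by (rule Lp_carrierE)
  note l = left_Lp(1)[OF inv_closed[OF s] f(1)] and r = right_Lp[OF t f(1)]
  show ?thesis
    unfolding f(2) left_regular_class[OF s f(1)] right_regular_class[OF t f(1)]
      left_regular_class[OF s r] right_regular_class[OF t l]
  proof (rule ae_class_eqI[OF bm[OF left_Lp(1)[OF inv_closed[OF s] r]] bm[OF right_Lp[OF t l]]])
    show "AE r in M. f (inv s \<otimes> r \<otimes> t) = f (inv s \<otimes> (r \<otimes> t))"
      using s t by (intro AE_I2) (simp add: m_assoc)
  qed
qed

section \<open>The algebra of convolvers\<close>

abbreviation "A \<equiv> CV G M p"

text \<open>Brings \<open>CV\<close> into the form in which \<open>cnormed_module_operators\<close>
  applies.\<close>

lemma CV_eq: "A = operator_algebra E\<lparr>carrier := carrier A\<rparr>"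
  by (simp add: CV_def)

lemma CV_simps:
  "mult A = compose (carrier E)" "one A = (\<lambda>x\<in>carrier E. x)" "zero A = (\<lambda>x\<in>carrier E. \<zero>\<^bsub>E\<^esub>)"
  "add A = (\<lambda>a b. \<lambda>x\<in>carrier E. a x \<oplus>\<^bsub>E\<^esub> b x)" "smult A = (\<lambda>c a. \<lambda>x\<in>carrier E. c \<odot>\<^bsub>E\<^esub> a x)"
  "mnorm A = P.E.opnorm"
  by (simp_all add: CV_def operator_algebra_def P.E.opnorm_def fun_eq_iff)

lemma CV_carrier_iff:
  "a \<in> carrier A \<longleftrightarrow> a \<in> bounded_operators E \<and>
     (\<forall>s\<in>carrier G. \<forall>\<xi>\<in>carrier E. a (rreg s \<xi>) = rreg s (a \<xi>))"
proof -
  have "compose (carrier E) a (rreg s) = compose (carrier E) (rreg s) a \<longleftrightarrow>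
      (\<forall>\<xi>\<in>carrier E. a (rreg s \<xi>) = rreg s (a \<xi>))" for s
    by (auto simp: compose_def restrict_def fun_eq_iff)
  then show ?thesis
    by (simp add: CV_def)
qed

lemma CV_bounded: "a \<in> carrier A \<Longrightarrow> a \<in> bounded_operators E"
  and CV_commute: "a \<in> carrier A \<Longrightarrow> s \<in> carrier G \<Longrightarrow> \<xi> \<in> carrier E \<Longrightarrow> a (rreg s \<xi>) = rreg s (a \<xi>)"
  by (auto simp: CV_carrier_iff)

lemma CV_closed: "a \<in> carrier A \<Longrightarrow> \<xi> \<in> carrier E \<Longrightarrow> a \<xi> \<in> carrier E"
  using P.E.bounded_operatorsD(2)[OF CV_bounded] .

lemma CV_ext: "a \<in> carrier A \<Longrightarrow> b \<in> carrier A \<Longrightarrow> (\<And>\<xi>. \<xi> \<in> carrier E \<Longrightarrow> a \<xi> = b \<xi>) \<Longrightarrow> a = b"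
  by (rule P.E.bounded_operators_eqI) (simp_all add: CV_bounded)

lemma left_regular_CV: "s \<in> carrier G \<Longrightarrow> lreg s \<in> carrier A"
  by (simp add: CV_carrier_iff left_regular_bounded left_right_commute)

lemma CV_zero_closed: "(\<lambda>x\<in>carrier E. \<zero>\<^bsub>E\<^esub>) \<in> carrier A"
proof -
  have "(\<lambda>x\<in>carrier E. \<zero>\<^bsub>E\<^esub>) \<in> bounded_operators E"
    by (rule P.E.bounded_operatorsI[where C = 0]) simp_all
  moreover have "rreg s \<zero>\<^bsub>E\<^esub> = \<zero>\<^bsub>E\<^esub>" if "s \<in> carrier G" for s
    using regular_linear(4)[OF that P.E.zero_closed, of 0] that by (simp add: right_regular_closed)
  ultimately show ?thesis
    by (simp add: CV_carrier_iff right_regular_closed)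
qed

lemma CV_add_closed:
  assumes "a \<in> carrier A" "b \<in> carrier A"
  shows "(\<lambda>x\<in>carrier E. a x \<oplus>\<^bsub>E\<^esub> b x) \<in> carrier A"
proof -
  note ab = CV_bounded[OF assms(1)] CV_bounded[OF assms(2)]
  have "(\<lambda>x\<in>carrier E. a x \<oplus>\<^bsub>E\<^esub> b x) \<in> bounded_operators E"
  proof (rule P.E.bounded_operatorsI[where C = "P.E.opnorm a + P.E.opnorm b"])
    fix x assume x: "x \<in> carrier E"
    show "mnorm E (a x \<oplus>\<^bsub>E\<^esub> b x) \<le> (P.E.opnorm a + P.E.opnorm b) * mnorm E x"
      using P.E.norm_triangle[of "a x" "b x"] P.E.opnorm_apply[OF ab(1) x] P.E.opnorm_apply[OF ab(2) x]
        CV_closed assms x by (simp add: distrib_right)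
  qed (simp_all add: CV_closed assms P.E.bounded_operatorsD[OF ab(1)] P.E.bounded_operatorsD[OF ab(2)]
      P.E.a_ac P.E.smult_add_right)
  then show ?thesis
    using assms by (simp add: CV_carrier_iff right_regular_closed CV_closed[OF assms(1)] CV_closed[OF assms(2)] regular_linear)
qed

lemma CV_smult_closed:
  assumes "a \<in> carrier A"
  shows "(\<lambda>x\<in>carrier E. c \<odot>\<^bsub>E\<^esub> a x) \<in> carrier A"
proof -
  note ab = CV_bounded[OF assms(1)]
  have "(\<lambda>x\<in>carrier E. c \<odot>\<^bsub>E\<^esub> a x) \<in> bounded_operators E"
  proof (rule P.E.bounded_operatorsI[where C = "cmod c * P.E.opnorm a"])
    fix x assume x: "x \<in> carrier E"
    show "mnorm E (c \<odot>\<^bsub>E\<^esub> a x) \<le> cmod c * P.E.opnorm a * mnorm E x"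
      using P.E.opnorm_apply[OF ab(1) x] CV_closed assms x
      by (simp add: P.E.norm_smult mult.assoc mult_left_mono)
  next
    show "c \<odot>\<^bsub>E\<^esub> a (d \<odot>\<^bsub>E\<^esub> x) = d \<odot>\<^bsub>E\<^esub> (c \<odot>\<^bsub>E\<^esub> a x)" if "x \<in> carrier E" for d x
      using that by (simp add: P.E.bounded_operatorsD[OF ab] mult.commute CV_closed[OF assms] flip: P.E.smult_assoc)
  qed (simp_all add: CV_closed assms P.E.bounded_operatorsD[OF ab(1)] P.E.smult_add_right)
  then show ?thesis
    using assms by (simp add: CV_carrier_iff right_regular_closed CV_closed[OF assms(1)] regular_linear)
qed

lemma CV_compose_closed:
  assumes "a \<in> carrier A" "b \<in> carrier A"
  shows "compose (carrier E) a b \<in> carrier A"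
proof -
  note ab = CV_bounded[OF assms(1)] CV_bounded[OF assms(2)]
  have "(\<lambda>x\<in>carrier E. a (b x)) \<in> bounded_operators E"
  proof (rule P.E.bounded_operatorsI[where C = "P.E.opnorm a * P.E.opnorm b"])
    fix x assume x: "x \<in> carrier E"
    show "mnorm E (a (b x)) \<le> P.E.opnorm a * P.E.opnorm b * mnorm E x"
      using order_trans[OF P.E.opnorm_apply[OF ab(1) CV_closed[OF assms(2) x]]
          mult_left_mono[OF P.E.opnorm_apply[OF ab(2) x] P.E.opnorm_nonneg[OF ab(1)]]]
      by (simp add: mult.assoc)
  qed (simp_all add: CV_closed assms P.E.bounded_operatorsD[OF ab(1)] P.E.bounded_operatorsD[OF ab(2)])
  then show ?thesis
    using assms by (simp add: compose_def CV_carrier_iff right_regular_closed CV_closed[OF assms(2)])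
qed

sublocale A: cnormed_module "CV G M p"
proof -
  have "cnormed_module (operator_algebra E\<lparr>carrier := carrier A\<rparr>)"
    by (rule P.E.cnormed_module_operators)
      (auto simp: CV_bounded CV_zero_closed CV_add_closed CV_smult_closed)
  then show "cnormed_module (CV G M p)"
    by (simp only: CV_eq[symmetric])
qed

lemma CV_one_closed: "(\<lambda>x\<in>carrier E. x) \<in> carrier A"
proof -
  have "lreg \<one> = (\<lambda>x\<in>carrier E. x)"
    using left_regular_extensional[of \<one>] by (auto simp: left_regular_one extensional_def fun_eq_iff)
  then show ?thesis
    using left_regular_CV[OF one_closed] by simp
qed

sublocale Am: monoid "CV G M p"
proof (rule monoidI)
  show "\<one>\<^bsub>A\<^esub> \<in> carrier A"
    by (simp add: CV_simps CV_one_closed)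
  fix a assume a: "a \<in> carrier A"
  note ext = P.E.bounded_operatorsD(1)[OF CV_bounded[OF a]]
  show "\<one>\<^bsub>A\<^esub> \<otimes>\<^bsub>A\<^esub> a = a" "a \<otimes>\<^bsub>A\<^esub> \<one>\<^bsub>A\<^esub> = a"
    using ext CV_closed[OF a] by (auto simp: CV_simps compose_def extensional_def fun_eq_iff)
  fix b assume b: "b \<in> carrier A"
  show "a \<otimes>\<^bsub>A\<^esub> b \<in> carrier A"
    using CV_compose_closed[OF a b] by (simp add: CV_simps)
  fix c assume c: "c \<in> carrier A"
  show "a \<otimes>\<^bsub>A\<^esub> b \<otimes>\<^bsub>A\<^esub> c = a \<otimes>\<^bsub>A\<^esub> (b \<otimes>\<^bsub>A\<^esub> c)"
    using CV_closed[OF c] by (simp add: CV_simps compose_def fun_eq_iff restrict_def)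
qed

text \<open>Lets a convolver act on functions instead of classes. Additivity, homogeneity and
  commutation with translations then hold almost everywhere, while functions of one class have
  literally the same image (\<open>act_cong\<close>).\<close>

definition act :: "(('a \<Rightarrow> complex) set \<Rightarrow> ('a \<Rightarrow> complex) set) \<Rightarrow> ('a \<Rightarrow> complex) \<Rightarrow> 'a \<Rightarrow> complex" where
  "act u f = rep (u (cls f))"

context
  fixes u assumes u: "u \<in> carrier (CV G M p)"
begin

lemma act_Lp: "f \<in> LF \<Longrightarrow> act u f \<in> LF"
  and act_class: "f \<in> LF \<Longrightarrow> cls (act u f) = u (cls f)"
  unfolding act_def using rep_Lp[OF CV_closed[OF u ae_class_in_Lp]] by auto

lemma act_eqI:
  assumes "f \<in> LF" "h \<in> borel_measurable M" "u (cls f) = cls h"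
  shows "AE t in M. act u f t = h t"
  using ae_class_eq_iff[OF bm[OF act_Lp[OF assms(1)]] assms(2)] act_class[OF assms(1)] assms(3) by simp

lemma act_cong:
  assumes "f \<in> LF" "g \<in> LF" "AE t in M. f t = g t"
  shows "act u f = act u g"
  unfolding act_def using ae_class_eqI[OF bm[OF assms(1)] bm[OF assms(2)] assms(3)] by simp

lemma act_add:
  assumes f: "f \<in> LF" and g: "g \<in> LF"
  shows "AE t in M. act u (\<lambda>x. f x + g x) t = act u f t + act u g t"
proof (rule act_eqI[OF Lp_functions_add[OF p f g]])
  note m = bm[OF act_Lp[OF f]] bm[OF act_Lp[OF g]]
  show "(\<lambda>t. act u f t + act u g t) \<in> borel_measurable M"
    using m by measurable
  show "u (cls (\<lambda>x. f x + g x)) = cls (\<lambda>t. act u f t + act u g t)"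
    unfolding add_ae_class[where p = p, OF m, symmetric] add_ae_class[where p = p, OF bm[OF f] bm[OF g], symmetric]
      act_class[OF f] act_class[OF g]
    by (rule P.E.bounded_operatorsD(3)[OF CV_bounded[OF u] ae_class_in_Lp[OF f] ae_class_in_Lp[OF g]])
qed

lemma act_smult:
  assumes f: "f \<in> LF"
  shows "AE t in M. act u (\<lambda>x. c * f x) t = c * act u f t"
proof (rule act_eqI[OF Lp_functions_smult[OF p f]])
  note m = bm[OF act_Lp[OF f]]
  show "(\<lambda>t. c * act u f t) \<in> borel_measurable M"
    using m by measurable
  show "u (cls (\<lambda>x. c * f x)) = cls (\<lambda>t. c * act u f t)"
    unfolding smult_ae_class[where p = p, OF m, symmetric] smult_ae_class[where p = p, OF bm[OF f], symmetric] act_class[OF f]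
    by (rule P.E.bounded_operatorsD(4)[OF CV_bounded[OF u] ae_class_in_Lp[OF f]])
qed

lemma act_right:
  assumes s: "s \<in> carrier G" and f: "f \<in> LF"
  shows "AE t in M. act u (\<lambda>t. f (t \<otimes> s)) t = act u f (t \<otimes> s)"
proof (rule act_eqI[OF right_Lp[OF s f] bm[OF right_Lp[OF s act_Lp[OF f]]]])
  show "u (cls (\<lambda>t. f (t \<otimes> s))) = cls (\<lambda>t. act u f (t \<otimes> s))"
    unfolding right_regular_class[OF s f, symmetric] right_regular_class[OF s act_Lp[OF f], symmetric] act_class[OF f]
    by (rule CV_commute[OF u s ae_class_in_Lp[OF f]])
qed

end

definition isometric :: "(('a \<Rightarrow> complex) set \<Rightarrow> ('a \<Rightarrow> complex) set) \<Rightarrow> bool" where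
  "isometric u \<longleftrightarrow> u \<in> carrier (CV G M p) \<and> (\<forall>\<xi>\<in>carrier E. mnorm E (u \<xi>) = mnorm E \<xi>)"

lemma isometricD:
  assumes "isometric u"
  shows "u \<in> carrier (CV G M p)" "\<xi> \<in> carrier E \<Longrightarrow> mnorm E (u \<xi>) = mnorm E \<xi>"
  using assms by (auto simp: isometric_def)

lemma Lp_int_act:
  assumes "isometric u" "f \<in> LF"
  shows "Lp_int M p (act u f) = Lp_int M p f"
proof -
  have "Lp_int M p (act u f) powr (1/p) = Lp_int M p f powr (1/p)"
    using isometricD[OF assms(1)] assms(2)
    by (simp add: act_class ae_class_in_Lp act_Lp flip: mnorm_ae_class)
  then have "(Lp_int M p (act u f) powr (1/p)) powr p = (Lp_int M p f powr (1/p)) powr p"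
    by simp
  then show ?thesis
    using p by (simp add: powr_powr)
qed

text \<open>\<open>u\<close> preserves each p-integral occurring in
  \<open>clarkson_disjoint_iff\<close>, so the criterion holds for the images as soon as it holds
  for \<open>f\<close> and \<open>g\<close>.\<close>

lemma act_disjoint:
  assumes iso: "isometric u" and "p \<noteq> 2" and f: "f \<in> LF" and g: "g \<in> LF" and fg: "AE t in M. f t * g t = 0"
  shows "AE t in M. act u f t * act u g t = 0"
proof -
  note u = isometricD(1)[OF iso]
  note fa = act_Lp[OF u f] and ga = act_Lp[OF u g]
  have "Lp_int M p (act u (\<lambda>x. f x + g x)) = Lp_int M p (\<lambda>t. act u f t + act u g t)"
    by (rule Lp_int_cong_AE[OF bm[OF act_Lp[OF u Lp_functions_add[OF p f g]]]
          bm[OF Lp_functions_add[OF p fa ga]] act_add[OF u f g]])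
  then have sum: "Lp_int M p (\<lambda>t. act u f t + act u g t) = Lp_int M p (\<lambda>x. f x + g x)"
    using Lp_int_act[OF iso Lp_functions_add[OF p f g]] by simp
  have mg: "(\<lambda>x. - 1 * g x) \<in> LF"
    by (rule Lp_functions_smult[OF p g])
  have "AE t in M. act u (\<lambda>x. f x + - 1 * g x) t = act u f t - act u g t"
    using act_add[OF u f mg] act_smult[OF u g, of "-1"] by eventually_elim simp
  then have "Lp_int M p (act u (\<lambda>x. f x + - 1 * g x)) = Lp_int M p (\<lambda>t. act u f t - act u g t)"
    by (rule Lp_int_cong_AE[OF bm[OF act_Lp[OF u Lp_functions_add[OF p f mg]]]
          bm[OF Lp_functions_diff[OF p fa ga]]])
  then have diff: "Lp_int M p (\<lambda>t. act u f t - act u g t) = Lp_int M p (\<lambda>x. f x - g x)"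
    using Lp_int_act[OF iso Lp_functions_add[OF p f mg]] by simp
  show ?thesis
    unfolding clarkson_disjoint_iff[OF p \<open>p \<noteq> 2\<close> fa ga] sum diff Lp_int_act[OF iso f] Lp_int_act[OF iso g]
    using fg unfolding clarkson_disjoint_iff[OF p \<open>p \<noteq> 2\<close> f g] .
qed

text \<open>Agreement survives linear combinations and, both operators being bounded, limits in
  norm; \<open>Lp_functions_induct\<close> does the rest.\<close>

lemma bounded_operators_eq_on_indicators:
  assumes a: "a \<in> bounded_operators E" and b: "b \<in> bounded_operators E"
    and eq: "\<And>B. B \<in> sets M \<Longrightarrow> emeasure M B < \<infinity> \<Longrightarrow> a (cls (indicator B)) = b (cls (indicator B))"
  shows "a = b"
proof (rule P.E.bounded_operators_eqI[OF a b])
  fix \<xi> assume "\<xi> \<in> carrier E"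
  then obtain f where f: "f \<in> LF" "\<xi> = cls f"
    by (rule Lp_carrierE)
  have "a (cls f) = b (cls f)"
    using f(1)
  proof (induct rule: Lp_functions_induct[OF p, consumes 1, case_names indicator smult add limit])
    case (indicator B)
    then show ?case by (rule eq)
  next
    case (smult c g)
    then show ?case
      using smult_ae_class[where p = p and c = c, OF bm[OF smult(1)]] P.E.bounded_operatorsD(4)[OF a ae_class_in_Lp[OF smult(1)], of c]
        P.E.bounded_operatorsD(4)[OF b ae_class_in_Lp[OF smult(1)], of c] by simp
  next
    case (add g h)
    then show ?case
      using add_ae_class[where p = p, OF bm[OF add(1)] bm[OF add(3)]]
        P.E.bounded_operatorsD(3)[OF a ae_class_in_Lp[OF add(1)] ae_class_in_Lp[OF add(3)]]
        P.E.bounded_operatorsD(3)[OF b ae_class_in_Lp[OF add(1)] ae_class_in_Lp[OF add(3)]] by simp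
  next
    case (limit g s)
    let ?\<xi> = "cls g" and ?\<eta> = "\<lambda>i. cls (s i)"
    have "?\<xi> \<in> carrier E"
      by (rule ae_class_in_Lp[OF limit(1)])
    moreover have "?\<eta> i \<in> carrier E" for i
      by (rule ae_class_in_Lp[OF limit(2)])
    ultimately have G: "?\<xi> \<in> carrier E" "\<And>i. ?\<eta> i \<in> carrier E" .
    note aG = P.E.bounded_operatorsD(2)[OF a] and bG = P.E.bounded_operatorsD(2)[OF b]
    have diff: "?\<xi> \<ominus>\<^bsub>E\<^esub> ?\<eta> i = cls (\<lambda>x. g x - s i x)" for i
    proof -
      have "?\<xi> \<ominus>\<^bsub>E\<^esub> ?\<eta> i = ?\<xi> \<oplus>\<^bsub>E\<^esub> (-1) \<odot>\<^bsub>E\<^esub> ?\<eta> i"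
        using G by (simp add: a_minus_def P.E.smult_minus_one)
      also have "\<dots> = cls (\<lambda>x. g x + - 1 * s i x)"
        unfolding smult_ae_class[where p = p and c = "-1", OF bm[OF limit(2)[of i]]]
        by (rule add_ae_class[OF bm[OF limit(1)] bm[OF Lp_functions_smult[OF p limit(2)]]])
      finally show ?thesis by simp
    qed
    have "mnorm E (?\<xi> \<ominus>\<^bsub>E\<^esub> ?\<eta> i) = Lp_int M p (\<lambda>x. g x - s i x) powr (1/p)" for i
      unfolding diff by (rule mnorm_ae_class[OF Lp_functions_diff[OF p limit(1,2)]])
    moreover have "(\<lambda>i. Lp_int M p (\<lambda>x. g x - s i x) powr (1/p)) \<longlonglongrightarrow> 0"
      using p by (intro tendsto_zero_powrI[OF limit(4) tendsto_const]) auto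
    ultimately have lim: "(\<lambda>i. mnorm E (?\<xi> \<ominus>\<^bsub>E\<^esub> ?\<eta> i)) \<longlonglongrightarrow> 0"
      by simp
    have "mnorm E (a ?\<xi> \<ominus>\<^bsub>E\<^esub> b ?\<xi>) \<le> (P.E.opnorm a + P.E.opnorm b) * mnorm E (?\<xi> \<ominus>\<^bsub>E\<^esub> ?\<eta> i)" for i
    proof -
      have "mnorm E (a ?\<xi> \<ominus>\<^bsub>E\<^esub> b ?\<xi>) \<le> mnorm E (a ?\<xi> \<ominus>\<^bsub>E\<^esub> a (?\<eta> i)) + mnorm E (b (?\<eta> i) \<ominus>\<^bsub>E\<^esub> b ?\<xi>)"
        using P.E.norm_diff_triangle[of "a ?\<xi>" "a (?\<eta> i)" "b ?\<xi>"] limit(3) G aG bG by simp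
      also have "mnorm E (b (?\<eta> i) \<ominus>\<^bsub>E\<^esub> b ?\<xi>) = mnorm E (b ?\<xi> \<ominus>\<^bsub>E\<^esub> b (?\<eta> i))"
        using G bG by (intro P.E.norm_minus_commute) auto
      also have "mnorm E (a ?\<xi> \<ominus>\<^bsub>E\<^esub> a (?\<eta> i)) \<le> P.E.opnorm a * mnorm E (?\<xi> \<ominus>\<^bsub>E\<^esub> ?\<eta> i)"
        using P.E.opnorm_apply[OF a, of "?\<xi> \<ominus>\<^bsub>E\<^esub> ?\<eta> i"] G by (simp add: P.E.bounded_operators_diff[OF a])
      also have "mnorm E (b ?\<xi> \<ominus>\<^bsub>E\<^esub> b (?\<eta> i)) \<le> P.E.opnorm b * mnorm E (?\<xi> \<ominus>\<^bsub>E\<^esub> ?\<eta> i)"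
        using P.E.opnorm_apply[OF b, of "?\<xi> \<ominus>\<^bsub>E\<^esub> ?\<eta> i"] G by (simp add: P.E.bounded_operators_diff[OF b])
      finally show ?thesis
        by (simp only: distrib_right add_mono)
    qed
    then have "\<exists>N. \<forall>i\<ge>N. mnorm E (a ?\<xi> \<ominus>\<^bsub>E\<^esub> b ?\<xi>) \<le>
        (P.E.opnorm a + P.E.opnorm b) * mnorm E (?\<xi> \<ominus>\<^bsub>E\<^esub> ?\<eta> i)"
      by simp
    then have "mnorm E (a ?\<xi> \<ominus>\<^bsub>E\<^esub> b ?\<xi>) \<le> 0"
      by (rule LIMSEQ_le_const[OF tendsto_mult_right_zero[OF lim]])
    then have "mnorm E (a ?\<xi> \<ominus>\<^bsub>E\<^esub> b ?\<xi>) = 0"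
      using P.E.norm_nonneg[of "a ?\<xi> \<ominus>\<^bsub>E\<^esub> b ?\<xi>"] G aG bG by (intro antisym) auto
    then show ?case
      using G aG bG by (simp add: P.E.norm_eq_0_iff P.E.diff_eq_zero_iff)
  qed
  then show "a \<xi> = b \<xi>"
    unfolding f(2) .
qed

subsection \<open>Localisation of isometric convolvers\<close>

text \<open>The superlevel sets at heights \<open>1 / (real n + 1)\<close> have finite measure by
  Markov's inequality, and they exhaust the part of \<open>X\<close> where \<open>f\<close> is
  nonzero, so one of them is not null. It is a set of finite positive measure to which
  \<open>ergodic\<close> can be applied.\<close>

lemma nonnull_level:
  assumes f: "f \<in> LF" and X: "X \<in> sets M" and nz: "\<not> (AE t in M. t \<in> X \<longrightarrow> f t = 0)"
  obtains d B where "0 < d" "B = {t \<in> X. d \<le> cmod (f t)}" "B \<in> sets M" "0 < emeasure M B" "emeasure M B < \<infinity>"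
proof -
  define B where "B d = {t \<in> X. d \<le> cmod (f t)}" for d
  have Bs: "B d \<in> sets M" for d
  proof -
    have "B d = X \<inter> {t \<in> space M. d \<le> cmod (f t)}"
      using sets.sets_into_space[OF X] by (auto simp: B_def)
    moreover have "{t \<in> space M. d \<le> cmod (f t)} \<in> sets M"
      using bm[OF f] by measurable
    ultimately show ?thesis
      using X by auto
  qed
  have fin: "emeasure M (B d) < \<infinity>" if d: "0 < d" for d
  proof -
    have "emeasure M {x \<in> space M. cmod (f x) powr p \<ge> d powr p} \<le>
        ennreal ((1 / d powr p) * (\<integral>x. cmod (f x) powr p \<partial>M))"
      using Lp_functionsD(2)[OF f] d by (intro integral_Markov_inequality) auto
    also have "\<dots> < \<infinity>" by simp
    finally have lt: "emeasure M {x \<in> space M. cmod (f x) powr p \<ge> d powr p} < \<infinity>" .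
    show ?thesis
    proof (rule emeasure_finite_subset[OF _ _ lt])
      show "B d \<subseteq> {x \<in> space M. cmod (f x) powr p \<ge> d powr p}"
        using sets.sets_into_space[OF X] d p by (auto simp: B_def intro!: powr_mono2)
      show "{x \<in> space M. cmod (f x) powr p \<ge> d powr p} \<in> sets M"
        using borel_measurable_integrable[OF Lp_functionsD(2)[OF f]] by measurable
    qed
  qed
  have "\<exists>n. emeasure M (B (1 / (real n + 1))) \<noteq> 0"
  proof (rule ccontr)
    assume "\<not> ?thesis"
    then have "B (1 / (real n + 1)) \<in> null_sets M" for n :: nat
      by (intro null_setsI Bs) blast
    then have "AE t in M. t \<notin> B (1 / (real n + 1))" for n :: nat
      by (rule AE_not_in)
    then have "AE t in M. \<forall>n::nat. t \<notin> B (1 / (real n + 1))"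
      by (simp add: AE_all_countable)
    then have "AE t in M. t \<in> X \<longrightarrow> f t = 0"
    proof eventually_elim
      case (elim t)
      show ?case
      proof (rule impI, rule ccontr)
        assume "t \<in> X" "f t \<noteq> 0"
        moreover obtain n :: nat where "1 / (real n + 1) < cmod (f t)"
          using \<open>f t \<noteq> 0\<close> nat_approx_posE[of "cmod (f t)"] by (auto simp: add.commute)
        moreover have "t \<notin> B (1 / (real n + 1))"
          using elim by blast
        ultimately show False
          by (simp add: B_def)
      qed
    qed
    then show False using nz by simp
  qed
  then obtain n :: nat where n: "emeasure M (B (1 / (real n + 1))) \<noteq> 0" by blast
  have d: "0 < 1 / (real n + 1)" by simp
  show ?thesis
  proof (rule that[OF d])
    show "B (1 / (real n + 1)) = {t \<in> X. 1 / (real n + 1) \<le> cmod (f t)}"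
      by (simp add: B_def)
    show "0 < emeasure M (B (1 / (real n + 1)))"
      using n by (simp add: zero_less_iff_neq_zero)
  qed (use Bs fin[OF d] in auto)
qed

lemma mult_inv_cancel:
  "a \<in> carrier G \<Longrightarrow> b \<in> carrier G \<Longrightarrow> a \<otimes> (inv a \<otimes> b) = b"
  "a \<in> carrier G \<Longrightarrow> b \<in> carrier G \<Longrightarrow> inv a \<otimes> (a \<otimes> b) = b"
  by (simp_all flip: m_assoc)

lemma set_mult_memI: "a \<in> X \<Longrightarrow> b \<in> Y \<Longrightarrow> a \<otimes> b \<in> X <#> Y"
  by (auto simp: set_mult_def)

lemma AE_not_positive:
  assumes "B \<in> sets M" "0 < emeasure M B" "AE t in M. t \<notin> B" shows False
  using AE_iff_null_sets[OF assms(1)] assms(2,3) null_setsD1[of B M] by auto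

text \<open>Replaces the countable subcover that a large group may lack: were \<open>f\<close> not
  zero almost everywhere on \<open>X\<close>, a superlevel set would contain a compact set of
  positive measure, and finitely many of the given neighbourhoods would cover it.\<close>

lemma Lp_locally_zero:
  assumes f: "f \<in> LF" and X: "X \<in> sets M"
    and loc: "\<And>x. x \<in> X \<Longrightarrow> \<exists>U. openin T U \<and> x \<in> U \<and> (AE t in M. t \<in> U \<longrightarrow> f t = 0)"
  shows "AE t in M. t \<in> X \<longrightarrow> f t = 0"
proof (rule ccontr)
  assume "\<not> ?thesis"
  then obtain d B where B: "0 < d" "B = {t \<in> X. d \<le> cmod (f t)}" "B \<in> sets M" "0 < emeasure M B" "emeasure M B < \<infinity>"
    by (rule nonnull_level[OF f X])
  obtain K where K: "compactin T K" "K \<subseteq> B" "0 < emeasure M K"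
    using positive_compact_subset[OF B(3-5)] .
  obtain U where U: "\<And>x. x \<in> X \<Longrightarrow> openin T (U x) \<and> x \<in> U x \<and> (AE t in M. t \<in> U x \<longrightarrow> f t = 0)"
    using loc by metis
  have KX: "K \<subseteq> X" using K(2) B(2) by auto
  have "\<exists>\<F>. finite \<F> \<and> \<F> \<subseteq> U ` K \<and> K \<subseteq> \<Union>\<F>"
    using U KX by (intro compactinD[OF K(1)]) blast+
  then obtain Y where Y: "finite Y" "Y \<subseteq> K" "K \<subseteq> (\<Union>x\<in>Y. U x)"
    by (metis finite_subset_image)
  have "AE t in M. \<forall>x\<in>Y. t \<in> U x \<longrightarrow> f t = 0"
    using Y KX U by (intro AE_finite_allI) blast+
  then have "AE t in M. t \<notin> K"
  proof eventually_elim
    case (elim t)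
    show ?case
    proof
      assume t: "t \<in> K"
      then have "f t = 0" using elim Y(3) by blast
      then show False using t K(2) B(1,2) by auto
    qed
  qed
  then show False
    using AE_not_positive[OF compact_sets[OF K(1)] K(3)] by simp
qed

text \<open>\<open>x\<close> belongs to the spread if \<open>u\<close> moves some function supported in \<open>V\<close> partly into \<open>x V\<close>.\<close>

definition spread :: "(('a \<Rightarrow> complex) set \<Rightarrow> ('a \<Rightarrow> complex) set) \<Rightarrow> 'a set \<Rightarrow> 'a set" where
  "spread u V = {x \<in> carrier G. \<exists>f\<in>LF. (\<forall>t\<in>carrier G - V. f t = 0) \<and>
     \<not> (AE t in M. inv x \<otimes> t \<in> V \<longrightarrow> act u f t = 0)}"

lemma spread_carrier: "spread u V \<subseteq> carrier G"
  by (auto simp: spread_def)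

lemma spread_mono:
  assumes "V \<subseteq> W" shows "spread u V \<subseteq> spread u W"
proof
  fix x assume "x \<in> spread u V"
  then obtain f where f: "x \<in> carrier G" "f \<in> LF" "\<forall>t\<in>carrier G - V. f t = 0"
    "\<not> (AE t in M. inv x \<otimes> t \<in> V \<longrightarrow> act u f t = 0)"
    by (auto simp: spread_def)
  have "\<not> (AE t in M. inv x \<otimes> t \<in> W \<longrightarrow> act u f t = 0)"
  proof
    assume "AE t in M. inv x \<otimes> t \<in> W \<longrightarrow> act u f t = 0"
    then have "AE t in M. inv x \<otimes> t \<in> V \<longrightarrow> act u f t = 0"
      by eventually_elim (use assms in blast)
    then show False using f(4) by simp
  qed
  then show "x \<in> spread u W"
    using f assms unfolding spread_def by blast
qed

lemma left_open: "x \<in> carrier G \<Longrightarrow> openin T V \<Longrightarrow> openin T {t \<in> carrier G. x \<otimes> t \<in> V}"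
  by (rule open_preimage[OF continuous_left])

lemma indicator_nonzero:
  assumes V: "openin T V" "V \<noteq> {}" "emeasure M V < \<infinity>"
  shows "indicator V \<in> LF" "0 < measure M V" "0 < Lp_int M p (indicator V)"
proof -
  show "indicator V \<in> LF"
    using Lp_functions_indicator[OF p open_sets[OF V(1)] V(3)] .
  show m: "0 < measure M V"
    using open_pos[OF V(1,2)] V(3) by (simp add: measure_def enn2real_positive_iff)
  show "0 < Lp_int M p (indicator V)"
    using m Lp_int_indicator[OF p open_sets[OF V(1)] V(3)] by simp
qed

text \<open>If no \<open>x\<close> belonged to the spread, the image of \<open>indicator V\<close>
  would vanish near every point and hence almost everywhere, contrary to \<open>u\<close> being
  isometric.\<close>

lemma spread_nonempty:
  assumes u: "isometric u" and V: "openin T V" "\<one> \<in> V" "emeasure M V < \<infinity>"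
  shows "spread u V \<noteq> {}"
proof
  assume empty: "spread u V = {}"
  have "V \<noteq> {}" using V(2) by blast
  note ind = indicator_nonzero[OF V(1) this V(3)]
  note ua = act_Lp[OF isometricD(1)[OF u] ind(1)]
  have "AE t in M. t \<in> carrier G \<longrightarrow> act u (indicator V) t = 0"
  proof (rule Lp_locally_zero[OF ua])
    show "carrier G \<in> sets M"
      using sets.top[of M] by simp
    fix x assume x: "x \<in> carrier G"
    have "AE t in M. inv x \<otimes> t \<in> V \<longrightarrow> act u (indicator V) t = 0"
    proof (rule ccontr)
      assume nz: "\<not> ?thesis"
      have "x \<in> spread u V"
        unfolding spread_def by (intro CollectI conjI bexI[of _ "indicator V"] x nz ind(1)) simp
      then show False using empty by blast
    qed
    then have "AE t in M. t \<in> {t \<in> carrier G. inv x \<otimes> t \<in> V} \<longrightarrow> act u (indicator V) t = 0"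
      by eventually_elim blast
    moreover have "openin T {t \<in> carrier G. inv x \<otimes> t \<in> V}"
      using left_open[OF inv_closed[OF x] V(1)] .
    ultimately show "\<exists>U. openin T U \<and> x \<in> U \<and> (AE t in M. t \<in> U \<longrightarrow> act u (indicator V) t = 0)"
      using x V(2) by (intro exI[of _ "{t \<in> carrier G. inv x \<otimes> t \<in> V}"]) auto
  qed
  moreover have "AE t in M. t \<in> carrier G"
    by (rule AE_I2) simp
  ultimately have "AE t in M. act u (indicator V) t = 0"
    by eventually_elim simp
  then have "Lp_int M p (act u (indicator V)) = 0"
    using Lp_int_zero_iff[OF p ua] by blast
  then show False
    using ind(3) Lp_int_act[OF u ind(1)] by simp
qed

text \<open>Let \<open>u f1\<close> be nonzero on \<open>B1\<close> inside \<open>x V\<close> and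
  \<open>u f2\<close> on \<open>B2\<close> inside \<open>y V\<close>. Ergodicity gives
  \<open>s\<close> for which \<open>t\<close> in \<open>B1\<close> and \<open>t \<otimes> s\<close>
  in \<open>B2\<close> occur together on a set of positive measure. By commutation with right
  translations and \<open>act_disjoint\<close>, \<open>f1\<close> and the right translate of
  \<open>f2\<close> by \<open>s\<close> must overlap, say at \<open>c\<close>, so \<open>c\<close>
  and \<open>d = c \<otimes> s\<close> lie in \<open>V\<close>. With
  \<open>a = inv x \<otimes> t\<close> and \<open>b = inv y \<otimes> (t \<otimes> s)\<close> the
  identity follows by solving for \<open>s\<close> twice.\<close>

lemma spread_close:
  assumes u: "isometric u" and p2: "p \<noteq> 2" and V: "openin T V"
    and x: "x \<in> spread u V" and y: "y \<in> spread u V"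
  shows "\<exists>a\<in>V. \<exists>b\<in>V. \<exists>c\<in>V. \<exists>d\<in>V. inv x \<otimes> y = a \<otimes> (inv c \<otimes> d) \<otimes> inv b"
proof -
  note uC = isometricD(1)[OF u]
  obtain f1 where f1: "x \<in> carrier G" "f1 \<in> LF" "\<forall>t\<in>carrier G - V. f1 t = 0"
    "\<not> (AE t in M. inv x \<otimes> t \<in> V \<longrightarrow> act u f1 t = 0)"
    using x unfolding spread_def by blast
  obtain f2 where f2: "y \<in> carrier G" "f2 \<in> LF" "\<forall>t\<in>carrier G - V. f2 t = 0"
    "\<not> (AE t in M. inv y \<otimes> t \<in> V \<longrightarrow> act u f2 t = 0)"
    using y unfolding spread_def by blast
  have nonnull: "\<not> (AE t in M. t \<in> {t \<in> carrier G. inv z \<otimes> t \<in> V} \<longrightarrow> h t = 0)"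
    if "\<not> (AE t in M. inv z \<otimes> t \<in> V \<longrightarrow> h t = 0)" for z and h :: "'a \<Rightarrow> complex"
  proof
    assume "AE t in M. t \<in> {t \<in> carrier G. inv z \<otimes> t \<in> V} \<longrightarrow> h t = 0"
    moreover have "AE t in M. t \<in> carrier G"
      by (rule AE_I2) simp
    ultimately have "AE t in M. inv z \<otimes> t \<in> V \<longrightarrow> h t = 0"
      by eventually_elim simp
    then show False using that by (rule notE[rotated])
  qed
  obtain d1 B1 where B1: "0 < d1" "B1 = {t \<in> {t \<in> carrier G. inv x \<otimes> t \<in> V}. d1 \<le> cmod (act u f1 t)}"
    "B1 \<in> sets M" "0 < emeasure M B1" "emeasure M B1 < \<infinity>"
    by (rule nonnull_level[OF act_Lp[OF uC f1(2)] open_sets[OF left_open[OF inv_closed[OF f1(1)] V]] nonnull[OF f1(4)]])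
  obtain d2 B2 where B2: "0 < d2" "B2 = {t \<in> {t \<in> carrier G. inv y \<otimes> t \<in> V}. d2 \<le> cmod (act u f2 t)}"
    "B2 \<in> sets M" "0 < emeasure M B2" "emeasure M B2 < \<infinity>"
    by (rule nonnull_level[OF act_Lp[OF uC f2(2)] open_sets[OF left_open[OF inv_closed[OF f2(1)] V]] nonnull[OF f2(4)]])
  obtain s where s: "s \<in> carrier G" and N: "{t \<in> B1. t \<otimes> s \<in> B2} \<in> sets M" "0 < emeasure M {t \<in> B1. t \<otimes> s \<in> B2}"
    by (rule ergodic[OF B1(3-5) B2(3-5)])
  have "\<not> (AE t in M. f1 t * f2 (t \<otimes> s) = 0)"
  proof
    assume "AE t in M. f1 t * f2 (t \<otimes> s) = 0"
    then have "AE t in M. act u f1 t * act u (\<lambda>t. f2 (t \<otimes> s)) t = 0"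
      by (rule act_disjoint[OF u p2 f1(2) right_Lp[OF s f2(2)]])
    moreover have "AE t in M. act u (\<lambda>t. f2 (t \<otimes> s)) t = act u f2 (t \<otimes> s)"
      by (rule act_right[OF uC s f2(2)])
    ultimately have "AE t in M. t \<notin> {t \<in> B1. t \<otimes> s \<in> B2}"
    proof eventually_elim
      case (elim t)
      show ?case
      proof
        assume "t \<in> {t \<in> B1. t \<otimes> s \<in> B2}"
        then have t: "t \<in> B1" "t \<otimes> s \<in> B2" by simp_all
        have "act u f1 t \<noteq> 0"
          using t(1)[unfolded B1(2)] B1(1) by auto
        moreover have "act u f2 (t \<otimes> s) \<noteq> 0"
          using t(2)[unfolded B2(2)] B2(1) by auto
        ultimately show False
          using elim by simp
      qed
    qed
    then show False
      using AE_not_positive[OF N] by simp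
  qed
  then have "\<not> (\<forall>c\<in>carrier G. f1 c * f2 (c \<otimes> s) = 0)"
  proof (rule contrapos_nn)
    assume "\<forall>c\<in>carrier G. f1 c * f2 (c \<otimes> s) = 0"
    then show "AE t in M. f1 t * f2 (t \<otimes> s) = 0"
      by (intro AE_I2) (simp only: space_M)
  qed
  then obtain c where c: "c \<in> carrier G" "f1 c * f2 (c \<otimes> s) \<noteq> 0"
    by blast
  then have "f1 c \<noteq> 0" "f2 (c \<otimes> s) \<noteq> 0"
    by simp_all
  then have cV: "c \<in> V" and dV: "c \<otimes> s \<in> V"
    using f1(3) f2(3) c(1) m_closed[OF c(1) s] by blast+
  have "{t \<in> B1. t \<otimes> s \<in> B2} \<noteq> {}"
  proof
    assume empty: "{t \<in> B1. t \<otimes> s \<in> B2} = {}"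
    show False
      using N(2) unfolding empty by simp
  qed
  then obtain t where t: "t \<in> B1" "t \<otimes> s \<in> B2"
    by blast
  have tG: "t \<in> carrier G" and aV: "inv x \<otimes> t \<in> V"
    using t(1)[unfolded B1(2)] by simp_all
  have bV: "inv y \<otimes> (t \<otimes> s) \<in> V"
    using t(2)[unfolded B2(2)] by simp
  have "inv x \<otimes> t \<otimes> (inv c \<otimes> (c \<otimes> s)) \<otimes> inv (inv y \<otimes> (t \<otimes> s)) = inv x \<otimes> y"
  proof -
    have "inv c \<otimes> (c \<otimes> s) = s"
      using c(1) s by (simp add: m_assoc[symmetric])
    moreover have "inv (inv y \<otimes> (t \<otimes> s)) = inv (t \<otimes> s) \<otimes> y"
      using f2(1) tG s by (simp add: inv_mult_group)
    moreover have "inv x \<otimes> t \<otimes> s \<otimes> (inv (t \<otimes> s) \<otimes> y) = inv x \<otimes> ((t \<otimes> s) \<otimes> (inv (t \<otimes> s) \<otimes> y))"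
      using f1(1) f2(1) tG s by (simp only: m_assoc inv_closed m_closed)
    ultimately show ?thesis
      using mult_inv_cancel(1)[of "t \<otimes> s" y] f2(1) tG s by simp
  qed
  from this[symmetric] show ?thesis
    by (intro bexI[OF _ aV] bexI[OF _ bV] bexI[OF _ cV] bexI[OF _ dV])
qed

lemma unit_nbhd_compact:
  obtains V L where "openin T V" "\<one> \<in> V" "V \<subseteq> L" "compactin T L" "emeasure M V < \<infinity>"
proof -
  have "compactin T {\<one>}" "openin T (carrier G)" "{\<one>} \<subseteq> carrier G"
    using openin_topspace[of T] by auto
  from compact_nbhd[OF this] obtain V L where VL: "openin T V" "compactin T L" "{\<one>} \<subseteq> V" "V \<subseteq> L"
    by metis
  then show ?thesis
    using that[of V L] emeasure_finite_subset[OF VL(4) compact_sets[OF VL(2)] compact_finite[OF VL(2)]] by auto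
qed

lemma unit_nbhd_mult:
  assumes W: "openin T W" "\<one> \<in> W"
  obtains V where "openin T V" "\<one> \<in> V" "V \<subseteq> W" "\<And>a b. a \<in> V \<Longrightarrow> b \<in> V \<Longrightarrow> a \<otimes> b \<in> W"
    "\<And>a b. a \<in> V \<Longrightarrow> b \<in> V \<Longrightarrow> a \<otimes> inv b \<in> W"
proof -
  let ?P = "prod_topology T T"
  have c: "continuous_map ?P T (\<lambda>z. fst z \<otimes> snd z)" "continuous_map ?P T (\<lambda>z. fst z \<otimes> inv (snd z))"
    by (intro continuous_mult continuous_inv continuous_map_fst continuous_map_snd)+
  define Z where "Z = {z \<in> topspace ?P. fst z \<otimes> snd z \<in> W} \<inter> {z \<in> topspace ?P. fst z \<otimes> inv (snd z) \<in> W}"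
  have op: "openin ?P Z"
    unfolding Z_def by (intro openin_Int openin_continuous_map_preimage[OF c(1) W(1)] openin_continuous_map_preimage[OF c(2) W(1)])
  have "(\<one>, \<one>) \<in> Z"
    using W(2) by (simp add: Z_def)
  from openin_prod_topology_alt[THEN iffD1, rule_format, OF op this]
  obtain U V where UV: "openin T U" "openin T V" "\<one> \<in> U" "\<one> \<in> V" "U \<times> V \<subseteq> Z"
    by auto
  show ?thesis
  proof (rule that[of "U \<inter> V \<inter> W"])
    show "a \<otimes> b \<in> W" if "a \<in> U \<inter> V \<inter> W" "b \<in> U \<inter> V \<inter> W" for a b
      using UV(5) that by (auto simp: Z_def)
    show "a \<otimes> inv b \<in> W" if "a \<in> U \<inter> V \<inter> W" "b \<in> U \<inter> V \<inter> W" for a b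
      using UV(5) that by (auto simp: Z_def)
  qed (use UV W in auto)
qed

text \<open>One factor more than in \<open>spread_close\<close>, to absorb the passage to the limit point \<open>t\<close> in
  \<open>spread_center\<close>.\<close>

definition fivefold :: "'a set \<Rightarrow> 'a set" where
  "fivefold V = {e \<otimes> (a \<otimes> (inv c \<otimes> d) \<otimes> inv b) | a b c d e. a \<in> V \<and> b \<in> V \<and> c \<in> V \<and> d \<in> V \<and> e \<in> V}"

lemma fivefoldI:
  "a \<in> V \<Longrightarrow> b \<in> V \<Longrightarrow> c \<in> V \<Longrightarrow> d \<in> V \<Longrightarrow> e \<in> V \<Longrightarrow> e \<otimes> (a \<otimes> (inv c \<otimes> d) \<otimes> inv b) \<in> fivefold V"
  unfolding fivefold_def by blast

text \<open>The chain \<open>V1\<close> to \<open>V4\<close> spends one shrinking on each of the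
  four multiplications in \<open>fivefold\<close>.\<close>

lemma fivefold_small:
  assumes W: "openin T W" "\<one> \<in> W" and V0: "openin T V0" "\<one> \<in> V0"
  obtains V where "openin T V" "\<one> \<in> V" "V \<subseteq> V0" "fivefold V \<subseteq> W"
proof -
  obtain V1 where V1: "openin T V1" "\<one> \<in> V1" "\<And>a b. a \<in> V1 \<Longrightarrow> b \<in> V1 \<Longrightarrow> a \<otimes> b \<in> W"
    using unit_nbhd_mult[OF W] by metis
  obtain V2 where V2: "openin T V2" "\<one> \<in> V2" "V2 \<subseteq> V1" "\<And>a b. a \<in> V2 \<Longrightarrow> b \<in> V2 \<Longrightarrow> a \<otimes> inv b \<in> V1"
    "\<And>a b. a \<in> V2 \<Longrightarrow> b \<in> V2 \<Longrightarrow> a \<otimes> b \<in> V1"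
    using unit_nbhd_mult[OF V1(1,2)] by metis
  obtain V3 where V3: "openin T V3" "\<one> \<in> V3" "V3 \<subseteq> V2" "\<And>a b. a \<in> V3 \<Longrightarrow> b \<in> V3 \<Longrightarrow> a \<otimes> b \<in> V2"
    "\<And>a b. a \<in> V3 \<Longrightarrow> b \<in> V3 \<Longrightarrow> a \<otimes> inv b \<in> V2"
    using unit_nbhd_mult[OF V2(1,2)] by metis
  obtain V4 where V4: "openin T V4" "\<one> \<in> V4" "V4 \<subseteq> V3" "\<And>a b. a \<in> V4 \<Longrightarrow> b \<in> V4 \<Longrightarrow> a \<otimes> b \<in> V3"
    "\<And>a b. a \<in> V4 \<Longrightarrow> b \<in> V4 \<Longrightarrow> a \<otimes> inv b \<in> V3"
    using unit_nbhd_mult[OF V3(1,2)] by metis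
  \<comment> \<open>The third set puts the inverses of elements of \<open>V\<close> into
    \<open>V4\<close>, as the factor \<open>inv c\<close> demands.\<close>
  define V where "V = V4 \<inter> V0 \<inter> {x \<in> carrier G. inv x \<in> V4}"
  have "openin T {x \<in> carrier G. inv x \<in> V4}"
    using open_preimage[OF continuous_inv[of T "\<lambda>x. x"] V4(1)] by simp
  then have V: "openin T V" "\<one> \<in> V" "V \<subseteq> V0"
    using V4 V0 by (auto simp: V_def)
  have "fivefold V \<subseteq> W"
  proof
    fix z assume "z \<in> fivefold V"
    then obtain a b c d e where abc: "a \<in> V" "b \<in> V" "c \<in> V" "d \<in> V" "e \<in> V"
      and z: "z = e \<otimes> (a \<otimes> (inv c \<otimes> d) \<otimes> inv b)"
      by (auto simp: fivefold_def)
    have "inv c \<otimes> d \<in> V3"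
      using abc V4(4) by (auto simp: V_def)
    then have "a \<otimes> (inv c \<otimes> d) \<in> V2"
      using abc V3(4) V4(3) by (auto simp: V_def)
    then have "a \<otimes> (inv c \<otimes> d) \<otimes> inv b \<in> V1"
      using abc V2(4) V3(3) V4(3) by (auto simp: V_def)
    moreover have "e \<in> V1"
      using abc V2(3) V3(3) V4(3) by (auto simp: V_def)
    ultimately show "z \<in> W"
      unfolding z by (intro V1(3))
  qed
  then show ?thesis
    using that V by blast
qed

text \<open>By \<open>spread_close\<close> all spreads of neighbourhoods inside \<open>V0\<close>
  lie in one compact set \<open>Q\<close> around a fixed \<open>x0\<close>. They are nonempty and
  decrease with \<open>V\<close>, so by compactness some \<open>t\<close> is in the closure of all
  of them. An element \<open>y\<close> of the spread close to \<open>t\<close> then gives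
  \<open>inv t \<otimes> x\<close> as \<open>inv t \<otimes> y\<close> times
  \<open>inv y \<otimes> x\<close>; the first factor is the extra one in
  \<open>fivefold\<close>.\<close>

lemma spread_center:
  assumes u: "isometric u" and p2: "p \<noteq> 2"
    and V0: "openin T V0" "\<one> \<in> V0" "V0 \<subseteq> L0" "compactin T L0"
  obtains t where "t \<in> carrier G"
    "\<And>V x. openin T V \<Longrightarrow> \<one> \<in> V \<Longrightarrow> V \<subseteq> V0 \<Longrightarrow> x \<in> spread u V \<Longrightarrow> inv t \<otimes> x \<in> fivefold V"
proof -
  define nb where "nb V \<longleftrightarrow> openin T V \<and> \<one> \<in> V \<and> V \<subseteq> V0" for V
  have fin: "emeasure M V < \<infinity>" if "nb V" for V
    using that V0(3) compact_sets[OF V0(4)] compact_finite[OF V0(4)]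
    by (intro emeasure_finite_subset[of V L0]) (auto simp: nb_def)
  have nbV0: "nb V0" using V0 by (simp add: nb_def)
  obtain x0 where x0: "x0 \<in> spread u V0"
    using spread_nonempty[OF u V0(1,2) fin[OF nbV0]] by blast
  have x0G: "x0 \<in> carrier G" using x0 spread_carrier by blast
  define Q where "Q = (\<lambda>t. x0 \<otimes> t) ` (L0 <#> ((\<lambda>x. inv x) ` L0 <#> L0) <#> (\<lambda>x. inv x) ` L0)"
  have Q: "compactin T Q"
    unfolding Q_def by (intro compact_left_image compact_set_mult compact_inv_image V0(4) x0G)
  have spreadQ: "spread u V \<subseteq> Q" if "nb V" for V
  proof
    fix y assume "y \<in> spread u V"
    then have y: "y \<in> spread u V0" "y \<in> carrier G"
      using spread_mono[of V V0 u] that spread_carrier[of u V] by (auto simp: nb_def)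
    then obtain a b c d where abcd: "a \<in> V0" "b \<in> V0" "c \<in> V0" "d \<in> V0" "inv x0 \<otimes> y = a \<otimes> (inv c \<otimes> d) \<otimes> inv b"
      using spread_close[OF u p2 V0(1) x0 y(1)] by blast
    then have "inv x0 \<otimes> y \<in> L0 <#> ((\<lambda>x. inv x) ` L0 <#> L0) <#> (\<lambda>x. inv x) ` L0"
      using V0(3) by (auto intro!: set_mult_memI imageI)
    then have "x0 \<otimes> (inv x0 \<otimes> y) \<in> Q"
      unfolding Q_def by (rule imageI)
    then show "y \<in> Q"
      using mult_inv_cancel(1)[OF x0G y(2)] by simp
  qed
  have "\<exists>t\<in>Q. \<forall>V. nb V \<longrightarrow> (\<forall>U. openin T U \<and> t \<in> U \<longrightarrow> U \<inter> spread u V \<noteq> {})"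
  proof (rule ccontr)
    assume "\<not> ?thesis"
    then have "\<forall>t\<in>Q. \<exists>V U. nb V \<and> openin T U \<and> t \<in> U \<and> U \<inter> spread u V = {}"
      by blast
    then obtain V U where VO: "\<And>t. t \<in> Q \<Longrightarrow> nb (V t) \<and> openin T (U t) \<and> t \<in> U t \<and> U t \<inter> spread u (V t) = {}"
      by metis
    have "\<exists>\<F>. finite \<F> \<and> \<F> \<subseteq> U ` Q \<and> Q \<subseteq> \<Union>\<F>"
      using VO by (intro compactinD[OF Q]) blast+
    then obtain Y where Y: "finite Y" "Y \<subseteq> Q" "Q \<subseteq> (\<Union>x\<in>Y. U x)"
      by (metis finite_subset_image)
    \<comment> \<open>\<open>V0\<close> is included so that \<open>V'\<close> is still a small
      neighbourhood if the finite cover is empty. Monotonicity of the spread makes the spread of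
      \<open>V'\<close> avoid every set of the cover, hence all of \<open>Q\<close>.\<close>
    define V' where "V' = V0 \<inter> (\<Inter>t\<in>Y. V t)"
    have "openin T V'"
    proof (cases "Y = {}")
      case False
      then show ?thesis
        unfolding V'_def using Y VO V0(1) by (intro openin_Int openin_Inter) (auto simp: nb_def)
    qed (simp add: V'_def V0)
    then have nb: "nb V'"
      using Y VO V0 unfolding V'_def nb_def by blast
    have "spread u V' = {}"
    proof (rule ccontr)
      assume "spread u V' \<noteq> {}"
      then obtain y where y: "y \<in> spread u V'" by blast
      then obtain t where t: "t \<in> Y" "y \<in> U t"
        using spreadQ[OF nb] Y(3) by blast
      then have "y \<in> spread u (V t)"
        using y spread_mono[of V' "V t"] by (auto simp: V'_def)
      then show False
        using VO t Y(2) by blast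
    qed
    then show False
      using spread_nonempty[OF u _ _ fin[OF nb]] nb by (simp add: nb_def)
  qed
  then obtain t where t: "t \<in> Q" "\<And>V U. nb V \<Longrightarrow> openin T U \<Longrightarrow> t \<in> U \<Longrightarrow> U \<inter> spread u V \<noteq> {}"
    by blast
  have tG: "t \<in> carrier G" using t(1) compact_carrier[OF Q] by blast
  show ?thesis
  proof (rule that[OF tG])
    fix V x assume V: "openin T V" "\<one> \<in> V" "V \<subseteq> V0" and x: "x \<in> spread u V"
    have "t \<in> {w \<in> carrier G. inv t \<otimes> w \<in> V}"
      using tG V by simp
    then have "{w \<in> carrier G. inv t \<otimes> w \<in> V} \<inter> spread u V \<noteq> {}"
      using V by (intro t(2) left_open inv_closed tG) (simp add: nb_def)
    then obtain y where y: "y \<in> carrier G" "inv t \<otimes> y \<in> V" "y \<in> spread u V"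
      by blast
    obtain a b c d where abcd: "a \<in> V" "b \<in> V" "c \<in> V" "d \<in> V" "inv y \<otimes> x = a \<otimes> (inv c \<otimes> d) \<otimes> inv b"
      using spread_close[OF u p2 V(1) y(3) x] by blast
    have "x \<in> carrier G" using x spread_carrier by blast
    then have "inv t \<otimes> x = (inv t \<otimes> y) \<otimes> (inv y \<otimes> x)"
    proof -
      assume x: "x \<in> carrier G"
      have "(inv t \<otimes> y) \<otimes> (inv y \<otimes> x) = inv t \<otimes> ((y \<otimes> inv y) \<otimes> x)"
        using tG y(1) x by (simp only: m_assoc inv_closed m_closed)
      then show ?thesis
        using tG y(1) x by simp
    qed
    then show "inv t \<otimes> x \<in> fivefold V"
      using fivefoldI[OF abcd(1-4) y(2)] abcd(5) by simp
  qed
qed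

subsection \<open>Isometric convolvers are scalar multiples of translations\<close>

lemma translate_isometric:
  assumes u: "isometric u" and t: "t \<in> carrier G"
  defines "v \<equiv> compose (carrier E) (lreg (inv t)) u"
  shows "isometric v" and "f \<in> LF \<Longrightarrow> AE w in M. act v f w = act u f (t \<otimes> w)"
proof -
  note uC = isometricD(1)[OF u]
  show v: "isometric v"
    unfolding isometric_def v_def
    using CV_compose_closed[OF left_regular_CV[OF inv_closed[OF t]] uC] isometricD(2)[OF u] CV_closed[OF uC] t
    by (simp add: compose_def left_regular_norm)
  show "AE w in M. act v f w = act u f (t \<otimes> w)" if f: "f \<in> LF"
  proof (rule act_eqI[OF isometricD(1)[OF v] f])
    show "(\<lambda>w. act u f (t \<otimes> w)) \<in> borel_measurable M"
      by (rule bm[OF left_Lp(1)[OF t act_Lp[OF uC f]]])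
    show "v (cls f) = cls (\<lambda>w. act u f (t \<otimes> w))"
      using left_regular_class[OF inv_closed[OF t] act_Lp[OF uC f]] t
      by (simp add: v_def compose_def ae_class_in_Lp[OF f] act_class[OF uC f])
  qed
qed

text \<open>Left invariance of null sets moves the vanishing of \<open>act u f\<close> on a
  translate of \<open>V\<close> back to the identity.\<close>

lemma spread_translate:
  assumes u: "isometric u" and t: "t \<in> carrier G"
    and x: "x \<in> spread (compose (carrier E) (lreg (inv t)) u) V"
  shows "t \<otimes> x \<in> spread u V"
proof -
  let ?v = "compose (carrier E) (lreg (inv t)) u"
  obtain f where f: "x \<in> carrier G" "f \<in> LF" "\<forall>t\<in>carrier G - V. f t = 0"
    and nz: "\<not> (AE w in M. inv x \<otimes> w \<in> V \<longrightarrow> act ?v f w = 0)"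
    using x unfolding spread_def by blast
  have "\<not> (AE w in M. inv (t \<otimes> x) \<otimes> w \<in> V \<longrightarrow> act u f w = 0)"
  proof (rule contrapos_nn[OF nz])
    assume "AE w in M. inv (t \<otimes> x) \<otimes> w \<in> V \<longrightarrow> act u f w = 0"
    then have "AE w in M. inv (t \<otimes> x) \<otimes> (t \<otimes> w) \<in> V \<longrightarrow> act u f (t \<otimes> w) = 0"
      by (rule AE_left[OF t])
    moreover have "AE w in M. w \<in> carrier G"
      by (rule AE_I2) simp
    moreover note translate_isometric(2)[OF u t f(2)]
    ultimately show "AE w in M. inv x \<otimes> w \<in> V \<longrightarrow> act ?v f w = 0"
    proof eventually_elim
      case (elim w)
      have "inv (t \<otimes> x) \<otimes> (t \<otimes> w) = inv x \<otimes> (inv t \<otimes> (t \<otimes> w))"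
        using t f(1) elim(2) by (simp add: inv_mult_group m_assoc)
      also have "\<dots> = inv x \<otimes> w"
        using t elim(2) by (simp add: mult_inv_cancel)
      finally show ?case
        using elim(1,3) by simp
    qed
  qed
  then show ?thesis
    unfolding spread_def using f t by blast
qed

lemma act_zero:
  assumes v: "v \<in> carrier (CV G M p)" and f: "f \<in> LF" and z: "\<And>t. t \<in> carrier G \<Longrightarrow> f t = 0"
  shows "AE t in M. act v f t = 0"
proof -
  have "act v f = act v (\<lambda>t. 0 * f t)"
    by (rule act_cong[OF v f Lp_functions_smult[OF p f]]) (rule AE_I2, simp add: z)
  then show ?thesis
    using act_smult[OF v f, of 0] by simp
qed

lemma act_split:
  assumes v: "v \<in> carrier (CV G M p)" and f: "f \<in> LF" and g: "g \<in> LF" and h: "h \<in> LF"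
    and z: "\<And>t. t \<in> carrier G \<Longrightarrow> f t = g t + h t"
  shows "AE t in M. act v f t = act v g t + act v h t"
proof -
  have "act v f = act v (\<lambda>t. g t + h t)"
    by (rule act_cong[OF v f Lp_functions_add[OF p g h]]) (rule AE_I2, simp add: z)
  then show ?thesis
    using act_add[OF v g h] by simp
qed

section \<open>Convolvers concentrated at the identity are local, hence scalar\<close>

context
  fixes v V0
  assumes v: "isometric v" and V0: "openin T V0" "\<one> \<in> V0"
    and loc: "\<And>V. openin T V \<Longrightarrow> \<one> \<in> V \<Longrightarrow> V \<subseteq> V0 \<Longrightarrow> spread v V \<subseteq> fivefold V"
begin

lemmas vC = isometricD(1)[OF v]

lemma local_compact:
  assumes K: "compactin T K" and C: "compactin T C" and KC: "K \<inter> C = {}"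
    and f: "f \<in> LF" and f0: "\<And>t. t \<in> carrier G \<Longrightarrow> t \<notin> K \<Longrightarrow> f t = 0"
  shows "AE t in M. t \<in> C \<longrightarrow> act v f t = 0"
proof -
  note KG = compact_carrier[OF K] and CG = compact_carrier[OF C]
  define W where "W = carrier G - (C <#> (\<lambda>x. inv x) ` K)"
  have "closedin T (C <#> (\<lambda>x. inv x) ` K)"
    by (intro compact_closed compact_set_mult compact_inv_image K C)
  then have W: "openin T W"
    unfolding W_def by (simp add: closedin_def)
  have W1: "\<one> \<in> W"
  proof -
    have "\<one> \<noteq> c \<otimes> inv k" if "c \<in> C" "k \<in> K" for c k
    proof
      assume "\<one> = c \<otimes> inv k"
      moreover have "c \<in> carrier G" "k \<in> carrier G" using that KG CG by auto
      ultimately have "c = k"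
        by (metis inv_closed inv_equality inv_inv)
      then show False using that KC by blast
    qed
    then show ?thesis
      by (auto simp: W_def set_mult_def)
  qed
  obtain V where V: "openin T V" "\<one> \<in> V" "V \<subseteq> V0" "fivefold V \<subseteq> W"
    using fivefold_small[OF W W1 V0] .
  define U where "U r = {t \<in> carrier G. t \<otimes> inv r \<in> V}" for r
  have U: "openin T (U r)" "r \<in> U r" if "r \<in> carrier G" for r
    using that V unfolding U_def by (auto intro!: open_preimage continuous_right)
  have "\<exists>\<F>. finite \<F> \<and> \<F> \<subseteq> U ` K \<and> K \<subseteq> \<Union>\<F>"
    using U KG by (intro compactinD[OF K]) blast+
  then obtain X where X: "finite X" "X \<subseteq> K" "K \<subseteq> (\<Union>r\<in>X. U r)"
    by (metis finite_subset_image)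
  have one: "AE t in M. t \<in> C \<longrightarrow> act v f t = 0"
    if r: "r \<in> K" and f: "f \<in> LF" and f0: "\<And>t. t \<in> carrier G \<Longrightarrow> t \<notin> U r \<Longrightarrow> f t = 0" for f r
  proof (rule Lp_locally_zero[OF act_Lp[OF vC f] compact_sets[OF C]])
    have rG: "r \<in> carrier G" using r KG by blast
    define g where "g t = f (t \<otimes> r)" for t
    have g: "g \<in> LF"
      unfolding g_def[abs_def] by (rule right_Lp[OF rG f])
    have g0: "g t = 0" if "t \<in> carrier G - V" for t
      unfolding g_def using that rG by (intro f0) (auto simp: U_def m_assoc)
    fix w assume w: "w \<in> C"
    then have wG: "w \<in> carrier G" using CG by blast
    define x where "x = w \<otimes> inv r"
    have xG: "x \<in> carrier G" using wG rG by (simp add: x_def)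
    have "x \<notin> W"
      unfolding W_def x_def using set_mult_memI[OF w imageI[OF r]] by blast
    then have xs: "x \<notin> spread v V"
      using loc[OF V(1-3)] V(4) by blast
    have "AE t in M. inv x \<otimes> t \<in> V \<longrightarrow> act v g t = 0"
    proof (rule ccontr)
      assume "\<not> ?thesis"
      then have "x \<in> spread v V"
        unfolding spread_def using xG g g0 by blast
      then show False using xs by blast
    qed
    moreover have "AE t in M. act v g t = act v f (t \<otimes> r)"
      using act_right[OF vC rG f] unfolding g_def .
    ultimately have "AE t in M. inv x \<otimes> t \<in> V \<longrightarrow> act v f (t \<otimes> r) = 0"
      by eventually_elim simp
    then have "AE t in M. inv x \<otimes> (t \<otimes> inv r) \<in> V \<longrightarrow> act v f (t \<otimes> inv r \<otimes> r) = 0"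
      by (rule AE_right[OF inv_closed[OF rG]])
    moreover have "AE t in M. t \<in> carrier G"
      by (rule AE_I2) simp
    ultimately have "AE t in M. t \<in> {t \<in> carrier G. inv x \<otimes> (t \<otimes> inv r) \<in> V} \<longrightarrow> act v f t = 0"
      by eventually_elim (use rG in \<open>simp add: m_assoc\<close>)
    moreover have "openin T {t \<in> carrier G. inv x \<otimes> (t \<otimes> inv r) \<in> V}"
      using xG rG by (intro open_preimage continuous_mult V(1)) auto
    moreover have "w \<in> {t \<in> carrier G. inv x \<otimes> (t \<otimes> inv r) \<in> V}"
      using wG xG V(2) by (simp add: x_def[symmetric])
    ultimately show "\<exists>U. openin T U \<and> w \<in> U \<and> (AE t in M. t \<in> U \<longrightarrow> act v f t = 0)"
      by blast
  qed
  \<comment> \<open>The cover is handled by cutting off one \<open>U r\<close> at a time, so the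
    function has to vary in the induction.\<close>
  have "AE t in M. t \<in> C \<longrightarrow> act v f t = 0"
    if "finite X" "X \<subseteq> K" "f \<in> LF" "\<forall>t\<in>carrier G. t \<notin> (\<Union>r\<in>X. U r) \<longrightarrow> f t = 0" for X f
    using that
  proof (induction X arbitrary: f rule: finite_induct)
    case empty
    then have "AE t in M. act v f t = 0"
      by (intro act_zero[OF vC]) auto
    then show ?case by eventually_elim simp
  next
    case (insert r X)
    have rK: "r \<in> K" "r \<in> carrier G" using insert.prems KG by auto
    note Us = open_sets[OF U(1)[OF rK(2)]]
    have Uc: "carrier G - U r \<in> sets M"
      using sets.compl_sets[OF Us] by simp
    note f = insert.prems(2)
    note f1 = Lp_functions_indicator_mult[OF p f Us] and f2 = Lp_functions_indicator_mult[OF p f Uc]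
    have "AE t in M. act v f t = act v (\<lambda>x. indicator (U r) x * f x) t + act v (\<lambda>x. indicator (carrier G - U r) x * f x) t"
      by (rule act_split[OF vC f f1 f2]) (simp add: indicator_def)
    moreover have "AE t in M. t \<in> C \<longrightarrow> act v (\<lambda>x. indicator (U r) x * f x) t = 0"
      by (rule one[OF rK(1) f1]) simp
    moreover have "AE t in M. t \<in> C \<longrightarrow> act v (\<lambda>x. indicator (carrier G - U r) x * f x) t = 0"
      using insert.prems by (intro insert.IH f2) (auto simp: indicator_def)
    ultimately show ?case
      by eventually_elim simp
  qed
  from this[OF X(1,2) f] show ?thesis
    using f0 X(3) by blast
qed

text \<open>Each point off \<open>K\<close> has a compact neighbourhood disjoint from
  \<open>K\<close>, to which \<open>local_compact\<close> applies; \<open>Lp_locally_zero\<close>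
  joins these neighbourhoods.\<close>

lemma local_indicator_compact:
  assumes K: "compactin T K"
  shows "AE t in M. t \<notin> K \<longrightarrow> act v (indicator K) t = 0"
proof -
  note K' = Lp_functions_indicator[OF p compact_sets[OF K] compact_finite[OF K]]
  have op: "openin T (carrier G - K)"
    using compact_closed[OF K] by (simp add: closedin_def)
  have "AE t in M. t \<in> carrier G - K \<longrightarrow> act v (indicator K) t = 0"
  proof (rule Lp_locally_zero[OF act_Lp[OF vC K'] open_sets[OF op]])
    fix x assume x: "x \<in> carrier G - K"
    then have "compactin T {x}" "{x} \<subseteq> carrier G - K" by auto
    from compact_nbhd[OF this(1) op this(2)]
    obtain U L where UL: "openin T U" "compactin T L" "{x} \<subseteq> U" "U \<subseteq> L" "L \<subseteq> carrier G - K"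
      by metis
    have "AE t in M. t \<in> L \<longrightarrow> act v (indicator K) t = 0"
      using UL(5) by (intro local_compact[OF K UL(2) _ K']) auto
    then have "AE t in M. t \<in> U \<longrightarrow> act v (indicator K) t = 0"
      by eventually_elim (use UL(4) in blast)
    then show "\<exists>U. openin T U \<and> x \<in> U \<and> (AE t in M. t \<in> U \<longrightarrow> act v (indicator K) t = 0)"
      using UL(1,3) by blast
  qed
  moreover have "AE t in M. t \<in> carrier G"
    by (rule AE_I2) simp
  ultimately show ?thesis
    by eventually_elim simp
qed

text \<open>\<open>h\<close> is the part of the image outside \<open>B\<close>. Replacing
  \<open>B\<close> by a compact subset \<open>K\<close> changes nothing outside \<open>B\<close>
  except for the image of \<open>indicator (B - K)\<close>, whose p-integral is
  \<open>measure M (B - K)\<close> because \<open>v\<close> is isometric; and this is arbitrarily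
  small.\<close>

lemma local_indicator:
  assumes B: "B \<in> sets M" "emeasure M B < \<infinity>"
  shows "AE t in M. t \<notin> B \<longrightarrow> act v (indicator B) t = 0"
proof -
  note B' = Lp_functions_indicator[OF p B]
  have Bc: "carrier G - B \<in> sets M"
    using sets.compl_sets[OF B(1)] by simp
  define h where "h x = indicator (carrier G - B) x * act v (indicator B) x" for x
  have h: "h \<in> LF"
    unfolding h_def[abs_def] by (rule Lp_functions_indicator_mult[OF p act_Lp[OF vC B'] Bc])
  have le: "Lp_int M p h \<le> e" if e: "0 < e" for e
  proof -
    obtain K where K: "compactin T K" "K \<subseteq> B" "measure M (B - K) < e"
      using finite_inner[OF B e] .
    note K' = Lp_functions_indicator[OF p compact_sets[OF K(1)] compact_finite[OF K(1)]]
    have BK: "B - K \<in> sets M"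
      using B(1) compact_sets[OF K(1)] by blast
    have BKf: "emeasure M (B - K) < \<infinity>"
      by (rule emeasure_finite_subset[OF Diff_subset B])
    note BK' = Lp_functions_indicator[OF p BK BKf]
    have "AE t in M. act v (indicator B) t = act v (indicator K) t + act v (indicator (B - K)) t"
      using K(2) by (intro act_split[OF vC B' K' BK']) (auto simp: indicator_def)
    moreover note local_indicator_compact[OF K(1)]
    ultimately have "AE t in M. cmod (h t) \<le> cmod (act v (indicator (B - K)) t)"
      by eventually_elim (use K(2) in \<open>auto simp: h_def indicator_def\<close>)
    then have "Lp_int M p h \<le> Lp_int M p (act v (indicator (B - K)))"
      by (rule Lp_int_mono[OF p h act_Lp[OF vC BK']])
    also have "\<dots> = measure M (B - K)"
      using Lp_int_act[OF v BK'] Lp_int_indicator[OF p BK BKf] by simp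
    finally show ?thesis
      using K(3) by simp
  qed
  have "Lp_int M p h = 0"
    using field_le_epsilon[of "Lp_int M p h" 0] le by (intro antisym) auto
  then have "AE t in M. h t = 0"
    using Lp_int_zero_iff[OF p h] by blast
  moreover have "AE t in M. t \<in> carrier G"
    by (rule AE_I2) simp
  ultimately show ?thesis
    by eventually_elim (auto simp: h_def)
qed

text \<open>The image of \<open>indicator (B - S)\<close> lives on \<open>B - S\<close> and does not
  contribute on \<open>S\<close>. Thus \<open>v\<close> acts as multiplication by a function that is
  consistent between sets of finite measure.\<close>

lemma local_restrict:
  assumes B: "B \<in> sets M" "emeasure M B < \<infinity>" and S: "S \<in> sets M" "S \<subseteq> B"
  shows "AE t in M. t \<in> S \<longrightarrow> act v (indicator S) t = act v (indicator B) t"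
proof -
  have BS: "B - S \<in> sets M" using B S by blast
  have BSf: "emeasure M (B - S) < \<infinity>"
    by (rule emeasure_finite_subset[OF Diff_subset B])
  have Sf: "emeasure M S < \<infinity>"
    by (rule emeasure_finite_subset[OF S(2) B])
  note L = Lp_functions_indicator[OF p B] Lp_functions_indicator[OF p S(1) Sf] Lp_functions_indicator[OF p BS BSf]
  have "AE t in M. act v (indicator B) t = act v (indicator S) t + act v (indicator (B - S)) t"
    using S(2) by (intro act_split[OF vC L]) (auto simp: indicator_def)
  moreover note local_indicator[OF BS BSf]
  ultimately show ?thesis
    by eventually_elim simp
qed

text \<open>The essential range on a set of positive measure is nonempty: otherwise every complex
  number has a ball with null preimage, and by Lindelof countably many such balls cover the
  plane.\<close>

lemma local_essential_value:
  assumes B: "B \<in> sets M" "0 < emeasure M B" "emeasure M B < \<infinity>"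
  obtains z where "\<And>e. 0 < e \<Longrightarrow> 0 < emeasure M {t \<in> B. dist (act v (indicator B) t) z < e}"
proof -
  let ?\<phi> = "act v (indicator B)"
  note \<phi>m = bm[OF act_Lp[OF vC Lp_functions_indicator[OF p B(1,3)]]]
  have S: "{t \<in> B. dist (?\<phi> t) z < e} \<in> sets M" for z e
  proof -
    have "{t \<in> B. dist (?\<phi> t) z < e} = B \<inter> {t \<in> space M. dist (?\<phi> t) z < e}"
      using sets.sets_into_space[OF B(1)] by auto
    moreover have "{t \<in> space M. dist (?\<phi> t) z < e} \<in> sets M"
      using \<phi>m by measurable
    ultimately show ?thesis
      using B(1) by auto
  qed
  have "\<exists>z. \<forall>e>0. emeasure M {t \<in> B. dist (?\<phi> t) z < e} \<noteq> 0"
  proof (rule ccontr)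
    assume "\<not> ?thesis"
    then have "\<forall>z. \<exists>e>0. emeasure M {t \<in> B. dist (?\<phi> t) z < e} = 0" by blast
    then obtain e where e: "\<And>z. 0 < e z" "\<And>z. emeasure M {t \<in> B. dist (?\<phi> t) z < e z} = 0"
      by metis
    obtain \<F> where F: "\<F> \<subseteq> range (\<lambda>z. ball z (e z))" "countable \<F>" "\<Union>\<F> = \<Union>(range (\<lambda>z. ball z (e z)))"
      using Lindelof[of "range (\<lambda>z. ball z (e z))"] by auto
    have "\<Union>\<F> = UNIV"
      unfolding F(3) using e(1) centre_in_ball by blast
    obtain Z where Z: "countable Z" "\<F> = (\<lambda>z. ball z (e z)) ` Z"
      using F(1,2) by (metis countable_subset_image)
    have "AE t in M. \<forall>z\<in>Z. t \<notin> {t \<in> B. dist (?\<phi> t) z < e z}"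
      by (subst AE_ball_countable[OF Z(1)]) (use S e(2) in \<open>blast intro: AE_not_in null_setsI\<close>)
    then have "AE t in M. t \<notin> B"
    proof eventually_elim
      case (elim t)
      obtain z where "z \<in> Z" "?\<phi> t \<in> ball z (e z)"
        using \<open>\<Union>\<F> = UNIV\<close> Z(2) by blast
      then show ?case
        using elim by (auto simp: dist_commute)
    qed
    then show False
      using AE_not_positive[OF B(1,2)] by simp
  qed
  then show ?thesis
    using that by (meson zero_less_iff_neq_zero)
qed

text \<open>Let \<open>z\<close> be an essential value on a reference set \<open>B0\<close>. If the
  multiplier on some \<open>B\<close> stayed at distance at least \<open>d\<close> from
  \<open>z\<close> on a nonnull set \<open>B1\<close>, ergodicity would translate a nonnull part of
  \<open>A0\<close>, where the multiplier on \<open>B0\<close> is within \<open>d\<close> of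
  \<open>z\<close>, into \<open>B1\<close>. Commutation with right translations equates the two
  multipliers there.\<close>

lemma local_constant:
  obtains z where "\<And>B. B \<in> sets M \<Longrightarrow> emeasure M B < \<infinity> \<Longrightarrow> AE t in M. t \<in> B \<longrightarrow> act v (indicator B) t = z"
proof -
  obtain B0 L0 where B0: "openin T B0" "\<one> \<in> B0" "emeasure M B0 < \<infinity>"
    by (rule unit_nbhd_compact) (rule that)
  note B0s = open_sets[OF B0(1)]
  have B0pos: "0 < emeasure M B0"
    using B0 by (intro open_pos) auto
  let ?\<phi> = "act v (indicator B0)"
  obtain z where z: "\<And>e. 0 < e \<Longrightarrow> 0 < emeasure M {t \<in> B0. dist (?\<phi> t) z < e}"
    using local_essential_value[OF B0s B0pos B0(3)] by metis
  have "AE t in M. t \<in> B \<longrightarrow> act v (indicator B) t = z" if B: "B \<in> sets M" "emeasure M B < \<infinity>" for B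
  proof (rule ccontr)
    let ?\<psi> = "act v (indicator B)"
    note B' = Lp_functions_indicator[OF p B]
    note \<psi> = act_Lp[OF vC B']
    define h where "h t = indicator B t * ?\<psi> t + (- z) * indicator B t" for t
    have h: "h \<in> LF"
      unfolding h_def[abs_def]
      by (intro Lp_functions_add[OF p] Lp_functions_indicator_mult[OF p \<psi> B(1)] Lp_functions_smult[OF p B'])
    assume nz: "\<not> ?thesis"
    have "\<not> (AE t in M. t \<in> B \<longrightarrow> h t = 0)"
    proof (rule contrapos_nn[OF nz])
      assume "AE t in M. t \<in> B \<longrightarrow> h t = 0"
      then show "AE t in M. t \<in> B \<longrightarrow> ?\<psi> t = z"
        by eventually_elim (simp add: h_def)
    qed
    then obtain d B1 where B1: "0 < d" "B1 = {t \<in> B. d \<le> cmod (h t)}" "B1 \<in> sets M" "0 < emeasure M B1" "emeasure M B1 < \<infinity>"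
      by (rule nonnull_level[OF h B(1)])
    define A0 where "A0 = {t \<in> B0. dist (?\<phi> t) z < d}"
    have A0s: "A0 \<in> sets M"
    proof -
      have "A0 = B0 \<inter> {t \<in> space M. dist (?\<phi> t) z < d}"
        using sets.sets_into_space[OF B0s] by (auto simp: A0_def)
      moreover have "{t \<in> space M. dist (?\<phi> t) z < d} \<in> sets M"
        using bm[OF act_Lp[OF vC Lp_functions_indicator[OF p B0s B0(3)]]] by measurable
      ultimately show ?thesis
        using B0s by auto
    qed
    have A0f: "emeasure M A0 < \<infinity>"
      by (rule emeasure_finite_subset[OF _ B0s B0(3)]) (auto simp: A0_def)
    obtain s where s: "s \<in> carrier G" and N: "{t \<in> A0. t \<otimes> s \<in> B1} \<in> sets M" "0 < emeasure M {t \<in> A0. t \<otimes> s \<in> B1}"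
      by (rule ergodic[OF A0s _ A0f B1(3-5)]) (use z[OF B1(1)] in \<open>simp_all add: A0_def\<close>)
    define N1 where "N1 = {t \<in> A0. t \<otimes> s \<in> B1}"
    \<comment> \<open>The right translate of \<open>N1\<close> by \<open>s\<close>: a subset of
      \<open>B1\<close>, and \<open>indicator N1\<close> is the pullback of its indicator along
      right translation by \<open>s\<close>.\<close>
    define N2 where "N2 = {w \<in> carrier G. w \<otimes> inv s \<in> N1}"
    have N1: "N1 \<in> sets M" "N1 \<subseteq> B0" "N1 \<subseteq> carrier G"
      using N(1) sets.sets_into_space[OF N(1)] by (auto simp: N1_def A0_def)
    have N1f: "emeasure M N1 < \<infinity>"
      by (rule emeasure_finite_subset[OF N1(2) B0s B0(3)])
    have N2: "N2 \<in> sets M"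
      unfolding N2_def by (rule sets_right[OF inv_closed[OF s] N1(1)])
    have N2B: "N2 \<subseteq> B"
      using s B1(2) by (auto simp: N2_def N1_def m_assoc)
    have N2f: "emeasure M N2 < \<infinity>"
      by (rule emeasure_finite_subset[OF N2B B])
    have ind: "indicator N2 (t \<otimes> s) = (indicator N1 t :: complex)" if "t \<in> carrier G" for t
      using that s by (simp add: indicator_def N2_def m_assoc)
    have "act v (indicator N1) = act v (\<lambda>t. indicator N2 (t \<otimes> s))"
      by (rule act_cong[OF vC Lp_functions_indicator[OF p N1(1) N1f] right_Lp[OF s Lp_functions_indicator[OF p N2 N2f]]])
        (rule AE_I2, simp add: ind)
    then have "AE t in M. act v (indicator N1) t = act v (indicator N2) (t \<otimes> s)"
      using act_right[OF vC s Lp_functions_indicator[OF p N2 N2f]] by simp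
    moreover have "AE t in M. t \<in> N1 \<longrightarrow> act v (indicator N1) t = ?\<phi> t"
      by (rule local_restrict[OF B0s B0(3) N1(1,2)])
    moreover have "AE t in M. t \<otimes> s \<in> N2 \<longrightarrow> act v (indicator N2) (t \<otimes> s) = ?\<psi> (t \<otimes> s)"
      by (rule AE_right[OF s local_restrict[OF B N2 N2B]])
    moreover have "AE t in M. t \<in> carrier G"
      by (rule AE_I2) simp
    ultimately have "AE t in M. t \<notin> N1"
    proof eventually_elim
      case (elim t)
      show ?case
      proof
        assume t: "t \<in> N1"
        then have "t \<otimes> s \<in> N2"
          using elim(4) s by (simp add: N2_def m_assoc)
        then have eq: "?\<phi> t = ?\<psi> (t \<otimes> s)"
          using elim(1-3) t by simp
        have "dist (?\<phi> t) z < d"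
          using t by (simp add: N1_def A0_def)
        moreover have "t \<otimes> s \<in> B1"
          using t by (simp add: N1_def)
        then have "d \<le> cmod (?\<psi> (t \<otimes> s) - z)"
          unfolding B1(2) h_def by auto
        ultimately show False
          by (simp add: eq dist_norm)
      qed
    qed
    then show False
      using AE_not_positive[OF N] by (simp add: N1_def)
  qed
  then show ?thesis
    using that by blast
qed

text \<open>Agreement with the scalar operator on indicators extends by density; evaluating the norm
  on one nonzero vector makes the scalar unimodular.\<close>

lemma local_scalar:
  obtains z where "cmod z = 1" "v = (\<lambda>x\<in>carrier E. z \<odot>\<^bsub>E\<^esub> x)"
proof -
  obtain z where z: "\<And>B. B \<in> sets M \<Longrightarrow> emeasure M B < \<infinity> \<Longrightarrow> AE t in M. t \<in> B \<longrightarrow> act v (indicator B) t = z"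
    using local_constant by metis
  let ?z = "\<lambda>x\<in>carrier E. z \<odot>\<^bsub>E\<^esub> x"
  have "?z \<in> carrier A"
    using CV_smult_closed[OF CV_one_closed, of z] by (simp cong: restrict_cong)
  note zb = CV_bounded[OF this]
  have eq: "v = ?z"
  proof (rule bounded_operators_eq_on_indicators[OF CV_bounded[OF vC] zb])
    fix B assume B: "B \<in> sets M" "emeasure M B < \<infinity>"
    note B' = Lp_functions_indicator[OF p B]
    have "AE t in M. act v (indicator B) t = z * indicator B t"
      using z[OF B] local_indicator[OF B] by eventually_elim (simp add: indicator_def)
    then have "cls (act v (indicator B)) = cls (\<lambda>t. z * indicator B t)"
      by (intro ae_class_eqI bm[OF act_Lp[OF vC B']] bm[OF Lp_functions_smult[OF p B']])
    then show "v (cls (indicator B)) = ?z (cls (indicator B))"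
      using ae_class_in_Lp[OF B'] smult_ae_class[where p = p, OF bm[OF B']] by (simp add: act_class[OF vC B'])
  qed
  obtain B0 L0 where B0: "openin T B0" "\<one> \<in> B0" "emeasure M B0 < \<infinity>"
    by (rule unit_nbhd_compact) (rule that)
  have "B0 \<noteq> {}" using B0(2) by blast
  note ind = indicator_nonzero[OF B0(1) this B0(3)]
  have \<xi>: "cls (indicator B0) \<in> carrier E"
    by (rule ae_class_in_Lp[OF ind(1)])
  have "mnorm E (cls (indicator B0)) \<noteq> 0"
    using ind(3) mnorm_ae_class[OF ind(1)] by simp
  moreover have "cmod z * mnorm E (cls (indicator B0)) = mnorm E (cls (indicator B0))"
    using isometricD(2)[OF v \<xi>] \<xi> by (simp add: eq P.E.norm_smult)
  ultimately have "cmod z = 1" by simp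
  then show ?thesis
    using that eq by blast
qed

end

theorem isometric_convolver:
  assumes u: "isometric u" and p2: "p \<noteq> 2"
  obtains z s where "cmod z = 1" "s \<in> carrier G" "u = z \<odot>\<^bsub>A\<^esub> lreg s"
proof -
  obtain V0 L0 where V0: "openin T V0" "\<one> \<in> V0" "V0 \<subseteq> L0" "compactin T L0" "emeasure M V0 < \<infinity>"
    by (rule unit_nbhd_compact)
  obtain t where t: "t \<in> carrier G"
    "\<And>V x. openin T V \<Longrightarrow> \<one> \<in> V \<Longrightarrow> V \<subseteq> V0 \<Longrightarrow> x \<in> spread u V \<Longrightarrow> inv t \<otimes> x \<in> fivefold V"
    by (rule spread_center[OF u p2 V0(1-4)]) (rule that)
  define v where "v = compose (carrier E) (lreg (inv t)) u"
  have v: "isometric v"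
    unfolding v_def by (rule translate_isometric(1)[OF u t(1)])
  have loc: "spread v V \<subseteq> fivefold V" if V: "openin T V" "\<one> \<in> V" "V \<subseteq> V0" for V
  proof
    fix x assume x: "x \<in> spread v V"
    then have xG: "x \<in> carrier G" using spread_carrier by blast
    have "t \<otimes> x \<in> spread u V"
      using spread_translate[OF u t(1) x[unfolded v_def]] .
    from t(2)[OF V this] show "x \<in> fivefold V"
      using mult_inv_cancel(2)[OF t(1) xG] by simp
  qed
  obtain z where z: "cmod z = 1" "v = (\<lambda>x\<in>carrier E. z \<odot>\<^bsub>E\<^esub> x)"
    using local_scalar[OF v V0(1,2) loc] by metis
  note uC = isometricD(1)[OF u]
  have "u \<xi> = z \<odot>\<^bsub>E\<^esub> lreg t \<xi>" if \<xi>: "\<xi> \<in> carrier E" for \<xi>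
  proof -
    have "u \<xi> = lreg t (lreg (inv t) (u \<xi>))"
      using left_regular_mult[OF t(1) inv_closed[OF t(1)] CV_closed[OF uC \<xi>]] t(1) CV_closed[OF uC \<xi>]
      by (simp add: left_regular_one)
    also have "lreg (inv t) (u \<xi>) = v \<xi>"
      using \<xi> by (simp add: v_def compose_def)
    also have "lreg t (v \<xi>) = z \<odot>\<^bsub>E\<^esub> lreg t \<xi>"
      using \<xi> by (simp add: z(2) regular_linear(3)[OF t(1) \<xi>])
    finally show ?thesis .
  qed
  then have "u = z \<odot>\<^bsub>A\<^esub> lreg t"
    using CV_smult_closed[OF left_regular_CV[OF t(1)], of z] by (intro CV_ext[OF uC]) (simp_all add: CV_simps)
  then show ?thesis
    using that z(1) t(1) by blast
qed

end

subsection \<open>The map Delta\<close>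

lemma continuous_map_mult_complex:
  fixes f g :: "'a \<Rightarrow> complex"
  assumes "continuous_map X euclidean f" "continuous_map X euclidean g"
  shows "continuous_map X euclidean (\<lambda>x. f x * g x)"
proof -
  have "continuous_map (prod_topology euclidean euclidean) euclidean (\<lambda>z :: complex \<times> complex. fst z * snd z)"
    by (simp add: continuous_map_iff_continuous2 continuous_intros)
  moreover have "continuous_map X (prod_topology euclidean euclidean) (\<lambda>x. (f x, g x))"
    unfolding continuous_map_paired using assms by blast
  ultimately have "continuous_map X euclidean ((\<lambda>z. fst z * snd z) \<circ> (\<lambda>x. (f x, g x)))"
    by (rule continuous_map_compose[rotated])
  then show ?thesis
    by (simp add: o_def)
qed

text \<open>Transport of structure: the group axioms of \<open>H\<close> and the continuity of its
  operations are read off from \<open>G\<close> through \<open>f\<close> and its continuous inverse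
  \<open>g\<close>. For operators this settles joint weak* continuity of the product without any
  computation. \<open>iso\<close> speaks of products and bijectivity only, so the unit is a separate
  assumption.\<close>

lemma topological_group_isoI:
  assumes G: "topological_group G T" and f: "f \<in> iso G H" and one: "f \<one>\<^bsub>G\<^esub> = \<one>\<^bsub>H\<^esub>"
    and homeo: "homeomorphic_map T S f"
  shows "topological_group_iso G T H S f"
proof -
  interpret G: group G
    using G by (simp add: topological_group_def)
  have topG: "topspace T = carrier G" and multG: "continuous_map (prod_topology T T) T (\<lambda>(x, y). x \<otimes>\<^bsub>G\<^esub> y)"
    and invG: "continuous_map T T (\<lambda>x. inv\<^bsub>G\<^esub> x)"
    using G by (auto simp: topological_group_def)
  have bij: "bij_betw f (carrier G) (carrier H)" and hom: "f \<in> hom G H"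
    using f by (auto simp: iso_def)
  have img: "f ` carrier G = carrier H"
    using bij by (simp add: bij_betw_def)
  have mult: "f (x \<otimes>\<^bsub>G\<^esub> y) = f x \<otimes>\<^bsub>H\<^esub> f y" if "x \<in> carrier G" "y \<in> carrier G" for x y
    using hom that by (simp add: hom_def)
  obtain g where g: "continuous_map T S f" "continuous_map S T g"
    "\<And>x. x \<in> topspace T \<Longrightarrow> g (f x) = x" "\<And>y. y \<in> topspace S \<Longrightarrow> f (g y) = y"
    using homeo unfolding homeomorphic_map_maps homeomorphic_maps_def by blast
  have topH: "topspace S = carrier H"
    using homeomorphic_imp_surjective_map[OF homeo] img topG by simp
  have gG: "g y \<in> carrier G" if "y \<in> carrier H" for y
    using g(2) that by (auto simp: continuous_map_def topG topH)
  have fg: "f (g y) = y" if "y \<in> carrier H" for y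
    using g(4) that by (simp add: topH)
  have fH: "f x \<in> carrier H" if "x \<in> carrier G" for x
    using img that by blast
  have multH: "x \<otimes>\<^bsub>H\<^esub> y = f (g x \<otimes>\<^bsub>G\<^esub> g y)" if "x \<in> carrier H" "y \<in> carrier H" for x y
    using that by (simp add: mult gG fg)
  interpret H: group H
  proof (rule groupI)
    show "\<one>\<^bsub>H\<^esub> \<in> carrier H"
      using fH[OF G.one_closed] one by simp
    fix x assume x: "x \<in> carrier H"
    show "\<one>\<^bsub>H\<^esub> \<otimes>\<^bsub>H\<^esub> x = x"
      using mult[of "\<one>\<^bsub>G\<^esub>" "g x"] x by (simp add: gG fg one)
    show "\<exists>y\<in>carrier H. y \<otimes>\<^bsub>H\<^esub> x = \<one>\<^bsub>H\<^esub>"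
      using mult[of "inv\<^bsub>G\<^esub> (g x)" "g x"] x
      by (intro bexI[of _ "f (inv\<^bsub>G\<^esub> (g x))"] fH) (simp_all add: gG fg one)
    fix y assume y: "y \<in> carrier H"
    show "x \<otimes>\<^bsub>H\<^esub> y \<in> carrier H"
      using x y by (simp add: multH fH gG)
    fix z assume z: "z \<in> carrier H"
    have "f (g x \<otimes>\<^bsub>G\<^esub> g y \<otimes>\<^bsub>G\<^esub> g z) = f (g x \<otimes>\<^bsub>G\<^esub> (g y \<otimes>\<^bsub>G\<^esub> g z))"
      using x y z by (simp add: G.m_assoc gG)
    then show "x \<otimes>\<^bsub>H\<^esub> y \<otimes>\<^bsub>H\<^esub> z = x \<otimes>\<^bsub>H\<^esub> (y \<otimes>\<^bsub>H\<^esub> z)"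
      using x y z by (simp add: mult gG fg)
  qed
  have "continuous_map (prod_topology S S) S (\<lambda>z. f ((\<lambda>(x, y). x \<otimes>\<^bsub>G\<^esub> y) (g (fst z), g (snd z))))"
  proof (rule continuous_map_compose[OF _ g(1), unfolded o_def])
    have "continuous_map (prod_topology S S) (prod_topology T T) (\<lambda>z. (g (fst z), g (snd z)))"
      unfolding continuous_map_paired
      using continuous_map_compose[OF continuous_map_fst[of S S] g(2)] continuous_map_compose[OF continuous_map_snd[of S S] g(2)]
      by (simp add: o_def)
    from continuous_map_compose[OF this multG]
    show "continuous_map (prod_topology S S) T (\<lambda>z. (\<lambda>(x, y). x \<otimes>\<^bsub>G\<^esub> y) (g (fst z), g (snd z)))"
      by (simp add: o_def)
  qed
  then have "continuous_map (prod_topology S S) S (\<lambda>(x, y). x \<otimes>\<^bsub>H\<^esub> y)"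
    by (rule continuous_map_eq) (auto simp: topH multH)
  moreover have "continuous_map S S (\<lambda>x. f (inv\<^bsub>G\<^esub> (g x)))"
    using continuous_map_compose[OF continuous_map_compose[OF g(2) invG] g(1)] by (simp add: o_def)
  then have "continuous_map S S (\<lambda>x. inv\<^bsub>H\<^esub> x)"
  proof (rule continuous_map_eq)
    fix x assume "x \<in> topspace S"
    then have x: "x \<in> carrier H" by (simp add: topH)
    have "f (inv\<^bsub>G\<^esub> (g x)) \<otimes>\<^bsub>H\<^esub> x = \<one>\<^bsub>H\<^esub>"
      using mult[of "inv\<^bsub>G\<^esub> (g x)" "g x"] x by (simp add: gG fg one)
    then show "f (inv\<^bsub>G\<^esub> (g x)) = inv\<^bsub>H\<^esub> x"
      using x by (intro H.inv_equality[symmetric] fH G.inv_closed gG)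
  qed
  ultimately have "topological_group H S"
    by (simp add: topological_group_def H.is_group topH)
  then show ?thesis
    using G f homeo by (simp add: topological_group_iso_def)
qed

lemma circle_group_simps [simp]:
  "carrier circle_group = sphere 0 1" "mult circle_group = (*)" "one circle_group = 1"
  "topspace circle_topology = sphere 0 1"
  by (simp_all add: circle_group_def circle_topology_def)

lemma group_circle: "group circle_group"
proof (rule groupI)
  fix x assume "x \<in> carrier circle_group"
  then show "\<exists>y\<in>carrier circle_group. y \<otimes>\<^bsub>circle_group\<^esub> x = \<one>\<^bsub>circle_group\<^esub>"
    by (intro bexI[of _ "inverse x"]) (auto simp: norm_inverse intro!: left_inverse)
qed (auto simp: norm_mult)

lemma inv_circle: "x \<in> sphere 0 1 \<Longrightarrow> inv\<^bsub>circle_group\<^esub> x = inverse x"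
  by (rule group.inv_equality[OF group_circle]) (auto simp: norm_inverse intro!: left_inverse)

lemma continuous_circle_incl: "continuous_map circle_topology euclidean (\<lambda>x. x)"
  unfolding circle_topology_def by simp

lemma topological_group_circle: "topological_group circle_group circle_topology"
proof -
  have "continuous_map (prod_topology circle_topology circle_topology) euclidean (\<lambda>z. fst z * snd z)"
    unfolding circle_topology_def by (intro continuous_map_mult_complex) (auto intro!: continuous_intros)
  then have 1: "continuous_map (prod_topology circle_topology circle_topology) circle_topology (\<lambda>(x, y). x * y)"
    by (subst (3) circle_topology_def) (auto simp: continuous_map_in_subtopology case_prod_unfold norm_mult)
  have "continuous_map circle_topology euclidean (inverse :: complex \<Rightarrow> complex)"
    unfolding circle_topology_def by (auto intro!: continuous_intros)
  then have "continuous_map circle_topology circle_topology inverse"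
    by (subst (2) circle_topology_def) (auto simp: continuous_map_in_subtopology norm_inverse)
  then have "continuous_map circle_topology circle_topology (\<lambda>x. inv\<^bsub>circle_group\<^esub> x)"
    by (rule continuous_map_eq) (simp add: inv_circle)
  then show ?thesis
    using 1 by (simp add: topological_group_def group_circle)
qed

lemma topological_group_DirProd:
  assumes G: "topological_group G T" and H: "topological_group H S"
  shows "topological_group (G \<times>\<times> H) (prod_topology T S)"
proof -
  have gG: "group G" and gH: "group H" and top: "topspace T = carrier G" "topspace S = carrier H"
    and mG: "continuous_map (prod_topology T T) T (\<lambda>(x, y). x \<otimes>\<^bsub>G\<^esub> y)"
    and mH: "continuous_map (prod_topology S S) S (\<lambda>(x, y). x \<otimes>\<^bsub>H\<^esub> y)"
    and iG: "continuous_map T T (\<lambda>x. inv\<^bsub>G\<^esub> x)" and iH: "continuous_map S S (\<lambda>x. inv\<^bsub>H\<^esub> x)"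
    using G H by (auto simp: topological_group_def)
  let ?P = "prod_topology T S"
  have f: "continuous_map (prod_topology ?P ?P) T (\<lambda>z. fst (fst z))" "continuous_map (prod_topology ?P ?P) T (\<lambda>z. fst (snd z))"
    "continuous_map (prod_topology ?P ?P) S (\<lambda>z. snd (fst z))" "continuous_map (prod_topology ?P ?P) S (\<lambda>z. snd (snd z))"
    using continuous_map_compose[OF continuous_map_fst[of ?P ?P] continuous_map_fst[of T S]]
      continuous_map_compose[OF continuous_map_snd[of ?P ?P] continuous_map_fst[of T S]]
      continuous_map_compose[OF continuous_map_fst[of ?P ?P] continuous_map_snd[of T S]]
      continuous_map_compose[OF continuous_map_snd[of ?P ?P] continuous_map_snd[of T S]]
    by (simp_all add: o_def)
  have "continuous_map (prod_topology ?P ?P) T (\<lambda>z. fst (fst z) \<otimes>\<^bsub>G\<^esub> fst (snd z))"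
    using continuous_map_compose[OF _ mG, of "prod_topology ?P ?P" "\<lambda>z. (fst (fst z), fst (snd z))"] f
    by (simp add: o_def continuous_map_paired)
  moreover have "continuous_map (prod_topology ?P ?P) S (\<lambda>z. snd (fst z) \<otimes>\<^bsub>H\<^esub> snd (snd z))"
    using continuous_map_compose[OF _ mH, of "prod_topology ?P ?P" "\<lambda>z. (snd (fst z), snd (snd z))"] f
    by (simp add: o_def continuous_map_paired)
  ultimately have "continuous_map (prod_topology ?P ?P) ?P (\<lambda>z. (fst (fst z) \<otimes>\<^bsub>G\<^esub> fst (snd z), snd (fst z) \<otimes>\<^bsub>H\<^esub> snd (snd z)))"
    by (simp add: continuous_map_paired)
  then have m: "continuous_map (prod_topology ?P ?P) ?P (\<lambda>(x, y). x \<otimes>\<^bsub>G \<times>\<times> H\<^esub> y)"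
    by (simp add: case_prod_unfold mult_DirProd')
  have "continuous_map ?P ?P (\<lambda>z. (inv\<^bsub>G\<^esub> (fst z), inv\<^bsub>H\<^esub> (snd z)))"
    unfolding continuous_map_paired
    using continuous_map_compose[OF continuous_map_fst iG, of S] continuous_map_compose[OF continuous_map_snd iH, of T]
    by (simp add: o_def)
  then have "continuous_map ?P ?P (\<lambda>x. inv\<^bsub>G \<times>\<times> H\<^esub> x)"
  proof (rule continuous_map_eq)
    fix x assume "x \<in> topspace ?P"
    then show "(inv\<^bsub>G\<^esub> (fst x), inv\<^bsub>H\<^esub> (snd x)) = inv\<^bsub>G \<times>\<times> H\<^esub> x"
      using inv_DirProd[OF gG gH, of "fst x" "snd x"] by (auto simp: top)
  qed
  then show ?thesis
    using m DirProd_group[OF gG gH] by (simp add: topological_group_def top)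
qed

section \<open>Continuity of the coefficients of the left regular representation\<close>

context haar_Lp
begin

text \<open>By Hoelder and left invariance the error made in replacing \<open>f\<close> by
  \<open>h i\<close> does not depend on \<open>r\<close>, so the coefficients converge
  uniformly.\<close>

lemma coefficient_limit:
  assumes f: "f \<in> LF" and s: "\<And>i :: nat. h i \<in> LF" and g: "g \<in> Lp_functions M q"
    and cont: "\<And>i. continuous_map T euclidean (\<lambda>r. \<integral>t. h i (inv r \<otimes> t) * g t \<partial>M)"
    and lim: "(\<lambda>i. Lp_int M p (\<lambda>x. f x - h i x)) \<longlonglongrightarrow> 0"
  shows "continuous_map T euclidean (\<lambda>r. \<integral>t. f (inv r \<otimes> t) * g t \<partial>M)"
proof -
  let ?C = "Lp_int M q g powr (1/q)"
  have lim': "(\<lambda>i. Lp_int M p (\<lambda>x. f x - h i x) powr (1/p) * ?C) \<longlonglongrightarrow> 0"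
    using p by (intro tendsto_mult_left_zero tendsto_zero_powrI[OF lim tendsto_const]) auto
  have bound: "dist (\<integral>t. h i (inv r \<otimes> t) * g t \<partial>M) (\<integral>t. f (inv r \<otimes> t) * g t \<partial>M) \<le>
      Lp_int M p (\<lambda>x. f x - h i x) powr (1/p) * ?C" if r: "r \<in> carrier G" for r i
  proof -
    note ir = inv_closed[OF r]
    note d = Lp_functions_diff[OF p f s[of i]]
    have "(\<integral>t. f (inv r \<otimes> t) * g t \<partial>M) - (\<integral>t. h i (inv r \<otimes> t) * g t \<partial>M) =
        (\<integral>t. (f (inv r \<otimes> t) - h i (inv r \<otimes> t)) * g t \<partial>M)"
      using holder(1)[OF p left_Lp(1)[OF ir f] g] holder(1)[OF p left_Lp(1)[OF ir s] g]
      by (simp add: left_diff_distrib)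
    then have "dist (\<integral>t. h i (inv r \<otimes> t) * g t \<partial>M) (\<integral>t. f (inv r \<otimes> t) * g t \<partial>M) =
        cmod (\<integral>t. (f (inv r \<otimes> t) - h i (inv r \<otimes> t)) * g t \<partial>M)"
      by (simp add: dist_norm norm_minus_commute)
    also have "\<dots> \<le> Lp_int M p (\<lambda>t. f (inv r \<otimes> t) - h i (inv r \<otimes> t)) powr (1/p) * ?C"
      by (rule holder(2)[OF p left_Lp(1)[OF ir d] g])
    also have "Lp_int M p (\<lambda>t. f (inv r \<otimes> t) - h i (inv r \<otimes> t)) = Lp_int M p (\<lambda>x. f x - h i x)"
      by (rule left_Lp(2)[OF ir d])
    finally show ?thesis .
  qed
  have "continuous_map T Met_TC.mtopology (\<lambda>r. \<integral>t. f (inv r \<otimes> t) * g t \<partial>M)"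
  proof (rule Met_TC.continuous_map_uniform_limit)
    show "\<forall>\<^sub>F i in sequentially. continuous_map T Met_TC.mtopology (\<lambda>r. \<integral>t. h i (inv r \<otimes> t) * g t \<partial>M)"
      using cont by simp
    fix e :: real assume "0 < e"
    then have "\<forall>\<^sub>F i in sequentially. Lp_int M p (\<lambda>x. f x - h i x) powr (1/p) * ?C < e"
      using order_tendstoD(2)[OF lim'] by blast
    then show "\<forall>\<^sub>F i in sequentially. \<forall>r\<in>topspace T. (\<integral>t. f (inv r \<otimes> t) * g t \<partial>M) \<in> UNIV \<and>
        dist (\<integral>t. h i (inv r \<otimes> t) * g t \<partial>M) (\<integral>t. f (inv r \<otimes> t) * g t \<partial>M) < e"
    proof eventually_elim
      case (elim i)
      show ?case
      proof (intro ballI conjI UNIV_I)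
        fix r assume "r \<in> topspace T"
        then have "r \<in> carrier G" by simp
        from le_less_trans[OF bound[OF this] elim]
        show "dist (\<integral>t. h i (inv r \<otimes> t) * g t \<partial>M) (\<integral>t. f (inv r \<otimes> t) * g t \<partial>M) < e" .
      qed
    qed
  qed simp
  then show ?thesis by simp
qed

text \<open>The p-integral of the difference of the indicators of \<open>K\<close> and of a left
  translate of \<open>K\<close> is the measure of the symmetric difference, which
  \<open>translate_compact_small\<close> makes small near the identity.\<close>

lemma coefficient_compact:
  assumes K: "compactin T K" and g: "g \<in> Lp_functions M q"
  shows "continuous_map T euclidean (\<lambda>r. \<integral>t. indicator K (inv r \<otimes> t) * g t \<partial>M)"
proof -
  note Ks = compact_sets[OF K] and Kf = compact_finite[OF K]
  note K' = Lp_functions_indicator[OF p Ks Kf]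
  let ?C = "Lp_int M q g powr (1/q)"
  have "continuous_map T Met_TC.mtopology (\<lambda>r. \<integral>t. indicator K (inv r \<otimes> t) * g t \<partial>M)"
    unfolding Met_TC.continuous_map_to_metric
  proof (intro ballI allI impI)
    fix r0 and e :: real assume "r0 \<in> topspace T" and e: "0 < e"
    then have r0: "r0 \<in> carrier G" by simp
    \<comment> \<open>The symmetric difference has two halves of measure below \<open>d\<close>, so
      the difference has norm below \<open>e / (?C + 1)\<close>; the summand 1 covers the case where
      \<open>g\<close> has norm zero.\<close>
    define d where "d = (e / (?C + 1)) powr p / 2"
    have C: "0 \<le> ?C" by simp
    then have C1: "0 < ?C + 1" by linarith
    then have d: "0 < d"
      using e by (simp add: d_def)
    obtain U where U: "openin T U" "\<one> \<in> U"
      "\<And>s. s \<in> U \<Longrightarrow> measure M ({t \<in> carrier G. inv s \<otimes> t \<in> K} - K) < d"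
      "\<And>s. s \<in> U \<Longrightarrow> measure M (K - {t \<in> carrier G. inv s \<otimes> t \<in> K}) < d"
      by (rule translate_compact_small[OF K d]) (rule that)
    have "dist (\<integral>t. indicator K (inv r0 \<otimes> t) * g t \<partial>M) (\<integral>t. indicator K (inv r \<otimes> t) * g t \<partial>M) < e"
      if r: "r \<in> carrier G" "inv r0 \<otimes> r \<in> U" for r
    proof -
      define s where "s = inv r0 \<otimes> r"
      have s: "s \<in> carrier G" using r r0 by (simp add: s_def)
      let ?K = "{t \<in> carrier G. inv s \<otimes> t \<in> K}"
      have K's: "?K \<in> sets M" "emeasure M ?K < \<infinity>"
        using emeasure_left[OF inv_closed[OF s] Ks] Kf by auto
      define F where "F t = indicator K t - (indicator K (inv s \<otimes> t) :: complex)" for t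
      have F: "F \<in> LF"
        unfolding F_def[abs_def] by (rule Lp_functions_diff[OF p K' left_Lp(1)[OF inv_closed[OF s] K']])
      have Dm: "?K - K \<in> sets M" "K - ?K \<in> sets M"
        using K's Ks by blast+
      have Df: "emeasure M (?K - K) < \<infinity>" "emeasure M (K - ?K) < \<infinity>"
        by (rule emeasure_finite_subset[OF Diff_subset K's] emeasure_finite_subset[OF Diff_subset Ks Kf])+
      have "Lp_int M p F = (\<integral>t. indicator (?K - K) t + indicator (K - ?K) t \<partial>M)"
        unfolding Lp_int_def F_def using p
        by (intro Bochner_Integration.integral_cong[OF refl]) (auto simp: indicator_def)
      also have "\<dots> = measure M (?K - K) + measure M (K - ?K)"
        using Dm Df by simp
      also have "\<dots> < 2 * d"
        using U(3,4)[of s] r(2) by (simp add: s_def)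
      finally have Fd: "Lp_int M p F < (e / (?C + 1)) powr p"
        by (simp add: d_def)
      have eqF: "AE t in M. indicator K (inv r0 \<otimes> t) - (indicator K (inv r \<otimes> t) :: complex) = F (inv r0 \<otimes> t)"
      proof (rule AE_I2)
        fix t assume "t \<in> space M"
        then have t: "t \<in> carrier G" by simp
        have "inv s \<otimes> (inv r0 \<otimes> t) = inv r \<otimes> t"
          using r0 r(1) t by (simp add: s_def inv_mult_group m_assoc mult_inv_cancel)
        then show "indicator K (inv r0 \<otimes> t) - (indicator K (inv r \<otimes> t) :: complex) = F (inv r0 \<otimes> t)"
          by (simp add: F_def)
      qed
      note L0 = left_Lp(1)[OF inv_closed[OF r0] K'] and L1 = left_Lp(1)[OF inv_closed[OF r(1)] K']
      have "(\<integral>t. indicator K (inv r0 \<otimes> t) * g t \<partial>M) - (\<integral>t. indicator K (inv r \<otimes> t) * g t \<partial>M) =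
          (\<integral>t. (indicator K (inv r0 \<otimes> t) - indicator K (inv r \<otimes> t)) * g t \<partial>M)"
        using holder(1)[OF p L0 g] holder(1)[OF p L1 g] by (simp only: left_diff_distrib Bochner_Integration.integral_diff)
      then have "dist (\<integral>t. indicator K (inv r0 \<otimes> t) * g t \<partial>M) (\<integral>t. indicator K (inv r \<otimes> t) * g t \<partial>M) =
          cmod (\<integral>t. (indicator K (inv r0 \<otimes> t) - indicator K (inv r \<otimes> t)) * g t \<partial>M)"
        by (simp only: dist_norm)
      also have "\<dots> \<le> Lp_int M p (\<lambda>t. indicator K (inv r0 \<otimes> t) - indicator K (inv r \<otimes> t)) powr (1/p) * ?C"
        by (rule holder(2)[OF p Lp_functions_diff[OF p L0 L1] g])
      also have "Lp_int M p (\<lambda>t. indicator K (inv r0 \<otimes> t) - indicator K (inv r \<otimes> t)) = Lp_int M p (\<lambda>t. F (inv r0 \<otimes> t))"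
        by (rule Lp_int_cong_AE[OF bm[OF Lp_functions_diff[OF p L0 L1]] bm[OF left_Lp(1)[OF inv_closed[OF r0] F]] eqF])
      also have "\<dots> = Lp_int M p F"
        by (rule left_Lp(2)[OF inv_closed[OF r0] F])
      also have "Lp_int M p F powr (1/p) * ?C \<le> ((e / (?C + 1)) powr p) powr (1/p) * ?C"
        using Fd p by (intro mult_right_mono powr_mono2) auto
      also have "\<dots> = e / (?C + 1) * ?C"
        using p e C1 by (simp add: powr_powr)
      also have "\<dots> < e"
      proof -
        have "?C / (?C + 1) < 1"
          using C1 by (simp add: divide_less_eq)
        then have "e * (?C / (?C + 1)) < e * 1"
          using e by (intro mult_strict_left_mono)
        then show ?thesis by simp
      qed
      finally show ?thesis .
    qed
    moreover have "openin T {r \<in> carrier G. inv r0 \<otimes> r \<in> U}"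
      by (rule left_open[OF inv_closed[OF r0] U(1)])
    moreover have "r0 \<in> {r \<in> carrier G. inv r0 \<otimes> r \<in> U}"
      using r0 U(2) by simp
    ultimately show "\<exists>U. openin T U \<and> r0 \<in> U \<and> (\<forall>r\<in>U. (\<integral>t. indicator K (inv r \<otimes> t) * g t \<partial>M) \<in>
        Met_TC.mball (\<integral>t. indicator K (inv r0 \<otimes> t) * g t \<partial>M) e)"
      by (intro exI[of _ "{r \<in> carrier G. inv r0 \<otimes> r \<in> U}"]) auto
  qed
  then show ?thesis by simp
qed

text \<open>Density reduces to indicators of sets of finite measure, and \<open>finite_inner\<close>
  approximates these by compact sets.\<close>

lemma coefficient_continuous:
  assumes f: "f \<in> LF" and g: "g \<in> Lp_functions M q"
  shows "continuous_map T euclidean (\<lambda>r. \<integral>t. f (inv r \<otimes> t) * g t \<partial>M)"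
  using f
proof (induct rule: Lp_functions_induct[OF p, consumes 1, case_names indicator smult add limit])
  case (indicator B)
  have "\<exists>K. compactin T K \<and> K \<subseteq> B \<and> measure M (B - K) < 1 / (real i + 1)" for i :: nat
  proof -
    have "0 < 1 / (real i + 1)" by simp
    then show ?thesis
      by (rule finite_inner[OF indicator]) blast
  qed
  then obtain K where K: "\<And>i :: nat. compactin T (K i)" "\<And>i. K i \<subseteq> B" "\<And>i. measure M (B - K i) < 1 / (real i + 1)"
    by metis
  note B' = Lp_functions_indicator[OF p indicator]
  have K': "indicator (K i) \<in> LF" for i
    by (rule Lp_functions_indicator[OF p compact_sets[OF K(1)] compact_finite[OF K(1)]])
  have eq: "Lp_int M p (\<lambda>x. indicator B x - indicator (K i) x) = measure M (B - K i)" for i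
  proof -
    have "(\<lambda>x. indicator B x - indicator (K i) x) = (indicator (B - K i) :: 'a \<Rightarrow> complex)"
      using K(2)[of i] by (auto simp: indicator_def fun_eq_iff)
    moreover have "B - K i \<in> sets M"
      using indicator(1) compact_sets[OF K(1)] by blast
    ultimately show ?thesis
      using Lp_int_indicator[OF p _ emeasure_finite_subset[OF Diff_subset indicator]] by simp
  qed
  have lim: "(\<lambda>i. Lp_int M p (\<lambda>x. indicator B x - indicator (K i) x)) \<longlonglongrightarrow> 0"
    unfolding eq
  proof (rule tendsto_sandwich[OF _ _ tendsto_const])
    show "\<forall>\<^sub>F i in sequentially. measure M (B - K i) \<le> 1 / (real i + 1)"
      using K(3) by (intro always_eventually allI less_imp_le)
    show "(\<lambda>i. 1 / (real i + 1)) \<longlonglongrightarrow> 0"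
      using LIMSEQ_inverse_real_of_nat by (simp add: inverse_eq_divide add.commute)
  qed simp
  show ?case
    by (rule coefficient_limit[OF B' K' g coefficient_compact[OF K(1) g] lim])
next
  case (smult c h)
  have "continuous_map T euclidean (\<lambda>r. c * (\<integral>t. h (inv r \<otimes> t) * g t \<partial>M))"
    by (intro continuous_map_mult_complex smult(2)) simp
  then show ?case
    by (simp add: mult.assoc)
next
  case (add h k)
  have "continuous_map T euclidean (\<lambda>r. (\<integral>t. h (inv r \<otimes> t) * g t \<partial>M) + (\<integral>t. k (inv r \<otimes> t) * g t \<partial>M))"
    by (intro continuous_map_add add(2,4))
  then show ?case
  proof (rule continuous_map_eq)
    fix r assume "r \<in> topspace T"
    then have r: "inv r \<in> carrier G" by simp
    show "(\<integral>t. h (inv r \<otimes> t) * g t \<partial>M) + (\<integral>t. k (inv r \<otimes> t) * g t \<partial>M) =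
        (\<integral>t. (h (inv r \<otimes> t) + k (inv r \<otimes> t)) * g t \<partial>M)"
      using holder(1)[OF p left_Lp(1)[OF r add(1)] g] holder(1)[OF p left_Lp(1)[OF r add(3)] g]
      by (simp only: distrib_right Bochner_Integration.integral_add)
  qed
next
  case (limit h s)
  show ?case
    by (rule coefficient_limit[OF limit(1,2) g limit(3,4)])
qed

definition Delta :: "complex \<times> 'a \<Rightarrow> ('a \<Rightarrow> complex) set \<Rightarrow> ('a \<Rightarrow> complex) set" where
  "Delta = (\<lambda>(z, s). z \<odot>\<^bsub>A\<^esub> lreg s)"

lemma Delta_CV: "s \<in> carrier G \<Longrightarrow> Delta (z, s) \<in> carrier A"
  unfolding Delta_def using A.smult_closed[OF left_regular_CV] by simp

lemma Delta_apply: "\<xi> \<in> carrier E \<Longrightarrow> Delta (z, s) \<xi> = z \<odot>\<^bsub>E\<^esub> lreg s \<xi>"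
  by (simp add: Delta_def CV_simps)

lemma Delta_mult:
  assumes "s \<in> carrier G" "t \<in> carrier G"
  shows "Delta (z, s) \<otimes>\<^bsub>A\<^esub> Delta (w, t) = Delta (z * w, s \<otimes> t)"
proof (rule CV_ext)
  show "Delta (z, s) \<otimes>\<^bsub>A\<^esub> Delta (w, t) \<in> carrier A"
    using assms Delta_CV by (intro Am.m_closed)
  fix \<xi> assume \<xi>: "\<xi> \<in> carrier E"
  have "(Delta (z, s) \<otimes>\<^bsub>A\<^esub> Delta (w, t)) \<xi> = Delta (z, s) (Delta (w, t) \<xi>)"
    using \<xi> by (simp add: CV_simps compose_def)
  also have "\<dots> = z \<odot>\<^bsub>E\<^esub> lreg s (w \<odot>\<^bsub>E\<^esub> lreg t \<xi>)"
    using \<xi> assms by (simp add: Delta_apply left_regular_closed)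
  also have "\<dots> = Delta (z * w, s \<otimes> t) \<xi>"
    using \<xi> assms by (simp add: Delta_apply left_regular_closed regular_linear left_regular_mult P.E.smult_assoc)
  finally show "(Delta (z, s) \<otimes>\<^bsub>A\<^esub> Delta (w, t)) \<xi> = Delta (z * w, s \<otimes> t) \<xi>" .
qed (use assms Delta_CV in simp)

lemma Delta_one: "Delta (1, \<one>) = \<one>\<^bsub>A\<^esub>"
  by (rule CV_ext) (simp_all add: Delta_CV Delta_apply left_regular_one, simp add: CV_simps)

lemma Delta_norm: "cmod z = 1 \<Longrightarrow> s \<in> carrier G \<Longrightarrow> \<xi> \<in> carrier E \<Longrightarrow> mnorm E (Delta (z, s) \<xi>) = mnorm E \<xi>"
  by (simp add: Delta_apply P.E.norm_smult left_regular_closed left_regular_norm)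

lemma unit_bump:
  obtains B where "openin T B" "\<one> \<in> B" "emeasure M B < \<infinity>"
  by (rule unit_nbhd_compact) (rule that)

lemma Delta_opnorm:
  assumes "cmod z = 1" "s \<in> carrier G" shows "mnorm A (Delta (z, s)) = 1"
proof -
  obtain B0 where B0: "openin T B0" "\<one> \<in> B0" "emeasure M B0 < \<infinity>"
    by (rule unit_bump)
  have "B0 \<noteq> {}" using B0(2) by blast
  note ind = indicator_nonzero[OF B0(1) this B0(3)]
  have "mnorm E (cls (indicator B0)) \<noteq> 0"
    using ind(3) mnorm_ae_class[OF ind(1)] by simp
  then have "\<exists>x\<in>carrier E. x \<noteq> \<zero>\<^bsub>E\<^esub>"
    using ae_class_in_Lp[OF ind(1)] by (intro bexI[of _ "cls (indicator B0)"]) auto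
  then show ?thesis
    unfolding CV_simps using assms by (intro P.E.opnorm_isometry Delta_norm CV_bounded Delta_CV) auto
qed

abbreviation "UA \<equiv> isometry_group A"

lemma Delta_isometry_group:
  assumes "cmod z = 1" "s \<in> carrier G" shows "Delta (z, s) \<in> carrier UA"
proof -
  have z: "z \<noteq> 0" "cmod (inverse z) = 1"
    using assms(1) by (auto simp: norm_inverse)
  have inv: "Delta (z, s) \<otimes>\<^bsub>A\<^esub> Delta (inverse z, inv s) = \<one>\<^bsub>A\<^esub>" "Delta (inverse z, inv s) \<otimes>\<^bsub>A\<^esub> Delta (z, s) = \<one>\<^bsub>A\<^esub>"
    using assms z by (simp_all add: Delta_mult Delta_one)
  then have "Delta (z, s) \<in> Units A"
    using assms Delta_CV unfolding Units_def by blast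
  moreover have "inv\<^bsub>A\<^esub> (Delta (z, s)) = Delta (inverse z, inv s)"
    using inv assms by (intro Am.inv_char Delta_CV) auto
  ultimately show ?thesis
    using assms z by (simp add: isometry_group_def Delta_opnorm)
qed

text \<open>Both \<open>u\<close> and its inverse are contractions.\<close>

lemma isometry_group_isometric:
  assumes "u \<in> carrier UA" shows "isometric u"
proof -
  have U: "u \<in> Units A" and n: "mnorm A u = 1" "mnorm A (inv\<^bsub>A\<^esub> u) = 1"
    using assms by (auto simp: isometry_group_def)
  have uC: "u \<in> carrier A" and vC: "inv\<^bsub>A\<^esub> u \<in> carrier A"
    using U by auto
  have "mnorm E (u \<xi>) = mnorm E \<xi>" if \<xi>: "\<xi> \<in> carrier E" for \<xi>
  proof (rule antisym)
    show "mnorm E (u \<xi>) \<le> mnorm E \<xi>"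
      using P.E.opnorm_apply[OF CV_bounded[OF uC] \<xi>] n(1) by (simp add: CV_simps)
    have "(inv\<^bsub>A\<^esub> u \<otimes>\<^bsub>A\<^esub> u) \<xi> = \<xi>"
      using Am.Units_l_inv[OF U] \<xi> by (simp add: CV_simps)
    then have "(inv\<^bsub>A\<^esub> u) (u \<xi>) = \<xi>"
      using \<xi> by (simp add: CV_simps(1) compose_def)
    then show "mnorm E \<xi> \<le> mnorm E (u \<xi>)"
      using P.E.opnorm_apply[OF CV_bounded[OF vC] CV_closed[OF uC \<xi>]] n(2) by (simp add: CV_simps)
  qed
  then show ?thesis
    using uC by (simp add: isometric_def)
qed

section \<open>The weak* topology on the isometry group and separating coefficients\<close>

abbreviation "YT \<equiv> isometry_topology A (CV_weak_star G M p)"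

lemma isometry_carrier: "carrier UA \<subseteq> carrier A"
  using isometry_group_isometric isometricD(1) by blast

lemma topspace_YT [simp]: "topspace YT = carrier UA"
  using isometry_carrier CV_bounded by (auto simp: isometry_topology_def CV_weak_star_def)

text \<open>A weak* continuous functional that sees both coordinates: at
  \<open>Delta (z, s')\<close> its value is \<open>z\<close> times the measure of the intersection
  of the translates of \<open>V\<close> by \<open>s'\<close> and \<open>s\<close>.\<close>

definition coeff :: "'a set \<Rightarrow> 'a \<Rightarrow> (('a \<Rightarrow> complex) set \<Rightarrow> ('a \<Rightarrow> complex) set) \<Rightarrow> complex" where
  "coeff V s a = Lp_pairing M (a (cls (indicator V))) (cls (indicator {x \<in> carrier G. inv s \<otimes> x \<in> V}))"

lemma translate_sets:
  assumes V: "openin T V" "emeasure M V < \<infinity>" and s: "s \<in> carrier G"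
  shows "{x \<in> carrier G. inv s \<otimes> x \<in> V} \<in> sets M" "emeasure M {x \<in> carrier G. inv s \<otimes> x \<in> V} = emeasure M V"
  using emeasure_left[OF inv_closed[OF s] open_sets[OF V(1)]] .

lemma indicator_Lq:
  assumes V: "openin T V" "emeasure M V < \<infinity>" and s: "s \<in> carrier G"
  shows "indicator {x \<in> carrier G. inv s \<otimes> x \<in> V} \<in> Lp_functions M q"
  using translate_sets[OF assms] V(2) conjugate_exponent(1)[OF p] by (intro Lp_functions_indicator) auto

lemma coeff_Delta:
  assumes V: "openin T V" "emeasure M V < \<infinity>" and s: "s \<in> carrier G" "s' \<in> carrier G"
  shows "coeff V s (Delta (z, s')) = z * measure M {x \<in> carrier G. inv s' \<otimes> x \<in> V \<and> inv s \<otimes> x \<in> V}"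
proof -
  note ind = Lp_functions_indicator[OF p open_sets[OF V(1)] V(2)]
  note l = left_Lp(1)[OF inv_closed[OF s(2)] ind]
  let ?S = "\<lambda>s. {x \<in> carrier G. inv s \<otimes> x \<in> V}"
  have Ss: "?S s' \<inter> ?S s \<in> sets M"
    using translate_sets[OF V s(1)] translate_sets[OF V s(2)] by blast
  have Sf: "emeasure M (?S s' \<inter> ?S s) < \<infinity>"
    using V(2) unfolding translate_sets(2)[OF V s(1), symmetric]
    by (rule emeasure_finite_subset[OF Int_lower2 translate_sets(1)[OF V s(1)]])
  have "Delta (z, s') (cls (indicator V)) = cls (\<lambda>t. z * indicator V (inv s' \<otimes> t))"
    using Delta_apply[OF ae_class_in_Lp[OF ind]] left_regular_class[OF s(2) ind] smult_ae_class[where p = p, OF bm[OF l]]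
    by simp
  then have "coeff V s (Delta (z, s')) = (\<integral>t. z * indicator V (inv s' \<otimes> t) * indicator (?S s) t \<partial>M)"
    unfolding coeff_def
    using Lp_pairing_ae_class[OF bm[OF Lp_functions_smult[OF p l]] bm[OF indicator_Lq[OF V s(1)]]] by simp
  also have "\<dots> = (\<integral>t. z * complex_of_real (indicator (?S s' \<inter> ?S s) t) \<partial>M)"
    by (intro Bochner_Integration.integral_cong[OF refl]) (auto simp: indicator_def)
  also have "\<dots> = z * complex_of_real (\<integral>t. indicator (?S s' \<inter> ?S s) t \<partial>M)"
    by (simp only: integral_mult_right_zero integral_complex_of_real)
  also have "(\<integral>t. indicator (?S s' \<inter> ?S s) t \<partial>M) = measure M (?S s' \<inter> ?S s)"
    using Ss Sf by simp
  also have "?S s' \<inter> ?S s = {x \<in> carrier G. inv s' \<otimes> x \<in> V \<and> inv s \<otimes> x \<in> V}"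
    by auto
  finally show ?thesis .
qed

text \<open>If the translates of \<open>V\<close> by \<open>s'\<close> and \<open>s\<close> meet,
  then \<open>s'\<close> equals \<open>s\<close> times a quotient of two elements of
  \<open>V\<close>; so it suffices that such quotients stay in the translate of \<open>B\<close> by
  \<open>inv s\<close>.\<close>

lemma separating_bump:
  assumes B: "openin T B" "s \<in> B"
  obtains V where "openin T V" "\<one> \<in> V" "emeasure M V < \<infinity>"
    "\<And>s' x. s' \<in> carrier G \<Longrightarrow> x \<in> carrier G \<Longrightarrow> inv s' \<otimes> x \<in> V \<Longrightarrow> inv s \<otimes> x \<in> V \<Longrightarrow> s' \<in> B"
proof -
  have s: "s \<in> carrier G" using B open_carrier by blast
  have W: "openin T {w \<in> carrier G. s \<otimes> w \<in> B}" "\<one> \<in> {w \<in> carrier G. s \<otimes> w \<in> B}"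
    using left_open[OF s B(1)] B(2) s by auto
  obtain V where V: "openin T V" "\<one> \<in> V" "\<And>a b. a \<in> V \<Longrightarrow> b \<in> V \<Longrightarrow> a \<otimes> inv b \<in> {w \<in> carrier G. s \<otimes> w \<in> B}"
    using unit_nbhd_mult[OF W] by metis
  obtain B0 where B0: "openin T B0" "\<one> \<in> B0" "emeasure M B0 < \<infinity>"
    by (rule unit_bump)
  show ?thesis
  proof (rule that[of "V \<inter> B0"])
    show "emeasure M (V \<inter> B0) < \<infinity>"
      by (rule emeasure_finite_subset[OF _ open_sets[OF B0(1)] B0(3)]) auto
    fix s' x assume x: "s' \<in> carrier G" "x \<in> carrier G" "inv s' \<otimes> x \<in> V \<inter> B0" "inv s \<otimes> x \<in> V \<inter> B0"
    then have "s \<otimes> ((inv s \<otimes> x) \<otimes> inv (inv s' \<otimes> x)) \<in> B"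
      using V(3)[of "inv s \<otimes> x" "inv s' \<otimes> x"] by simp
    moreover have "s \<otimes> ((inv s \<otimes> x) \<otimes> inv (inv s' \<otimes> x)) = s'"
    proof -
      have "(inv s \<otimes> x) \<otimes> inv (inv s' \<otimes> x) = inv s \<otimes> (x \<otimes> (inv x \<otimes> s'))"
        using s x by (simp add: inv_mult_group m_assoc)
      then show ?thesis
        using s x by (simp add: mult_inv_cancel)
    qed
    ultimately show "s' \<in> B" by simp
  qed (use V B0 in auto)
qed

lemma Delta_separated:
  assumes s: "s \<in> carrier G" and t: "t \<in> carrier G" and "s \<noteq> t"
  obtains V where "openin T V" "\<one> \<in> V" "emeasure M V < \<infinity>"
    "{x \<in> carrier G. inv t \<otimes> x \<in> V \<and> inv s \<otimes> x \<in> V} = {}"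
proof -
  have "closedin T {t}"
    using compact_closed[of "{t}"] t by simp
  then have op: "openin T (carrier G - {t})"
    by (simp add: closedin_def)
  have sB: "s \<in> carrier G - {t}"
    using s \<open>s \<noteq> t\<close> by simp
  obtain V where V: "openin T V" "\<one> \<in> V" "emeasure M V < \<infinity>"
    "\<And>s' x. s' \<in> carrier G \<Longrightarrow> x \<in> carrier G \<Longrightarrow> inv s' \<otimes> x \<in> V \<Longrightarrow> inv s \<otimes> x \<in> V \<Longrightarrow> s' \<in> carrier G - {t}"
    by (rule separating_bump[OF op sB]) (rule that)
  show ?thesis
    by (rule that[OF V(1-3)]) (use V(4)[OF t] in auto)
qed

lemma coeff_self:
  assumes V: "openin T V" "\<one> \<in> V" "emeasure M V < \<infinity>" and s: "s \<in> carrier G"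
  shows "coeff V s (Delta (z, s)) = z * measure M V" "0 < measure M V"
proof -
  have "V \<noteq> {}" using V(2) by blast
  from indicator_nonzero(2)[OF V(1) this V(3)] show "0 < measure M V" .
  have "measure M {x \<in> carrier G. inv s \<otimes> x \<in> V} = measure M V"
    unfolding measure_def translate_sets(2)[OF V(1,3) s] ..
  then show "coeff V s (Delta (z, s)) = z * measure M V"
    using coeff_Delta[OF V(1,3) s s] by simp
qed

text \<open>The coefficient centred at \<open>s\<close> with a separating bump is nonzero at
  \<open>Delta (z, s)\<close> and zero at \<open>Delta (w, t)\<close> when \<open>s\<close> and
  \<open>t\<close> differ; once the points agree, any bump compares the scalars.\<close>

lemma Delta_inj:
  assumes eq: "Delta (z, s) = Delta (w, t)" and z: "z \<noteq> 0" and s: "s \<in> carrier G" and t: "t \<in> carrier G"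
  shows "z = w" "s = t"
proof -
  show st: "s = t"
  proof (rule ccontr)
    assume "s \<noteq> t"
    then obtain V where V: "openin T V" "\<one> \<in> V" "emeasure M V < \<infinity>"
      and e: "{x \<in> carrier G. inv t \<otimes> x \<in> V \<and> inv s \<otimes> x \<in> V} = {}"
      by (rule Delta_separated[OF s t])
    have "coeff V s (Delta (w, t)) = 0"
      using coeff_Delta[OF V(1,3) s t, of w] unfolding e by simp
    then show False
      using coeff_self(1)[OF V s, of z] coeff_self(2)[OF V s] z by (simp add: eq)
  qed
  obtain V where V: "openin T V" "\<one> \<in> V" "emeasure M V < \<infinity>"
    by (rule unit_bump)
  have zw: "Delta (z, t) = Delta (w, t)"
    using eq unfolding st .
  have "z * complex_of_real (measure M V) = w * complex_of_real (measure M V)"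
    by (rule trans[OF coeff_self(1)[OF V t, of z, symmetric, unfolded zw] coeff_self(1)[OF V t]])
  moreover have "complex_of_real (measure M V) \<noteq> 0"
    using coeff_self(2)[OF V t] by simp
  ultimately show "z = w"
    by (simp only: mult_cancel_right simp_thms)
qed

lemma continuous_Delta: "continuous_map (prod_topology circle_topology T) YT Delta"
proof -
  let ?X = "prod_topology circle_topology T"
  have "continuous_map ?X (weak_star_topology E (Lp M q) (Lp_pairing M)) Delta"
  proof (rule P.continuous_map_into_weak_star)
    fix zs assume "zs \<in> topspace ?X"
    then obtain z s where zs: "zs = (z, s)" "cmod z = 1" "s \<in> carrier G" by auto
    show "Delta zs \<in> bounded_operators E"
      unfolding zs(1) by (rule CV_bounded[OF Delta_CV[OF zs(3)]])
    show "P.E.opnorm (Delta zs) \<le> 1"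
      using Delta_opnorm[OF zs(2,3)] unfolding zs(1) CV_simps by simp
  next
    fix \<xi> \<eta> assume \<xi>: "\<xi> \<in> carrier E" and \<eta>: "\<eta> \<in> carrier (Lp M q)"
    obtain f where f: "f \<in> LF" "\<xi> = cls f" using \<xi> by (rule Lp_carrierE)
    obtain g where g: "g \<in> Lp_functions M q" "\<eta> = cls g" using \<eta> by (rule Lp_carrierE)
    have 1: "continuous_map ?X euclidean (\<lambda>zs. fst zs)"
      using continuous_map_compose[OF continuous_map_fst continuous_circle_incl, of T] by (simp add: o_def)
    have 2: "continuous_map ?X euclidean (\<lambda>zs. \<integral>t. f (inv (snd zs) \<otimes> t) * g t \<partial>M)"
      by (rule continuous_comp[OF coefficient_continuous[OF f(1) g(1)] continuous_map_snd])
    have "continuous_map ?X euclidean (\<lambda>zs. fst zs * (\<integral>t. f (inv (snd zs) \<otimes> t) * g t \<partial>M))"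
      by (rule continuous_map_mult_complex[OF 1 2])
    then show "continuous_map ?X euclidean (\<lambda>zs. Lp_pairing M (Delta zs \<xi>) \<eta>)"
    proof (rule continuous_map_eq)
      fix zs assume "zs \<in> topspace ?X"
      then obtain z s where zs: "zs = (z, s)" "cmod z = 1" "s \<in> carrier G" by auto
      have "Lp_pairing M (Delta zs \<xi>) \<eta> = z * Lp_pairing M (lreg s \<xi>) \<eta>"
        unfolding zs(1) Delta_apply[OF \<xi>] by (rule P.D_smult_left[OF left_regular_closed[OF zs(3) \<xi>] \<eta>])
      also have "Lp_pairing M (lreg s \<xi>) \<eta> = (\<integral>t. f (inv s \<otimes> t) * g t \<partial>M)"
        unfolding f(2) g(2) left_regular_class[OF zs(3) f(1)]
        by (rule Lp_pairing_ae_class[OF bm[OF left_Lp(1)[OF inv_closed[OF zs(3)] f(1)]] bm[OF g(1)]])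
      finally show "fst zs * (\<integral>t. f (inv (snd zs) \<otimes> t) * g t \<partial>M) = Lp_pairing M (Delta zs \<xi>) \<eta>"
        unfolding zs(1) by simp
    qed
  qed
  then show ?thesis
    unfolding isometry_topology_def CV_weak_star_def
    by (auto simp: continuous_map_in_subtopology Delta_CV Delta_isometry_group)
qed

lemma continuous_coeff:
  assumes V: "openin T V" "emeasure M V < \<infinity>" and s: "s \<in> carrier G"
  shows "continuous_map YT euclidean (coeff V s)"
proof -
  have "continuous_map (weak_star_topology E (Lp M q) (Lp_pairing M)) euclidean (coeff V s)"
    unfolding coeff_def[abs_def]
    by (intro P.continuous_map_weak_star_eval ae_class_in_Lp indicator_Lq[OF V s]
        Lp_functions_indicator[OF p open_sets[OF V(1)] V(2)])
  then show ?thesis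
    unfolding isometry_topology_def CV_weak_star_def by (intro continuous_map_from_subtopology)
qed

subsection \<open>Norm distances, openness and components\<close>

lemma diff_ae_class:
  assumes f: "f \<in> LF" and g: "g \<in> LF"
  shows "cls f \<ominus>\<^bsub>E\<^esub> cls g = cls (\<lambda>x. f x - g x)"
proof -
  have "cls f \<ominus>\<^bsub>E\<^esub> cls g = cls f \<oplus>\<^bsub>E\<^esub> (-1) \<odot>\<^bsub>E\<^esub> cls g"
    using ae_class_in_Lp[OF g] by (simp add: a_minus_def P.E.smult_minus_one)
  also have "\<dots> = cls (\<lambda>x. f x + - 1 * g x)"
    unfolding smult_ae_class[where p = p and c = "-1", OF bm[OF g]]
    by (rule add_ae_class[OF bm[OF f] bm[OF Lp_functions_smult[OF p g]]])
  finally show ?thesis by simp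
qed

lemma CV_diff_apply:
  assumes a: "a \<in> carrier A" and b: "b \<in> carrier A" and \<xi>: "\<xi> \<in> carrier E"
  shows "(a \<ominus>\<^bsub>A\<^esub> b) \<xi> = a \<xi> \<ominus>\<^bsub>E\<^esub> b \<xi>"
proof -
  have eq: "a \<ominus>\<^bsub>A\<^esub> b = a \<oplus>\<^bsub>A\<^esub> (-1) \<odot>\<^bsub>A\<^esub> b"
    using b by (simp add: a_minus_def A.smult_minus_one)
  have "(a \<ominus>\<^bsub>A\<^esub> b) \<xi> = a \<xi> \<oplus>\<^bsub>E\<^esub> (-1) \<odot>\<^bsub>E\<^esub> b \<xi>"
    unfolding eq using \<xi> by (simp add: CV_simps)
  also have "\<dots> = a \<xi> \<ominus>\<^bsub>E\<^esub> b \<xi>"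
    using CV_closed[OF b \<xi>] by (simp add: a_minus_def P.E.smult_minus_one)
  finally show ?thesis .
qed

lemma mdistance_CV:
  assumes "a \<in> carrier A" "b \<in> carrier A"
  shows "mdistance A a b = P.E.opnorm (a \<ominus>\<^bsub>A\<^esub> b)"
  using A.mdistance_eq[OF assms] by (simp add: CV_simps)

lemma Delta_near:
  assumes s: "s \<in> carrier G"
  shows "mdistance A (Delta (z, s)) (Delta (w, s)) \<le> cmod (z - w)"
  unfolding mdistance_CV[OF Delta_CV[OF s] Delta_CV[OF s]]
proof (rule P.E.opnorm_least)
  fix \<xi> assume \<xi>: "\<xi> \<in> carrier E"
  note l = left_regular_closed[OF s \<xi>]
  have "(Delta (z, s) \<ominus>\<^bsub>A\<^esub> Delta (w, s)) \<xi> = (z - w) \<odot>\<^bsub>E\<^esub> lreg s \<xi>"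
    unfolding CV_diff_apply[OF Delta_CV[OF s] Delta_CV[OF s] \<xi>] Delta_apply[OF \<xi>] P.E.smult_diff_left[OF l] ..
  then show "mnorm E ((Delta (z, s) \<ominus>\<^bsub>A\<^esub> Delta (w, s)) \<xi>) \<le> cmod (z - w) * mnorm E \<xi>"
    using P.E.norm_smult[OF l] left_regular_norm[OF s \<xi>] by simp
qed simp

text \<open>For a separating bump the two images \<open>F\<close> and \<open>H\<close> have disjoint
  supports, so subtracting \<open>H\<close> cannot decrease the norm of \<open>F\<close>, which is
  that of the bump.\<close>

lemma Delta_far:
  assumes s: "s \<in> carrier G" and t: "t \<in> carrier G" and "s \<noteq> t" and z: "cmod z = 1"
  shows "1 \<le> mdistance A (Delta (z, s)) (Delta (w, t))"
proof -
  obtain V where V: "openin T V" "\<one> \<in> V" "emeasure M V < \<infinity>"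
    and e: "{x \<in> carrier G. inv t \<otimes> x \<in> V \<and> inv s \<otimes> x \<in> V} = {}"
    by (rule Delta_separated[OF s t \<open>s \<noteq> t\<close>])
  have "V \<noteq> {}" using V(2) by blast
  note ind = indicator_nonzero[OF V(1) this V(3)]
  let ?\<xi> = "cls (indicator V)"
  note \<xi> = ae_class_in_Lp[OF ind(1)]
  define F where "F x = z * indicator V (inv s \<otimes> x)" for x
  define H where "H x = w * indicator V (inv t \<otimes> x)" for x
  note ls = left_Lp(1)[OF inv_closed[OF s] ind(1)] and lt = left_Lp(1)[OF inv_closed[OF t] ind(1)]
  have F: "F \<in> LF" and H: "H \<in> LF"
    unfolding F_def[abs_def] H_def[abs_def] by (rule Lp_functions_smult[OF p ls] Lp_functions_smult[OF p lt])+
  have D: "Delta (z, s) ?\<xi> = cls F" "Delta (w, t) ?\<xi> = cls H"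
    unfolding Delta_apply[OF \<xi>] left_regular_class[OF s ind(1)] left_regular_class[OF t ind(1)]
      smult_ae_class[OF bm[OF ls]] smult_ae_class[OF bm[OF lt]] F_def[abs_def] H_def[abs_def] by (rule refl)+
  have "AE x in M. cmod (F x) \<le> cmod (F x - H x)"
  proof (rule AE_I2)
    fix x assume "x \<in> space M"
    then have "F x = 0 \<or> H x = 0"
      using e by (auto simp: F_def H_def indicator_def)
    then show "cmod (F x) \<le> cmod (F x - H x)" by auto
  qed
  then have "Lp_int M p F \<le> Lp_int M p (\<lambda>x. F x - H x)"
    by (rule Lp_int_mono[OF p F Lp_functions_diff[OF p F H]])
  then have "mnorm E (cls F) \<le> mnorm E (cls F \<ominus>\<^bsub>E\<^esub> cls H)"
    unfolding diff_ae_class[OF F H] mnorm_ae_class[OF F] mnorm_ae_class[OF Lp_functions_diff[OF p F H]]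
    using p by (intro powr_mono2) auto
  then have "mnorm E ?\<xi> \<le> mnorm E ((Delta (z, s) \<ominus>\<^bsub>A\<^esub> Delta (w, t)) ?\<xi>)"
    unfolding CV_diff_apply[OF Delta_CV[OF s] Delta_CV[OF t] \<xi>] D[symmetric] Delta_norm[OF z s \<xi>] .
  also have "\<dots> \<le> P.E.opnorm (Delta (z, s) \<ominus>\<^bsub>A\<^esub> Delta (w, t)) * mnorm E ?\<xi>"
    by (rule P.E.opnorm_apply[OF CV_bounded[OF A.minus_closed[OF Delta_CV[OF s] Delta_CV[OF t]]] \<xi>])
  finally have "1 * mnorm E ?\<xi> \<le> mdistance A (Delta (z, s)) (Delta (w, t)) * mnorm E ?\<xi>"
    unfolding mdistance_CV[OF Delta_CV[OF s] Delta_CV[OF t]] by simp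
  moreover have "0 < mnorm E ?\<xi>"
    using ind(3) mnorm_ae_class[OF ind(1)] by simp
  ultimately show ?thesis
    by (rule mult_right_le_imp_le)
qed

lemma isometry_group_simps [simp]: "mult UA = mult A" "one UA = one A"
  by (simp_all add: isometry_group_def)

lemma Delta_one_left: "s \<in> carrier G \<Longrightarrow> Delta (1, s) = lreg s"
  by (rule CV_ext) (simp_all add: Delta_CV left_regular_CV Delta_apply left_regular_closed)

text \<open>The circle of unimodular multiples of \<open>lreg s\<close>. For
  \<open>p \<noteq> 2\<close> it turns out to be the class of \<open>lreg s\<close> modulo the
  identity component.\<close>

definition fibre :: "'a \<Rightarrow> (('a \<Rightarrow> complex) set \<Rightarrow> ('a \<Rightarrow> complex) set) set" where
  "fibre s = (\<lambda>z. Delta (z, s)) ` sphere 0 1"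

lemma fibreI: "cmod z = 1 \<Longrightarrow> Delta (z, s) \<in> fibre s"
  by (auto simp: fibre_def)

lemma fibreE:
  assumes "u \<in> fibre s" obtains z where "cmod z = 1" "u = Delta (z, s)"
  using assms by (auto simp: fibre_def)

lemma fibre_subset: "s \<in> carrier G \<Longrightarrow> fibre s \<subseteq> carrier UA"
  by (auto simp: fibre_def Delta_isometry_group)

lemma fibre_eq_iff:
  assumes "s \<in> carrier G" "t \<in> carrier G" "Delta (z, s) \<in> fibre t" "cmod z = 1"
  shows "s = t"
proof -
  obtain w where w: "Delta (z, s) = Delta (w, t)"
    using assms(3) by (rule fibreE)
  have "z \<noteq> 0" using assms(4) by auto
  from Delta_inj(2)[OF w this assms(1,2)] show ?thesis .
qed

text \<open>The union on the left is the shape to which \<open>r_coset\<close> unfolds. The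
  inclusion of the right-hand side writes \<open>w\<close> as \<open>w / z\<close> times
  \<open>z\<close>.\<close>

lemma fibre_translate:
  assumes s: "s \<in> carrier G" and t: "t \<in> carrier G" and z: "cmod z = 1"
  shows "(\<Union>h\<in>fibre s. {h \<otimes>\<^bsub>A\<^esub> Delta (z, t)}) = fibre (s \<otimes> t)"
proof
  show "(\<Union>h\<in>fibre s. {h \<otimes>\<^bsub>A\<^esub> Delta (z, t)}) \<subseteq> fibre (s \<otimes> t)"
    using s t z by (auto elim!: fibreE simp: Delta_mult norm_mult intro!: fibreI)
  show "fibre (s \<otimes> t) \<subseteq> (\<Union>h\<in>fibre s. {h \<otimes>\<^bsub>A\<^esub> Delta (z, t)})"
  proof
    fix u assume "u \<in> fibre (s \<otimes> t)"
    then obtain w where w: "cmod w = 1" "u = Delta (w, s \<otimes> t)"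
      by (rule fibreE)
    have "u = Delta (w / z, s) \<otimes>\<^bsub>A\<^esub> Delta (z, t)"
      using s t z w(2) by (auto simp: Delta_mult)
    moreover have "Delta (w / z, s) \<in> fibre s"
      using w z by (intro fibreI) (simp add: norm_divide)
    ultimately show "u \<in> (\<Union>h\<in>fibre s. {h \<otimes>\<^bsub>A\<^esub> Delta (z, t)})" by blast
  qed
qed

lemma fibre_mult:
  assumes s: "s \<in> carrier G" and t: "t \<in> carrier G"
  shows "fibre s <#>\<^bsub>UA\<^esub> fibre t = fibre (s \<otimes> t)"
proof -
  have "fibre s <#>\<^bsub>UA\<^esub> fibre t = (\<Union>k\<in>fibre t. \<Union>h\<in>fibre s. {h \<otimes>\<^bsub>A\<^esub> k})"
    unfolding set_mult_def by auto
  also have "\<dots> = (\<Union>z\<in>sphere 0 1. \<Union>h\<in>fibre s. {h \<otimes>\<^bsub>A\<^esub> Delta (z, t)})"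
    by (simp add: fibre_def[of t])
  also have "\<dots> = (\<Union>z\<in>sphere (0 :: complex) 1. fibre (s \<otimes> t))"
    by (intro SUP_cong refl) (simp add: fibre_translate[OF s t])
  also have "\<dots> = fibre (s \<otimes> t)"
  proof -
    have "sphere (0 :: complex) 1 \<noteq> {}" by simp
    then show ?thesis by blast
  qed
  finally show ?thesis .
qed

lemma circle_connected: "connectedin circle_topology (sphere 0 1)"
  unfolding circle_topology_def connectedin_subtopology using connected_sphere[of "0 :: complex" 1] by simp

section \<open>Surjectivity and openness of \<open>Delta\<close>\<close>

context
  assumes p2: "p \<noteq> 2"
begin

lemma isometry_groupE:
  assumes "u \<in> carrier UA"
  obtains z s where "cmod z = 1" "s \<in> carrier G" "u = Delta (z, s)"
  by (rule isometric_convolver[OF isometry_group_isometric[OF assms] p2]) (rule that, simp_all add: Delta_def)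

lemma Delta_image: "Delta ` (sphere 0 1 \<times> carrier G) = carrier UA"
proof
  show "Delta ` (sphere 0 1 \<times> carrier G) \<subseteq> carrier UA"
    by (auto simp: Delta_isometry_group)
  show "carrier UA \<subseteq> Delta ` (sphere 0 1 \<times> carrier G)"
  proof
    fix u assume "u \<in> carrier UA"
    then obtain z s where "cmod z = 1" "s \<in> carrier G" "u = Delta (z, s)"
      by (rule isometry_groupE)
    then show "u \<in> Delta ` (sphere 0 1 \<times> carrier G)"
      by (intro image_eqI[of _ _ "(z, s)"]) auto
  qed
qed

lemma Delta_inj_on: "inj_on Delta (sphere 0 1 \<times> carrier G)"
proof (rule inj_onI)
  fix x y assume "x \<in> sphere 0 1 \<times> carrier G" "y \<in> sphere 0 1 \<times> carrier G" and eq: "Delta x = Delta y"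
  then obtain z s w t where x: "x = (z, s)" "cmod z = 1" "s \<in> carrier G" and y: "y = (w, t)" "t \<in> carrier G"
    by auto
  have "z \<noteq> 0" using x(2) by auto
  from Delta_inj[OF eq[unfolded x(1) y(1)] this x(3) y(2)] show "x = y"
    by (simp add: x(1) y(1))
qed

text \<open>A single coefficient recovers both coordinates: if it is nonzero, the bumps overlap and
  the point lies in \<open>B\<close>; its direction in the plane is the scalar, since it is a
  positive multiple of it.\<close>

lemma open_map_Delta: "open_map (prod_topology circle_topology T) YT Delta"
  unfolding open_map_def
proof (intro allI impI)
  fix W assume W: "openin (prod_topology circle_topology T) W"
  show "openin YT (Delta ` W)"
  proof (subst openin_subopen, rule ballI)
    fix y assume "y \<in> Delta ` W"
    then obtain z0 s0 where zs0: "(z0, s0) \<in> W" and y: "y = Delta (z0, s0)" by auto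
    obtain A0 B where AB: "openin circle_topology A0" "openin T B" "z0 \<in> A0" "s0 \<in> B" "A0 \<times> B \<subseteq> W"
      using openin_prod_topology_alt[THEN iffD1, rule_format, OF W zs0] by auto
    have s0: "s0 \<in> carrier G" using AB(2,4) open_carrier by blast
    have z0: "cmod z0 = 1" using openin_subset[OF AB(1)] AB(3) by auto
    obtain W0 where W0: "open W0" "A0 = sphere 0 1 \<inter> W0"
      using AB(1) by (auto simp: circle_topology_def openin_open)
    obtain e where e: "0 < e" "ball z0 e \<subseteq> W0"
      using W0 AB(3) open_contains_ball by blast
    obtain V where V: "openin T V" "\<one> \<in> V" "emeasure M V < \<infinity>"
      "\<And>s' x. s' \<in> carrier G \<Longrightarrow> x \<in> carrier G \<Longrightarrow> inv s' \<otimes> x \<in> V \<Longrightarrow> inv s0 \<otimes> x \<in> V \<Longrightarrow> s' \<in> B"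
      by (rule separating_bump[OF AB(2,4)]) (rule that)
    \<comment> \<open>Zero is removed for two reasons: \<open>sgn\<close> is discontinuous there,
      and a nonzero coefficient is what guarantees the overlap.\<close>
    define Q where "Q = (- {0 :: complex}) \<inter> sgn -` ball z0 e"
    have Q: "open Q"
      unfolding Q_def by (rule continuous_open_preimage) (auto intro!: continuous_on_sgn continuous_on_id)
    have sgn1: "sgn (z * complex_of_real m) = z" if "cmod z = 1" "0 < m" for z m
      using that by (simp add: sgn_mult sgn_of_real) (simp add: sgn_div_norm)
    define N where "N = {a \<in> topspace YT. coeff V s0 a \<in> Q}"
    have "openin YT N"
      unfolding N_def using continuous_coeff[OF V(1,3) s0] Q by (intro openin_continuous_map_preimage) auto
    moreover have "y \<in> N"
    proof -
      have "coeff V s0 y = z0 * complex_of_real (measure M V)" "0 < measure M V"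
        unfolding y using coeff_self[OF V(1-3) s0] by auto
      then have "coeff V s0 y \<in> Q"
        using z0 e(1) sgn1 by (auto simp: Q_def)
      then show ?thesis
        unfolding N_def y using Delta_isometry_group[OF z0 s0] by simp
    qed
    moreover have "N \<subseteq> Delta ` W"
    proof
      fix a assume a: "a \<in> N"
      then have "a \<in> carrier UA" and aQ: "coeff V s0 a \<in> Q"
        by (auto simp: N_def)
      then obtain w t where wt: "cmod w = 1" "t \<in> carrier G" "a = Delta (w, t)"
        using isometry_groupE by metis
      let ?S = "{x \<in> carrier G. inv t \<otimes> x \<in> V \<and> inv s0 \<otimes> x \<in> V}"
      have c: "coeff V s0 a = w * complex_of_real (measure M ?S)"
        unfolding wt(3) by (rule coeff_Delta[OF V(1,3) s0 wt(2)])
      then have m: "measure M ?S \<noteq> 0"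
        using aQ by (auto simp: Q_def)
      then have "?S \<noteq> {}" by (metis measure_empty)
      then have "t \<in> B"
        using V(4)[OF wt(2)] by blast
      moreover have "0 < measure M ?S"
        using m by (simp add: zero_less_measure_iff)
      then have "sgn (coeff V s0 a) = w"
        unfolding c by (rule sgn1[OF wt(1)])
      then have "w \<in> A0"
        using aQ e(2) wt(1) W0(2) by (auto simp: Q_def)
      ultimately show "a \<in> Delta ` W"
        using AB(5) wt(3) by blast
    qed
    ultimately show "\<exists>N. openin YT N \<and> y \<in> N \<and> N \<subseteq> Delta ` W"
      by blast
  qed
qed

lemma homeomorphic_Delta: "homeomorphic_map (prod_topology circle_topology T) YT Delta"
  using Delta_image Delta_inj_on
  by (intro bijective_open_imp_homeomorphic_map continuous_Delta open_map_Delta) simp_all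

lemma topological_group_circle_G: "topological_group (circle_group \<times>\<times> G) (prod_topology circle_topology T)"
  using lcg by (intro topological_group_DirProd topological_group_circle) (simp add: locally_compact_group_def)

lemma Delta_iso: "Delta \<in> iso (circle_group \<times>\<times> G) UA"
  using Delta_image Delta_inj_on
  by (auto simp: iso_def hom_def bij_betw_def Delta_mult Delta_isometry_group)

theorem Delta_topological_group_iso:
  "topological_group_iso (circle_group \<times>\<times> G) (prod_topology circle_topology T) UA YT Delta"
  by (rule topological_group_isoI[OF topological_group_circle_G Delta_iso _ homeomorphic_Delta])
    (simp add: Delta_one)

section \<open>The identity component in the norm topology\<close>

abbreviation "NT \<equiv> subtopology (norm_topology A) (carrier UA)"

lemma topspace_NT: "topspace NT = carrier UA"
  using isometry_carrier by (auto simp: norm_topology_def Metric_space.topspace_mtopology[OF A.Metric_space])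

text \<open>By \<open>Delta_far\<close>, a unit ball around a point of the circle contains no
  element over another point of \<open>G\<close>.\<close>

lemma fibre_open:
  assumes s: "s \<in> carrier G" shows "openin NT (fibre s)"
proof -
  interpret MA: Metric_space "carrier A" "mdistance A"
    by (rule A.Metric_space)
  have "fibre s = (\<Union>c\<in>fibre s. MA.mball c 1) \<inter> carrier UA"
  proof
    have "c \<in> MA.mball c 1" if "c \<in> fibre s" for c
      using that fibre_subset[OF s] isometry_carrier by (auto simp: MA.centre_in_mball_iff)
    then show "fibre s \<subseteq> (\<Union>c\<in>fibre s. MA.mball c 1) \<inter> carrier UA"
      using fibre_subset[OF s] by blast
    show "(\<Union>c\<in>fibre s. MA.mball c 1) \<inter> carrier UA \<subseteq> fibre s"
    proof
      fix u assume "u \<in> (\<Union>c\<in>fibre s. MA.mball c 1) \<inter> carrier UA"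
      then obtain c where c: "c \<in> fibre s" "u \<in> MA.mball c 1" and u: "u \<in> carrier UA" by blast
      obtain z where z: "cmod z = 1" "c = Delta (z, s)"
        using c(1) by (rule fibreE)
      obtain w t where w: "cmod w = 1" "t \<in> carrier G" "u = Delta (w, t)"
        using u by (rule isometry_groupE)
      have "s = t"
      proof (rule ccontr)
        assume "s \<noteq> t"
        from Delta_far[OF s w(2) this z(1), of w] show False
          using c(2) z(2) w(3) by (simp add: MA.in_mball)
      qed
      then show "u \<in> fibre s"
        using w by (simp add: fibreI)
    qed
  qed
  moreover have "openin MA.mtopology (\<Union>c\<in>fibre s. MA.mball c 1)"
    by (intro openin_Union) (auto intro: MA.openin_mball)
  ultimately show ?thesis
    unfolding norm_topology_def openin_subtopology by blast
qed

lemma fibre_closed: "closedin NT (fibre \<one>)"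
proof -
  have "carrier UA - fibre \<one> = (\<Union>s\<in>carrier G - {\<one>}. fibre s)"
  proof
    show "carrier UA - fibre \<one> \<subseteq> (\<Union>s\<in>carrier G - {\<one>}. fibre s)"
    proof
      fix u assume u: "u \<in> carrier UA - fibre \<one>"
      then obtain z s where z: "cmod z = 1" "s \<in> carrier G" "u = Delta (z, s)"
        using isometry_groupE by (metis DiffD1)
      then have "s \<noteq> \<one>"
        using u fibreI by auto
      then show "u \<in> (\<Union>s\<in>carrier G - {\<one>}. fibre s)"
        using z fibreI by auto
    qed
    show "(\<Union>s\<in>carrier G - {\<one>}. fibre s) \<subseteq> carrier UA - fibre \<one>"
    proof
      fix u assume "u \<in> (\<Union>s\<in>carrier G - {\<one>}. fibre s)"
      then obtain s where s: "s \<in> carrier G" "s \<noteq> \<one>" "u \<in> fibre s" by blast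
      obtain z where z: "cmod z = 1" "u = Delta (z, s)"
        using s(3) by (rule fibreE)
      have "u \<notin> fibre \<one>"
        using fibre_eq_iff[OF s(1) one_closed _ z(1)] s(2) z(2) by blast
      then show "u \<in> carrier UA - fibre \<one>"
        using s fibre_subset by blast
    qed
  qed
  moreover have "openin NT (\<Union>s\<in>carrier G - {\<one>}. fibre s)"
    by (intro openin_Union) (auto intro: fibre_open)
  ultimately show ?thesis
    unfolding closedin_def topspace_NT using fibre_subset[OF one_closed] by simp
qed

lemma fibre_connected: "connectedin NT (fibre \<one>)"
proof -
  interpret MA: Metric_space "carrier A" "mdistance A"
    by (rule A.Metric_space)
  have "continuous_map circle_topology MA.mtopology (\<lambda>z. Delta (z, \<one>))"
    unfolding MA.continuous_map_to_metric
  proof (intro ballI allI impI)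
    fix z and e :: real assume z: "z \<in> topspace circle_topology" and e: "0 < e"
    have "openin circle_topology (sphere 0 1 \<inter> ball z e)"
      unfolding circle_topology_def by (intro openin_open_Int) simp
    moreover have "Delta (w, \<one>) \<in> MA.mball (Delta (z, \<one>)) e" if "w \<in> sphere 0 1 \<inter> ball z e" for w
    proof -
      have "mdistance A (Delta (z, \<one>)) (Delta (w, \<one>)) < e"
        using Delta_near[OF one_closed, of z w] that by (simp add: dist_norm)
      then show ?thesis
        by (simp add: MA.in_mball Delta_CV)
    qed
    ultimately show "\<exists>U. openin circle_topology U \<and> z \<in> U \<and> (\<forall>w\<in>U. Delta (w, \<one>) \<in> MA.mball (Delta (z, \<one>)) e)"
      using z e by (intro exI[of _ "sphere 0 1 \<inter> ball z e"]) auto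
  qed
  then have "continuous_map circle_topology NT (\<lambda>z. Delta (z, \<one>))"
    unfolding norm_topology_def continuous_map_in_subtopology by (auto simp: Delta_isometry_group)
  from connectedin_continuous_map_image[OF this circle_connected] show ?thesis
    unfolding fibre_def .
qed

text \<open>A component is contained in every clopen set that it meets and contains every connected
  set through its base point; \<open>fibre \<one>\<close> is both clopen and connected.\<close>

lemma isometry_group_0_eq: "isometry_group_0 A = fibre \<one>"
proof -
  have one: "\<one>\<^bsub>A\<^esub> \<in> fibre \<one>"
    using fibreI[of 1 \<one>] by (simp add: Delta_one)
  let ?C = "connected_component_of_set NT \<one>\<^bsub>A\<^esub>"
  have "\<one>\<^bsub>A\<^esub> \<in> topspace NT"
    unfolding topspace_NT using one fibre_subset[OF one_closed] by blast
  then have "\<one>\<^bsub>A\<^esub> \<in> ?C"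
    by (simp only: mem_Collect_eq connected_component_of_refl)
  then have "?C \<subseteq> fibre \<one>"
    using connectedin_clopen_cases[OF connectedin_connected_component_of fibre_closed fibre_open[OF one_closed]] one
    by (metis disjnt_iff)
  moreover have "fibre \<one> \<subseteq> ?C"
    by (rule connected_component_of_maximal[OF fibre_connected one])
  ultimately show ?thesis
    unfolding isometry_group_0_def by blast
qed

section \<open>The quotient by the identity component\<close>

lemma pi0_class_Delta:
  assumes "cmod z = 1" "s \<in> carrier G" shows "pi0_class A (Delta (z, s)) = fibre s"
  using fibre_translate[OF one_closed assms(2,1)] assms(2)
  by (simp add: pi0_class_def r_coset_def isometry_group_0_eq)

lemma pi0_class_left_regular: "s \<in> carrier G \<Longrightarrow> pi0_class A (lreg s) = fibre s"
  using pi0_class_Delta[of 1 s] by (simp add: Delta_one_left)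

lemma pi0_group_carrier: "carrier (pi0_group A) = fibre ` carrier G"
proof -
  have "carrier (pi0_group A) = pi0_class A ` carrier UA"
    by (auto simp: pi0_group_def FactGroup_def RCOSETS_def pi0_class_def)
  also have "\<dots> = fibre ` carrier G"
  proof
    show "pi0_class A ` carrier UA \<subseteq> fibre ` carrier G"
    proof
      fix c assume "c \<in> pi0_class A ` carrier UA"
      then obtain u where u: "u \<in> carrier UA" "c = pi0_class A u" by blast
      obtain z s where "cmod z = 1" "s \<in> carrier G" "u = Delta (z, s)"
        using u(1) by (rule isometry_groupE)
      then show "c \<in> fibre ` carrier G"
        using u(2) pi0_class_Delta by simp
    qed
    show "fibre ` carrier G \<subseteq> pi0_class A ` carrier UA"
      using pi0_class_left_regular Delta_isometry_group[of 1] Delta_one_left by (fastforce simp: image_iff)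
  qed
  finally show ?thesis .
qed

lemma pi0_iso: "fibre \<in> iso G (pi0_group A)"
proof -
  have "inj_on fibre (carrier G)"
  proof (rule inj_onI)
    fix s t assume st: "s \<in> carrier G" "t \<in> carrier G" "fibre s = fibre t"
    show "s = t"
      using fibre_eq_iff[OF st(1,2), of 1] fibreI[of 1 s] st(3) by simp
  qed
  moreover have "fibre (s \<otimes> t) = fibre s \<otimes>\<^bsub>pi0_group A\<^esub> fibre t" if "s \<in> carrier G" "t \<in> carrier G" for s t
    using fibre_mult[OF that] by (simp add: pi0_group_def FactGroup_def)
  ultimately show ?thesis
    by (simp add: iso_def hom_def bij_betw_def pi0_group_carrier)
qed

text \<open>After composition with \<open>Delta\<close>, the class map becomes
  \<open>fibre \<circ> snd\<close>, a quotient map. As the projection \<open>snd\<close> is itself a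
  quotient map, so is \<open>fibre\<close>, and an injective quotient map is a
  homeomorphism.\<close>

lemma homeomorphic_fibre: "homeomorphic_map T (pi0_topology A (CV_weak_star G M p)) fibre"
proof -
  let ?X = "prod_topology circle_topology T" and ?Q = "pi0_topology A (CV_weak_star G M p)"
  have "quotient_map YT ?Q (pi0_class A)"
    unfolding pi0_topology_def by (rule quotient_map_quotient_topology)
  with homeomorphic_Delta have "quotient_map ?X ?Q (pi0_class A \<circ> Delta)"
    unfolding homeomorphic_map_def by (blast intro: quotient_map_compose)
  then have q: "quotient_map ?X ?Q (fibre \<circ> snd)"
  proof (rule quotient_map_eq)
    fix x assume "x \<in> topspace ?X"
    then obtain z s where "x = (z, s)" "cmod z = 1" "s \<in> carrier G" by auto
    then show "(pi0_class A \<circ> Delta) x = (fibre \<circ> snd) x"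
      by (simp add: pi0_class_Delta)
  qed
  \<comment> \<open>A projection from a product is surjective, hence a quotient map, only if the
    other factor is nonempty or the target is trivial; nonemptiness of the circle settles
    this.\<close>
  have "topspace circle_topology \<noteq> {}" by simp
  then have "circle_topology \<noteq> trivial_topology"
    by (simp only: null_topspace_iff_trivial not_False_eq_True)
  then have "quotient_map ?X T snd"
    by simp
  then have "quotient_map T ?Q fibre"
    using q quotient_map_compose_eq by blast
  moreover have "inj_on fibre (topspace T)"
    using pi0_iso by (simp add: iso_def bij_betw_def)
  ultimately show ?thesis
    unfolding homeomorphic_map_def by blast
qed

theorem pi0_topological_group_iso:
  "topological_group_iso G T (pi0_group A) (pi0_topology A (CV_weak_star G M p)) (\<lambda>s. pi0_class A (lreg s))"
proof (rule topological_group_isoI)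
  show "topological_group G T"
    using lcg by (simp add: locally_compact_group_def)
  \<comment> \<open>The two maps are identified on the carrier only, so the properties of
    \<open>fibre\<close> are passed on by congruence rules.\<close>
  have eq: "fibre s = pi0_class A (lreg s)" if "s \<in> carrier G" for s
    using pi0_class_left_regular[OF that] by simp
  show "(\<lambda>s. pi0_class A (lreg s)) \<in> iso G (pi0_group A)"
    by (rule iso_eq[OF pi0_iso]) (rule pi0_class_left_regular)
  show "pi0_class A (lreg \<one>) = \<one>\<^bsub>pi0_group A\<^esub>"
    by (simp add: pi0_class_left_regular pi0_group_def FactGroup_def isometry_group_0_eq)
  show "homeomorphic_map T (pi0_topology A (CV_weak_star G M p)) (\<lambda>s. pi0_class A (lreg s))"
    by (rule homeomorphic_map_eq[OF homeomorphic_fibre]) (simp add: eq)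
qed

end

end

theorem theoremB:
  fixes G :: "('a, 'b) monoid_scheme" and T :: "'a topology" and M :: "'a measure" and p :: real
  assumes "locally_compact_group G T"
    and "left_haar_measure G T M"
    and "1 < p" and "p \<noteq> 2"
  shows "topological_group_iso
           (circle_group \<times>\<times> G) (prod_topology circle_topology T)
           (isometry_group (CV G M p)) (isometry_topology (CV G M p) (CV_weak_star G M p))
           (\<lambda>(\<gamma>, s). \<gamma> \<odot>\<^bsub>CV G M p\<^esub> left_regular G M p s)
       \<and> topological_group_iso
           G T
           (pi0_group (CV G M p)) (pi0_topology (CV G M p) (CV_weak_star G M p))
           (\<lambda>s. pi0_class (CV G M p) (left_regular G M p s))"
proof -
  have "group G"
    using assms(1) by (simp add: locally_compact_group_def topological_group_def)
  then interpret haar_Lp G T M p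
    using assms by (intro haar_Lp.intro haar_group.intro haar_group_axioms.intro haar_Lp_axioms.intro)
  show ?thesis
    using Delta_topological_group_iso[OF assms(4)] pi0_topological_group_iso[OF assms(4)]
    unfolding Delta_def by blast
qed

end
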